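(* Let $R$ be a commutative ring with unit, $M$ a smooth manifold without boundary and $G$ a simple graph on the vertex set $[n]=\{1,\dots,n\}$. Let $F(M,G)=\{(x_1,\dots,x_n)\in M^n\mid (i,j)\in E(G)\Rightarrow x_i\ne x_j\}$, and let $\mathcal A_G$ be the associated manifold arrangement of diagonals in $M^n$, so that $\mathcal M(\mathcal A_G)=F(M,G)$. Then $H^*(Tot(A^*(\mathcal A_G)))$ is isomorphic to $H^*(F(M,G);R)$ as algebras.
   Context: As throughout the paper's treatment of arrangements, the ambient manifold is connected. $E(G)$ is the edge set of $G$. The lattice $L_G$ consists of all partitions of $[n]$ given by connected components of spanning subgraphs of $G$ (subgraphs with vertex set $[n]$ and any subset of edges), ordered by refinement (the partition into singletons is the minimum $\mathbf 0$). It is a geometric lattice with rank $r(p)=n-|p|$, $|p|$ the number of blocks; atoms correspond to edges. For $p\in L_G$, $\Delta_p\subseteq M^n$ is the set of $x$ with $x_i=x_j$ whenever $i,j$ lie in the same block of $p$. $\mathcal A_G=\{\Delta_a\mid a\text{ an atom of }L_G\}$, a manifold arrangement in $M^n$ (locally diffeomorphic to a linear subspace arrangement) with intersection lattice $L_G$. OS-algebra. For a geometric lattice $L$, $E^*(L)$ is the exterior $R$-algebra on $e_a$, $a$ an atom, with derivation $\partial(e_{a_1}\cdots e_{a_k})=\sum_j(-1)^{j-1}e_{a_1}\cdots\widehat{e_{a_j}}\cdots e_{a_k}$; $S$ is dependent if $r(\bigvee S)<|S|$; $A^*(L)=E^*(L)/(\partial e_S:S\text{ dependent})=\bigoplus_pA^*(L)_p$,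 $A^*(L)_p$ spanned by the $e_S$ with $\bigvee S=p$; $\partial$ maps $A^*(L)_p$ to $\bigoplus_qA^*(L)_q$ over $q$ covered by $p$. Coefficients. $C^*(X)$ denotes singular $R$-cochains; $C_0^*(X)$ the cochains vanishing on all singular simplices contained in members of some open cover of $X$ (depending on the cochain); $\hat C^*(X)=C^*(X)/C_0^*(X)$; $\hat C^*(X,A)=\ker(\hat C^*(X)\to\hat C^*(A))$. $\hat{\mathcal C}(\mathcal A_G)_p=\hat C^*(M^n,M^n-\Delta_p)$, with inclusions $f_{p,q}$ ($q\le p$), differential $\delta$ and cup product $\hat{\mathcal C}(\mathcal A_G)_p\otimes\hat{\mathcal C}(\mathcal A_G)_q\to\hat{\mathcal C}(\mathcal A_G)_{p\vee q}$. $A^*(\mathcal A_G)=A^*(L_G,\hat{\mathcal C}(\mathcal A_G))=\bigoplus_{p\in L_G}A^*(L_G)_p\otimes_R\hat{\mathcal C}(\mathcal A_G)_p$ with $\partial(x\otimes c)=\sum_ix_i\otimes f_{p,p_i}(c)$ if $\partial x=\sum_ix_i$, $x_i\in A^*(L_G)_{p_i}$, $p$ covering $p_i$; $\delta(x\otimes c)=(-1)^{r(p)}x\otimes\delta c$; product $(x\otimes c_1)(y\otimes c_2)=(-1)^{\deg(c_1)r(q)}xy\otimes(c_1\cup c_2)$ for $x\in A^*(L_G)_p,y\in A^*(L_G)_q$. $Tot$ has differential $\partial+\delta$ and $\deg(x\otimes c)=\deg c-r(p)$; it is a differential graded algebra. *)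

theory Defs
  imports "HOL-Analysis.Abstract_Topological_Spaces" "HOL-Homology.Homology" "HOL-Algebra.QuotRing" "HOL-Algebra.Module"
    "HOL-Algebra.Lattice" "HOL-Library.Disjoint_Sets"
begin

section \<open>Graded algebras with a differential\<close>

text \<open>The differential need not have degree \<open>1\<close>: the map \<open>\<partial>\<close> of an exterior or OS-algebra,
  which lowers the degree by one, is recorded in the same field.\<close>

record ('r, 'a) diff_algebra = "('r, 'a) module" +
  homog :: "int \<Rightarrow> 'a set"
  differential :: "'a \<Rightarrow> 'a"

text \<open>Elements are cosets of \<open>I\<close>; operations are evaluated on all representatives, in the style of
  \<^const>\<open>rcoset_mult\<close>.\<close>

definition quotient_algebra :: "('r, 'a) diff_algebra \<Rightarrow> 'a set \<Rightarrow> ('r, 'a set) diff_algebra" where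
  "quotient_algebra A I =
    \<lparr>carrier = carrier (A Quot I), mult = mult (A Quot I), one = one (A Quot I),
     zero = zero (A Quot I), add = add (A Quot I),
     smult = (\<lambda>a X. \<Union>x\<in>X. I +>\<^bsub>A\<^esub> (a \<odot>\<^bsub>A\<^esub> x)),
     homog = (\<lambda>k. (\<lambda>x. I +>\<^bsub>A\<^esub> x) ` homog A k),
     differential = (\<lambda>X. \<Union>x\<in>X. I +>\<^bsub>A\<^esub> differential A x)\<rparr>"

definition cohomology :: "('r, 'a) diff_algebra \<Rightarrow> ('r, 'a set) diff_algebra" where
  "cohomology A =
    (let Z = {x \<in> carrier A. differential A x = \<zero>\<^bsub>A\<^esub>}
     in quotient_algebra (A\<lparr>carrier := Z, homog := (\<lambda>k. homog A k \<inter> Z)\<rparr>)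
          (differential A ` carrier A))"

definition graded_algebra_iso ::
  "('r, 'm) ring_scheme \<Rightarrow> ('r, 'a) diff_algebra \<Rightarrow> ('r, 'b) diff_algebra \<Rightarrow> ('a \<Rightarrow> 'b) \<Rightarrow> bool" where
  "graded_algebra_iso R A B \<phi> \<longleftrightarrow>
     \<phi> \<in> ring_iso A B \<and>
     (\<forall>a\<in>carrier R. \<forall>x\<in>carrier A. \<phi> (a \<odot>\<^bsub>A\<^esub> x) = a \<odot>\<^bsub>B\<^esub> \<phi> x) \<and>
     (\<forall>k. \<phi> ` homog A k = homog B k)"

definition module_span :: "('r, 'm) ring_scheme \<Rightarrow> ('r, 'a, 'n) module_scheme \<Rightarrow> 'a set \<Rightarrow> 'a set" where
  "module_span R A S = \<Inter>{H. submodule H R A \<and> S \<subseteq> H}"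


section \<open>Free modules with a bilinear product and a differential\<close>

definition neg_one_pow :: "('r, 'm) ring_scheme \<Rightarrow> int \<Rightarrow> 'r" where
  "neg_one_pow R k = (if even k then \<one>\<^bsub>R\<^esub> else \<ominus>\<^bsub>R\<^esub> \<one>\<^bsub>R\<^esub>)"

definition basis_elt :: "('r, 'm) ring_scheme \<Rightarrow> 'u \<Rightarrow> 'u \<Rightarrow> 'r" where
  "basis_elt R u = (\<lambda>w. if w = u then \<one>\<^bsub>R\<^esub> else \<zero>\<^bsub>R\<^esub>)"

definition support :: "('r, 'm) ring_scheme \<Rightarrow> ('u \<Rightarrow> 'r) \<Rightarrow> 'u set" where
  "support R f = {u. f u \<noteq> \<zero>\<^bsub>R\<^esub>}"

definition linear_extension ::
  "('r, 'm) ring_scheme \<Rightarrow> ('u \<Rightarrow> 'v \<Rightarrow> 'r) \<Rightarrow> ('u \<Rightarrow> 'r) \<Rightarrow> 'v \<Rightarrow> 'r" where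
  "linear_extension R \<phi> f = (\<lambda>w. \<Oplus>\<^bsub>R\<^esub>u\<in>support R f. f u \<otimes>\<^bsub>R\<^esub> \<phi> u w)"

text \<open>The free \<open>R\<close>-module on \<open>X\<close> (finitely supported functions), with unit the generator \<open>e\<close>, and
  with product \<open>m\<close>, degree \<open>dg\<close> and differential \<open>d\<close> prescribed on generators.\<close>

definition free_algebra ::
  "('r, 'm) ring_scheme \<Rightarrow> 'u set \<Rightarrow> 'u \<Rightarrow> ('u \<Rightarrow> 'u \<Rightarrow> 'u \<Rightarrow> 'r) \<Rightarrow> ('u \<Rightarrow> int) \<Rightarrow>
   ('u \<Rightarrow> 'u \<Rightarrow> 'r) \<Rightarrow> ('r, 'u \<Rightarrow> 'r) diff_algebra" where
  "free_algebra R X e m dg d =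
    (let F = {f. range f \<subseteq> carrier R \<and> finite (support R f) \<and> support R f \<subseteq> X}
     in \<lparr>carrier = F,
         mult = (\<lambda>f g. linear_extension R (\<lambda>u. linear_extension R (m u) g) f),
         one = basis_elt R e,
         zero = (\<lambda>_. \<zero>\<^bsub>R\<^esub>),
         add = (\<lambda>f g u. f u \<oplus>\<^bsub>R\<^esub> g u),
         smult = (\<lambda>a f u. a \<otimes>\<^bsub>R\<^esub> f u),
         homog = (\<lambda>k. {f \<in> F. \<forall>u\<in>support R f. dg u = k}),
         differential = linear_extension R d\<rparr>)"


section \<open>The exterior algebra and the OS-algebra\<close>

text \<open>The tensor algebra of the free module on \<open>X\<close>: basis all words over \<open>X\<close>, product
  concatenation, and
  \<open>\<partial>(a\<^sub>1 \<dots> a\<^sub>k) = (\<Sum>j. (-1)^(j-1) a\<^sub>1 \<dots> a\<^sub>j\<^sub>-\<^sub>1 a\<^sub>j\<^sub>+\<^sub>1 \<dots> a\<^sub>k)\<close>, with \<open>j\<close> counted from \<open>0\<close> below.\<close>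

definition tensor_algebra ::
  "('r, 'm) ring_scheme \<Rightarrow> 'x set \<Rightarrow> ('r, 'x list \<Rightarrow> 'r) diff_algebra" where
  "tensor_algebra R X =
     free_algebra R (lists X) [] (\<lambda>u v. basis_elt R (u @ v)) (\<lambda>w. int (length w))
       (\<lambda>w v. \<Oplus>\<^bsub>R\<^esub>j\<in>{..<length w}.
          neg_one_pow R (int j) \<otimes>\<^bsub>R\<^esub> basis_elt R (take j w @ drop (Suc j) w) v)"

definition exterior_relations ::
  "('r, 'm) ring_scheme \<Rightarrow> 'x set \<Rightarrow> ('x list \<Rightarrow> 'r) set" where
  "exterior_relations R X =
     (let T = tensor_algebra R X in genideal T {v \<otimes>\<^bsub>T\<^esub> v | v. v \<in> homog T 1})"

definition exterior_algebra ::
  "('r, 'm) ring_scheme \<Rightarrow> 'x set \<Rightarrow> ('r, ('x list \<Rightarrow> 'r) set) diff_algebra" where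
  "exterior_algebra R X = quotient_algebra (tensor_algebra R X) (exterior_relations R X)"

definition exterior_monomial ::
  "('r, 'm) ring_scheme \<Rightarrow> 'x set \<Rightarrow> 'x list \<Rightarrow> ('x list \<Rightarrow> 'r) set" where
  "exterior_monomial R X w =
     exterior_relations R X +>\<^bsub>tensor_algebra R X\<^esub> basis_elt R w"

definition covers :: "('p, 'm) gorder_scheme \<Rightarrow> 'p \<Rightarrow> 'p \<Rightarrow> bool" where
  "covers L p q \<longleftrightarrow> p \<in> carrier L \<and> q \<in> carrier L \<and> q \<sqsubset>\<^bsub>L\<^esub> p \<and>
     \<not> (\<exists>u\<in>carrier L. q \<sqsubset>\<^bsub>L\<^esub> u \<and> u \<sqsubset>\<^bsub>L\<^esub> p)"

definition lattice_atoms :: "('p, 'm) gorder_scheme \<Rightarrow> 'p set" where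
  "lattice_atoms L = {a. covers L a \<bottom>\<^bsub>L\<^esub>}"

text \<open>In the following \<open>L\<close> is a geometric lattice and \<open>r\<close> its rank function. A set \<open>S\<close> of atoms is
  represented by its enumerations \<open>w\<close> without repetition; \<open>e\<^sub>S\<close> depends on the enumeration only up to
  sign.\<close>

definition OS_relations ::
  "('r, 'm) ring_scheme \<Rightarrow> ('p, 'n) gorder_scheme \<Rightarrow> ('p \<Rightarrow> nat) \<Rightarrow> ('p list \<Rightarrow> 'r) set set" where
  "OS_relations R L r =
     (let E = exterior_algebra R (lattice_atoms L)
      in genideal E {differential E (exterior_monomial R (lattice_atoms L) w) | w.
           distinct w \<and> set w \<subseteq> lattice_atoms L \<and> r (\<Squnion>\<^bsub>L\<^esub>(set w)) < card (set w)})"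

definition OS_algebra ::
  "('r, 'm) ring_scheme \<Rightarrow> ('p, 'n) gorder_scheme \<Rightarrow> ('p \<Rightarrow> nat) \<Rightarrow>
   ('r, ('p list \<Rightarrow> 'r) set set) diff_algebra" where
  "OS_algebra R L r =
     quotient_algebra (exterior_algebra R (lattice_atoms L)) (OS_relations R L r)"

definition OS_monomial ::
  "('r, 'm) ring_scheme \<Rightarrow> ('p, 'n) gorder_scheme \<Rightarrow> ('p \<Rightarrow> nat) \<Rightarrow> 'p list \<Rightarrow>
   ('p list \<Rightarrow> 'r) set set" where
  "OS_monomial R L r w =
     OS_relations R L r +>\<^bsub>exterior_algebra R (lattice_atoms L)\<^esub>
       exterior_monomial R (lattice_atoms L) w"

definition OS_part ::
  "('r, 'm) ring_scheme \<Rightarrow> ('p, 'n) gorder_scheme \<Rightarrow> ('p \<Rightarrow> nat) \<Rightarrow> 'p \<Rightarrow>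
   ('p list \<Rightarrow> 'r) set set set" where
  "OS_part R L r p = module_span R (OS_algebra R L r)
     {OS_monomial R L r w | w. distinct w \<and> set w \<subseteq> lattice_atoms L \<and> \<Squnion>\<^bsub>L\<^esub>(set w) = p}"

text \<open>The component in \<open>A\<^sup>*(L)\<^sub>q\<close> of an element of \<open>A\<^sup>*(L) = \<Oplus>\<^sub>q A\<^sup>*(L)\<^sub>q\<close>.\<close>

definition OS_component ::
  "('r, 'm) ring_scheme \<Rightarrow> ('p, 'n) gorder_scheme \<Rightarrow> ('p \<Rightarrow> nat) \<Rightarrow> 'p \<Rightarrow>
   ('p list \<Rightarrow> 'r) set set \<Rightarrow> ('p list \<Rightarrow> 'r) set set" where
  "OS_component R L r q x =
     (THE y. y \<in> (\<Pi>\<^sub>E p\<in>carrier L. OS_part R L r p) \<and>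
        x = (\<Oplus>\<^bsub>OS_algebra R L r\<^esub>p\<in>carrier L. y p)) q"


section \<open>The algebra \<open>A\<^sup>*(L, C)\<close>\<close>

text \<open>The coefficients are subcomplexes \<open>D p\<close> of a fixed differential graded algebra \<open>C\<close> with
  \<open>D p \<subseteq> D q\<close> for \<open>q \<le> p\<close> and \<open>D p \<cdot> D q \<subseteq> D (p \<squnion> q)\<close>, so that the maps \<open>f\<^sub>p\<^sub>,\<^sub>q\<close> are inclusions.
  The direct sum of the tensor products \<open>A\<^sup>*(L)\<^sub>p \<otimes>\<^sub>R D\<^sup>k p\<close> over all \<open>p\<close> and \<open>k\<close> is the free module on the
  symbols \<open>x \<otimes> c\<close>, here \<open>(p, k, x, c)\<close>, modulo bilinearity in \<open>x\<close> and \<open>c\<close>.\<close>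

definition tensor_generators ::
  "('r, 'm) ring_scheme \<Rightarrow> ('p, 'n) gorder_scheme \<Rightarrow> ('p \<Rightarrow> nat) \<Rightarrow> ('r, 'c) diff_algebra \<Rightarrow>
   ('p \<Rightarrow> 'c set) \<Rightarrow> ('p \<times> int \<times> ('p list \<Rightarrow> 'r) set set \<times> 'c) set" where
  "tensor_generators R L r C D =
     {(p, k, x, c). p \<in> carrier L \<and> x \<in> OS_part R L r p \<and> c \<in> D p \<inter> homog C k}"

definition tensor_free ::
  "('r, 'm) ring_scheme \<Rightarrow> ('p, 'n) gorder_scheme \<Rightarrow> ('p \<Rightarrow> nat) \<Rightarrow> ('r, 'c) diff_algebra \<Rightarrow>
   ('p \<Rightarrow> 'c set) \<Rightarrow> ('r, 'p \<times> int \<times> ('p list \<Rightarrow> 'r) set set \<times> 'c \<Rightarrow> 'r) diff_algebra" where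
  "tensor_free R L r C D =
    (let A = OS_algebra R L r
     in free_algebra R (tensor_generators R L r C D) (\<bottom>\<^bsub>L\<^esub>, 0, \<one>\<^bsub>A\<^esub>, \<one>\<^bsub>C\<^esub>)
       (\<lambda>(p, k, x, c) (q, l, y, d) w. neg_one_pow R (k * int (r q)) \<otimes>\<^bsub>R\<^esub>
            basis_elt R (p \<squnion>\<^bsub>L\<^esub> q, k + l, x \<otimes>\<^bsub>A\<^esub> y, c \<otimes>\<^bsub>C\<^esub> d) w)
       (\<lambda>(p, k, x, c). k - int (r p))
       (\<lambda>(p, k, x, c) w.
          (\<Oplus>\<^bsub>R\<^esub>q\<in>{q. covers L p q}. basis_elt R (q, k, OS_component R L r q (differential A x), c) w)
          \<oplus>\<^bsub>R\<^esub> neg_one_pow R (int (r p)) \<otimes>\<^bsub>R\<^esub> basis_elt R (p, k + 1, x, differential C c) w))"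

definition tensor_relations ::
  "('r, 'm) ring_scheme \<Rightarrow> ('p, 'n) gorder_scheme \<Rightarrow> ('p \<Rightarrow> nat) \<Rightarrow> ('r, 'c) diff_algebra \<Rightarrow>
   ('p \<Rightarrow> 'c set) \<Rightarrow> ('p \<times> int \<times> ('p list \<Rightarrow> 'r) set set \<times> 'c \<Rightarrow> 'r) set" where
  "tensor_relations R L r C D =
    (let A = OS_algebra R L r; F = tensor_free R L r C D; G = tensor_generators R L r C D;
         t = basis_elt R
     in module_span R F
      ({t (p, k, x \<oplus>\<^bsub>A\<^esub> y, c) \<ominus>\<^bsub>F\<^esub> (t (p, k, x, c) \<oplus>\<^bsub>F\<^esub> t (p, k, y, c)) | p k x y c.
          (p, k, x, c) \<in> G \<and> (p, k, y, c) \<in> G} \<union>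
       {t (p, k, x, c \<oplus>\<^bsub>C\<^esub> d) \<ominus>\<^bsub>F\<^esub> (t (p, k, x, c) \<oplus>\<^bsub>F\<^esub> t (p, k, x, d)) | p k x c d.
          (p, k, x, c) \<in> G \<and> (p, k, x, d) \<in> G} \<union>
       {t (p, k, a \<odot>\<^bsub>A\<^esub> x, c) \<ominus>\<^bsub>F\<^esub> a \<odot>\<^bsub>F\<^esub> t (p, k, x, c) | a p k x c.
          a \<in> carrier R \<and> (p, k, x, c) \<in> G} \<union>
       {t (p, k, x, a \<odot>\<^bsub>C\<^esub> c) \<ominus>\<^bsub>F\<^esub> a \<odot>\<^bsub>F\<^esub> t (p, k, x, c) | a p k x c.
          a \<in> carrier R \<and> (p, k, x, c) \<in> G}))"

definition OS_tensor ::
  "('r, 'm) ring_scheme \<Rightarrow> ('p, 'n) gorder_scheme \<Rightarrow> ('p \<Rightarrow> nat) \<Rightarrow> ('r, 'c) diff_algebra \<Rightarrow>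
   ('p \<Rightarrow> 'c set) \<Rightarrow> ('r, ('p \<times> int \<times> ('p list \<Rightarrow> 'r) set set \<times> 'c \<Rightarrow> 'r) set) diff_algebra" where
  "OS_tensor R L r C D = quotient_algebra (tensor_free R L r C D) (tensor_relations R L r C D)"


section \<open>Singular cochains\<close>

text \<open>\<open>C\<^sup>*(X)\<close> is the direct sum of the \<open>C\<^sup>k(X)\<close>: a cochain assigns to \<open>k\<close> a function on singular
  \<open>k\<close>-simplices, zero for almost all \<open>k\<close>.\<close>

type_synonym ('r, 'a) cochain = "nat \<Rightarrow> ((nat \<Rightarrow> real) \<Rightarrow> 'a) \<Rightarrow> 'r"

definition back_face :: "nat \<Rightarrow> nat \<Rightarrow> ((nat \<Rightarrow> real) \<Rightarrow> 'a) \<Rightarrow> (nat \<Rightarrow> real) \<Rightarrow> 'a" where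
  "back_face k i \<sigma> =
     restrict (\<lambda>x. \<sigma> (\<lambda>j. if j < i then 0 else x (j - i))) (standard_simplex (k - i))"

definition cochain_fun ::
  "'a topology \<Rightarrow> ('r, 'a) cochain \<Rightarrow> ('r, 'a) cochain" where
  "cochain_fun X c = (\<lambda>k. restrict (c k) (singular_simplex_set k X))"

definition cochain_algebra ::
  "('r, 'm) ring_scheme \<Rightarrow> 'a topology \<Rightarrow> ('r, ('r, 'a) cochain) diff_algebra" where
  "cochain_algebra R X =
    (let K = {c. (\<forall>k. c k \<in> singular_simplex_set k X \<rightarrow>\<^sub>E carrier R) \<and>
                 finite {k. \<exists>\<sigma>\<in>singular_simplex_set k X. c k \<sigma> \<noteq> \<zero>\<^bsub>R\<^esub>}}
     in \<lparr>carrier = K,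
         mult = (\<lambda>c d. cochain_fun X (\<lambda>k \<sigma>. \<Oplus>\<^bsub>R\<^esub>i\<in>{..k}.
            c i (restrict \<sigma> (standard_simplex i)) \<otimes>\<^bsub>R\<^esub> d (k - i) (back_face k i \<sigma>))),
         one = cochain_fun X (\<lambda>k \<sigma>. if k = 0 then \<one>\<^bsub>R\<^esub> else \<zero>\<^bsub>R\<^esub>),
         zero = cochain_fun X (\<lambda>k \<sigma>. \<zero>\<^bsub>R\<^esub>),
         add = (\<lambda>c d. cochain_fun X (\<lambda>k \<sigma>. c k \<sigma> \<oplus>\<^bsub>R\<^esub> d k \<sigma>)),
         smult = (\<lambda>a c. cochain_fun X (\<lambda>k \<sigma>. a \<otimes>\<^bsub>R\<^esub> c k \<sigma>)),
         homog = (\<lambda>m. {c \<in> K. \<forall>k. int k \<noteq> m \<longrightarrow> (\<forall>\<sigma>\<in>singular_simplex_set k X. c k \<sigma> = \<zero>\<^bsub>R\<^esub>)}),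
         differential = (\<lambda>c. cochain_fun X (\<lambda>k \<sigma>. if k = 0 then \<zero>\<^bsub>R\<^esub> else
            (\<Oplus>\<^bsub>R\<^esub>i\<in>{..k}. neg_one_pow R (int i) \<otimes>\<^bsub>R\<^esub> c (k - 1) (singular_face k i \<sigma>)))) \<rparr>)"

definition locally_zero_cochains ::
  "('r, 'm) ring_scheme \<Rightarrow> 'a topology \<Rightarrow> ('r, 'a) cochain set" where
  "locally_zero_cochains R X =
     {c \<in> carrier (cochain_algebra R X).
       \<exists>\<U>. (\<forall>U\<in>\<U>. openin X U) \<and> \<Union>\<U> = topspace X \<and>
         (\<forall>k \<sigma>. singular_simplex k X \<sigma> \<and> (\<exists>U\<in>\<U>. \<sigma> ` standard_simplex k \<subseteq> U)
            \<longrightarrow> c k \<sigma> = \<zero>\<^bsub>R\<^esub>)}"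

definition hat_cochains ::
  "('r, 'm) ring_scheme \<Rightarrow> 'a topology \<Rightarrow> ('r, ('r, 'a) cochain set) diff_algebra" where
  "hat_cochains R X = quotient_algebra (cochain_algebra R X) (locally_zero_cochains R X)"

definition hat_cochains_rel ::
  "('r, 'm) ring_scheme \<Rightarrow> 'a topology \<Rightarrow> 'a set \<Rightarrow> ('r, 'a) cochain set set" where
  "hat_cochains_rel R X A =
    (let Y = subtopology X A
     in a_kernel (hat_cochains R X) (hat_cochains R Y)
          (\<lambda>z. \<Union>c\<in>z. locally_zero_cochains R Y +>\<^bsub>cochain_algebra R Y\<^esub> cochain_fun Y c))"


section \<open>Graphs and the arrangement of diagonals\<close>

definition simple_graph_on :: "nat \<Rightarrow> nat set set \<Rightarrow> bool" where
  "simple_graph_on n E \<longleftrightarrow> (\<forall>e\<in>E. e \<subseteq> {1..n} \<and> card e = 2)"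

definition conn_rel :: "nat \<Rightarrow> nat set set \<Rightarrow> (nat \<times> nat) set" where
  "conn_rel n S = {(i, j). {i, j} \<in> S}\<^sup>* \<inter> {1..n} \<times> {1..n}"

definition component_partition :: "nat \<Rightarrow> nat set set \<Rightarrow> nat set set" where
  "component_partition n S = {1..n} // conn_rel n S"

definition bond_lattice :: "nat \<Rightarrow> nat set set \<Rightarrow> nat set set gorder" where
  "bond_lattice n E =
     \<lparr>carrier = component_partition n ` Pow E, eq = (=), le = refines {1..n}\<rparr>"

definition bond_rank :: "nat \<Rightarrow> nat set set \<Rightarrow> nat" where
  "bond_rank n p = n - card p"

definition power_space :: "'a topology \<Rightarrow> nat \<Rightarrow> (nat \<Rightarrow> 'a) topology" where
  "power_space M n = product_topology (\<lambda>_. M) {1..n}"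

definition partition_diagonal :: "'a topology \<Rightarrow> nat \<Rightarrow> nat set set \<Rightarrow> (nat \<Rightarrow> 'a) set" where
  "partition_diagonal M n p =
     {x \<in> topspace (power_space M n). \<forall>B\<in>p. \<forall>i\<in>B. \<forall>j\<in>B. x i = x j}"

definition graph_configuration_space ::
  "'a topology \<Rightarrow> nat \<Rightarrow> nat set set \<Rightarrow> (nat \<Rightarrow> 'a) topology" where
  "graph_configuration_space M n E = subtopology (power_space M n)
     {x \<in> topspace (power_space M n). \<forall>i j. {i, j} \<in> E \<longrightarrow> x i \<noteq> x j}"

text \<open>\<open>Tot(A\<^sup>*(\<A>\<^sub>G))\<close>\<close>

definition arrangement_algebra ::
  "('r, 'm) ring_scheme \<Rightarrow> 'a topology \<Rightarrow> nat \<Rightarrow> nat set set \<Rightarrow>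
   ('r, (nat set set \<times> int \<times> (nat set set list \<Rightarrow> 'r) set set \<times> ('r, nat \<Rightarrow> 'a) cochain set
           \<Rightarrow> 'r) set) diff_algebra" where
  "arrangement_algebra R M n E =
     OS_tensor R (bond_lattice n E) (bond_rank n) (hat_cochains R (power_space M n))
       (\<lambda>p. hat_cochains_rel R (power_space M n)
              (topspace (power_space M n) - partition_diagonal M n p))"


text \<open>The atoms of the bond lattice are the edges, and the complement of the arrangement of diagonals
  is the graph configuration space.\<close>

lemma equiv_conn_rel: "equiv {1..n} (conn_rel n S)"
proof -
  have "sym ({(i, j). {i, j} \<in> S}\<^sup>*)"
    by (rule sym_rtrancl) (auto simp: sym_def insert_commute)
  then have "sym (conn_rel n S)" by (auto simp: conn_rel_def sym_def)
  moreover have "trans (conn_rel n S)" by (auto simp: conn_rel_def trans_def)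
  ultimately show ?thesis
    by (auto simp: equiv_def refl_on_def conn_rel_def)
qed

lemma partition_on_component_partition: "partition_on {1..n} (component_partition n S)"
  unfolding component_partition_def by (rule partition_on_quotient[OF equiv_conn_rel])

lemma refines_component_partition_iff:
  "refines {1..n} (component_partition n S) (component_partition n T) \<longleftrightarrow> conn_rel n S \<subseteq> conn_rel n T"
proof
  assume L: "refines {1..n} (component_partition n S) (component_partition n T)"
  show "conn_rel n S \<subseteq> conn_rel n T"
  proof (clarify)
    fix i j assume ij: "(i, j) \<in> conn_rel n S"
    then have i: "i \<in> {1..n}" by (auto simp: conn_rel_def)
    then have "conn_rel n S `` {i} \<in> component_partition n S" by (auto simp: component_partition_def quotient_def)
    then obtain Y where Y: "Y \<in> {1..n} // conn_rel n T" "conn_rel n S `` {i} \<subseteq> Y"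
      using L unfolding refines_def component_partition_def by blast
    have "i \<in> conn_rel n S `` {i}" using equiv_class_self[OF equiv_conn_rel i] .
    then show "(i, j) \<in> conn_rel n T"
      using quotient_eq_iff[OF equiv_conn_rel Y(1) Y(1), of i j] Y(2) ij by auto
  qed
next
  assume "conn_rel n S \<subseteq> conn_rel n T"
  then show "refines {1..n} (component_partition n S) (component_partition n T)"
    unfolding refines_def using partition_on_component_partition[of n S] partition_on_component_partition[of n T]
    by (fastforce simp: component_partition_def quotient_def)
qed

lemma component_partition_eq_iff: "component_partition n S = component_partition n T \<longleftrightarrow> conn_rel n S = conn_rel n T"
  by (metis component_partition_def equalityI refines_component_partition_iff refines_refl partition_on_component_partition order_refl)

lemma conn_rel_empty: "conn_rel n {} = Id_on {1..n}"
  by (auto simp: conn_rel_def)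

lemma conn_rel_mono: "S \<subseteq> T \<Longrightarrow> conn_rel n S \<subseteq> conn_rel n T"
  unfolding conn_rel_def by (intro Int_mono rtrancl_mono) auto

lemma conn_rel_single: 
  assumes "i \<in> {1..n}" "j \<in> {1..n}"
  shows "conn_rel n {{i,j}} = Id_on {1..n} \<union> {(i,j),(j,i)}"
proof -
  have *: "{(a, b). {a, b} \<in> {{i,j}}} = {(i,j),(j,i)}" by (auto simp: doubleton_eq_iff)
  have "{(i,j),(j,i)}\<^sup>* = Id \<union> {(i,j),(j,i)}"
  proof -
    have "(a,b) \<in> {(i,j),(j,i)}\<^sup>* \<Longrightarrow> a = b \<or> (a,b) = (i,j) \<or> (a,b) = (j,i)" for a b
      by (induction rule: rtrancl_induct) auto
    then show ?thesis by auto
  qed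
  then show ?thesis using assms unfolding conn_rel_def * by auto
qed

lemma bottom_bond_lattice: "\<bottom>\<^bsub>bond_lattice n E\<^esub> = component_partition n {}"
proof -
  have le: "refines {1..n} (component_partition n {}) (component_partition n S)" for S
    unfolding refines_component_partition_iff by (intro conn_rel_mono) simp
  have "least (bond_lattice n E) (component_partition n {}) (carrier (bond_lattice n E))"
    using le by (auto simp: least_def bond_lattice_def)
  moreover have "x = component_partition n {}" if "least (bond_lattice n E) x (carrier (bond_lattice n E))" for x
  proof -
    from that obtain S where "x = component_partition n S" "refines {1..n} x (component_partition n {})"
      by (auto simp: least_def bond_lattice_def)
    then show ?thesis using le[of S] by (metis component_partition_eq_iff refines_component_partition_iff subset_antisym)
  qed
  ultimately show ?thesis unfolding bottom_def by (metis someI)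
qed

lemma lless_bond_lattice_iff: "component_partition n S \<sqsubset>\<^bsub>bond_lattice n E\<^esub> component_partition n T
  \<longleftrightarrow> conn_rel n S \<subset> conn_rel n T"
  using component_partition_eq_iff[of n S T] refines_component_partition_iff[of n S T]
  by (auto simp: lless_def bond_lattice_def)

lemma atoms_bond_lattice:
  assumes "simple_graph_on n E"
  shows "lattice_atoms (bond_lattice n E) = (\<lambda>e. component_partition n {e}) ` E"
proof -
  have edge: "\<exists>i j. e = {i,j} \<and> i \<noteq> j \<and> i \<in> {1..n} \<and> j \<in> {1..n}" if "e \<in> E" for e
  proof -
    have "e \<subseteq> {1..n}" "card e = 2" using assms that unfolding simple_graph_on_def by blast+
    then show ?thesis unfolding card_2_iff by blast
  qed
  have big: "conn_rel n {} \<subset> conn_rel n {e}" if "e \<in> E" for e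
    using edge[OF that] by (auto simp: conn_rel_empty conn_rel_single)
  have carr: "carrier (bond_lattice n E) = component_partition n ` Pow E" by (simp add: bond_lattice_def)
  have "covers (bond_lattice n E) (component_partition n {e}) (component_partition n {})" if e: "e \<in> E" for e
  proof -
    obtain i j where ij: "e = {i,j}" "i \<in> {1..n}" "j \<in> {1..n}" using edge[OF e] by blast
    have False if "conn_rel n {} \<subset> conn_rel n S" "conn_rel n S \<subset> conn_rel n {e}" for S
    proof -
      have "sym (conn_rel n S)" using equiv_conn_rel equivE by blast
      with that show False unfolding conn_rel_empty ij(1) conn_rel_single[OF ij(2,3)]
        by (auto simp: sym_def)
    qed
    then show ?thesis using e big[OF e] by (auto simp: covers_def carr lless_bond_lattice_iff)
  qed
  moreover have "\<exists>e\<in>E. a = component_partition n {e}"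
    if a: "covers (bond_lattice n E) a (component_partition n {})" for a
  proof -
    obtain S where S: "S \<subseteq> E" "a = component_partition n S" using a by (auto simp: covers_def carr)
    then have "S \<noteq> {}" using a by (auto simp: covers_def lless_bond_lattice_iff)
    then obtain e where e: "e \<in> S" by blast
    have "\<not> conn_rel n {e} \<subset> conn_rel n S"
      using a S e big[of e] by (auto simp: covers_def carr lless_bond_lattice_iff)
    moreover have "conn_rel n {e} \<subseteq> conn_rel n S" using e by (intro conn_rel_mono) auto
    ultimately show ?thesis using S e by (auto simp: component_partition_eq_iff)
  qed
  ultimately show ?thesis unfolding lattice_atoms_def bottom_bond_lattice by blast
qed

lemma topspace_graph_configuration_space:
  assumes "simple_graph_on n E"
  shows "topspace (graph_configuration_space M n E) = topspace (power_space M n) -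
    (\<Union>a\<in>lattice_atoms (bond_lattice n E). partition_diagonal M n a)"
proof -
  have diag: "x \<in> partition_diagonal M n (component_partition n {{i,j}}) \<longleftrightarrow>
     x \<in> topspace (power_space M n) \<and> x i = x j" if "{i,j} \<in> E" for x i j
  proof -
    have ij: "i \<in> {1..n}" "j \<in> {1..n}" using assms that by (auto simp: simple_graph_on_def)
    have "(\<forall>B\<in>component_partition n {{i,j}}. \<forall>a\<in>B. \<forall>b\<in>B. x a = x b) \<longleftrightarrow>
        (\<forall>(a, b)\<in>conn_rel n {{i,j}}. x a = x b)" (is "?L \<longleftrightarrow> ?Q")
    proof
      assume L: ?L
      show ?Q
      proof clarify
        fix a b assume ab: "(a, b) \<in> conn_rel n {{i,j}}"
        then have a: "a \<in> {1..n}" unfolding conn_rel_def by blast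
        then have "conn_rel n {{i,j}} `` {a} \<in> component_partition n {{i,j}}"
          unfolding component_partition_def by (rule quotientI)
        moreover have "a \<in> conn_rel n {{i,j}} `` {a}" by (rule equiv_class_self[OF equiv_conn_rel a])
        ultimately show "x a = x b" using L ab by blast
      qed
    next
      assume Q: ?Q
      show ?L
      proof (intro ballI)
        fix B a b assume "B \<in> component_partition n {{i,j}}" "a \<in> B" "b \<in> B"
        then have "(a, b) \<in> conn_rel n {{i,j}}"
          using quotient_eq_iff[OF equiv_conn_rel, of B _ _ B a b] unfolding component_partition_def by blast
        then show "x a = x b" using Q by blast
      qed
    qed
    also have "\<dots> \<longleftrightarrow> x i = x j" unfolding conn_rel_single[OF ij] by auto
    finally show ?thesis unfolding partition_diagonal_def by blast
  qed
  have edge: "\<exists>i j. e = {i,j}" if "e \<in> E" for e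
  proof -
    have "card e = 2" using assms that unfolding simple_graph_on_def by blast
    then show ?thesis unfolding card_2_iff by blast
  qed
  have "(\<exists>e\<in>E. x \<in> partition_diagonal M n (component_partition n {e})) \<longleftrightarrow>
     (\<exists>i j. {i,j} \<in> E \<and> x i = x j)" if "x \<in> topspace (power_space M n)" for x
  proof
    assume "\<exists>e\<in>E. x \<in> partition_diagonal M n (component_partition n {e})"
    then obtain e where e: "e \<in> E" "x \<in> partition_diagonal M n (component_partition n {e})" by blast
    obtain i j where "e = {i, j}" using edge[OF e(1)] by blast
    with e diag[of i j x] show "\<exists>i j. {i,j} \<in> E \<and> x i = x j" by blast
  next
    assume "\<exists>i j. {i,j} \<in> E \<and> x i = x j"
    then obtain i j where "{i,j} \<in> E" "x i = x j" by blast
    then show "\<exists>e\<in>E. x \<in> partition_diagonal M n (component_partition n {e})"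
      using diag[of i j x] that by blast
  qed
  then show ?thesis
    unfolding atoms_bond_lattice[OF assms] graph_configuration_space_def topspace_subtopology
    by blast
qed


section \<open>Smooth manifolds\<close>

text \<open>\<open>C\<^sup>k\<close> functions on an open subset \<open>U\<close> of \<^term>\<open>Euclidean_space d\<close>, whose points are sequences
  vanishing from index \<open>d\<close> on: all iterated partial derivatives of order at most \<open>k\<close> exist and are
  continuous. Not using a type of class \<open>euclidean_space\<close> admits \<open>d = 0\<close>.\<close>

primrec C_k_on :: "nat \<Rightarrow> nat \<Rightarrow> (nat \<Rightarrow> real) set \<Rightarrow> ((nat \<Rightarrow> real) \<Rightarrow> real) \<Rightarrow> bool" where
  "C_k_on 0 d U f \<longleftrightarrow> continuous_map (subtopology (Euclidean_space d) U) euclideanreal f"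
| "C_k_on (Suc k) d U f \<longleftrightarrow>
     continuous_map (subtopology (Euclidean_space d) U) euclideanreal f \<and>
     (\<forall>i<d. \<exists>g. (\<forall>x\<in>U. ((\<lambda>t. f (x(i := t))) has_real_derivative g x) (at (x i))) \<and>
        C_k_on k d U g)"

definition smooth_on :: "nat \<Rightarrow> (nat \<Rightarrow> real) set \<Rightarrow> ((nat \<Rightarrow> real) \<Rightarrow> nat \<Rightarrow> real) \<Rightarrow> bool" where
  "smooth_on d U F \<longleftrightarrow> (\<forall>j<d. \<forall>k. C_k_on k d U (\<lambda>x. F x j))"

text \<open>A \<open>d\<close>-dimensional smooth manifold without boundary, given by an atlas \<open>\<A>\<close> of charts
  \<open>(U, \<phi>)\<close>; the atlas is not required to be maximal.\<close>

definition smooth_manifold ::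
  "nat \<Rightarrow> 'a topology \<Rightarrow> ('a set \<times> ('a \<Rightarrow> nat \<Rightarrow> real)) set \<Rightarrow> bool" where
  "smooth_manifold d M \<A> \<longleftrightarrow>
     Hausdorff_space M \<and> second_countable M \<and> (\<Union>(U, \<phi>)\<in>\<A>. U) = topspace M \<and>
     (\<forall>(U, \<phi>)\<in>\<A>. openin M U \<and> openin (Euclidean_space d) (\<phi> ` U) \<and>
        homeomorphic_map (subtopology M U) (subtopology (Euclidean_space d) (\<phi> ` U)) \<phi>) \<and>
     (\<forall>(U, \<phi>)\<in>\<A>. \<forall>(V, \<psi>)\<in>\<A>.
        smooth_on d (\<phi> ` (U \<inter> V)) (\<lambda>y. \<psi> (inv_into U \<phi> y)))"

end

(* The map sending x tensor c to eps(x) c|F, from Tot to the algebra of germs of cochains on F = F(M,G), where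
   eps : A(L) -> A(L)_0 = R is the projection, is a surjective homomorphism of differential graded algebras.
   Its kernel consists of the elements whose coefficients are supported on the union of the diagonals.
   It is acyclic by induction on the number of diagonals: on elements supported on one more diagonal
   Delta_a, multiplication by e_a contracts Tot because d(e_a x) = x - e_a dx, and what is left after
   splitting off such an element is supported on the other diagonals; cochains can be split along closed
   sets because M^n is hereditarily normal.
   The map from cochains to germs on F is also surjective with acyclic kernel, by iterated subdivision.
   A surjective homomorphism with acyclic kernel induces an isomorphism in cohomology. *)

theory Submission
  imports "HOL-Analysis.Urysohn" Defs
begin

\<comment> \<open>The contraction by \<open>e_a\<close> is only partially defined:
  \<open>e_a x\<close> lies over \<open>p \<squnion> a\<close>, so \<open>e_a x \<otimes> c\<close>
  makes sense only if the germ \<open>c\<close> is supported on the diagonal of \<open>a\<close> as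
  well. This forces the induction over the diagonals, and it fixes what is asked of the
  coefficients: a germ supported on each of two closed sets is supported on their intersection, and
  one supported on a union is a sum of germs supported on the pieces. Ordinary cochains have no such
  calculus of supports, since one that vanishes on two open sets need not vanish on their union;
  germs do.

  To speak of the support of an element of Tot, which is a class modulo bilinearity, coordinates are
  required. They come from the identity that also drives the contraction:
  \<open>x = e_a (\<partial> x)\<close> on \<open>A(L)_p\<close> for an atom \<open>a\<close> below
  \<open>p\<close>, so by induction on the rank each \<open>A(L)_p\<close> has a finite dual basis.

  Finally, \<open>A(L)\<close> is a quotient of a quotient, and its splitting over the flats has to
  be proved: the preimage of all relations in the tensor algebra is stable under keeping only the
  words whose join lies in a prescribed set of flats.\<close>
text \<open>\<open>x \<otimes>.A y\<close> abbreviates \<open>x \<otimes>\<^bsub>A\<^esub> y\<close>, and likewise for the other indexed operations.\<close>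

syntax "_index" :: "logic \<Rightarrow> index" ("._" [1000] 1000)

abbreviation (input) in_carrier (infix ".:" 50) where "x .: A \<equiv> x \<in> carrier A"
abbreviation (input) weight (infix ".>" 50) where "w .> R \<equiv> w \<in> UNIV \<rightarrow> carrier R"
abbreviation (input) iff_input (infixr "<->" 25) where "p <-> q \<equiv> (p :: bool) = q"
abbreviation (input) "dif \<equiv> differential"
abbreviation (input) "linext \<equiv> linear_extension"
abbreviation (input) "sg \<equiv> neg_one_pow"
abbreviation (input) "sdx \<equiv> standard_simplex"
abbreviation (input) "bdy \<equiv> chain_boundary"
abbreviation (input) "schain \<equiv> singular_chain"
abbreviation (input) "sface \<equiv> singular_face"

lemmas (in module) mod = module_axioms

section \<open>Modules with a product and a differential\<close>

definition lin ::
 "('r, 'm) ring_scheme => ('r, 'a, 'n) module_scheme => ('r, 'b, 'k) module_scheme => ('a => 'b) => bool" where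
 "lin R A B f <-> f \<in> carrier A \<rightarrow> carrier B &
  (ALL x:carrier A. ALL y:carrier A. f (x \<oplus>.A y) = f x \<oplus>.B f y) &
  (ALL a:carrier R. ALL x:carrier A. f (a \<odot>.A x) = a \<odot>.B f x)"

lemma linI:
 assumes "!!x. x .: A ==> f x .: B"
  and "!!x y. x .: A ==> y .: A ==> f (x \<oplus>.A y) = f x \<oplus>.B f y"
  and "!!a x. a .: R ==> x .: A ==> f (a \<odot>.A x) = a \<odot>.B f x"
 shows "lin R A B f"
 using assms unfolding lin_def by auto

lemma linD:
 assumes "lin R A B f"
 shows "x .: A ==> f x .: B"
  and "x .: A ==> y .: A ==> f (x \<oplus>.A y) = f x \<oplus>.B f y"
  and "a .: R ==> x .: A ==> f (a \<odot>.A x) = a \<odot>.B f x"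
 using assms unfolding lin_def by auto

lemma lin_zero:
 assumes "module R A" "module R B" "lin R A B f"
 shows "f \<zero>.A = \<zero>.B"
proof -
 interpret A: module R A by fact
 interpret B: module R B by fact
 have "f \<zero>.A = f (\<zero>.R \<odot>.A \<zero>.A)" by simp
 also have "... = \<zero>.R \<odot>.B f \<zero>.A" by (rule linD(3)[OF assms(3)]) simp_all
 also have "... = \<zero>.B" using linD(1)[OF assms(3)] by simp
 finally show ?thesis .
qed

lemma lin_a_inv:
 assumes "module R A" "module R B" "lin R A B f" "x .: A"
 shows "f (\<ominus>.A x) = \<ominus>.B f x"
proof -
 interpret A: module R A by fact
 interpret B: module R B by fact
 note f = linD[OF assms(3)]
 have "f (\<ominus>.A x) \<oplus>.B f x = f (\<ominus>.A x \<oplus>.A x)" using f(2) assms(4) by simp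
 also have "... = \<zero>.B" using lin_zero[OF assms(1-3)] assms(4) by (simp add: A.l_neg)
 finally show ?thesis using B.minus_equality f(1) assms(4) by (metis A.a_inv_closed)
qed

lemma lin_minus:
 assumes "module R A" "module R B" "lin R A B f" "x .: A" "y .: A"
 shows "f (x \<ominus>.A y) = f x \<ominus>.B f y"
proof -
 interpret A: module R A by fact
 show ?thesis using lin_a_inv[OF assms(1-3,5)] linD[OF assms(3)] assms(4,5)
  by (simp add: a_minus_def)
qed

lemma lin_finsum:
 assumes "module R A" "module R B" "lin R A B f" "finite S" "g \<in> S \<rightarrow> carrier A"
 shows "f (\<Oplus>.A i\<in>S. g i) = (\<Oplus>.B i\<in>S. f (g i))"
proof -
 interpret A: module R A by fact
 interpret B: module R B by fact
 note f = linD[OF assms(3)]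
 show ?thesis using assms(4,5)
 proof (induction S rule: finite_induct)
  case empty show ?case using lin_zero[OF assms(1-3)] by simp
 next
  case (insert x F)
  hence "g \<in> F \<rightarrow> carrier A" "g x .: A" by auto
  thus ?case using insert f by (simp add: A.finsum_insert B.finsum_insert Pi_def)
 qed
qed

lemma lin_comp:
 "lin R A B f ==> lin R B C g ==> lin R A C (%x. g (f x))"
 unfolding lin_def by (auto simp: Pi_def)

lemma lin_id: "lin R A A (%x. x)"
 by (auto simp: lin_def)

lemma (in module) lin_const_zero:
 "lin R A M (%x. \<zero>.M)"
 by (auto simp: lin_def)

lemma (in module) lin_sum:
 assumes "lin R A M f" "lin R A M g"
 shows "lin R A M (%x. f x \<oplus>.M g x)"
 using assms unfolding lin_def
 by (auto simp: Pi_def smult_r_distr M.a_ac)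

lemma (in module) lin_smult:
 assumes "lin R A M f" "a .: R"
 shows "lin R A M (%x. a \<odot>.M f x)"
 using assms unfolding lin_def
 by (auto simp: Pi_def smult_r_distr smult_assoc1[symmetric] R.m_comm)

lemma (in module) lin_finsum_fun:
 assumes "finite S" "!!i. i \<in> S ==> lin R A M (f i)" and A: "module R A"
 shows "lin R A M (%x. \<Oplus>.M i\<in>S. f i x)"
 using assms(1,2)
proof (induction S rule: finite_induct)
 case empty show ?case using lin_const_zero by simp
next
 case (insert i S)
 have 1: "lin R A M (%x. f i x \<oplus>.M (\<Oplus>.M i\<in>S. f i x))"
  using insert by (intro lin_sum) auto
 have "(\<Oplus>.M j\<in>insert i S. f j x) = f i x \<oplus>.M (\<Oplus>.M j\<in>S. f j x)" if "x .: A" for x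
 proof -
  have "!!j. j \<in> insert i S ==> f j x .: M" using linD(1)[OF insert.prems that] by blast
  thus ?thesis using insert.hyps by (intro M.finsum_insert) auto
 qed
 moreover have "x \<oplus>.A y .: A" if "x .: A" "y .: A" for x y
 proof -
  interpret A: module R A by fact
  show ?thesis using that by auto
 qed
 moreover have "a \<odot>.A x .: A" if "x .: A" "a .: R" for x a
  using module.smult_closed[OF A] that by blast
 ultimately show ?case using linD[OF 1]
  by (intro linI) simp_all
qed

text \<open>The target carries no module structure beforehand, only operations respected by a
  surjection, so each axiom is pulled back to representatives. In this form it applies to quotients,
  whose operations are given by unions over cosets.\<close>

lemma module_image:
 assumes "module R A" "f ` carrier A = carrier B"
  and add: "!!x y. x .: A ==> y .: A ==> f (x \<oplus>.A y) = f x \<oplus>.B f y"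
  and smult: "!!a x. a .: R ==> x .: A ==> f (a \<odot>.A x) = a \<odot>.B f x"
  and zero: "f \<zero>.A = \<zero>.B"
 shows "module R B"
proof -
 interpret A: module R A by fact
 have rep: "EX x:carrier A. y = f x" if "y .: B" for y using assms(2) that by blast
 have cl: "f x .: B" if "x .: A" for x using assms(2) that by blast
 have "abelian_group B"
 proof (rule abelian_groupI)
  fix x y assume "x .: B" "y .: B"
  then obtain x' y' where *: "x' .: A" "x = f x'" "y' .: A" "y = f y'" using rep by meson
  show "x \<oplus>.B y .: B" using * cl by (simp flip: add)
  show "x \<oplus>.B y = y \<oplus>.B x" using * by (simp flip: add add: A.M.a_comm)
  fix z assume "z .: B"
  then obtain z' where "z' .: A" "z = f z'" using rep by meson
  thus "x \<oplus>.B y \<oplus>.B z = x \<oplus>.B (y \<oplus>.B z)" using * by (simp flip: add add: A.M.a_assoc)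
 next
  show "\<zero>.B .: B" using cl[of "\<zero>.A"] zero by simp
 next
  fix x assume "x .: B"
  then obtain x' where *: "x' .: A" "x = f x'" using rep by meson
  show "\<zero>.B \<oplus>.B x = x" using * by (simp flip: add zero)
  show "EX y:carrier B. y \<oplus>.B x = \<zero>.B"
  using * cl by (intro bexI[of _ "f (\<ominus>.A x')"]) (simp_all flip: add zero add: A.M.l_neg)
 qed
 moreover have "module_axioms R B"
 proof
  fix a x y assume a: "a .: R" and "x .: B"
  then obtain x' where *: "x' .: A" "x = f x'" using rep by meson
  show "a \<odot>.B x .: B" using * a cl by (simp flip: smult)
  {
  fix b assume b: "b .: R"
  show "(a \<oplus>.R b) \<odot>.B x = a \<odot>.B x \<oplus>.B b \<odot>.B x"
  using * a b by (simp flip: smult add add: A.smult_l_distr)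
  show "(a \<otimes>.R b) \<odot>.B x = a \<odot>.B (b \<odot>.B x)" using * a b by (simp flip: smult add: A.smult_assoc1)
  }
  assume "y .: B"
  then obtain y' where "y' .: A" "y = f y'" using rep by meson
  thus "a \<odot>.B (x \<oplus>.B y) = a \<odot>.B x \<oplus>.B a \<odot>.B y"
  using * a by (simp flip: smult add add: A.smult_r_distr)
 next
  fix x assume "x .: B"
  then obtain x' where "x' .: A" "x = f x'" using rep by meson
  thus "\<one>.R \<odot>.B x = x" by (simp flip: smult)
 qed
 ultimately show ?thesis by (simp add: module_def A.is_cring)
qed

text \<open>Only bilinearity of the product and linearity of the differential are asked, which a
  free module with product and differential prescribed on generators has at once. Associativity,
  signs and the Leibniz rule are added where they have been proved.\<close>

locale diff_alg = module R A for R :: "('r, 'm) ring_scheme" (structure) and A :: "('r, 'a) diff_algebra" (structure) +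
 assumes mult_closed [simp, intro]: "x .: A ==> y .: A ==> x \<otimes>.A y .: A"
  and mult_l_distr: "x .: A ==> y .: A ==> z .: A ==> (x \<oplus>.A y) \<otimes>.A z = x \<otimes>.A z \<oplus>.A y \<otimes>.A z"
  and mult_r_distr: "x .: A ==> y .: A ==> z .: A ==> z \<otimes>.A (x \<oplus>.A y) = z \<otimes>.A x \<oplus>.A z \<otimes>.A y"
  and smult_mult_l: "a .: R ==> x .: A ==> y .: A ==> (a \<odot>.A x) \<otimes>.A y = a \<odot>.A (x \<otimes>.A y)"
  and smult_mult_r: "a .: R ==> x .: A ==> y .: A ==> x \<otimes>.A (a \<odot>.A y) = a \<odot>.A (x \<otimes>.A y)"
  and unit_closed [simp, intro]: "\<one>.A .: A"
  and d_lin: "lin R A A (dif A)"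
begin

lemmas d_closed [simp, intro] = linD(1)[OF d_lin]
lemmas d_add = linD(2)[OF d_lin]
lemmas d_smult = linD(3)[OF d_lin]

lemma d_zero [simp]: "dif A \<zero>.A = \<zero>.A"
 by (rule lin_zero[OF mod mod d_lin])

lemma lmul_lin: "x .: A ==> lin R A A (%y. x \<otimes>.A y)"
 by (intro linI) (auto simp: mult_r_distr smult_mult_r)

lemma rmul_lin: "y .: A ==> lin R A A (%x. x \<otimes>.A y)"
 by (intro linI) (auto simp: mult_l_distr smult_mult_l)

lemma mult_zero_r [simp]: "x .: A ==> x \<otimes>.A \<zero>.A = \<zero>.A"
 by (rule lin_zero[OF mod mod lmul_lin])

lemma mult_zero_l [simp]: "x .: A ==> \<zero>.A \<otimes>.A x = \<zero>.A"
 using lin_zero[OF mod mod rmul_lin] .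

end

lemma diff_alg_image:
 assumes "diff_alg R A" "f ` carrier A = carrier B"
  and add: "!!x y. x .: A ==> y .: A ==> f (x \<oplus>.A y) = f x \<oplus>.B f y"
  and smult: "!!a x. a .: R ==> x .: A ==> f (a \<odot>.A x) = a \<odot>.B f x"
  and mult: "!!x y. x .: A ==> y .: A ==> f (x \<otimes>.A y) = f x \<otimes>.B f y"
  and d: "!!x. x .: A ==> f (dif A x) = dif B (f x)"
  and zero: "f \<zero>.A = \<zero>.B" and one: "f \<one>.A = \<one>.B"
 shows "diff_alg R B"
proof -
 interpret A: diff_alg R A by fact
 interpret B: module R B by (rule module_image[OF A.mod assms(2) add smult zero])
 have rep: "EX x:carrier A. y = f x" if "y .: B" for y using assms(2) that by blast
 have cl: "f x .: B" if "x .: A" for x using assms(2) that by blast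
 show ?thesis
 proof
  fix x y assume "x .: B" "y .: B"
  then obtain x' y' where *: "x' .: A" "x = f x'" "y' .: A" "y = f y'" using rep by meson
  show "x \<otimes>.B y .: B" using * cl by (simp flip: mult)
  show "(a \<odot>.B x) \<otimes>.B y = a \<odot>.B (x \<otimes>.B y)" if "a .: R" for a
  using * that by (simp flip: mult smult add: A.smult_mult_l)
  show "x \<otimes>.B (a \<odot>.B y) = a \<odot>.B (x \<otimes>.B y)" if "a .: R" for a
  using * that by (simp flip: mult smult add: A.smult_mult_r)
  fix z assume "z .: B"
  then obtain z' where z: "z' .: A" "z = f z'" using rep by meson
  show "(x \<oplus>.B y) \<otimes>.B z = x \<otimes>.B z \<oplus>.B y \<otimes>.B z" using * z by (simp flip: mult add add: A.mult_l_distr)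
  show "z \<otimes>.B (x \<oplus>.B y) = z \<otimes>.B x \<oplus>.B z \<otimes>.B y" using * z by (simp flip: mult add add: A.mult_r_distr)
 next
  show "\<one>.B .: B" using cl one by force
  show "lin R B B (dif B)"
  proof (rule linI)
  fix x assume "x .: B"
  then obtain x' where *: "x' .: A" "x = f x'" using rep by meson
  show "dif B x .: B" using * cl by (simp flip: d)
  show "dif B (a \<odot>.B x) = a \<odot>.B dif B x" if "a .: R" for a
  using * that by (simp flip: d smult add: A.d_smult)
  fix y assume "y .: B"
  then obtain y' where "y' .: A" "y = f y'" using rep by meson
  thus "dif B (x \<oplus>.B y) = dif B x \<oplus>.B dif B y"
  using * by (simp flip: d add add: A.d_add)
  qed
 qed
qed

subsection \<open>Quotients\<close>

lemma (in module) sub_subgroup: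
 assumes "submodule I R M"
 shows "abelian_subgroup I M"
proof -
 have "additive_subgroup I M" using assms by (simp add: additive_subgroup_def submodule_def)
 thus ?thesis using M.abelian_group_axioms by (intro abelian_subgroupI3)
qed

lemma (in module) cos_iff:
 assumes "submodule I R M" "x .: M" "y .: M"
 shows "I +>.M x = I +>.M y <-> x \<ominus>.M y \<in> I"
proof -
 interpret I: abelian_subgroup I M by (rule sub_subgroup[OF assms(1)])
 show ?thesis using assms(2,3)
  by (metis I.a_rcos_self I.a_repr_independence' I.a_rcos_module a_minus_def)
qed

lemma (in module) coset_zero:
 assumes "submodule I R M" 
 shows "I +>.M \<zero>.M = I"
proof -
 interpret I: abelian_subgroup I M by (rule sub_subgroup[OF assms(1)])
 show ?thesis by (simp add: I.a_subset M.a_coset_add_zero)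
qed

lemma (in module) coset_eq_zero_iff:
 assumes "submodule I R M" "x .: M"
 shows "I +>.M x = I <-> x \<in> I"
proof -
 interpret I: abelian_subgroup I M by (rule sub_subgroup[OF assms(1)])
 show ?thesis using assms(2) by (metis M.a_coset_join1 M.a_coset_join2 I.a_subgroup)
qed

lemma (in module) minus_eq_smult:
 assumes "x .: M" shows "\<ominus>.M x = (\<ominus> \<one>) \<odot>.M x"
 using smult_l_minus[OF R.one_closed assms] assms by simp

lemma (in module) subI':
 assumes "I <= carrier M" "\<zero>.M \<in> I" "!!x y. x \<in> I ==> y \<in> I ==> x \<oplus>.M y \<in> I"
  "!!a x. a .: R ==> x \<in> I ==> a \<odot>.M x \<in> I"
 shows "submodule I R M"
 using assms minus_eq_smult by (intro submoduleI) (auto simp: subset_iff)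

lemma subD:
 assumes "submodule I R M"
 shows "I <= carrier M" "\<zero>.M \<in> I" "x \<in> I ==> y \<in> I ==> x \<oplus>.M y \<in> I"
  "a .: R ==> x \<in> I ==> a \<odot>.M x \<in> I"
 using assms by (auto simp: submodule_def subgroup_def submodule_axioms_def)

lemma (in module) submodule_minus:
 assumes "submodule I R M" "x \<in> I" "y \<in> I"
 shows "x \<ominus>.M y \<in> I"
proof -
 have "y .: M" using assms subD by blast
 thus ?thesis using assms minus_eq_smult[of y] subD[OF assms(1)] by (simp add: a_minus_def)
qed

lemma (in module) in_coset_iff:
 assumes "submodule I R M" "x .: M"
 shows "y \<in> I +>.M x <-> y .: M & I +>.M y = I +>.M x"
proof -
 interpret I: abelian_subgroup I M by (rule sub_subgroup[OF assms(1)])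
 show ?thesis using assms(2)
  by (metis I.a_elemrcos_carrier I.a_rcos_self I.a_repr_independence')
qed

lemma Union_constant: "A ~= {} ==> (!!x. x \<in> A ==> f x = c) ==> (\<Union>x\<in>A. f x) = c"
 by auto

context module begin

text \<open>The operations of \<open>quotient_algebra\<close> are unions over all representatives;
  each is evaluated by showing that the term is constant on the coset.\<close>

lemma quotient_union:
 assumes "submodule I R M" "x .: M" "!!y. y .: M ==> y \<ominus>.M x \<in> I ==> F y = c"
 shows "(\<Union>y\<in>I +>.M x. F y) = c"
proof (rule Union_constant)
 show "I +>.M x ~= {}" using in_coset_iff[OF assms(1,2)] assms(2) by blast
 fix y assume "y \<in> I +>.M x"
 hence "y .: M" "y \<ominus>.M x \<in> I" using in_coset_iff[OF assms(1,2)] cos_iff[OF assms(1)] assms(2) by auto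
 thus "F y = c" using assms(3) by blast
qed

end

lemma qalg_simps:
 "carrier (quotient_algebra A I) = (%x. I +>.A x) ` carrier A"
 "one (quotient_algebra A I) = I +>.A \<one>.A"
 "zero (quotient_algebra A I) = I"
 "homog (quotient_algebra A I) k = (%x. I +>.A x) ` homog A k"
 by (auto simp: quotient_algebra_def FactRing_def A_RCOSETS_def' RCOSETS_def a_r_coset_def)

lemma quotient_smult:
 assumes "module R A" "submodule I R A" "a .: R" "x .: A"
 shows "a \<odot>\<^bsub>quotient_algebra A I\<^esub> (I +>.A x) = I +>.A (a \<odot>.A x)"
proof -
 interpret module R A by fact
 have "(\<Union>y\<in>I +>.A x. I +>.A (a \<odot>.A y)) = I +>.A (a \<odot>.A x)"
 proof (rule quotient_union[OF assms(2,4)])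
  fix y assume y: "y .: A" "y \<ominus>.A x \<in> I"
  hence "a \<odot>.A (y \<ominus>.A x) \<in> I" using subD(4)[OF assms(2,3)] by blast
  hence "a \<odot>.A y \<ominus>.A a \<odot>.A x \<in> I"
  using y assms(3,4) by (simp add: a_minus_def smult_r_distr smult_r_minus)
  thus "I +>.A (a \<odot>.A y) = I +>.A (a \<odot>.A x)"
  using y assms(3,4) by (simp add: cos_iff[OF assms(2)])
 qed
 thus ?thesis by (simp add: quotient_algebra_def)
qed

lemma quotient_add:
 assumes "module R A" "submodule I R A" "x .: A" "y .: A"
 shows "(I +>.A x) \<oplus>\<^bsub>quotient_algebra A I\<^esub> (I +>.A y) = I +>.A (x \<oplus>.A y)"
proof -
 interpret module R A by fact
 interpret I: abelian_subgroup I A by (rule sub_subgroup[OF assms(2)])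
 show ?thesis using I.a_rcos_sum[OF assms(3,4)] by (simp add: quotient_algebra_def FactRing_def)
qed

lemma quotient_module:
 assumes "module R A" "submodule I R A"
 shows "module R (quotient_algebra A I)"
proof -
 interpret module R A by fact
 show ?thesis
  by (rule module_image[OF assms(1), of "%x. I +>.A x"])
  (use assms in "auto simp: qalg_simps quotient_add quotient_smult coset_zero")
qed

locale diff_ideal = diff_alg R A for R :: "('r, 'm) ring_scheme" (structure) and A :: "('r, 'a) diff_algebra" (structure) +
 fixes I :: "'a set"
 assumes I_sub: "submodule I R A"
  and I_mult_l: "x .: A ==> y \<in> I ==> x \<otimes>.A y \<in> I"
  and I_mult_r: "x .: A ==> y \<in> I ==> y \<otimes>.A x \<in> I"
  and I_d: "x \<in> I ==> dif A x \<in> I"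
begin

lemma quotient_mult:
 assumes "x .: A" "y .: A"
 shows "(I +>.A x) \<otimes>\<^bsub>quotient_algebra A I\<^esub> (I +>.A y) = I +>.A (x \<otimes>.A y)"
proof -
 have sub: "I <= carrier A" using I_sub subD by blast
 have "(\<Union>a\<in>I +>.A x. \<Union>b\<in>I +>.A y. I +>.A (a \<otimes>.A b)) = I +>.A (x \<otimes>.A y)"
 proof (rule quotient_union[OF I_sub assms(1)], rule quotient_union[OF I_sub assms(2)])
  fix a b assume a: "a .: A" "a \<ominus>.A x \<in> I" and b: "b .: A" "b \<ominus>.A y \<in> I"
  have "a \<otimes>.A b \<ominus>.A x \<otimes>.A y = a \<otimes>.A (b \<ominus>.A y) \<oplus>.A (a \<ominus>.A x) \<otimes>.A y"
  proof -
  have "a \<otimes>.A (b \<ominus>.A y) = a \<otimes>.A b \<ominus>.A a \<otimes>.A y"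
  using lin_minus[OF mod mod lmul_lin] a(1) b(1) assms by simp
  moreover have "(a \<ominus>.A x) \<otimes>.A y = a \<otimes>.A y \<ominus>.A x \<otimes>.A y"
  using lin_minus[OF mod mod rmul_lin] a(1) b(1) assms by simp
  ultimately show ?thesis using a(1) b(1) assms
  by (simp add: a_minus_def M.a_assoc) (simp add: M.a_assoc[symmetric] M.l_neg)
  qed
  moreover have "... \<in> I" using a b assms I_mult_l I_mult_r subD(3)[OF I_sub] by blast
  ultimately show "I +>.A (a \<otimes>.A b) = I +>.A (x \<otimes>.A y)"
  using a b assms by (simp add: cos_iff[OF I_sub])
 qed
 thus ?thesis by (simp add: quotient_algebra_def FactRing_def rcoset_mult_def)
qed

lemma quotient_d:
 assumes "x .: A"
 shows "dif (quotient_algebra A I) (I +>.A x) = I +>.A dif A x"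
proof -
 have "(\<Union>y\<in>I +>.A x. I +>.A dif A y) = I +>.A dif A x"
 proof (rule quotient_union[OF I_sub assms])
  fix y assume y: "y .: A" "y \<ominus>.A x \<in> I"
  hence "dif A y \<ominus>.A dif A x \<in> I"
  using I_d[OF y(2)] lin_minus[OF mod mod d_lin y(1) assms] by simp
  thus "I +>.A dif A y = I +>.A dif A x"
  using y(1) assms by (simp add: cos_iff[OF I_sub])
 qed
 thus ?thesis by (simp add: quotient_algebra_def)
qed

lemmas quotient_simps = qalg_simps quotient_add[OF mod I_sub]
 quotient_smult[OF mod I_sub] quotient_mult quotient_d coset_zero[OF I_sub]

lemma quotient_diff_alg: "diff_alg R (quotient_algebra A I)"
 by (rule diff_alg_image[OF diff_alg_axioms, of "%x. I +>.A x"]) (auto simp: quotient_simps)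

end

subsection \<open>Differential graded algebras and quasi-isomorphisms\<close>

text \<open>The grading is recorded by operators \<open>gr \<theta>\<close> acting on the summand of degree \<open>k\<close> as the scalar
  \<open>\<theta> k\<close>: this gives at once the projections and the sign in the Leibniz rule, and avoids infinite
  direct sums.\<close>

locale graded_dga = diff_alg R A for R :: "('r, 'm) ring_scheme" (structure) and A :: "('r, 'a) diff_algebra" (structure) +
 fixes gr :: "(int => 'r) => 'a => 'a"
 assumes gr_lin: "th .> R ==> lin R A A (gr th)"
  and gr_gr: "th .> R ==> \<eta> .> R ==> x .: A ==> gr th (gr \<eta> x) = gr (%k. th k \<otimes> \<eta> k) x"
  and gr_one: "x .: A ==> gr (%_. \<one>) x = x"
  and homog_subset: "homog A k <= carrier A"
  and gr_homog: "th .> R ==> x \<in> homog A k ==> gr th x = th k \<odot>.A x"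
  and gr_indicator: "x .: A ==> gr (%j. if j = k then \<one> else \<zero>) x \<in> homog A k"
  and d_gr: "th .> R ==> x .: A ==> dif A (gr th x) = gr (%k. th (k - 1)) (dif A x)"
  and d_d: "x .: A ==> dif A (dif A x) = \<zero>.A"
  and d_one: "dif A \<one>.A = \<zero>.A"
  and leibniz: "x .: A ==> y .: A ==>
  dif A (x \<otimes>.A y) = dif A x \<otimes>.A y \<oplus>.A gr (sg R) x \<otimes>.A dif A y"

lemma (in cring) sg_closed [simp, intro]: "sg R k .: R"
 by (simp add: neg_one_pow_def)

lemma (in cring) sg_add: "sg R (j + k) = sg R j \<otimes> sg R k"
 by (simp add: neg_one_pow_def l_minus r_minus)

lemma (in cring) neg_one_pow_square: "sg R k \<otimes> sg R k = \<one>"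
 by (simp add: neg_one_pow_def l_minus r_minus)

definition diff_hom ::
 "('r, 'm) ring_scheme => ('r, 'a) diff_algebra => ('r, 'b) diff_algebra => ('a => 'b) => bool" where
 "diff_hom R A B f <-> lin R A B f &
  (ALL x:carrier A. ALL y:carrier A. f (x \<otimes>.A y) = f x \<otimes>.B f y) & f \<one>.A = \<one>.B &
  (ALL x:carrier A. f (dif A x) = dif B (f x))"

context graded_dga begin

abbreviation "cocycles == {x \<in> carrier A. dif A x = \<zero>.A}"
abbreviation "coboundaries == dif A ` carrier A"
abbreviation "cocyc == A\<lparr>carrier := cocycles, homog := (%k. homog A k \<inter> cocycles)\<rparr>"

lemma sign_sign: "x .: A ==> gr (sg R) (gr (sg R) x) = x"
 by (simp add: gr_gr Pi_def R.neg_one_pow_square gr_one)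

lemma gr_closed [simp]: "th .> R ==> x .: A ==> gr th x .: A"
 using linD(1)[OF gr_lin] by blast

lemma gr_zero: "th .> R ==> gr th \<zero>.A = \<zero>.A"
 by (rule lin_zero[OF mod mod gr_lin])

lemma sign_closed [simp]: "x .: A ==> gr (sg R) x .: A"
 by (simp add: Pi_def)

lemma sign_cocycle:
 assumes "x \<in> cocycles" shows "gr (sg R) x \<in> cocycles"
proof -
 have "dif A (gr (sg R) x) = gr (%k. sg R (k - 1)) \<zero>.A"
  using assms by (simp add: d_gr Pi_def)
 also have "... = \<zero>.A" by (simp add: gr_zero Pi_def)
 finally show ?thesis using assms by simp
qed

lemma cocycle_diff_alg: "diff_alg R cocyc"
proof -
 have cl: "x \<otimes>.A y \<in> cocycles" if "x \<in> cocycles" "y \<in> cocycles" for x y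
  using that by (simp add: leibniz)
 have one: "\<one>.A \<in> cocycles" by (simp add: d_one)
 have sub: "submodule cocycles R A"
  by (rule subI') (simp_all add: d_add d_smult subset_iff)
 hence "module R (A\<lparr>carrier := cocycles\<rparr>)" by (rule submodule.submodule_is_module[OF _ module_axioms])
 hence M: "module R cocyc" by (rule module_image[where f = "%x. x"]) auto
 show ?thesis unfolding diff_alg_def
 proof (intro conjI M, unfold_locales)
  show "lin R cocyc cocyc (dif cocyc)"
  by (rule linI) (auto simp: d_d d_add d_smult)
 qed (use cl one in "auto simp: mult_l_distr mult_r_distr smult_mult_l smult_mult_r")
qed

lemma coboundary_ideal: "diff_ideal R cocyc coboundaries"
proof -
 interpret Z: diff_alg R cocyc by (rule cocycle_diff_alg)
 have "submodule coboundaries R cocyc"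
 proof (rule Z.subI')
  show "coboundaries <= carrier cocyc" by (auto simp: d_d)
  show "\<zero>.cocyc \<in> coboundaries" using d_zero by force
  show "x \<oplus>.cocyc y \<in> coboundaries" if "x \<in> coboundaries" "y \<in> coboundaries" for x y
  using that d_add by (auto simp flip: d_add)
  show "a \<odot>.cocyc x \<in> coboundaries" if "a .: R" "x \<in> coboundaries" for a x
  using that d_smult by (auto simp flip: d_smult)
 qed
 moreover have "diff_ideal_axioms R cocyc coboundaries"
  if "submodule coboundaries R cocyc"
  using that
 proof (rule diff_ideal_axioms.intro, goal_cases)
  case (1 x y)
  then obtain b where b: "b .: A" "y = dif A b" by blast
  \<comment> \<open>The sign of the Leibniz rule is absorbed by twisting \<open>x\<close>
    beforehand: the sign operator is an involution and keeps cocycles, so only the term with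
    \<open>dif A b = y\<close> survives.\<close>
  have "dif A (gr (sg R) x \<otimes>.A b) = x \<otimes>.A y"
  using 1 b sign_cocycle[of x] by (simp add: leibniz sign_sign)
  moreover have "gr (sg R) x \<otimes>.A b .: A" using 1 b sign_closed[of x] by simp
  ultimately have "x \<otimes>.A y \<in> coboundaries" by (metis image_eqI)
  thus ?case by simp
 next
  case (2 x y)
  then obtain b where b: "b .: A" "y = dif A b" by blast
  have "dif A (b \<otimes>.A x) = y \<otimes>.A x"
  using 2 b by (simp add: leibniz)
  moreover have "b \<otimes>.A x .: A" using 2 b by simp
  ultimately have "y \<otimes>.A x \<in> coboundaries" by (metis image_eqI)
  thus ?case by simp
 next
  case (3 x)
  hence "dif A x = dif A \<zero>.A" by (auto simp: d_d)
  thus ?case by (simp add: image_iff) (metis M.zero_closed d_zero)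
 qed
 ultimately show ?thesis by (simp add: diff_ideal_def Z.diff_alg_axioms)
qed

definition cls :: "'a => 'a set" where
 "cls z = coboundaries +>.A z"

lemma cohomology_eq: "cohomology A = quotient_algebra cocyc coboundaries"
 by (simp add: cohomology_def Let_def)

lemma cocycle_class_eq: "cls z = coboundaries +>.cocyc z"
 by (simp add: cls_def a_r_coset_def r_coset_def)

lemma cohomology_diff_alg: "diff_alg R (cohomology A)"
 unfolding cohomology_eq by (rule diff_ideal.quotient_diff_alg[OF coboundary_ideal])

lemma coh_simps:
 "carrier (cohomology A) = cls ` cocycles"
 "homog (cohomology A) k = cls ` (homog A k \<inter> cocycles)"
 "\<one>\<^bsub>cohomology A\<^esub> = cls \<one>.A"
 "x \<in> cocycles ==> y \<in> cocycles ==> cls x \<oplus>\<^bsub>cohomology A\<^esub> cls y = cls (x \<oplus>.A y)"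
 "x \<in> cocycles ==> y \<in> cocycles ==> cls x \<otimes>\<^bsub>cohomology A\<^esub> cls y = cls (x \<otimes>.A y)"
 "a .: R ==> x \<in> cocycles ==> a \<odot>\<^bsub>cohomology A\<^esub> cls x = cls (a \<odot>.A x)"
proof -
 interpret Q: diff_ideal R cocyc coboundaries by (rule coboundary_ideal)
 note q = Q.quotient_simps[folded cohomology_eq cocycle_class_eq, simplified]
 show "carrier (cohomology A) = cls ` cocycles"
  "homog (cohomology A) k = cls ` (homog A k \<inter> cocycles)"
  "\<one>\<^bsub>cohomology A\<^esub> = cls \<one>.A"
  by (simp_all add: cohomology_eq qalg_simps cocycle_class_eq)
 show "x \<in> cocycles ==> y \<in> cocycles ==> cls x \<oplus>\<^bsub>cohomology A\<^esub> cls y = cls (x \<oplus>.A y)"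
  "x \<in> cocycles ==> y \<in> cocycles ==> cls x \<otimes>\<^bsub>cohomology A\<^esub> cls y = cls (x \<otimes>.A y)"
  "a .: R ==> x \<in> cocycles ==> a \<odot>\<^bsub>cohomology A\<^esub> cls x = cls (a \<odot>.A x)"
  using q by auto
qed

lemma cocycle_class_eq_iff:
 assumes "x \<in> cocycles" "y \<in> cocycles"
 shows "cls x = cls y <-> (EX b:carrier A. x \<ominus>.A y = dif A b)"
proof -
 interpret Q: diff_ideal R cocyc coboundaries by (rule coboundary_ideal)
 have inv: "\<ominus>.cocyc y = \<ominus>.A y"
 proof -
  have "\<ominus>.A y = (\<ominus> \<one>) \<odot>.A y" using assms minus_eq_smult by simp
  thus ?thesis using assms Q.minus_eq_smult[of y] by simp
 qed
 show ?thesis using Q.cos_iff[OF Q.I_sub, of x y] assms unfolding cocycle_class_eq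
  by (auto simp: a_minus_def inv)
qed

end

text \<open>Lifts of cocycles are corrected by elements of the acyclic kernel, which gives
  surjectivity; the same correction applied to a difference gives injectivity. The hypothesis
  \<open>gr\<close> says that the kernel is stable under the degree projections: then a homogeneous
  cocycle has a homogeneous lift, and homogeneous parts correspond exactly.\<close>

lemma quasi_iso:
 assumes "graded_dga R A gA" "graded_dga R B gB" "diff_hom R A B f"
  and homog: "!!k. f ` homog A k = homog B k" and surj: "f ` carrier A = carrier B"
  and gr: "!!th x. th .> R ==> x .: A ==> f x = \<zero>.B ==> f (gA th x) = \<zero>.B"
  and acyclic: "!!x. x .: A ==> f x = \<zero>.B ==> dif A x = \<zero>.A ==>
  EX w:carrier A. f w = \<zero>.B & dif A w = x"
 shows "EX \<phi>. graded_algebra_iso R (cohomology A) (cohomology B) \<phi>"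
proof -
 interpret A: graded_dga R A gA by fact
 interpret B: graded_dga R B gB by fact
 have lin: "lin R A B f" using assms(3) by (simp add: diff_hom_def)
 note f_minus = lin_minus[OF A.mod B.mod lin]
 note f_zero = lin_zero[OF A.mod B.mod lin]
 note f = linD[OF lin]
 have fd: "f (dif A x) = dif B (f x)" if "x .: A" for x
  using assms(3) that by (simp add: diff_hom_def)
 have fm: "f (x \<otimes>.A y) = f x \<otimes>.B f y" if "x .: A" "y .: A" for x y
  using assms(3) that by (simp add: diff_hom_def)
 have fZ: "f z \<in> B.cocycles" if "z \<in> A.cocycles" for z
  using that f(1) fd[of z] f_zero by simp
 have lift: "EX z:A.cocycles. f z = y & (ALL k. y \<in> homog B k --> (EX z:A.cocycles \<inter> homog A k. f z = y))"
  if y: "y \<in> B.cocycles" for y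
 proof -
  \<comment> \<open>For any lift \<open>x\<close> of the cocycle \<open>y\<close>,
    \<open>dif A x\<close> is a cocycle in the kernel, hence the differential of some
    \<open>w\<close> in the kernel, and \<open>x - w\<close> is a cocycle lifting
    \<open>y\<close>.\<close>
  have main: "EX w:carrier A. f w = \<zero>.B & dif A w = dif A x"
  if "x .: A" "f x = y" for x
  proof (rule acyclic)
  show "dif A x .: A" using that(1) by (rule A.d_closed)
  show "f (dif A x) = \<zero>.B" unfolding fd[OF that(1)] that(2) using y by blast
  show "dif A (dif A x) = \<zero>.A" using that(1) by (rule A.d_d)
  qed
  have "y \<in> f ` carrier A" using y surj by simp
  then obtain x where x: "x .: A" "f x = y" by auto
  obtain w where w: "w .: A" "f w = \<zero>.B" "dif A w = dif A x" using main[OF x] by auto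
  have 1: "x \<ominus>.A w \<in> A.cocycles & f (x \<ominus>.A w) = y"
  proof -
  have "dif A (x \<ominus>.A w) = \<zero>.A"
  unfolding lin_minus[OF A.mod A.mod A.d_lin x(1) w(1)] w(3)
  using x(1) by (simp add: a_minus_def A.M.r_neg)
  moreover have "f (x \<ominus>.A w) = y"
  unfolding f_minus[OF x(1) w(1)] w(2) x(2) using y by (simp add: a_minus_def)
  ultimately show ?thesis using x(1) w(1) by simp
  qed
  moreover have "EX z:A.cocycles \<inter> homog A k. f z = y" if k: "y \<in> homog B k" for k
  proof -
  have "y \<in> f ` homog A k" using k homog by simp
  then obtain x where x: "x \<in> homog A k" "f x = y" by auto
  hence xc: "x .: A" using A.homog_subset by blast
  obtain w where w: "w .: A" "f w = \<zero>.B" "dif A w = dif A x" using main[OF xc x(2)] by auto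
  \<comment> \<open>The correction \<open>w\<close> need not be homogeneous. Projecting
    \<open>x - w\<close> to degree \<open>k\<close> fixes \<open>x\<close> and replaces
    \<open>w\<close> by its part of degree \<open>k\<close>, which still lies in the kernel.\<close>
  define P where "P = (%j. if j = k then \<one>.R else \<zero>.R)"
  have P: "P .> R" by (auto simp: P_def)
  have "gA P (x \<ominus>.A w) \<in> homog A k" using A.gr_indicator[of "x \<ominus>.A w" k] xc w by (simp add: P_def)
  moreover have "gA P (x \<ominus>.A w) = x \<ominus>.A gA P w"
  using lin_minus[OF A.mod A.mod A.gr_lin[OF P] xc w(1)] A.gr_homog[OF P x(1)] xc
  by (simp add: P_def)
  moreover have "f (x \<ominus>.A gA P w) = y"
  using f_minus[OF xc, of "gA P w"] gr[OF P w(1,2)] w(1) P x y by (simp add: a_minus_def)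
  moreover have "dif A (gA P (x \<ominus>.A w)) = \<zero>.A"
  proof -
  have "dif A (x \<ominus>.A w) = \<zero>.A"
  using lin_minus[OF A.mod A.mod A.d_lin xc w(1)] w(3) xc
  by (simp add: a_minus_def A.M.r_neg)
  hence "dif A (gA P (x \<ominus>.A w)) = gA (%k. P (k - 1)) \<zero>.A"
  using A.d_gr[OF P, of "x \<ominus>.A w"] xc w(1) by simp
  also have "... = \<zero>.A" using P by (intro A.gr_zero) auto
  finally show ?thesis .
  qed
  ultimately show ?thesis using A.homog_subset[of k] by (intro bexI[of _ "gA P (x \<ominus>.A w)"]) auto
  qed
  ultimately show ?thesis by (intro bexI[of _ "x \<ominus>.A w"]) auto
 qed
 define \<phi> where "\<phi> X = B.cls (f (SOME z. z \<in> A.cocycles & A.cls z = X))" for X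
 have \<phi>: "\<phi> (A.cls z) = B.cls (f z)" if z: "z \<in> A.cocycles" for z
 proof -
  define z' where "z' = (SOME z'. z' \<in> A.cocycles & A.cls z' = A.cls z)"
  have z': "z' \<in> A.cocycles & A.cls z' = A.cls z" unfolding z'_def by (rule someI[of _ z]) (use z in auto)
  then obtain b where b: "b .: A" "z' \<ominus>.A z = dif A b" using A.cocycle_class_eq_iff[of z' z] z by auto
  have zz: "z' .: A" "z .: A" using z z' by auto
  have "f z' \<ominus>.B f z = dif B (f b)" unfolding f_minus[OF zz, symmetric] fd[OF b(1), symmetric] b(2) ..
  hence "B.cls (f z') = B.cls (f z)"
  using B.cocycle_class_eq_iff[OF fZ[OF conjunct1[OF z']] fZ[OF z]] f(1)[OF b(1)] by auto
  thus ?thesis by (simp add: \<phi>_def z'_def)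
 qed
 have "\<phi> \<in> ring_hom (cohomology A) (cohomology B)"
 proof (rule ring_hom_memI)
  fix X assume "X .: (cohomology A)"
  then obtain x where x: "x \<in> A.cocycles" "X = A.cls x" by (auto simp: A.coh_simps)
  show "\<phi> X .: (cohomology B)"
  unfolding x(2) \<phi>[OF x(1)] B.coh_simps(1) using fZ[OF x(1)] by (rule imageI)
  fix Y assume "Y .: (cohomology A)"
  then obtain y where y: "y \<in> A.cocycles" "Y = A.cls y" by (auto simp: A.coh_simps)
  have xy: "x .: A" "y .: A" using x y by auto
  have 1: "x \<otimes>.A y \<in> A.cocycles" using x y by (simp add: A.leibniz)
  show "\<phi> (X \<otimes>\<^bsub>cohomology A\<^esub> Y) = \<phi> X \<otimes>\<^bsub>cohomology B\<^esub> \<phi> Y"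
  unfolding x(2) y(2) A.coh_simps(5)[OF x(1) y(1)] \<phi>[OF x(1)] \<phi>[OF y(1)] \<phi>[OF 1]
  B.coh_simps(5)[OF fZ[OF x(1)] fZ[OF y(1)]] fm[OF xy] ..
  have 2: "x \<oplus>.A y \<in> A.cocycles" using x y by (simp add: A.d_add)
  show "\<phi> (X \<oplus>\<^bsub>cohomology A\<^esub> Y) = \<phi> X \<oplus>\<^bsub>cohomology B\<^esub> \<phi> Y"
  unfolding x(2) y(2) A.coh_simps(4)[OF x(1) y(1)] \<phi>[OF x(1)] \<phi>[OF y(1)] \<phi>[OF 2]
  B.coh_simps(4)[OF fZ[OF x(1)] fZ[OF y(1)]] f(2)[OF xy] ..
 next
  have "\<one>.A \<in> A.cocycles" using diff_alg.unit_closed[OF A.cocycle_diff_alg] by simp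
  moreover have "f \<one>.A = \<one>.B" using assms(3) by (simp add: diff_hom_def)
  ultimately show "\<phi> \<one>\<^bsub>cohomology A\<^esub> = \<one>\<^bsub>cohomology B\<^esub>"
  using \<phi>[of "\<one>.A"] unfolding A.coh_simps(3) B.coh_simps(3) by simp
 qed
 moreover have "bij_betw \<phi> (carrier (cohomology A)) (carrier (cohomology B))"
  unfolding bij_betw_def
 proof
  show "inj_on \<phi> (carrier (cohomology A))"
  proof (rule inj_onI)
  fix X Y assume "X .: (cohomology A)" "Y .: (cohomology A)" and eq: "\<phi> X = \<phi> Y"
  then obtain x y where x: "x \<in> A.cocycles" "X = A.cls x" and y: "y \<in> A.cocycles" "Y = A.cls y"
  by (auto simp: A.coh_simps)
  have xyc: "x .: A" "y .: A" using x y by auto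
  have "B.cls (f x) = B.cls (f y)"
  using eq unfolding x(2) y(2) \<phi>[OF x(1)] \<phi>[OF y(1)] .
  then obtain b' where b': "b' .: B" "f x \<ominus>.B f y = dif B b'"
  unfolding B.cocycle_class_eq_iff[OF fZ[OF x(1)] fZ[OF y(1)]] by auto
  hence "b' \<in> f ` carrier A" using surj by simp
  then obtain b where b: "b .: A" "f x \<ominus>.B f y = dif B (f b)" using b'(2) by auto
  have xy: "x \<ominus>.A y \<in> A.cocycles"
  using x y lin_minus[OF A.mod A.mod A.d_lin, of x y] by (simp add: a_minus_def)
  \<comment> \<open>Subtracting \<open>dif A b\<close> moves the difference of the two cocycles into
    the kernel without changing its class.\<close>
  define u where "u = (x \<ominus>.A y) \<ominus>.A dif A b"
  have "u .: A" using x y b by (simp add: u_def)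
  moreover have "f u = \<zero>.B"
  proof -
  have "f u = (f x \<ominus>.B f y) \<ominus>.B dif B (f b)"
  unfolding u_def using f_minus[of "x \<ominus>.A y" "dif A b"] f_minus[OF xyc] xyc b(1) fd[OF b(1)] by simp
  also have "... = \<zero>.B" unfolding b(2) using f(1)[OF b(1)] by (simp add: a_minus_def B.M.r_neg)
  finally show ?thesis .
  qed
  moreover have "dif A u = \<zero>.A"
  using xy b lin_minus[OF A.mod A.mod A.d_lin, of "x \<ominus>.A y" "dif A b"]
  by (simp add: u_def a_minus_def A.d_d)
  ultimately obtain w where w: "w .: A" "dif A w = u" using acyclic[of u] by auto
  have "dif A (w \<oplus>.A b) = u \<oplus>.A dif A b" using w b by (simp add: A.d_add)
  also have "... = x \<ominus>.A y"
  using x y b by (simp add: u_def a_minus_def A.M.a_assoc A.M.l_neg)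
  finally show "X = Y" unfolding x(2) y(2) A.cocycle_class_eq_iff[OF x(1) y(1)]
  using w(1) b(1) by (intro bexI[of _ "w \<oplus>.A b"]) auto
  qed
  have "\<phi> ` A.cls ` A.cocycles = (%z. B.cls (f z)) ` A.cocycles"
  unfolding image_image by (rule image_cong) (use \<phi> in auto)
  also have "... = B.cls ` (f ` A.cocycles)" unfolding image_image ..
  also have "f ` A.cocycles = B.cocycles"
  proof
  show "f ` A.cocycles <= B.cocycles" using fZ by blast
  show "B.cocycles <= f ` A.cocycles"
  proof
  fix y assume y: "y \<in> B.cocycles"
  then obtain z where "z \<in> A.cocycles" "f z = y" using lift[OF y] by auto
  thus "y \<in> f ` A.cocycles" by blast
  qed
  qed
  finally show "\<phi> ` carrier (cohomology A) = carrier (cohomology B)"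
  unfolding A.coh_simps(1) B.coh_simps(1) .
 qed
 moreover have "\<phi> (a \<odot>\<^bsub>cohomology A\<^esub> X) = a \<odot>\<^bsub>cohomology B\<^esub> \<phi> X"
  if a: "a .: R" and X: "X .: (cohomology A)" for a X
 proof -
  obtain x where x: "x \<in> A.cocycles" "X = A.cls x" using X unfolding A.coh_simps(1) by auto
  have xc: "x .: A" using x by simp
  have 1: "a \<odot>.A x \<in> A.cocycles" using x that by (simp add: A.d_smult)
  show ?thesis unfolding x(2) A.coh_simps(6)[OF a x(1)] \<phi>[OF x(1)] \<phi>[OF 1]
  B.coh_simps(6)[OF a fZ[OF x(1)]] f(3)[OF a xc] ..
 qed
 moreover have "\<phi> ` homog (cohomology A) k = homog (cohomology B) k" for k
 proof -
  have "\<phi> ` A.cls ` (homog A k \<inter> A.cocycles) = (%z. B.cls (f z)) ` (homog A k \<inter> A.cocycles)"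
  unfolding image_image by (rule image_cong) (use \<phi> in auto)
  also have "... = B.cls ` (f ` (homog A k \<inter> A.cocycles))" unfolding image_image ..
  also have "f ` (homog A k \<inter> A.cocycles) = homog B k \<inter> B.cocycles"
  proof
  show "f ` (homog A k \<inter> A.cocycles) <= homog B k \<inter> B.cocycles" using fZ homog by blast
  show "homog B k \<inter> B.cocycles <= f ` (homog A k \<inter> A.cocycles)"
  proof
  fix y assume y: "y \<in> homog B k \<inter> B.cocycles"
  hence "y \<in> B.cocycles" "y \<in> homog B k" by auto
  then obtain z where "z \<in> A.cocycles \<inter> homog A k" "f z = y" using lift[of y] by metis
  thus "y \<in> f ` (homog A k \<inter> A.cocycles)" by blast
  qed
  qed
  finally show ?thesis unfolding A.coh_simps(2) B.coh_simps(2) .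
 qed
 ultimately show ?thesis unfolding graded_algebra_iso_def ring_iso_def by blast
qed

lemma graded_algebra_iso_trans:
 assumes "graded_algebra_iso R A B \<phi>" "graded_algebra_iso R B C \<psi>"
 shows "graded_algebra_iso R A C (%x. \<psi> (\<phi> x))"
proof -
 have "\<psi> \<circ> \<phi> \<in> ring_iso A C" using assms ring_iso_set_trans by (auto simp: graded_algebra_iso_def)
 moreover have "\<phi> x .: B" if "x .: A" for x
  using assms(1) that by (auto simp: graded_algebra_iso_def ring_iso_def bij_betw_def)
 ultimately show ?thesis using assms unfolding graded_algebra_iso_def
  by (auto simp: o_def image_image[symmetric])
qed

lemma graded_algebra_iso_sym:
 assumes "diff_alg R A" "graded_algebra_iso R A B \<phi>" "!!k. homog A k <= carrier A"
 shows "graded_algebra_iso R B A (inv_into (carrier A) \<phi>)"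
proof -
 interpret A: diff_alg R A by fact
 let ?\<psi> = "inv_into (carrier A) \<phi>"
 have hom: "\<phi> \<in> ring_hom A B" and bij: "bij_betw \<phi> (carrier A) (carrier B)"
  and sm: "!!a x. a .: R ==> x .: A ==> \<phi> (a \<odot>.A x) = a \<odot>.B \<phi> x"
  and hg: "!!k. \<phi> ` homog A k = homog B k"
  using assms(2) by (auto simp: graded_algebra_iso_def ring_iso_def)
 have inj: "inj_on \<phi> (carrier A)" and im: "\<phi> ` carrier A = carrier B" using bij by (auto simp: bij_betw_def)
 have \<psi>: "?\<psi> (\<phi> x) = x" if "x .: A" for x using inv_into_f_f[OF inj that] .
 have rep: "EX x:carrier A. y = \<phi> x" if "y .: B" for y using im that by blast
 have "?\<psi> \<in> ring_hom B A"
 proof (rule ring_hom_memI)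
  fix x assume "x .: B"
  then obtain x' where x: "x' .: A" "x = \<phi> x'" using rep by blast
  show "?\<psi> x .: A" using x \<psi> by simp
  fix y assume "y .: B"
  then obtain y' where y: "y' .: A" "y = \<phi> y'" using rep by blast
  show "?\<psi> (x \<otimes>.B y) = ?\<psi> x \<otimes>.A ?\<psi> y"
  using x y \<psi> ring_hom_mult[OF hom, of x' y'] by (metis A.mult_closed)
  show "?\<psi> (x \<oplus>.B y) = ?\<psi> x \<oplus>.A ?\<psi> y"
  using x y \<psi> ring_hom_add[OF hom, of x' y'] by (metis A.M.a_closed)
 next
  show "?\<psi> \<one>.B = \<one>.A" using ring_hom_one[OF hom] \<psi> by (metis A.unit_closed)
 qed
 moreover have "bij_betw ?\<psi> (carrier B) (carrier A)" by (rule bij_betw_inv_into[OF bij])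
 moreover have "?\<psi> (a \<odot>.B x) = a \<odot>.A ?\<psi> x" if a: "a .: R" and xB: "x .: B" for a x
 proof -
  obtain x' where x: "x' .: A" "x = \<phi> x'" using rep[OF xB] by auto
  thus ?thesis using \<psi> sm[OF a x(1)] a by (metis A.smult_closed)
 qed
 moreover have "?\<psi> ` homog B k = homog A k" for k
  using inv_into_image_cancel[OF inj assms(3)] hg by metis
 ultimately show ?thesis by (auto simp: graded_algebra_iso_def ring_iso_def)
qed

section \<open>Free modules\<close>

definition fsupp :: "('r, 'm) ring_scheme => 'u set => ('u => 'r) set" where
 "fsupp R X = {f. range f <= carrier R & finite (support R f) & support R f <= X}"

definition free_lift ::
 "('r, 'm) ring_scheme => ('r, 'b, 'k) module_scheme => ('u => 'b) => ('u => 'r) => 'b" where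
 "free_lift R V \<phi> f = (\<Oplus>.V u\<in>support R f. f u \<odot>.V \<phi> u)"

text \<open>The ring as a module over itself, so that functionals and coordinate evaluations are
  linear maps in the sense of \<open>lin\<close> and \<open>free_lift\<close>.\<close>

definition scal :: "('r, 'm) ring_scheme => ('r, 'r) module" where
 "scal R = \<lparr>carrier = carrier R, mult = mult R, one = one R, zero = zero R, add = add R, smult = mult R\<rparr>"

lemma fsuppD:
 assumes "f \<in> fsupp R X"
 shows "f u .: R" "finite (support R f)" "support R f <= X" "u \<notin> support R f ==> f u = \<zero>.R"
 using assms by (auto simp: fsupp_def support_def)

lemma free_lift_cong:
 "(!!u. u \<in> support R f ==> \<phi> u = \<psi> u) ==> module R V ==> f \<in> fsupp R X ==>
  (!!u. u \<in> X ==> \<psi> u .: V) ==> free_lift R V \<phi> f = free_lift R V \<psi> f"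
proof -
 assume *: "!!u. u \<in> support R f ==> \<phi> u = \<psi> u" "module R V" "f \<in> fsupp R X"
  "!!u. u \<in> X ==> \<psi> u .: V"
 interpret V: module R V by fact
 show ?thesis unfolding free_lift_def
  by (rule V.M.finsum_cong') (use * fsuppD[OF *(3)] in auto)
qed

lemma free_lift_superset:
 assumes "module R V" "f \<in> fsupp R X" "!!u. u \<in> X ==> \<phi> u .: V"
  "finite S" "support R f <= S" "S <= X"
 shows "free_lift R V \<phi> f = (\<Oplus>.V u\<in>S. f u \<odot>.V \<phi> u)"
proof -
 interpret V: module R V by fact
 note f = fsuppD[OF assms(2)]
 show ?thesis unfolding free_lift_def
  by (rule V.M.add.finprod_mono_neutral_cong_left)
  (use f assms in "auto simp: subset_iff")
qed

context cring begin

lemma basis_elt_in: "u \<in> X ==> basis_elt R u \<in> fsupp R X"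
 by (auto simp: fsupp_def basis_elt_def support_def intro: finite_subset[of _ "{u}"])

lemma fsf_zero: "(%_. \<zero>) \<in> fsupp R X"
 by (auto simp: fsupp_def support_def)

lemma fsf_add:
 assumes "f \<in> fsupp R X" "g \<in> fsupp R X"
 shows "(%u. f u \<oplus> g u) \<in> fsupp R X"
proof -
 note f = fsuppD[OF assms(1)] and g = fsuppD[OF assms(2)]
 have s: "support R (%u. f u \<oplus> g u) <= support R f \<union> support R g" by (auto simp: support_def)
 have "finite (support R (%u. f u \<oplus> g u))" by (rule finite_subset[OF s]) (use f(2) g(2) in simp)
 moreover have "support R (%u. f u \<oplus> g u) <= X" using s f(3) g(3) by auto
 moreover have "range (%u. f u \<oplus> g u) <= carrier R" using f(1) g(1) by auto
 ultimately show ?thesis by (simp add: fsupp_def)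
qed

lemma fsf_smult:
 assumes "f \<in> fsupp R X" "a .: R"
 shows "(%u. a \<otimes> f u) \<in> fsupp R X"
proof -
 note f = fsuppD[OF assms(1)]
 have s: "support R (%u. a \<otimes> f u) <= support R f" using assms(2) by (auto simp: support_def)
 have "finite (support R (%u. a \<otimes> f u))" by (rule finite_subset[OF s f(2)])
 moreover have "support R (%u. a \<otimes> f u) <= X" using s f(3) by auto
 moreover have "range (%u. a \<otimes> f u) <= carrier R" using f(1) assms(2) by auto
 ultimately show ?thesis by (simp add: fsupp_def)
qed

lemma fsf_induct [consumes 1, case_names zero add basis]:
 fixes P :: "('u => 'a) => bool"
 assumes "f \<in> fsupp R X"
  and "P (%_. \<zero>)"
  and add: "!!f g. f \<in> fsupp R X ==> g \<in> fsupp R X ==> P f ==> P g ==> P (%u. f u \<oplus> g u)"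
  and basis: "!!a u. a .: R ==> u \<in> X ==> P (%w. a \<otimes> basis_elt R u w)"
 shows "P f"
proof -
 have "ALL f. support R f = S --> f \<in> fsupp R X --> P f" if "finite S" for S
  using that
 proof (induction S rule: finite_induct)
  case empty
  have *: "f' = (%_. \<zero>)" if s: "support R f' = {}" for f' :: "'u => 'a"
  proof
  fix u show "f' u = \<zero>" using s unfolding support_def by blast
  qed
  show ?case
  proof (intro allI impI)
  fix f' :: "'u => 'a" assume "support R f' = {}"
  hence "f' = (%_. \<zero>)" by (rule *)
  thus "P f'" using assms(2) by (simp only:)
  qed
 next
  case (insert u S)
  show ?case
  proof (intro allI impI)
  fix f assume f: "support R f = insert u S" "f \<in> fsupp R X"
  note fD = fsuppD[OF f(2)]
  define g where "g = f(u := \<zero>)"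
  have su: "support R g = S" using f(1) insert.hyps by (auto simp: g_def support_def)
  have "g w .: R" for w using fD(1)[of w] by (simp add: g_def)
  hence g: "g \<in> fsupp R X"
  using su fD(3) f(1) insert.hyps(1) by (auto simp: fsupp_def)
  have u: "u \<in> X" using fD(3) f(1) by auto
  have eq: "f = (%w. g w \<oplus> (f u \<otimes> basis_elt R u w))"
  proof
  fix w show "f w = g w \<oplus> (f u \<otimes> basis_elt R u w)"
  using fD(1)[of w] fD(1)[of u] by (cases "w = u") (simp_all add: g_def basis_elt_def)
  qed
  have Pg: "P g" using insert.IH su g by blast
  have "P (%w. g w \<oplus> (f u \<otimes> basis_elt R u w))"
  by (rule add[OF g fsf_smult[OF basis_elt_in[OF u] fD(1)] Pg basis[OF fD(1) u]])
  thus "P f" by (subst eq)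
  qed
 qed
 thus ?thesis using fsuppD(2)[OF assms(1)] assms(1) by blast
qed

end

lemma free_lift_closed:
 assumes "module R V" "f \<in> fsupp R X" "!!u. u \<in> X ==> \<phi> u .: V"
 shows "free_lift R V \<phi> f .: V"
proof -
 interpret V: module R V by fact
 show ?thesis unfolding free_lift_def using assms(3) fsuppD[OF assms(2)]
  by (intro V.M.finsum_closed) auto
qed

lemma free_lift_add:
 assumes "module R V" "f \<in> fsupp R X" "g \<in> fsupp R X"
  "!!u. u \<in> X ==> \<phi> u .: V"
 shows "free_lift R V \<phi> (%u. f u \<oplus>.R g u) = free_lift R V \<phi> f \<oplus>.V free_lift R V \<phi> g"
proof -
 interpret V: module R V by fact
 note f = fsuppD[OF assms(2)] and g = fsuppD[OF assms(3)]
 let ?S = "support R f \<union> support R g"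
 have fg: "(%u. f u \<oplus>.R g u) \<in> fsupp R X" using V.fsf_add assms by blast
 have "support R (%u. f u \<oplus>.R g u) <= ?S" by (auto simp: support_def)
 hence "free_lift R V \<phi> (%u. f u \<oplus>.R g u) = (\<Oplus>.V u\<in>?S. (f u \<oplus>.R g u) \<odot>.V \<phi> u)"
  using f g by (intro free_lift_superset[OF assms(1) fg assms(4)]) auto
 also have "... = (\<Oplus>.V u\<in>?S. f u \<odot>.V \<phi> u \<oplus>.V g u \<odot>.V \<phi> u)"
  using f g assms(4) by (intro V.M.finsum_cong') (auto simp: V.smult_l_distr subset_iff)
 also have "... = (\<Oplus>.V u\<in>?S. f u \<odot>.V \<phi> u) \<oplus>.V (\<Oplus>.V u\<in>?S. g u \<odot>.V \<phi> u)"
  using f g assms(4) by (intro V.M.finsum_addf) (auto simp: subset_iff)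
 also have "(\<Oplus>.V u\<in>?S. f u \<odot>.V \<phi> u) = free_lift R V \<phi> f"
  using f g by (intro free_lift_superset[OF assms(1,2,4), symmetric]) auto
 also have "(\<Oplus>.V u\<in>?S. g u \<odot>.V \<phi> u) = free_lift R V \<phi> g"
  using f g by (intro free_lift_superset[OF assms(1,3,4), symmetric]) auto
 finally show ?thesis .
qed

lemma free_lift_smult:
 assumes "module R V" "f \<in> fsupp R X" "a .: R"
  "!!u. u \<in> X ==> \<phi> u .: V"
 shows "free_lift R V \<phi> (%u. a \<otimes>.R f u) = a \<odot>.V free_lift R V \<phi> f"
proof -
 interpret V: module R V by fact
 note f = fsuppD[OF assms(2)]
 have af: "(%u. a \<otimes>.R f u) \<in> fsupp R X" using V.fsf_smult assms by blast
 have "support R (%u. a \<otimes>.R f u) <= support R f" using assms(3) by (auto simp: support_def)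
 hence "free_lift R V \<phi> (%u. a \<otimes>.R f u) = (\<Oplus>.V u\<in>support R f. (a \<otimes>.R f u) \<odot>.V \<phi> u)"
  using f by (intro free_lift_superset[OF assms(1) af assms(4)]) auto
 also have "... = (\<Oplus>.V u\<in>support R f. a \<odot>.V (f u \<odot>.V \<phi> u))"
  using f assms(3,4) by (intro V.M.finsum_cong') (auto simp: V.smult_assoc1 subset_iff)
 also have "... = a \<odot>.V (\<Oplus>.V u\<in>support R f. f u \<odot>.V \<phi> u)"
  using f assms(3,4) by (intro V.finsum_smult_ldistr[symmetric]) (auto simp: subset_iff)
 finally show ?thesis by (simp add: free_lift_def)
qed

lemma free_lift_basis:
 assumes "module R V" "u \<in> X" "!!u. u \<in> X ==> \<phi> u .: V"
 shows "free_lift R V \<phi> (basis_elt R u) = \<phi> u"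
proof -
 interpret V: module R V by fact
 have "free_lift R V \<phi> (basis_elt R u) = (\<Oplus>.V w\<in>{u}. basis_elt R u w \<odot>.V \<phi> w)"
  using assms by (intro free_lift_superset[OF assms(1) V.basis_elt_in[OF assms(2)] assms(3)])
  (auto simp: support_def basis_elt_def)
 also have "... = \<phi> u" using assms(2,3) by (subst V.M.finsum_insert) (auto simp: basis_elt_def)
 finally show ?thesis .
qed

context cring begin

lemma scal: "module R (scal R)"
proof -
 have "abelian_group (scal R)"
  by (rule abelian_groupI) (auto simp: scal_def a_ac intro!: l_neg bexI[of _ "\<ominus> _"])
 thus ?thesis
  by (intro module.intro is_cring module_axioms.intro)
  (auto simp: scal_def l_distr r_distr m_assoc)
qed

text \<open>Evaluation at \<open>w\<close> makes \<open>linear_extension\<close> a lift into the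
  ring itself, so its additivity, homogeneity and values on generators are those of
  \<open>free_lift\<close>.\<close>

lemma linext_eq_free_lift:
 "linext R \<phi> f w = free_lift R (scal R) (%u. \<phi> u w) f"
 by (simp add: linear_extension_def free_lift_def scal_def finsum_def finprod_def)

lemma linext_add:
 assumes "f \<in> fsupp R X" "g \<in> fsupp R X"
  "!!u. u \<in> X ==> \<phi> u \<in> fsupp R Y"
 shows "linext R \<phi> (%u. f u \<oplus> g u) = (%w. linext R \<phi> f w \<oplus> linext R \<phi> g w)"
 using free_lift_add[OF scal assms(1,2)] fsuppD(1)[OF assms(3)]
 by (simp add: linext_eq_free_lift fun_eq_iff scal_def)

lemma linext_smult:
 assumes "f \<in> fsupp R X" "a .: R"
  "!!u. u \<in> X ==> \<phi> u \<in> fsupp R Y"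
 shows "linext R \<phi> (%u. a \<otimes> f u) = (%w. a \<otimes> linext R \<phi> f w)"
 using free_lift_smult[OF scal assms(1,2)] fsuppD(1)[OF assms(3)]
 by (simp add: linext_eq_free_lift fun_eq_iff scal_def)

lemma linext_zero: "linext R \<phi> (%u. \<zero>) = (%w. \<zero>)"
 by (simp add: linear_extension_def support_def)

lemma linext_basis:
 assumes "u \<in> X" "!!u. u \<in> X ==> \<phi> u \<in> fsupp R Y"
 shows "linext R \<phi> (basis_elt R u) = \<phi> u"
 using free_lift_basis[OF scal assms(1)] fsuppD(1)[OF assms(2)]
 by (simp add: linext_eq_free_lift fun_eq_iff scal_def)

lemma linext_closed:
 assumes "f \<in> fsupp R X" "!!u. u \<in> X ==> \<phi> u \<in> fsupp R Y"
 shows "linext R \<phi> f \<in> fsupp R Y"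
 using assms(1)
proof (induction f rule: fsf_induct)
 case zero thus ?case by (simp add: linext_zero fsf_zero)
next
 case (add f g)
 have "linext R \<phi> (%u. f u \<oplus> g u) = (%w. linext R \<phi> f w \<oplus> linext R \<phi> g w)"
  by (rule linext_add[OF add(1,2) assms(2)])
 thus ?case using fsf_add[OF add(3,4)] by simp
next
 case (basis a u)
 have "linext R \<phi> (%w. a \<otimes> basis_elt R u w) = (%w. a \<otimes> linext R \<phi> (basis_elt R u) w)"
  by (rule linext_smult[OF basis_elt_in[OF basis(2)] basis(1) assms(2)])
 moreover have "linext R \<phi> (basis_elt R u) = \<phi> u"
  by (rule linext_basis[OF basis(2) assms(2)])
 ultimately show ?case using fsf_smult[OF assms(2)[OF basis(2)] basis(1)] by simp
qed

lemma linext_add_fun: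
 assumes "f \<in> fsupp R X" "!!u. u \<in> X ==> \<phi> u \<in> fsupp R Y"
  "!!u. u \<in> X ==> \<psi> u \<in> fsupp R Y"
 shows "linext R (%u w. \<phi> u w \<oplus> \<psi> u w) f = (%w. linext R \<phi> f w \<oplus> linext R \<psi> f w)"
proof
 fix w
 note f = fsuppD[OF assms(1)]
 have c: "\<phi> u w .: R" "\<psi> u w .: R" if "u \<in> support R f" for u
  using fsuppD(1)[OF assms(2)] fsuppD(1)[OF assms(3)] f that by blast+
 have "(\<Oplus>u\<in>support R f. f u \<otimes> (\<phi> u w \<oplus> \<psi> u w)) = (\<Oplus>u\<in>support R f. f u \<otimes> \<phi> u w \<oplus> f u \<otimes> \<psi> u w)"
  using c f by (intro finsum_cong') (auto simp: r_distr)
 also have "... = (\<Oplus>u\<in>support R f. f u \<otimes> \<phi> u w) \<oplus> (\<Oplus>u\<in>support R f. f u \<otimes> \<psi> u w)"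
  using c f by (intro finsum_addf) auto
 finally show "linext R (%u w. \<phi> u w \<oplus> \<psi> u w) f w = linext R \<phi> f w \<oplus> linext R \<psi> f w"
  by (simp add: linear_extension_def)
qed

lemma linext_smult_fun:
 assumes "f \<in> fsupp R X" "!!u. u \<in> X ==> \<phi> u \<in> fsupp R Y" "a .: R"
 shows "linext R (%u w. a \<otimes> \<phi> u w) f = (%w. a \<otimes> linext R \<phi> f w)"
proof
 fix w
 note f = fsuppD[OF assms(1)]
 have c: "\<phi> u w .: R" if "u \<in> support R f" for u
  using fsuppD(1)[OF assms(2)] f that by blast
 have "(\<Oplus>u\<in>support R f. f u \<otimes> (a \<otimes> \<phi> u w)) = (\<Oplus>u\<in>support R f. a \<otimes> (f u \<otimes> \<phi> u w))"
  using c f assms(3) by (intro finsum_cong') (auto simp: m_lcomm)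
 also have "... = a \<otimes> (\<Oplus>u\<in>support R f. f u \<otimes> \<phi> u w)"
  using c f assms(3) by (intro finsum_rdistr[symmetric]) auto
 finally show "linext R (%u w. a \<otimes> \<phi> u w) f w = a \<otimes> linext R \<phi> f w"
  by (simp add: linear_extension_def)
qed

end

lemma fa_simps:
 "carrier (free_algebra R X e m dg d) = fsupp R X"
 "f \<otimes>\<^bsub>free_algebra R X e m dg d\<^esub> g = linext R (%u. linext R (m u) g) f"
 "\<one>\<^bsub>free_algebra R X e m dg d\<^esub> = basis_elt R e"
 "\<zero>\<^bsub>free_algebra R X e m dg d\<^esub> = (%_. \<zero>.R)"
 "f \<oplus>\<^bsub>free_algebra R X e m dg d\<^esub> g = (%u. f u \<oplus>.R g u)"
 "a \<odot>\<^bsub>free_algebra R X e m dg d\<^esub> f = (%u. a \<otimes>.R f u)"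
 "homog (free_algebra R X e m dg d) k = {f \<in> fsupp R X. ALL u:support R f. dg u = k}"
 "dif (free_algebra R X e m dg d) = linext R d"
 by (auto simp: free_algebra_def Let_def fsupp_def)

locale free_diff_alg = cring R for R :: "('r, 'k) ring_scheme" (structure) +
 fixes X :: "'u set" and e :: 'u and m :: "'u => 'u => 'u => 'r" and dg :: "'u => int" and d :: "'u => 'u => 'r"
 assumes e_in: "e \<in> X"
  and m_in: "u \<in> X ==> v \<in> X ==> m u v \<in> fsupp R X"
  and d_in: "u \<in> X ==> d u \<in> fsupp R X"
begin

abbreviation "F == free_algebra R X e m dg d"

lemma free_module: "module R F"
proof -
 have "abelian_group F"
 proof (rule abelian_groupI)
  fix f assume "f .: F"
  hence f: "f \<in> fsupp R X" by (simp add: fa_simps)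
  show "EX g:carrier F. g \<oplus>.F f = \<zero>.F"
  using fsf_smult[OF f, of "\<ominus> \<one>"] fsuppD(1)[OF f]
  by (intro bexI[of _ "%u. \<ominus> \<one> \<otimes> f u"]) (simp_all add: fa_simps l_minus l_neg)
 next
  fix f g assume "f .: F" "g .: F"
  hence fg: "f \<in> fsupp R X" "g \<in> fsupp R X" by (simp_all add: fa_simps)
  note c = fsuppD(1)[OF fg(1)] fsuppD(1)[OF fg(2)]
  show "f \<oplus>.F g .: F" using fg by (simp add: fa_simps fsf_add)
  show "f \<oplus>.F g = g \<oplus>.F f" using c by (simp add: fa_simps a_comm)
  show "\<zero>.F \<oplus>.F f = f" using c by (simp add: fa_simps)
  fix h assume "h .: F"
  hence "h u .: R" for u by (simp add: fa_simps fsuppD(1))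
  thus "(f \<oplus>.F g) \<oplus>.F h = f \<oplus>.F (g \<oplus>.F h)" using c by (simp add: fa_simps a_assoc)
 qed (simp add: fa_simps fsf_zero)
 thus ?thesis
  by (intro module.intro is_cring module_axioms.intro)
  (simp_all add: fa_simps fsf_smult fsuppD(1) l_distr r_distr m_assoc)
qed

lemma free_diff_alg: "diff_alg R F"
proof -
 interpret module R F by (rule free_module)
 have lm: "linext R (m u) g \<in> fsupp R X" if "u \<in> X" "g \<in> fsupp R X" for u g
  using linext_closed[OF that(2) m_in[OF that(1)]] .
 show ?thesis
 proof
  show "lin R F F (dif F)"
  unfolding lin_def fa_simps
  using linext_closed[where \<phi> = d, OF _ d_in] linext_add[where \<phi> = d, OF _ _ d_in]
  linext_smult[where \<phi> = d, OF _ _ d_in] by blast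
  show "\<one>.F .: F" by (simp add: fa_simps basis_elt_in e_in)
  fix f g assume "f .: F" "g .: F"
  hence fg: "f \<in> fsupp R X" "g \<in> fsupp R X" by (auto simp: fa_simps)
  show "f \<otimes>.F g .: F" unfolding fa_simps by (rule linext_closed[OF fg(1) lm[OF _ fg(2)]])
  show "(a \<odot>.F f) \<otimes>.F g = a \<odot>.F (f \<otimes>.F g)" if "a .: R" for a
  unfolding fa_simps by (rule linext_smult[OF fg(1) that lm[OF _ fg(2)]])
  show "f \<otimes>.F (a \<odot>.F g) = a \<odot>.F (f \<otimes>.F g)" if a: "a .: R" for a
  proof -
  have "linext R (%u. linext R (m u) (%u. a \<otimes> g u)) f =
  linext R (%u w. a \<otimes> linext R (m u) g w) f"
  unfolding linext_eq_free_lift[of _ f]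
  proof (intro ext free_lift_cong[OF _ scal fg(1)])
  fix w u
  have c: "linext R (m u) g w .: R" if "u \<in> X" for u
  using fsuppD(1)[OF lm[OF that fg(2)]] .
  show "a \<otimes> linext R (m u) g w .: (scal R)" if "u \<in> X"
  using c[OF that] a by (simp add: scal_def)
  assume "u \<in> support R f"
  hence "u \<in> X" using fsuppD(3)[OF fg(1)] by blast
  thus "linext R (m u) (%u. a \<otimes> g u) w = a \<otimes> linext R (m u) g w"
  using linext_smult[OF fg(2) a m_in[OF \<open>u \<in> X\<close>]] by simp
  qed
  also have "... = (%w. a \<otimes> linext R (%u. linext R (m u) g) f w)"
  by (rule linext_smult_fun[OF fg(1) lm[OF _ fg(2)] a])
  finally show ?thesis unfolding fa_simps .
  qed
  fix h assume "h .: F"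
  hence h: "h \<in> fsupp R X" by (auto simp: fa_simps)
  show "(f \<oplus>.F g) \<otimes>.F h = f \<otimes>.F h \<oplus>.F g \<otimes>.F h"
  unfolding fa_simps by (rule linext_add[OF fg lm[OF _ h]])
  show "h \<otimes>.F (f \<oplus>.F g) = h \<otimes>.F f \<oplus>.F h \<otimes>.F g"
  proof -
  have "linext R (%u. linext R (m u) (%u. f u \<oplus> g u)) h =
  linext R (%u w. linext R (m u) f w \<oplus> linext R (m u) g w) h"
  unfolding linext_eq_free_lift[of _ h]
  proof (intro ext free_lift_cong[OF _ scal h])
  fix w u
  have c: "linext R (m u) g w .: R" if "u \<in> X" "g \<in> fsupp R X" for u g
  using fsuppD(1)[OF lm[OF that]] .
  show "linext R (m u) f w \<oplus> linext R (m u) g w .: (scal R)" if "u \<in> X"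
  using c[OF that fg(1)] c[OF that fg(2)] by (simp add: scal_def)
  assume "u \<in> support R h"
  hence "u \<in> X" using fsuppD(3)[OF h] by blast
  thus "linext R (m u) (%u. f u \<oplus> g u) w = linext R (m u) f w \<oplus> linext R (m u) g w"
  using linext_add[OF fg m_in[OF \<open>u \<in> X\<close>]] by simp
  qed
  also have "... = (%w. linext R (%u. linext R (m u) f) h w \<oplus> linext R (%u. linext R (m u) g) h w)"
  by (rule linext_add_fun[OF h lm[OF _ fg(1)] lm[OF _ fg(2)]])
  finally show ?thesis unfolding fa_simps .
  qed
 qed
qed

lemma mult_basis: "u \<in> X ==> v \<in> X ==> basis_elt R u \<otimes>.F basis_elt R v = m u v"
proof -
 assume u: "u \<in> X" and v: "v \<in> X"
 have "linext R (m u') (basis_elt R v) \<in> fsupp R X" if "u' \<in> X" for u'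
  by (rule linext_closed[OF basis_elt_in[OF v] m_in[OF that]])
 hence "linext R (%u. linext R (m u) (basis_elt R v)) (basis_elt R u) = linext R (m u) (basis_elt R v)"
  by (rule linext_basis[OF u])
 also have "... = m u v" by (rule linext_basis[OF v m_in[OF u]])
 finally show ?thesis unfolding fa_simps .
qed

lemma d_basis: "u \<in> X ==> dif F (basis_elt R u) = d u"
 unfolding fa_simps by (rule linext_basis[OF _ d_in])

lemma basis_closed: "u \<in> X ==> basis_elt R u .: F"
 by (simp add: fa_simps basis_elt_in)

lemma free_induct [consumes 1, case_names zero add basis]:
 assumes "f .: F" and "P \<zero>.F"
  and "!!f g. f .: F ==> g .: F ==> P f ==> P g ==> P (f \<oplus>.F g)"
  and "!!a u. a .: R ==> u \<in> X ==> P (a \<odot>.F basis_elt R u)"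
 shows "P f"
 by (rule fsf_induct[where P = P, OF assms(1)[unfolded fa_simps(1)]])
  (use assms(2-4) in "simp_all only: fa_simps(1,4,5,6)")

lemma linear_free_lift:
 assumes "module R V" "!!u. u \<in> X ==> \<phi> u .: V"
 shows "lin R F V (free_lift R V \<phi>)"
 unfolding lin_def fa_simps
 by (intro conjI funcsetI ballI free_lift_closed[OF assms(1) _ assms(2)] free_lift_add[OF assms(1) _ _ assms(2)]
  free_lift_smult[OF assms(1) _ _ assms(2)])

text \<open>The way in which identities on a free algebra are proved below: both sides are linear in
  each argument, so associativity or the Leibniz rule is checked on generators, one argument at a
  time.\<close>

lemma lin_eqI:
 assumes "module R V" "lin R F V g" "lin R F V h" "!!u. u \<in> X ==> g (basis_elt R u) = h (basis_elt R u)"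
  "f .: F"
 shows "g f = h f"
proof -
 have "f \<in> {f \<in> carrier F. g f = h f}"
 proof (rule free_induct[OF assms(5)])
  show "\<zero>.F \<in> {f \<in> carrier F. g f = h f}"
  using lin_zero[OF free_module assms(1) assms(2)] lin_zero[OF free_module assms(1) assms(3)]
  by (simp add: fa_simps fsf_zero)
 next
  fix f f' assume "f \<in> {f \<in> carrier F. g f = h f}" "f' \<in> {f \<in> carrier F. g f = h f}"
  hence f: "f .: F" "f' .: F" "g f = h f" "g f' = h f'" by auto
  have "f \<oplus>.F f' .: F" using f(1,2) unfolding fa_simps(1,5) by (rule fsf_add)
  moreover have "g (f \<oplus>.F f') = h (f \<oplus>.F f')"
  unfolding linD(2)[OF assms(2) f(1,2)] linD(2)[OF assms(3) f(1,2)] f(3,4) by (rule refl)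
  ultimately show "f \<oplus>.F f' \<in> {f \<in> carrier F. g f = h f}" by blast
 next
  fix a u assume a: "a .: R" "u \<in> X"
  have "a \<odot>.F basis_elt R u .: F" unfolding fa_simps(1,6) by (rule fsf_smult[OF basis_elt_in[OF a(2)] a(1)])
  moreover have "g (a \<odot>.F basis_elt R u) = h (a \<odot>.F basis_elt R u)"
  unfolding linD(3)[OF assms(2) a(1) basis_closed[OF a(2)]]
  linD(3)[OF assms(3) a(1) basis_closed[OF a(2)]] assms(4)[OF a(2)] by (rule refl)
  ultimately show "a \<odot>.F basis_elt R u \<in> {f \<in> carrier F. g f = h f}" by blast
 qed
 thus ?thesis by simp
qed

end

section \<open>The tensor algebra on words\<close>

lemma (in module) submodule_finsum:
 assumes "submodule I R M" "finite S" "!!i. i \<in> S ==> g i \<in> I"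
 shows "(\<Oplus>.M i\<in>S. g i) \<in> I"
 using assms(2,3)
proof (induction S rule: finite_induct)
 case empty show ?case using subD(2)[OF assms(1)] by simp
next
 case (insert i S)
 have c: "g \<in> S \<rightarrow> carrier M" "g i .: M" using insert.prems subD(1)[OF assms(1)] by auto
 have "(\<Oplus>.M i\<in>S. g i) \<in> I" by (rule insert.IH) (use insert.prems in auto)
 thus ?case using insert.prems c insert.hyps subD(3)[OF assms(1)] by (subst M.finsum_insert) auto
qed

lemma (in cring) fsf_finsum:
 assumes "finite S" "!!i. i \<in> S ==> g i \<in> fsupp R X"
 shows "(%v. \<Oplus>i\<in>S. g i v) \<in> fsupp R X"
 using assms
proof (induction S rule: finite_induct)
 case empty show ?case by (simp add: fsf_zero)
next
 case (insert i S)
 have gi: "g i \<in> fsupp R X" by (rule insert.prems) simp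
 have gS: "(%v. \<Oplus>i\<in>S. g i v) \<in> fsupp R X" by (rule insert.IH) (use insert.prems in auto)
 have "g j v .: R" if "j \<in> insert i S" for j v
  by (rule fsuppD(1)[OF insert.prems[OF that]])
 hence "(%v. \<Oplus>i\<in>insert i S. g i v) = (%v. g i v \<oplus> (\<Oplus>i\<in>S. g i v))"
  using insert.hyps by (intro ext finsum_insert) auto
 thus ?case using fsf_add[OF gi gS] by simp
qed

lemma (in free_diff_alg) finsum_pointwise:
 assumes "finite S" "!!i. i \<in> S ==> g i \<in> fsupp R X"
 shows "(\<Oplus>.F i\<in>S. g i) = (%v. \<Oplus>i\<in>S. g i v)"
 using assms
proof (induction S rule: finite_induct)
 case empty
 interpret F: module R F by (rule free_module)
 show ?case by (simp add: fa_simps)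
next
 case (insert i S)
 interpret F: module R F by (rule free_module)
 have IH: "(\<Oplus>.F i\<in>S. g i) = (%v. \<Oplus>i\<in>S. g i v)" by (rule insert.IH) (use insert.prems in auto)
 have "g j v .: R" if "j \<in> insert i S" for j v
  by (rule fsuppD(1)[OF insert.prems[OF that]])
 hence 1: "(\<Oplus>i\<in>insert i S. g i v) = g i v \<oplus> (\<Oplus>i\<in>S. g i v)" for v
  using insert.hyps by (intro finsum_insert) auto
 have "(\<Oplus>.F i\<in>insert i S. g i) = g i \<oplus>.F (\<Oplus>.F i\<in>S. g i)"
  using insert.hyps insert.prems by (intro F.M.finsum_insert) (auto simp: fa_simps(1))
 thus ?case unfolding IH 1 fa_simps .
qed

locale words = cring R for R :: "('r, 'k) ring_scheme" (structure) +
 fixes X :: "'x set"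
begin

definition face_sum :: "'x list => 'x list => 'r" where
 "face_sum w = (%v. \<Oplus>j\<in>{..<length w}. sg R (int j) \<otimes> basis_elt R (take j w @ drop (Suc j) w) v)"

lemma face_in: "w \<in> lists X ==> take j w @ drop (Suc j) w \<in> lists X"
 by (auto dest: in_set_takeD in_set_dropD)

lemma face_sum_in: "w \<in> lists X ==> face_sum w \<in> fsupp R (lists X)"
 unfolding face_sum_def by (intro fsf_finsum finite_lessThan fsf_smult basis_elt_in face_in sg_closed)

sublocale T: free_diff_alg R "lists X" "[]" "%u v. basis_elt R (u @ v)" "%w. int (length w)" face_sum
 by unfold_locales (use face_sum_in in "simp_all add: basis_elt_in")

abbreviation T :: "('r, 'x list => 'r) diff_algebra" where "T == tensor_algebra R X"
abbreviation mono :: "'x list => 'x list => 'r" where "mono w == basis_elt R w"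

lemma T_eq: "T = free_algebra R (lists X) [] (%u v. basis_elt R (u @ v)) (%w. int (length w)) face_sum"
 by (simp add: tensor_algebra_def face_sum_def[abs_def])

sublocale TA: diff_alg R T
 unfolding T_eq by (rule T.free_diff_alg)

lemmas T_simps = fa_simps[of R "lists X" "[]" "%u v. basis_elt R (u @ v)" "%w. int (length w)" face_sum, folded T_eq]
lemmas mono_in [simp] = T.basis_closed[folded T_eq]
lemmas T_mult_mono = T.mult_basis[folded T_eq]
lemmas T_d_mono = T.d_basis[folded T_eq]
lemmas T_linear_eqI = T.lin_eqI[folded T_eq]
lemmas T_finsum = T.finsum_pointwise[folded T_eq]
lemmas T_induct = T.free_induct[folded T_eq]

lemma T_val: "x .: T ==> x w .: R"
 unfolding T_simps(1) by (rule fsuppD(1))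

lemma face_sum_Nil: "face_sum [] = (%_. \<zero>)"
 by (simp add: face_sum_def)

lemma face_sum_eq:
 assumes "w \<in> lists X"
 shows "face_sum w = (\<Oplus>.T j\<in>{..<length w}. sg R (int j) \<odot>.T mono (take j w @ drop (Suc j) w))"
proof -
 have "(\<Oplus>.T j\<in>{..<length w}. sg R (int j) \<odot>.T mono (take j w @ drop (Suc j) w)) =
  (%v. \<Oplus>j\<in>{..<length w}. (sg R (int j) \<odot>.T mono (take j w @ drop (Suc j) w)) v)"
  by (rule T_finsum) (use assms in "auto simp: T_simps intro!: fsf_smult basis_elt_in face_in")
 thus ?thesis by (simp add: T_simps face_sum_def)
qed

lemma finsum_lessThan_Suc:
 assumes "module R V" "!!j. j < Suc n ==> g j .: V"
 shows "(\<Oplus>.V j\<in>{..<Suc n}. g j) = g 0 \<oplus>.V (\<Oplus>.V j\<in>{..<n}. g (Suc j))"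
proof -
 interpret V: module R V by fact
 have "(\<Oplus>.V j\<in>{..<Suc n}. g j) = g 0 \<oplus>.V (\<Oplus>.V j\<in>Suc ` {..<n}. g j)"
  unfolding lessThan_Suc_eq_insert_0 using assms(2) by (intro V.M.finsum_insert) auto
 also have "(\<Oplus>.V j\<in>Suc ` {..<n}. g j) = (\<Oplus>.V j\<in>{..<n}. g (Suc j))"
  using assms(2) by (intro V.M.finsum_reindex) auto
 finally show ?thesis .
qed

text \<open>The face omitting the first letter is \<open>mono w\<close>. Every other face omits a
  letter of \<open>w\<close>, which stands one place further right in \<open>a # w\<close>; this
  shift is the source of the minus sign. The rules for \<open>\<partial>\<close> on words are
  derived from this recursion.\<close>

lemma d_letter_mono:
 assumes "a \<in> X" "w \<in> lists X"
 shows "dif T (mono (a # w)) = mono w \<ominus>.T mono [a] \<otimes>.T dif T (mono w)"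
proof -
 let ?g = "%j. sg R (int j) \<odot>.T mono (take j (a # w) @ drop (Suc j) (a # w))"
 let ?h = "%j. sg R (int j) \<odot>.T mono (take j w @ drop (Suc j) w)"
 have aw: "a # w \<in> lists X" and a: "[a] \<in> lists X" using assms by auto
 have h: "?h j .: T" for j using face_in[OF assms(2)] by simp
 have g: "?g j .: T" for j using face_in[OF aw] by simp
 have gh: "?g (Suc j) = (\<ominus> \<one>) \<odot>.T (mono [a] \<otimes>.T ?h j)" for j
 proof -
  have "mono [a] \<otimes>.T ?h j = sg R (int j) \<odot>.T (mono [a] \<otimes>.T mono (take j w @ drop (Suc j) w))"
  using face_in[OF assms(2)] a by (intro TA.smult_mult_r) auto
  also have "mono [a] \<otimes>.T mono (take j w @ drop (Suc j) w) = mono (a # take j w @ drop (Suc j) w)"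
  using T_mult_mono[OF a face_in[OF assms(2)]] by simp
  finally have 1: "mono [a] \<otimes>.T ?h j = sg R (int j) \<odot>.T mono (a # take j w @ drop (Suc j) w)" .
  have 2: "(\<ominus> \<one>) \<odot>.T (sg R (int j) \<odot>.T mono (a # take j w @ drop (Suc j) w)) =
  ((\<ominus> \<one>) \<otimes> sg R (int j)) \<odot>.T mono (a # take j w @ drop (Suc j) w)"
  using face_in[OF aw, of "Suc j"] by (intro TA.smult_assoc1[symmetric]) auto
  have "(\<ominus> \<one>) \<otimes> sg R (int j) = sg R (int (Suc j))"
  by (auto simp: neg_one_pow_def l_minus)
  thus ?thesis unfolding 1 2 by simp
 qed
 have 1: "dif T (mono (a # w)) = (\<Oplus>.T j\<in>{..<Suc (length w)}. ?g j)"
  using T_d_mono[OF aw] face_sum_eq[OF aw] by simp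
 also have "... = ?g 0 \<oplus>.T (\<Oplus>.T j\<in>{..<length w}. ?g (Suc j))"
  by (rule finsum_lessThan_Suc[OF TA.mod]) (rule g)
 also have "?g 0 = mono w" using assms by (simp add: neg_one_pow_def)
 also have "(\<Oplus>.T j\<in>{..<length w}. ?g (Suc j)) = (\<ominus> \<one>) \<odot>.T (mono [a] \<otimes>.T (\<Oplus>.T j\<in>{..<length w}. ?h j))"
 proof -
  have "lin R T T (%x. (\<ominus> \<one>) \<odot>.T (mono [a] \<otimes>.T x))"
  using a by (intro TA.lin_smult TA.lmul_lin) auto
  from lin_finsum[OF TA.mod TA.mod this, of "{..<length w}" ?h]
  show ?thesis unfolding gh using h by simp
 qed
 also have "(\<Oplus>.T j\<in>{..<length w}. ?h j) = dif T (mono w)"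
  using T_d_mono[OF assms(2)] face_sum_eq[OF assms(2)] by simp
 finally show ?thesis
  using TA.minus_eq_smult[of "mono [a] \<otimes>.T dif T (mono w)"] a assms by (simp add: a_minus_def)
qed

lemma T_assoc:
 assumes "x .: T" "y .: T" "z .: T"
 shows "(x \<otimes>.T y) \<otimes>.T z = x \<otimes>.T (y \<otimes>.T z)"
proof -
 note M = TA.mod
 have 1: "(mono u \<otimes>.T mono v) \<otimes>.T z = mono u \<otimes>.T (mono v \<otimes>.T z)" if "u \<in> lists X" "v \<in> lists X" "z .: T" for u v z
 proof (rule T_linear_eqI[OF M _ _ _ that(3)])
  show "lin R T T (%z. (mono u \<otimes>.T mono v) \<otimes>.T z)" using that(1,2) by (intro TA.lmul_lin) auto
  show "lin R T T (%z. mono u \<otimes>.T (mono v \<otimes>.T z))"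
  using that(1,2) by (intro lin_comp[OF TA.lmul_lin TA.lmul_lin]) auto
  show "(mono u \<otimes>.T mono v) \<otimes>.T mono w = mono u \<otimes>.T (mono v \<otimes>.T mono w)" if "w \<in> lists X" for w
  using that \<open>u \<in> lists X\<close> \<open>v \<in> lists X\<close> by (simp add: T_mult_mono)
 qed
 have 2: "(mono u \<otimes>.T y) \<otimes>.T z = mono u \<otimes>.T (y \<otimes>.T z)" if u: "u \<in> lists X" and y: "y .: T" and z: "z .: T" for u y z
 proof (rule T_linear_eqI[OF M _ _ _ y])
  show "lin R T T (%y. (mono u \<otimes>.T y) \<otimes>.T z)"
  using u z by (intro lin_comp[OF TA.lmul_lin TA.rmul_lin]) auto
  show "lin R T T (%y. mono u \<otimes>.T (y \<otimes>.T z))"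
  using u z by (intro lin_comp[OF TA.rmul_lin TA.lmul_lin]) auto
 qed (rule 1[OF u _ z])
 show ?thesis
 proof (rule T_linear_eqI[OF M _ _ _ assms(1)])
  show "lin R T T (%x. (x \<otimes>.T y) \<otimes>.T z)"
  using assms by (intro lin_comp[OF TA.rmul_lin TA.rmul_lin]) auto
  show "lin R T T (%x. x \<otimes>.T (y \<otimes>.T z))"
  using assms by (intro TA.rmul_lin) auto
 qed (rule 2[OF _ assms(2,3)])
qed

lemma T_one: "\<one>.T = mono []"
 by (simp add: T_simps)

lemma T_l_one: "x .: T ==> \<one>.T \<otimes>.T x = x"
proof (rule T_linear_eqI[OF TA.mod _ lin_id])
 show "lin R T T (%x. \<one>.T \<otimes>.T x)" by (intro TA.lmul_lin) auto
qed (use T_mult_mono[of "[]"] in "auto simp: T_one")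

lemma T_r_one: "x .: T ==> x \<otimes>.T \<one>.T = x"
proof (rule T_linear_eqI[OF TA.mod _ lin_id])
 show "lin R T T (%x. x \<otimes>.T \<one>.T)" by (intro TA.rmul_lin) auto
qed (use T_mult_mono[of _ "[]"] in "auto simp: T_one")

lemma T_ring: "ring T"
proof (rule ringI)
 show "abelian_group T" by (rule TA.abelian_group_axioms)
 show "monoid T" by (rule monoidI) (auto simp: T_assoc T_l_one T_r_one)
qed (simp_all add: TA.mult_l_distr TA.mult_r_distr)

lemma d_letter:
 assumes "a \<in> X" "x .: T"
 shows "dif T (mono [a] \<otimes>.T x) = x \<ominus>.T mono [a] \<otimes>.T dif T x"
proof -
 have a: "[a] \<in> lists X" using assms by simp
 have "dif T (mono [a] \<otimes>.T x) = x \<oplus>.T (\<ominus> \<one>) \<odot>.T (mono [a] \<otimes>.T dif T x)"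
 proof (rule T_linear_eqI[OF TA.mod _ _ _ assms(2)])
  show "lin R T T (%x. dif T (mono [a] \<otimes>.T x))"
  using a by (intro lin_comp[OF TA.lmul_lin TA.d_lin]) auto
  show "lin R T T (%x. x \<oplus>.T (\<ominus> \<one>) \<odot>.T (mono [a] \<otimes>.T dif T x))"
  using a by (intro TA.lin_sum lin_id TA.lin_smult lin_comp[OF TA.d_lin TA.lmul_lin]) auto
  fix w assume w: "w \<in> lists X"
  thus "dif T (mono [a] \<otimes>.T mono w) = mono w \<oplus>.T (\<ominus> \<one>) \<odot>.T (mono [a] \<otimes>.T dif T (mono w))"
  using d_letter_mono[OF assms(1) w] T_mult_mono[OF a w] TA.minus_eq_smult[of "mono [a] \<otimes>.T dif T (mono w)"] a
  by (simp add: a_minus_def)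
 qed
 thus ?thesis using TA.minus_eq_smult[of "mono [a] \<otimes>.T dif T x"] a assms(2) by (simp add: a_minus_def)
qed

lemma d_mono_Nil: "dif T (mono []) = \<zero>.T"
 unfolding T_d_mono[OF lists.Nil] face_sum_Nil T_simps(4) by (rule refl)

lemma d_d_T:
 assumes "x .: T"
 shows "dif T (dif T x) = \<zero>.T"
proof (rule T_linear_eqI[OF TA.mod _ _ _ assms])
 show "lin R T T (%x. dif T (dif T x))"
  by (intro lin_comp[OF TA.d_lin TA.d_lin])
 show "lin R T T (%x. \<zero>.T)" by (rule TA.lin_const_zero)
 fix w assume "w \<in> lists X"
 thus "dif T (dif T (mono w)) = \<zero>.T"
 proof (induction w)
  case Nil show ?case by (simp add: d_mono_Nil)
 next
  case (Cons a w)
  hence w: "w \<in> lists X" "a \<in> X" "[a] \<in> lists X" "mono w .: T" "dif T (mono w) .: T" by auto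
  have IH: "dif T (dif T (mono w)) = \<zero>.T" by (rule Cons.IH)
  have "dif T (dif T (mono (a # w))) =
  dif T (mono w) \<ominus>.T dif T (mono [a] \<otimes>.T dif T (mono w))"
  unfolding d_letter_mono[OF w(2,1)] using w
  by (intro lin_minus[OF TA.mod TA.mod TA.d_lin]) auto
  also have "dif T (mono [a] \<otimes>.T dif T (mono w)) = dif T (mono w)"
  unfolding d_letter[OF w(2,5)] IH using w by (simp add: a_minus_def)
  finally show ?case using w by (simp add: a_minus_def TA.M.r_neg)
 qed
qed

subsection \<open>Leibniz rule on words\<close>

text \<open>The sign of the Leibniz rule as a linear operator, so that the rule can be stated for
  elements without a degree.\<close>

definition sign_op :: "('x list => 'r) => 'x list => 'r" where
 "sign_op f = (%w. sg R (int (length w)) \<otimes> f w)"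

definition restr :: "('x list => bool) => ('x list => 'r) => 'x list => 'r" where
 "restr Q f = (%w. if Q w then f w else \<zero>)"

lemma sign_op_lin: "lin R T T sign_op"
proof (rule linI)
 fix f assume f: "f .: T"
 have s: "support R (sign_op f) <= support R f" by (auto simp: support_def sign_op_def)
 have f': "f \<in> fsupp R (lists X)" using f by (simp add: T_simps)
 note fD = fsuppD[OF f']
 have "finite (support R (sign_op f))" by (rule finite_subset[OF s fD(2)])
 moreover have "support R (sign_op f) <= lists X" using s fD(3) by auto
 moreover have "range (sign_op f) <= carrier R" using fD(1) by (auto simp: sign_op_def)
 ultimately show "sign_op f .: T" by (simp add: T_simps fsupp_def)
 show "sign_op (a \<odot>.T f) = a \<odot>.T sign_op f" if "a .: R" for a
  using T_val[OF f] that by (simp add: sign_op_def T_simps m_lcomm)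
 fix g assume "g .: T"
 thus "sign_op (f \<oplus>.T g) = sign_op f \<oplus>.T sign_op g"
  using T_val[OF f] T_val[of g] by (simp add: sign_op_def T_simps r_distr)
qed

lemma restr_lin: "lin R T T (restr Q)"
proof (rule linI)
 fix f assume f: "f .: T"
 have s: "support R (restr Q f) <= support R f" by (auto simp: support_def restr_def)
 have f': "f \<in> fsupp R (lists X)" using f by (simp add: T_simps)
 note fD = fsuppD[OF f']
 have "finite (support R (restr Q f))" by (rule finite_subset[OF s fD(2)])
 moreover have "support R (restr Q f) <= lists X" using s fD(3) by auto
 moreover have "range (restr Q f) <= carrier R" using fD(1) by (auto simp: restr_def)
 ultimately show "restr Q f .: T" by (simp add: T_simps fsupp_def)
 show "restr Q (a \<odot>.T f) = a \<odot>.T restr Q f" if "a .: R" for a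
  using T_val[OF f] that by (auto simp: restr_def T_simps)
 fix g assume "g .: T"
 thus "restr Q (f \<oplus>.T g) = restr Q f \<oplus>.T restr Q g"
  using T_val[OF f] T_val[of g] by (auto simp: restr_def T_simps)
qed

lemma sign_op_mono: "sign_op (mono w) = sg R (int (length w)) \<odot>.T mono w"
 by (auto simp: sign_op_def basis_elt_def T_simps fun_eq_iff)

lemma restr_mono: "restr Q (mono w) = (if Q w then mono w else \<zero>.T)"
 by (auto simp: restr_def basis_elt_def T_simps fun_eq_iff)

lemma restr_mono_mult:
 assumes "u \<in> lists X" "x .: T"
 shows "restr Q (mono u \<otimes>.T x) = mono u \<otimes>.T restr (%w. Q (u @ w)) x"
  and "restr Q (x \<otimes>.T mono u) = restr (%w. Q (w @ u)) x \<otimes>.T mono u"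
proof -
 note M = TA.mod
 show "restr Q (mono u \<otimes>.T x) = mono u \<otimes>.T restr (%w. Q (u @ w)) x"
 proof (rule T_linear_eqI[OF M _ _ _ assms(2)])
  show "lin R T T (%x. restr Q (mono u \<otimes>.T x))"
  using assms by (intro lin_comp[OF TA.lmul_lin restr_lin]) auto
  show "lin R T T (%x. mono u \<otimes>.T restr (%w. Q (u @ w)) x)"
  using assms by (intro lin_comp[OF restr_lin TA.lmul_lin]) auto
 qed (use assms(1) in "auto simp: T_mult_mono restr_mono")
 show "restr Q (x \<otimes>.T mono u) = restr (%w. Q (w @ u)) x \<otimes>.T mono u"
 proof (rule T_linear_eqI[OF M _ _ _ assms(2)])
  show "lin R T T (%x. restr Q (x \<otimes>.T mono u))"
  using assms by (intro lin_comp[OF TA.rmul_lin restr_lin]) auto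
  show "lin R T T (%x. restr (%w. Q (w @ u)) x \<otimes>.T mono u)"
  using assms by (intro lin_comp[OF restr_lin TA.rmul_lin]) auto
 qed (use assms(1) in "auto simp: T_mult_mono restr_mono")
qed

lemma sign_op_mult:
 assumes "x .: T" "y .: T"
 shows "sign_op (x \<otimes>.T y) = sign_op x \<otimes>.T sign_op y"
proof -
 note M = TA.mod
 have 1: "sign_op (mono u \<otimes>.T y) = sign_op (mono u) \<otimes>.T sign_op y" if u: "u \<in> lists X" for u
 proof (rule T_linear_eqI[OF M _ _ _ assms(2)])
  show "lin R T T (%y. sign_op (mono u \<otimes>.T y))"
  using u by (intro lin_comp[OF TA.lmul_lin sign_op_lin]) auto
  show "lin R T T (%y. sign_op (mono u) \<otimes>.T sign_op y)"
  using u linD(1)[OF sign_op_lin] by (intro lin_comp[OF sign_op_lin TA.lmul_lin]) auto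
  fix w assume w: "w \<in> lists X"
  have "sg R (int (length (u @ w))) = sg R (int (length u)) \<otimes> sg R (int (length w))"
  using sg_add[of "int (length u)" "int (length w)"] by simp
  thus "sign_op (mono u \<otimes>.T mono w) = sign_op (mono u) \<otimes>.T sign_op (mono w)"
  unfolding sign_op_mono T_mult_mono[OF u w] using u w
  by (simp only:) (simp add: TA.smult_mult_l TA.smult_mult_r T_mult_mono TA.smult_assoc1[symmetric] m_comm)
 qed
 show ?thesis
 proof (rule T_linear_eqI[OF M _ _ _ assms(1)])
  show "lin R T T (%x. sign_op (x \<otimes>.T y))"
  using assms by (intro lin_comp[OF TA.rmul_lin sign_op_lin]) auto
  show "lin R T T (%x. sign_op x \<otimes>.T sign_op y)"
  using assms linD(1)[OF sign_op_lin] by (intro lin_comp[OF sign_op_lin TA.rmul_lin]) auto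
 qed (rule 1)
qed

text \<open>By induction on the letters of \<open>u\<close>: \<open>d_letter\<close> peels off the
  first one, and the sign it produces is the one by which \<open>sign_op\<close> changes when a
  letter is added.\<close>

lemma leibniz_mono:
 assumes "u \<in> lists X" "y .: T"
 shows "dif T (mono u \<otimes>.T y) = dif T (mono u) \<otimes>.T y \<oplus>.T sign_op (mono u) \<otimes>.T dif T y"
 using assms(1)
proof (induction u)
 case Nil
 have "sign_op (mono []) = \<one>.T" by (simp add: sign_op_mono neg_one_pow_def T_one)
 moreover have "mono [] \<otimes>.T y = y" using T_l_one[OF assms(2)] by (simp add: T_one)
 ultimately show ?case using assms(2) T_l_one[of "dif T y"] by (simp add: d_mono_Nil)
next
 case (Cons a u)
 have u: "u \<in> lists X" and a: "a \<in> X" "[a] \<in> lists X" using Cons.hyps by auto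
 have c: "mono u .: T" "mono [a] .: T" "dif T (mono u) .: T" "dif T y .: T"
  "sign_op (mono u) .: T"
  using mono_in[OF u] mono_in[OF a(2)] TA.d_closed[OF mono_in[OF u]] TA.d_closed[OF assms(2)]
  linD(1)[OF sign_op_lin mono_in[OF u]] .
 have mc: "mono (a # u) = mono [a] \<otimes>.T mono u" using T_mult_mono[OF a(2) u] by simp
 have sg: "sign_op (mono (a # u)) = \<ominus>.T (mono [a] \<otimes>.T sign_op (mono u))"
 proof -
  have "sign_op (mono [a]) = (\<ominus> \<one>) \<odot>.T mono [a]" by (simp add: sign_op_mono neg_one_pow_def)
  thus ?thesis unfolding mc sign_op_mult[OF c(2,1)] using c
  TA.minus_eq_smult[of "mono [a] \<otimes>.T sign_op (mono u)"] TA.smult_mult_l[of "\<ominus> \<one>" "mono [a]" "sign_op (mono u)"] by simp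
 qed
 let ?P = "mono u \<otimes>.T y" and ?Q = "mono [a] \<otimes>.T (dif T (mono u) \<otimes>.T y)"
  and ?S = "mono [a] \<otimes>.T (sign_op (mono u) \<otimes>.T dif T y)"
 have cc: "?P .: T" "?Q .: T" "?S .: T" using c assms(2) by auto
 have "dif T (mono (a # u) \<otimes>.T y) = ?P \<ominus>.T mono [a] \<otimes>.T dif T ?P"
  unfolding mc T_assoc[OF c(2,1) assms(2)] by (rule d_letter[OF a(1) cc(1)])
 also have "mono [a] \<otimes>.T dif T ?P = ?Q \<oplus>.T ?S"
  unfolding Cons.IH using c assms(2) by (simp add: TA.mult_r_distr)
 also have "?P \<ominus>.T (?Q \<oplus>.T ?S) = (?P \<ominus>.T ?Q) \<oplus>.T \<ominus>.T ?S"
  using cc by (simp add: a_minus_def TA.M.minus_add TA.M.a_ac)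
 also have "?P \<ominus>.T ?Q = dif T (mono (a # u)) \<otimes>.T y"
  unfolding d_letter_mono[OF a(1) u]
  using lin_minus[OF TA.mod TA.mod TA.rmul_lin[OF assms(2)], of "mono u" "mono [a] \<otimes>.T dif T (mono u)"]
  c T_assoc[OF c(2,3) assms(2)] by simp
 also have "\<ominus>.T ?S = sign_op (mono (a # u)) \<otimes>.T dif T y"
  unfolding sg
  using lin_a_inv[OF TA.mod TA.mod TA.rmul_lin[OF c(4)], of "mono [a] \<otimes>.T sign_op (mono u)"]
  c T_assoc[OF c(2,5,4)] by simp
 finally show ?case .
qed

lemma leibniz_T:
 assumes "x .: T" "y .: T"
 shows "dif T (x \<otimes>.T y) = dif T x \<otimes>.T y \<oplus>.T sign_op x \<otimes>.T dif T y"
proof (rule T_linear_eqI[OF TA.mod _ _ _ assms(1)])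
 show "lin R T T (%x. dif T (x \<otimes>.T y))"
  using assms by (intro lin_comp[OF TA.rmul_lin TA.d_lin]) auto
 show "lin R T T (%x. dif T x \<otimes>.T y \<oplus>.T sign_op x \<otimes>.T dif T y)"
  using assms by (intro TA.lin_sum lin_comp[OF TA.d_lin TA.rmul_lin]
  lin_comp[OF sign_op_lin TA.rmul_lin]) auto
qed (rule leibniz_mono[OF _ assms(2)])

end

section \<open>Ranked lattices and the OS-algebra\<close>

text \<open>What the argument uses of a geometric lattice, phrased for the operators
  \<open>\<Squnion>\<close> and \<open>\<bottom>\<close>, which select an element by choice.
  Semimodularity enters as \<open>rank_join_atom\<close>: joining one atom raises the rank by at
  most one.\<close>

locale ranked_lattice =
 fixes L :: "('p, 'n) gorder_scheme" (structure) and r :: "'p => nat"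
 assumes finite_carrier: "finite (carrier L)"
  and eq_L: "eq L = (=)"
  and le_refl: "p .: L ==> p \<sqsubseteq> p"
  and le_antisym: "p .: L ==> q .: L ==> p \<sqsubseteq> q ==> q \<sqsubseteq> p ==> p = q"
  and le_trans: "p .: L ==> q .: L ==> s .: L ==> p \<sqsubseteq> q ==> q \<sqsubseteq> s ==> p \<sqsubseteq> s"
  and sup_in: "S <= carrier L ==> \<Squnion>S .: L"
  and sup_upper: "S <= carrier L ==> p \<in> S ==> p \<sqsubseteq> \<Squnion>S"
  and sup_least: "S <= carrier L ==> q .: L ==> (!!p. p \<in> S ==> p \<sqsubseteq> q) ==> \<Squnion>S \<sqsubseteq> q"
  and bottom_eq: "\<bottom> = \<Squnion>{}"
  and rank_bottom: "r \<bottom> = 0"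
  and rank_strict: "p .: L ==> q .: L ==> p \<sqsubseteq> q ==> p ~= q ==> r p < r q"
  and rank_join_atom: "p .: L ==> a \<in> lattice_atoms L ==> r (p \<squnion> a) \<le> Suc (r p)"
  and atomistic: "p .: L ==> EX S <= lattice_atoms L. p = \<Squnion>S"
begin

lemma atoms_subset: "lattice_atoms L <= carrier L"
 by (auto simp: lattice_atoms_def covers_def)

lemma finite_atoms: "finite (lattice_atoms L)"
 by (rule finite_subset[OF atoms_subset finite_carrier])

lemma bottom_in: "\<bottom> .: L"
 unfolding bottom_eq by (rule sup_in) simp

lemma join_in: "p .: L ==> q .: L ==> p \<squnion> q .: L"
 unfolding join_def by (rule sup_in) simp

lemma join_upper1: "p .: L ==> q .: L ==> p \<sqsubseteq> p \<squnion> q"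
 unfolding join_def by (rule sup_upper) simp_all

lemma join_upper2: "p .: L ==> q .: L ==> q \<sqsubseteq> p \<squnion> q"
 unfolding join_def by (rule sup_upper) simp_all

lemma join_least: "p .: L ==> q .: L ==> s .: L ==> p \<sqsubseteq> s ==> q \<sqsubseteq> s ==> p \<squnion> q \<sqsubseteq> s"
 unfolding join_def by (rule sup_least) auto

lemma join_comm: "p \<squnion> q = q \<squnion> p"
 by (simp add: join_def insert_commute)

lemma join_absorb: "p .: L ==> q .: L ==> p \<sqsubseteq> q ==> p \<squnion> q = q"
 by (rule le_antisym) (auto intro: join_in join_least join_upper2 le_refl)

lemma sup_union:
 assumes "A <= carrier L" "B <= carrier L"
 shows "\<Squnion>(A \<union> B) = \<Squnion>A \<squnion> \<Squnion>B"
proof (rule le_antisym)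
 have AB: "A \<union> B <= carrier L" using assms by simp
 note c = sup_in[OF assms(1)] sup_in[OF assms(2)]
 show "\<Squnion>(A \<union> B) .: L" by (rule sup_in[OF AB])
 show "\<Squnion>A \<squnion> \<Squnion>B .: L" by (rule join_in[OF c])
 show "\<Squnion>(A \<union> B) \<sqsubseteq> \<Squnion>A \<squnion> \<Squnion>B"
 proof (rule sup_least[OF AB join_in[OF c]])
  fix p assume "p \<in> A \<union> B"
  thus "p \<sqsubseteq> \<Squnion>A \<squnion> \<Squnion>B"
  proof
  assume p: "p \<in> A"
  hence "p .: L" using assms by blast
  thus ?thesis using le_trans[OF _ c(1) join_in[OF c] sup_upper[OF assms(1) p] join_upper1[OF c]] by blast
  next
  assume p: "p \<in> B"
  hence "p .: L" using assms by blast
  thus ?thesis using le_trans[OF _ c(2) join_in[OF c] sup_upper[OF assms(2) p] join_upper2[OF c]] by blast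
  qed
 qed
 show "\<Squnion>A \<squnion> \<Squnion>B \<sqsubseteq> \<Squnion>(A \<union> B)"
  by (rule join_least[OF c sup_in[OF AB]]; rule sup_least[OF _ sup_in[OF AB]])
  (use assms sup_upper[OF AB] in auto)
qed

lemma sup_singleton: "p .: L ==> \<Squnion>{p} = p"
 by (rule le_antisym) (auto intro: sup_in sup_least sup_upper le_refl)

definition flat :: "'p list => 'p" where
 "flat w = \<Squnion>(set w)"

lemma flat_in: "w \<in> lists (lattice_atoms L) ==> flat w .: L"
 unfolding flat_def using atoms_subset by (intro sup_in) auto

lemma flat_Nil: "flat [] = \<bottom>"
 by (simp add: flat_def bottom_eq)

lemma flat_append:
 "u \<in> lists (lattice_atoms L) ==> w \<in> lists (lattice_atoms L) ==> flat (u @ w) = flat u \<squnion> flat w"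
 unfolding flat_def set_append using atoms_subset by (intro sup_union) auto

lemma flat_letter: "a \<in> lattice_atoms L ==> flat [a] = a"
 using atoms_subset by (auto simp: flat_def intro: sup_singleton)

lemma flat_Cons:
 "a \<in> lattice_atoms L ==> w \<in> lists (lattice_atoms L) ==> flat (a # w) = a \<squnion> flat w"
 using flat_append[of "[a]" w] flat_letter[of a] by simp

lemma rank_flat: "w \<in> lists (lattice_atoms L) ==> r (flat w) \<le> length w"
proof (induction w)
 case Nil show ?case by (simp add: flat_Nil rank_bottom)
next
 case (Cons a w)
 hence aw: "a \<in> lattice_atoms L" "w \<in> lists (lattice_atoms L)" by auto
 hence "r (flat (a # w)) \<le> Suc (r (flat w))"
  using rank_join_atom[of "flat w" a] flat_in[of w] by (simp add: flat_Cons join_comm)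
 thus ?case using Cons.IH aw(2) by simp
qed

lemma rank_atom: "a \<in> lattice_atoms L ==> r a > 0"
proof -
 assume a: "a \<in> lattice_atoms L"
 hence "\<bottom> \<sqsubset> a" by (simp add: lattice_atoms_def covers_def)
 hence "\<bottom> \<sqsubseteq> a" "\<bottom> ~= a" by (auto simp: lless_def eq_L)
 thus ?thesis using rank_strict[of \<bottom> a] bottom_in a atoms_subset by auto
qed

lemma rank_join_new_atom:
 assumes "p .: L" "a \<in> lattice_atoms L" "~  a \<sqsubseteq> p"
 shows "r (p \<squnion> a) = Suc (r p)"
proof -
 have a: "a .: L" using assms(2) atoms_subset by blast
 have "p ~= p \<squnion> a" using assms(3) join_upper2[OF assms(1) a] by auto
 hence "r p < r (p \<squnion> a)" using rank_strict[OF assms(1) join_in[OF assms(1) a] join_upper1[OF assms(1) a]] by blast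
 thus ?thesis using rank_join_atom[OF assms(1,2)] by simp
qed

lemma coversI:
 assumes "p .: L" "q .: L" "q \<sqsubseteq> p" "r p = Suc (r q)"
 shows "covers L p q"
proof -
 have "~  (q \<sqsubset> u & u \<sqsubset> p)" if "u .: L" for u
 proof
  assume "q \<sqsubset> u & u \<sqsubset> p"
  hence "q \<sqsubseteq> u" "q ~= u" "u \<sqsubseteq> p" "u ~= p" by (auto simp: lless_def eq_L)
  hence "r q < r u" "r u < r p" using rank_strict[of q u] rank_strict[of u p] assms that by blast+
  thus False using assms(4) by simp
 qed
 moreover have "p ~= q" using assms(4) by auto
 ultimately show ?thesis using assms by (auto simp: covers_def lless_def eq_L)
qed

lemma coversD: "covers L p q ==> p .: L & q .: L & q \<sqsubseteq> p"
 by (auto simp: covers_def lless_def)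

end

lemma ideal_imp_sub:
 assumes "diff_alg R A" "ideal I A" "!!x. x .: A ==> \<one>.A \<otimes>.A x = x"
 shows "submodule I R A"
proof -
 interpret A: diff_alg R A by fact
 interpret I: ideal I A by fact
 show ?thesis
 proof (rule A.subI')
  show "I <= carrier A" by (rule I.a_subset)
  show "\<zero>.A \<in> I" by (rule I.zero_closed)
  show "x \<oplus>.A y \<in> I" if "x \<in> I" "y \<in> I" for x y using that by (rule I.a_closed)
  fix a x assume a: "a .: R" and x: "x \<in> I"
  have xc: "x .: A" using x by (rule I.a_Hcarr)
  have "a \<odot>.A x = (a \<odot>.A \<one>.A) \<otimes>.A x"
  using A.smult_mult_l[OF a A.unit_closed xc] assms(3)[OF xc] by simp
  thus "a \<odot>.A x \<in> I" using I.I_l_closed[OF x, of "a \<odot>.A \<one>.A"] a by simp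
 qed
qed

lemma ideal_if_sub:
 assumes "ring A" "submodule I R A" "!!x y. x .: A ==> y \<in> I ==> x \<otimes>.A y \<in> I"
  "!!x y. x .: A ==> y \<in> I ==> y \<otimes>.A x \<in> I"
 shows "ideal I A"
 using assms by (intro idealI) (auto simp: submodule_def)

lemma ring_image:
 assumes "ring A" "diff_alg R B" "f ` carrier A = carrier B"
  and mult: "!!x y. x .: A ==> y .: A ==> f (x \<otimes>.A y) = f x \<otimes>.B f y"
  and one: "f \<one>.A = \<one>.B"
 shows "ring B"
proof -
 interpret A: ring A by fact
 interpret B: diff_alg R B by fact
 have rep: "EX x:carrier A. y = f x" if "y .: B" for y using assms(3) that by blast
 show ?thesis
 proof (rule ringI)
  show "abelian_group B" by (rule B.abelian_group_axioms)
  show "monoid B"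
  proof (rule monoidI)
  fix x y z assume "x .: B" "y .: B" "z .: B"
  then obtain x' y' z' where *: "x' .: A" "x = f x'" "y' .: A" "y = f y'" "z' .: A" "z = f z'"
  using rep by meson
  thus "x \<otimes>.B y \<otimes>.B z = x \<otimes>.B (y \<otimes>.B z)"
  by (simp flip: mult add: A.m_assoc)
  next
  fix x assume "x .: B"
  then obtain x' where *: "x' .: A" "x = f x'" using rep by meson
  show "\<one>.B \<otimes>.B x = x" using * mult[of "\<one>.A" x'] one by simp
  show "x \<otimes>.B \<one>.B = x" using * mult[of x' "\<one>.A"] one by simp
  qed auto
 qed (simp_all add: B.mult_l_distr B.mult_r_distr)
qed

lemma (in module) submodule_cancel:
 assumes "submodule I R M" "x \<in> I" "y .: M" "x \<oplus>.M y \<in> I"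
 shows "y \<in> I"
proof -
 have "x .: M" using assms subD(1) by blast
 hence "(x \<oplus>.M y) \<ominus>.M x = y" using assms(3) M.a_comm[of x y] by (simp add: a_minus_def M.a_assoc M.r_neg)
 thus ?thesis using submodule_minus[OF assms(1,4,2)] by simp
qed

subsection \<open>The exterior algebra\<close>

context words begin

abbreviation "J == exterior_relations R X"
abbreviation "EA == exterior_algebra R X"
abbreviation "qJ x == J +>.T x"

lemma squares_in: "{v \<otimes>.T v | v. v \<in> homog T 1} <= carrier T"
 by (auto simp: T_simps(1,7) intro!: TA.mult_closed[unfolded T_simps(1)])

lemma J_ideal: "ideal J T"
 unfolding exterior_relations_def Let_def by (rule ring.genideal_ideal[OF T_ring squares_in])

lemma J_square: "v \<in> homog T 1 ==> v \<otimes>.T v \<in> J"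
 using ring.genideal_self[OF T_ring squares_in] unfolding exterior_relations_def Let_def by blast

lemma J_minimal:
 assumes "submodule H R T" "!!x y. x .: T ==> y \<in> H ==> x \<otimes>.T y \<in> H"
  "!!x y. x .: T ==> y \<in> H ==> y \<otimes>.T x \<in> H" "!!v. v \<in> homog T 1 ==> v \<otimes>.T v \<in> H"
 shows "J <= H"
 unfolding exterior_relations_def Let_def
 by (rule ring.genideal_minimal[OF T_ring ideal_if_sub[OF T_ring assms(1-3)]]) (use assms(4) in auto)

lemma J_sub: "submodule J R T"
 by (rule ideal_imp_sub[OF TA.diff_alg_axioms J_ideal T_l_one])

lemma J_mult_l: "x .: T ==> y \<in> J ==> x \<otimes>.T y \<in> J"
 by (rule ideal.I_l_closed[OF J_ideal])

lemma J_mult_r: "x .: T ==> y \<in> J ==> y \<otimes>.T x \<in> J"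
 by (rule ideal.I_r_closed[OF J_ideal])

lemma homog_T: "homog T k <= carrier T"
 by (auto simp: T_simps(1,7))

lemma homog1_eq: "homog T 1 = fsupp R ((%a. [a]) ` X)"
proof -
 have "(EX a:X. w = [a]) <-> w \<in> lists X & int (length w) = 1" for w :: "'x list"
  by (cases w) (auto simp: image_iff)
 thus ?thesis by (auto simp: T_simps(7) fsupp_def image_iff subset_iff)
qed

lemma homog1_induct [consumes 1, case_names zero add basis]:
 assumes "v \<in> homog T 1" "P \<zero>.T"
  "!!f g. f \<in> homog T 1 ==> g \<in> homog T 1 ==> P f ==> P g ==> P (f \<oplus>.T g)"
  "!!c a. c .: R ==> a \<in> X ==> P (c \<odot>.T mono [a])"
 shows "P v"
 by (rule fsf_induct[where P = P, OF assms(1)[unfolded homog1_eq]])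
  (use assms(2-4) in "auto simp: T_simps(4,5,6) homog1_eq")

lemma sign_op_homog1: "v \<in> homog T 1 ==> sign_op v = \<ominus>.T v"
proof -
 assume v: "v \<in> homog T 1"
 hence vc: "v .: T" using homog_T by blast
 have "sign_op v = (\<ominus> \<one>) \<odot>.T v"
 proof
  fix w
  show "sign_op v w = ((\<ominus> \<one>) \<odot>.T v) w"
  proof (cases "v w = \<zero>")
  case True thus ?thesis by (simp add: sign_op_def T_simps)
  next
  case False
  hence "int (length w) = 1" using v by (auto simp: T_simps(7) support_def)
  thus ?thesis by (simp add: sign_op_def T_simps neg_one_pow_def)
  qed
 qed
 thus ?thesis using TA.minus_eq_smult[OF vc] by simp
qed

lemma d_homog1: "v \<in> homog T 1 ==> EX c:carrier R. dif T v = c \<odot>.T \<one>.T"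
proof (induction v rule: homog1_induct)
 case zero
 show ?case by (rule bexI[of _ \<zero>]) (simp_all)
next
 case (add f g)
 then obtain c c' where "c .: R" "dif T f = c \<odot>.T \<one>.T" "c' .: R" "dif T g = c' \<odot>.T \<one>.T"
  by blast
 moreover have "f .: T" "g .: T" using add homog_T by auto
 ultimately show ?case by (intro bexI[of _ "c \<oplus> c'"]) (simp_all add: TA.d_add TA.smult_l_distr)
next
 case (basis c a)
 have "dif T (mono [a]) = \<one>.T"
  using d_letter_mono[of a "[]"] basis by (simp add: d_mono_Nil T_one a_minus_def)
 thus ?case using basis by (intro bexI[of _ c]) (simp_all add: TA.d_smult)
qed

text \<open>In degree one \<open>\<partial> v\<close> is a scalar \<open>c\<close>, so the two terms
  of the Leibniz rule are \<open>c v\<close> and \<open>- c v\<close>.\<close>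

lemma d_square:
 assumes "v \<in> homog T 1"
 shows "dif T (v \<otimes>.T v) = \<zero>.T"
proof -
 have vc: "v .: T" using assms homog_T by blast
 obtain c where c: "c .: R" "dif T v = c \<odot>.T \<one>.T" using d_homog1[OF assms] by blast
 have 1: "(c \<odot>.T \<one>.T) \<otimes>.T v = c \<odot>.T v" using TA.smult_mult_l[OF c(1) TA.unit_closed vc] T_l_one[OF vc] by simp
 have nv: "\<ominus>.T v .: T" using vc by simp
 have 2: "\<ominus>.T v \<otimes>.T (c \<odot>.T \<one>.T) = \<ominus>.T (c \<odot>.T v)"
  using TA.smult_mult_r[OF c(1) nv TA.unit_closed] T_r_one[OF nv] TA.smult_r_minus[OF c(1) vc] by simp
 show ?thesis unfolding leibniz_T[OF vc vc] sign_op_homog1[OF assms] c(2) 1 2 using vc c(1) by (simp add: TA.M.r_neg)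
qed

lemma sign_square:
 assumes "v \<in> homog T 1"
 shows "sign_op (v \<otimes>.T v) = v \<otimes>.T v"
proof -
 have vc: "v .: T" using assms homog_T by blast
 hence nv: "\<ominus>.T v .: T" "v \<otimes>.T v .: T" by simp_all
 show ?thesis unfolding sign_op_mult[OF vc vc] sign_op_homog1[OF assms]
  using lin_a_inv[OF TA.mod TA.mod TA.lmul_lin[OF nv(1)] vc]
  lin_a_inv[OF TA.mod TA.mod TA.rmul_lin[OF vc] vc] nv(2) by simp
qed

text \<open>The elements of \<open>J\<close> whose differential and sign twist stay in
  \<open>J\<close> form an ideal containing all squares. The sign twist has to be carried along
  because it occurs in the Leibniz rule.\<close>

lemma J_stable:
 assumes "x \<in> J"
 shows "dif T x \<in> J" "sign_op x \<in> J"
proof -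
 let ?H = "{x \<in> J. dif T x \<in> J & sign_op x \<in> J}"
 note Jc = subsetD[OF subD(1)[OF J_sub]]
 note sg = linD[OF sign_op_lin]
 have "J <= ?H"
 proof (rule J_minimal)
  show "submodule ?H R T"
  proof (rule TA.subI')
  show "?H <= carrier T" using Jc by blast
  show "\<zero>.T \<in> ?H" using subD(2)[OF J_sub]
  lin_zero[OF TA.mod TA.mod sign_op_lin] by simp
  next
  fix x y assume x: "x \<in> ?H" and y: "y \<in> ?H"
  hence c: "x .: T" "y .: T" using Jc by auto
  show "x \<oplus>.T y \<in> ?H" using x y subD(3)[OF J_sub] by (simp add: TA.d_add[OF c] sg(2)[OF c])
  next
  fix a x assume a: "a .: R" and x: "x \<in> ?H"
  hence c: "x .: T" using Jc by auto
  show "a \<odot>.T x \<in> ?H" using x subD(4)[OF J_sub a] by (simp add: TA.d_smult[OF a c] sg(3)[OF a c])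
  qed
  fix x y assume x: "x .: T" and "y \<in> ?H"
  hence y: "y \<in> J" "dif T y \<in> J" "sign_op y \<in> J" and yc: "y .: T" using Jc by auto
  show "x \<otimes>.T y \<in> ?H"
  using J_mult_l[OF x y(1)] J_mult_l[OF TA.d_closed[OF x] y(1)] J_mult_l[OF sg(1)[OF x] y(2)] J_mult_l[OF sg(1)[OF x] y(3)]
  subD(3)[OF J_sub] by (simp add: leibniz_T[OF x yc] sign_op_mult[OF x yc])
  show "y \<otimes>.T x \<in> ?H"
  using J_mult_r[OF x y(1)] J_mult_r[OF x y(2)] J_mult_r[OF TA.d_closed[OF x] y(3)] J_mult_r[OF sg(1)[OF x] y(3)]
  subD(3)[OF J_sub] by (simp add: leibniz_T[OF yc x] sign_op_mult[OF yc x])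
 next
  fix v assume v: "v \<in> homog T 1"
  show "v \<otimes>.T v \<in> ?H" using J_square[OF v] subD(2)[OF J_sub] by (simp add: d_square[OF v] sign_square[OF v])
 qed
 thus "dif T x \<in> J" "sign_op x \<in> J" using assms by auto
qed

lemma J_diff_ideal: "diff_ideal R T J"
 by (intro diff_ideal.intro TA.diff_alg_axioms diff_ideal_axioms.intro J_sub J_mult_l J_mult_r J_stable(1))

sublocale Ext: diff_alg R EA
 unfolding exterior_algebra_def by (rule diff_ideal.quotient_diff_alg[OF J_diff_ideal])

lemmas EA_simps = qalg_simps[of T J, folded exterior_algebra_def]
 diff_ideal.quotient_simps[OF J_diff_ideal, folded exterior_algebra_def]

lemma EA_ring: "ring EA"
 by (rule ring_image[OF T_ring Ext.diff_alg_axioms, of qJ]) (auto simp: EA_simps)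

lemma qJ_lin: "lin R T EA qJ"
 by (rule linI) (auto simp: EA_simps)

text \<open>Letters anticommute modulo \<open>J\<close>, as expanding the square of
  \<open>a + b\<close> shows. The induction moves the first \<open>a\<close> past the letters of
  \<open>w\<close> until it meets the last one and forms a square.\<close>

lemma J_repeated: "w \<in> lists X ==> a \<in> X ==> mono (a # w @ [a]) \<in> J"
proof (induction w)
 case Nil
 have "mono [a] \<in> homog T 1" unfolding homog1_eq by (rule basis_elt_in) (use Nil in auto)
 from J_square[OF this] show ?case using T_mult_mono[of "[a]" "[a]"] Nil by simp
next
 case (Cons b w)
 hence b: "b \<in> X" and w: "w \<in> lists X" and a: "a \<in> X" by auto
 have h: "mono [a] \<in> homog T 1" "mono [b] \<in> homog T 1" unfolding homog1_eq by (rule basis_elt_in; use a b in simp)+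
 have hc: "mono [a] .: T" "mono [b] .: T" using a b by auto
 have "mono [a] \<oplus>.T mono [b] \<in> homog T 1" using fsf_add h unfolding homog1_eq T_simps(5) by blast
 from J_square[OF this] have "mono [a] \<otimes>.T mono [a] \<oplus>.T mono [b] \<otimes>.T mono [a] \<oplus>.T (mono [a] \<otimes>.T mono [b] \<oplus>.T mono [b] \<otimes>.T mono [b]) \<in> J"
  using hc by (simp add: TA.mult_l_distr TA.mult_r_distr)
 hence 1: "(mono [a,a] \<oplus>.T mono [b,a]) \<oplus>.T (mono [a,b] \<oplus>.T mono [b,b]) \<in> J"
  using a b by (simp add: T_mult_mono)
 have sq: "mono [a,a] \<in> J" "mono [b,b] \<in> J" using J_square[OF h(1)] J_square[OF h(2)] a b by (simp_all add: T_mult_mono)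
 have c: "mono [a,a] .: T" "mono [b,b] .: T" "mono [a,b] .: T" "mono [b,a] .: T" using a b by auto
 have 2: "mono [a,b] \<oplus>.T mono [b,a] \<in> J"
 proof -
  have "(mono [a,a] \<oplus>.T mono [b,a]) \<oplus>.T (mono [a,b] \<oplus>.T mono [b,b]) = mono [a,a] \<oplus>.T (mono [b,b] \<oplus>.T (mono [a,b] \<oplus>.T mono [b,a]))"
  using c by (simp add: TA.M.a_ac)
  hence "mono [a,a] \<oplus>.T (mono [b,b] \<oplus>.T (mono [a,b] \<oplus>.T mono [b,a])) \<in> J" using 1 by simp
  from TA.submodule_cancel[OF J_sub sq(1) _ this] have "mono [b,b] \<oplus>.T (mono [a,b] \<oplus>.T mono [b,a]) \<in> J" using c by simp
  from TA.submodule_cancel[OF J_sub sq(2) _ this] show ?thesis using c by simp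
 qed
 have bw: "b # w @ [a] \<in> lists X" "[a] \<in> lists X" "w @ [a] \<in> lists X" "[b] \<in> lists X" "[b, a] \<in> lists X" "[a, b] \<in> lists X" using a b w by auto
 have A: "mono [a,b] \<otimes>.T mono (w @ [a]) = mono (a # (b # w) @ [a])" using T_mult_mono[of "[a,b]" "w @ [a]"] bw by simp
 have B: "mono [b,a] \<otimes>.T mono (w @ [a]) = mono [b] \<otimes>.T mono (a # w @ [a])"
  using T_mult_mono[of "[b,a]" "w @ [a]"] T_mult_mono[of "[b]" "a # w @ [a]"] bw by simp
 have 3: "mono (a # (b # w) @ [a]) \<oplus>.T mono [b] \<otimes>.T mono (a # w @ [a]) \<in> J"
  using J_mult_r[OF mono_in[OF bw(3)] 2] TA.mult_l_distr[OF c(3,4) mono_in[OF bw(3)]] A B by simp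
 have 4: "mono [b] \<otimes>.T mono (a # w @ [a]) \<in> J"
  by (rule J_mult_l[OF mono_in[OF bw(4)] Cons.IH[OF w a]])
 have c5: "mono (a # (b # w) @ [a]) .: T" using bw by auto
 have "mono [b] \<otimes>.T mono (a # w @ [a]) \<oplus>.T mono (a # (b # w) @ [a]) \<in> J"
  using 3 TA.M.a_comm[OF c5 subsetD[OF subD(1)[OF J_sub] 4]] by simp
 from TA.submodule_cancel[OF J_sub 4 c5 this] show ?case .
qed

lemma J_not_distinct:
 assumes "w \<in> lists X" "~  distinct w"
 shows "mono w \<in> J"
proof -
 obtain u a v z where w: "w = u @ [a] @ v @ [a] @ z" using not_distinct_decomp[OF assms(2)] by blast
 have l: "u \<in> lists X" "a \<in> X" "v \<in> lists X" "z \<in> lists X" "a # v @ [a] \<in> lists X" "(a # v @ [a]) @ z \<in> lists X" using assms(1) w by auto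
 have "mono w = mono u \<otimes>.T (mono (a # v @ [a]) \<otimes>.T mono z)"
  unfolding T_mult_mono[OF l(5,4)] T_mult_mono[OF l(1,6)] w by simp
 thus ?thesis using J_mult_l[OF mono_in[OF l(1)] J_mult_r[OF mono_in[OF l(4)] J_repeated[OF l(3,2)]]] by simp
qed

end

section \<open>The relations of the OS-algebra, pulled back to words\<close>

locale OS = cring R + ranked_lattice L r
 for R :: "('r, 'k) ring_scheme" (structure) and L :: "('p, 'n) gorder_scheme" and r :: "'p => nat"
begin

sublocale words R "lattice_atoms L" ..

abbreviation "X == lattice_atoms L"
abbreviation "I == OS_relations R L r"
abbreviation "A == OS_algebra R L r"

definition dependent :: "'p list => bool" where
 "dependent w <-> distinct w & w \<in> lists X & r (flat w) < length w"

text \<open>The full preimage of the OS-ideal in the tensor algebra. It turns the OS-algebra, a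
  quotient of a quotient, into a single quotient of the module of words, where restriction to sets
  of words makes sense.\<close>

definition K :: "('p list => 'r) set" where
 "K = {x \<in> carrier T. qJ x \<in> I}"

lemma relators_eq:
 "{dif EA (exterior_monomial R X w) | w. distinct w & set w <= X & r (\<Squnion>.L(set w)) < card (set w)}
  = {qJ (dif T (mono w)) | w. dependent w}"
proof -
 have "dif EA (exterior_monomial R X w) = qJ (dif T (mono w))" if "set w <= X" for w
  unfolding exterior_monomial_def by (rule EA_simps(12)) (use that in "auto intro!: mono_in")
 moreover have "distinct w & set w <= X & r (\<Squnion>.L(set w)) < card (set w) <-> dependent w" for w
  by (auto simp: dependent_def flat_def distinct_card in_lists_conv_set)
 ultimately show ?thesis by (metis (no_types, lifting))
qed

lemma I_eq: "I = genideal EA {qJ (dif T (mono w)) | w. dependent w}"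
 unfolding OS_relations_def Let_def relators_eq ..

lemma dependent_lists: "dependent w ==> w \<in> lists X"
 by (simp add: dependent_def)

lemma relators_subset: "{qJ (dif T (mono w)) | w. dependent w} <= carrier EA"
 using dependent_lists by (auto simp: EA_simps(1))

lemma I_ideal: "ideal I EA"
 unfolding I_eq by (rule ring.genideal_ideal[OF EA_ring relators_subset])

lemma I_sub: "submodule I R EA"
proof (rule ideal_imp_sub[OF Ext.diff_alg_axioms I_ideal])
 interpret E: ring EA by (rule EA_ring)
 show "\<one>.EA \<otimes>.EA x = x" if "x .: EA" for x using that by simp
qed

lemma qJ_closed: "x .: T ==> qJ x .: EA"
 unfolding EA_simps(1) by (rule imageI)

lemma K_subset: "K <= carrier T"
 by (auto simp: K_def)

lemma K_sub: "submodule K R T"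
proof (rule TA.subI')
 show "K <= carrier T" by (rule K_subset)
 show "\<zero>.T \<in> K" using subD(2)[OF I_sub] lin_zero[OF TA.mod Ext.mod qJ_lin]
  by (simp add: K_def)
 show "x \<oplus>.T y \<in> K" if "x \<in> K" "y \<in> K" for x y
  using that subD(3)[OF I_sub] linD(2)[OF qJ_lin] by (simp add: K_def)
 show "a \<odot>.T x \<in> K" if "a .: R" "x \<in> K" for x a
  using that subD(4)[OF I_sub] linD(3)[OF qJ_lin] by (simp add: K_def)
qed

lemma qJ_mult: "x .: T ==> y .: T ==> qJ (x \<otimes>.T y) = qJ x \<otimes>.EA qJ y"
 by (rule EA_simps(11)[symmetric])

lemma qJ_d: "x .: T ==> qJ (dif T x) = dif EA (qJ x)"
 by (rule EA_simps(12)[symmetric])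

lemma K_mult_l: "x .: T ==> y \<in> K ==> x \<otimes>.T y \<in> K"
 using ideal.I_l_closed[OF I_ideal _ qJ_closed] by (simp add: K_def qJ_mult)

lemma K_mult_r: "x .: T ==> y \<in> K ==> y \<otimes>.T x \<in> K"
 using ideal.I_r_closed[OF I_ideal _ qJ_closed] by (simp add: K_def qJ_mult)

lemma J_subset_K: "J <= K"
proof
 fix x assume x: "x \<in> J"
 have xc: "x .: T" using subsetD[OF subD(1)[OF J_sub] x] .
 have "qJ x = \<zero>.EA" using TA.coset_eq_zero_iff[OF J_sub xc] x by (simp add: EA_simps)
 thus "x \<in> K" using xc subD(2)[OF I_sub] by (simp add: K_def)
qed

lemma K_relator: "dependent w ==> dif T (mono w) \<in> K"
 using ring.genideal_self[OF EA_ring relators_subset] dependent_lists[of w]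
 by (auto simp: K_def I_eq)

text \<open>The induction principle for \<open>K\<close>. The image of \<open>H\<close> in the
  exterior algebra is an ideal containing the relators, hence contains \<open>I\<close>; and
  elements of \<open>T\<close> with the same image differ by \<open>J\<close>, which lies in
  \<open>H\<close> because the squares do.\<close>

lemma K_minimal:
 assumes H: "submodule H R T" and l: "!!x y. x .: T ==> y \<in> H ==> x \<otimes>.T y \<in> H"
  and r: "!!x y. x .: T ==> y \<in> H ==> y \<otimes>.T x \<in> H" and s: "!!v. v \<in> homog T 1 ==> v \<otimes>.T v \<in> H"
  and d: "!!w. dependent w ==> dif T (mono w) \<in> H"
 shows "K <= H"
proof -
 have JH: "J <= H" by (rule J_minimal[OF H l r s])
 have Hc: "H <= carrier T" by (rule subD(1)[OF H])
 have im: "submodule (qJ ` H) R EA"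
 proof (rule Ext.subI')
  show "qJ ` H <= carrier EA" using Hc qJ_closed by auto
  show "\<zero>.EA \<in> qJ ` H"
  using lin_zero[OF TA.mod Ext.mod qJ_lin] subD(2)[OF H] by (metis imageI)
 next
  fix x y assume "x \<in> qJ ` H" "y \<in> qJ ` H"
  then obtain x' y' where *: "x' \<in> H" "x = qJ x'" "y' \<in> H" "y = qJ y'" by auto
  hence "x \<oplus>.EA y = qJ (x' \<oplus>.T y')" using Hc linD(2)[OF qJ_lin, of x' y'] by auto
  thus "x \<oplus>.EA y \<in> qJ ` H" using subD(3)[OF H *(1,3)] by simp
 next
  fix a x assume a: "a .: R" and "x \<in> qJ ` H"
  then obtain x' where *: "x' \<in> H" "x = qJ x'" by auto
  hence "a \<odot>.EA x = qJ (a \<odot>.T x')" using Hc linD(3)[OF qJ_lin a, of x'] by auto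
  thus "a \<odot>.EA x \<in> qJ ` H" using subD(4)[OF H a *(1)] by simp
 qed
 have "ideal (qJ ` H) EA"
 proof (rule ideal_if_sub[OF EA_ring im])
  fix x y assume x: "x .: EA" and y: "y \<in> qJ ` H"
  then obtain x' y' where *: "x' .: T" "x = qJ x'" "y' \<in> H" "y = qJ y'" by (auto simp: EA_simps(1))
  have y'c: "y' .: T" using * Hc by auto
  show "x \<otimes>.EA y \<in> qJ ` H" using qJ_mult[OF *(1) y'c] l[OF *(1,3)] * by (metis imageI)
  show "y \<otimes>.EA x \<in> qJ ` H" using qJ_mult[OF y'c *(1)] r[OF *(1,3)] * by (metis imageI)
 qed
 hence IH: "I <= qJ ` H"
  unfolding I_eq by (rule ring.genideal_minimal[OF EA_ring]) (use d in auto)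
 show ?thesis
 proof
  fix x assume "x \<in> K"
  hence x: "x .: T" "qJ x \<in> I" by (auto simp: K_def)
  then obtain h where h: "h \<in> H" "qJ x = qJ h" using IH by blast
  have hc: "h .: T" using h(1) Hc by blast
  have "x \<ominus>.T h \<in> J" using TA.cos_iff[OF J_sub x(1) hc] h(2) by simp
  hence "h \<oplus>.T (x \<ominus>.T h) \<in> H" using subD(3)[OF H h(1)] JH by blast
  also have "h \<oplus>.T (x \<ominus>.T h) = x" using x(1) hc TA.M.a_comm[of x "\<ominus>.T h"]
  by (simp add: a_minus_def TA.M.a_assoc[symmetric] TA.M.r_neg)
  finally show "x \<in> H" .
 qed
qed

text \<open>The relators are boundaries, so their differential is zero, and being of pure degree
  they are only multiplied by a sign under \<open>sign_op\<close>. Products are handled by the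
  Leibniz rule and the multiplicativity of \<open>sign_op\<close>.\<close>

lemma K_stable:
 assumes "x \<in> K"
 shows "dif T x \<in> K" "sign_op x \<in> K"
proof -
 let ?H = "{x \<in> K. dif T x \<in> K & sign_op x \<in> K}"
 note Kc = subsetD[OF K_subset]
 note sg = linD[OF sign_op_lin]
 have K0: "\<zero>.T \<in> K" by (rule subD(2)[OF K_sub])
 have "K <= ?H"
 proof (rule K_minimal)
  show "submodule ?H R T"
  proof (rule TA.subI')
  show "?H <= carrier T" using Kc by blast
  show "\<zero>.T \<in> ?H" using K0
  lin_zero[OF TA.mod TA.mod sign_op_lin] by simp
  next
  fix x y assume x: "x \<in> ?H" and y: "y \<in> ?H"
  hence c: "x .: T" "y .: T" using Kc by auto
  show "x \<oplus>.T y \<in> ?H" using x y subD(3)[OF K_sub] by (simp add: TA.d_add[OF c] sg(2)[OF c])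
  next
  fix a x assume a: "a .: R" and x: "x \<in> ?H"
  hence c: "x .: T" using Kc by auto
  show "a \<odot>.T x \<in> ?H" using x subD(4)[OF K_sub a] by (simp add: TA.d_smult[OF a c] sg(3)[OF a c])
  qed
  fix x y assume x: "x .: T" and "y \<in> ?H"
  hence y: "y \<in> K" "dif T y \<in> K" "sign_op y \<in> K" and yc: "y .: T" using Kc by auto
  show "x \<otimes>.T y \<in> ?H"
  using K_mult_l[OF x y(1)] K_mult_l[OF TA.d_closed[OF x] y(1)] K_mult_l[OF sg(1)[OF x] y(2)] K_mult_l[OF sg(1)[OF x] y(3)]
  subD(3)[OF K_sub] by (simp add: leibniz_T[OF x yc] sign_op_mult[OF x yc])
  show "y \<otimes>.T x \<in> ?H"
  using K_mult_r[OF x y(1)] K_mult_r[OF x y(2)] K_mult_r[OF TA.d_closed[OF x] y(3)] K_mult_r[OF sg(1)[OF x] y(3)]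
  subD(3)[OF K_sub] by (simp add: leibniz_T[OF yc x] sign_op_mult[OF yc x])
 next
  fix v assume v: "v \<in> homog T 1"
  thus "v \<otimes>.T v \<in> ?H" using J_square[OF v] J_subset_K K0 by (auto simp: d_square[OF v] sign_square[OF v])
 next
  fix w assume w: "dependent w"
  have wl: "w \<in> lists X" by (rule dependent_lists[OF w])
  have k: "dif T (mono w) \<in> K" by (rule K_relator[OF w])
  have "sign_op (dif T (mono w)) = sg R (int (length w) - 1) \<odot>.T dif T (mono w)"
  unfolding T_d_mono[OF wl] face_sum_eq[OF wl]
  proof -
  let ?g = "%j. sg R (int j) \<odot>.T mono (take j w @ drop (Suc j) w)"
  have g: "?g j .: T" for j using face_in[OF wl] by simp
  have 1: "sign_op (?g j) = sg R (int (length w) - 1) \<odot>.T ?g j" if "j \<in> {..<length w}" for j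
  proof -
  have "int (length (take j w @ drop (Suc j) w)) = int (length w) - 1" using that by auto
  thus ?thesis using face_in[OF wl, of j] sg(3)[of "sg R (int j)" "mono (take j w @ drop (Suc j) w)"]
  by (simp only: sign_op_mono sg_closed mono_in)
  (simp add: TA.smult_assoc1[symmetric] m_comm)
  qed
  have "sign_op (\<Oplus>.T j\<in>{..<length w}. ?g j) = (\<Oplus>.T j\<in>{..<length w}. sign_op (?g j))"
  by (rule lin_finsum[OF TA.mod TA.mod sign_op_lin]) (use g in auto)
  also have "... = (\<Oplus>.T j\<in>{..<length w}. sg R (int (length w) - 1) \<odot>.T ?g j)"
  by (rule TA.M.finsum_cong') (use g 1 in auto)
  also have "... = sg R (int (length w) - 1) \<odot>.T (\<Oplus>.T j\<in>{..<length w}. ?g j)"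
  by (rule TA.finsum_smult_ldistr[symmetric]) (use g in auto)
  finally show "sign_op (\<Oplus>.T j\<in>{..<length w}. ?g j) = sg R (int (length w) - 1) \<odot>.T (\<Oplus>.T j\<in>{..<length w}. ?g j)" .
  qed
  hence "sign_op (dif T (mono w)) \<in> K" using subD(4)[OF K_sub _ k] by simp
  thus "dif T (mono w) \<in> ?H" using k K0 d_d_T[OF mono_in[OF wl]] by simp
 qed
 thus "dif T x \<in> K" "sign_op x \<in> K" using assms by auto
qed

lemma I_diff_ideal: "diff_ideal R EA I"
proof (intro diff_ideal.intro Ext.diff_alg_axioms diff_ideal_axioms.intro I_sub)
 show "x \<otimes>.EA y \<in> I" if "x .: EA" "y \<in> I" for x y by (rule ideal.I_l_closed[OF I_ideal that(2,1)])
 show "y \<otimes>.EA x \<in> I" if "x .: EA" "y \<in> I" for x y by (rule ideal.I_r_closed[OF I_ideal that(2,1)])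
 fix y assume y: "y \<in> I"
 hence "y .: EA" using subD(1)[OF I_sub] by blast
 then obtain x where x: "x .: T" "y = qJ x" by (auto simp: EA_simps(1))
 hence "x \<in> K" using y by (simp add: K_def)
 hence "qJ (dif T x) \<in> I" using K_stable(1) by (auto simp: K_def)
 thus "dif EA y \<in> I" using x by (simp add: qJ_d)
qed

sublocale A: diff_alg R A
 unfolding OS_algebra_def by (rule diff_ideal.quotient_diff_alg[OF I_diff_ideal])

lemmas A_simps = qalg_simps[of EA I, folded OS_algebra_def]
 diff_ideal.quotient_simps[OF I_diff_ideal, folded OS_algebra_def]

definition os :: "('p list => 'r) => ('p list => 'r) set set" where
 "os x = I +>.EA qJ x"

lemma os_lin: "lin R T A os"
proof (rule linI)
 note q = linD[OF qJ_lin]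
 fix x assume x: "x .: T"
 show "os x .: A" using q(1)[OF x] by (auto simp: os_def A_simps(1))
 show "os (a \<odot>.T x) = a \<odot>.A os x" if "a .: R" for a
  unfolding os_def q(3)[OF that x] by (rule A_simps(10)[OF that q(1)[OF x], symmetric])
 fix y assume y: "y .: T"
 show "os (x \<oplus>.T y) = os x \<oplus>.A os y"
  unfolding os_def q(2)[OF x y] by (rule A_simps(9)[OF q(1)[OF x] q(1)[OF y], symmetric])
qed

lemmas os_closed [simp] = linD(1)[OF os_lin]
lemmas os_add = linD(2)[OF os_lin]
lemmas os_smult = linD(3)[OF os_lin]
lemmas os_minus = lin_minus[OF TA.mod A.mod os_lin]
lemmas os_zero = lin_zero[OF TA.mod A.mod os_lin]

lemma os_surj: "carrier A = os ` carrier T"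
 by (simp add: A_simps(1) EA_simps(1) image_image os_def)

lemma os_rep: "y .: A ==> EX x:carrier T. y = os x"
 unfolding os_surj by auto

lemma os_mult: "x .: T ==> y .: T ==> os (x \<otimes>.T y) = os x \<otimes>.A os y"
 unfolding os_def by (simp add: qJ_mult A_simps(11) qJ_closed)

lemma os_d: "x .: T ==> os (dif T x) = dif A (os x)"
 unfolding os_def by (simp add: qJ_d A_simps(12) qJ_closed)

lemma os_one: "os \<one>.T = \<one>.A"
 by (simp add: os_def A_simps(2) EA_simps(2))

lemma os_eq_zero_iff: "x .: T ==> os x = \<zero>.A <-> x \<in> K"
 using Ext.coset_eq_zero_iff[OF I_sub qJ_closed] by (simp add: os_def A_simps(3) K_def)

lemma os_eq_iff: "x .: T ==> y .: T ==> os x = os y <-> x \<ominus>.T y \<in> K"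
 using Ext.cos_iff[OF I_sub qJ_closed qJ_closed]
  lin_minus[OF TA.mod Ext.mod qJ_lin] by (simp add: os_def K_def)

lemma OS_monomial_eq: "OS_monomial R L r w = os (mono w)"
 by (simp add: OS_monomial_def exterior_monomial_def os_def)

subsection \<open>The grading by flats\<close>

text \<open>A dependent monomial is itself a relation: for \<open>w = a # u\<close>, multiplying the
  relator by \<open>e_a\<close> gives
  \<open>e_a (\<partial> e_w) = e_w - e_a e_a (\<partial> e_u)\<close>, and \<open>e_a e_a\<close>
  vanishes.\<close>

lemma mono_dependent:
 assumes "w \<in> lists X" "~  distinct w | r (flat w) < length w"
 shows "mono w \<in> K"
proof (cases "distinct w")
 case False thus ?thesis using J_not_distinct[OF assms(1)] J_subset_K by blast
next
 case True
 hence dep: "dependent w" using assms by (simp add: dependent_def)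
 then obtain a u where w: "w = a # u" by (cases w) (auto simp: dependent_def)
 have au: "a \<in> X" "u \<in> lists X" "[a] \<in> lists X" using assms(1) w by auto
 have c: "mono [a] .: T" "mono u .: T" "dif T (mono u) .: T" using au by auto
 have aa: "mono [a,a] \<in> K" using J_not_distinct[of "[a,a]"] au J_subset_K by auto
 have 1: "mono [a] \<otimes>.T dif T (mono w) \<in> K" by (rule K_mult_l[OF c(1) K_relator[OF dep]])
 have 2: "mono [a] \<otimes>.T dif T (mono w) = mono w \<ominus>.T mono [a,a] \<otimes>.T dif T (mono u)"
 proof -
  have "mono [a] \<otimes>.T (mono u \<ominus>.T mono [a] \<otimes>.T dif T (mono u)) =
  mono [a] \<otimes>.T mono u \<ominus>.T mono [a] \<otimes>.T (mono [a] \<otimes>.T dif T (mono u))"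
  by (rule lin_minus[OF TA.mod TA.mod TA.lmul_lin[OF c(1)]]) (use c in auto)
  also have "mono [a] \<otimes>.T (mono [a] \<otimes>.T dif T (mono u)) = mono [a,a] \<otimes>.T dif T (mono u)"
  using T_assoc[OF c(1,1,3)] T_mult_mono[OF au(3,3)] by simp
  also have "mono [a] \<otimes>.T mono u = mono w" using T_mult_mono[OF au(3,2)] w by simp
  finally show ?thesis using d_letter_mono[OF au(1,2)] w by simp
 qed
 have 3: "mono [a,a] \<otimes>.T dif T (mono u) \<in> K" by (rule K_mult_r[OF c(3) aa])
 have wc: "mono w .: T" using assms(1) by simp
 have c3: "mono [a,a] \<otimes>.T dif T (mono u) .: T" using 3 K_subset by blast
 have "(mono w \<ominus>.T mono [a,a] \<otimes>.T dif T (mono u)) \<oplus>.T mono [a,a] \<otimes>.T dif T (mono u) \<in> K"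
  by (rule subD(3)[OF K_sub 1[unfolded 2] 3])
 thus ?thesis using wc c3 by (simp add: a_minus_def TA.M.a_assoc TA.M.l_neg)
qed

text \<open>Indexed by sets of flats and not by single flats: restricting a product with a word
  \<open>u\<close> amounts to restricting the other factor to the preimage of \<open>Q\<close> under
  joining with \<open>flat u\<close>, which is rarely a single flat.\<close>

definition flr :: "'p set => ('p list => 'r) => 'p list => 'r" where
 "flr Q = restr (%w. flat w \<in> Q)"

lemma flat_restr_lin: "lin R T T (flr Q)"
 unfolding flr_def by (rule restr_lin)

lemma flat_restr_mono: "flr Q (mono w) = (if flat w \<in> Q then mono w else \<zero>.T)"
 unfolding flr_def by (rule restr_mono)

lemma restr_cong:
 assumes "x .: T" "!!w. w \<in> lists X ==> P w <-> Q w"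
 shows "restr P x = restr Q x"
proof
 fix w
 have "w \<in> lists X | x w = \<zero>" using fsuppD(3,4)[OF assms(1)[unfolded T_simps(1)]] by blast
 thus "restr P x w = restr Q x w" using assms(2) by (auto simp: restr_def)
qed

lemma flat_restr_mult:
 assumes "u \<in> lists X" "x .: T"
 shows "flr Q (mono u \<otimes>.T x) = mono u \<otimes>.T flr {q. flat u \<squnion>.L q \<in> Q} x"
  and "flr Q (x \<otimes>.T mono u) = flr {q. q \<squnion>.L flat u \<in> Q} x \<otimes>.T mono u"
proof -
 have "restr (%w. flat (u @ w) \<in> Q) x = restr (%w. flat w \<in> {q. flat u \<squnion>.L q \<in> Q}) x"
  by (rule restr_cong[OF assms(2)]) (simp add: flat_append[OF assms(1)])
 thus "flr Q (mono u \<otimes>.T x) = mono u \<otimes>.T flr {q. flat u \<squnion>.L q \<in> Q} x"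
  unfolding flr_def restr_mono_mult(1)[OF assms] by simp
 have "restr (%w. flat (w @ u) \<in> Q) x = restr (%w. flat w \<in> {q. q \<squnion>.L flat u \<in> Q}) x"
  by (rule restr_cong[OF assms(2)]) (simp add: flat_append[OF _ assms(1)])
 thus "flr Q (x \<otimes>.T mono u) = flr {q. q \<squnion>.L flat u \<in> Q} x \<otimes>.T mono u"
  unfolding flr_def restr_mono_mult(2)[OF assms] by simp
qed

lemma flat_restr_compl:
 assumes "x .: T"
 shows "flr Q x \<oplus>.T flr (- Q) x = x"
 using T_val[OF assms] by (auto simp: flr_def restr_def T_simps fun_eq_iff)

text \<open>A face of a dependent word \<open>w\<close> whose flat differs from
  \<open>flat w\<close> has rank below \<open>r (flat w)\<close>, hence below its own length, and
  vanishes by \<open>mono_dependent\<close>. So modulo \<open>K\<close> the relator is concentrated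
  in \<open>flat w\<close>. If \<open>Q\<close> misses that flat, every kept face is in
  \<open>K\<close>; if not, the complementary restriction is in \<open>K\<close>, and the sum of the
  two is the relator.\<close>

lemma K_flat_restr_relator:
 assumes "dependent w"
 shows "flr Q (dif T (mono w)) \<in> K"
proof -
 have wl: "w \<in> lists X" by (rule dependent_lists[OF assms])
 have dc: "dif T (mono w) .: T" using wl by simp
 have notin: "flr Q (dif T (mono w)) \<in> K" if Q: "flat w \<notin> Q" for Q
 proof -
  let ?g = "%j. sg R (int j) \<odot>.T mono (take j w @ drop (Suc j) w)"
  have g: "?g j .: T" for j using face_in[OF wl] by simp
  have "flr Q (dif T (mono w)) = (\<Oplus>.T j\<in>{..<length w}. flr Q (?g j))"
  unfolding T_d_mono[OF wl] face_sum_eq[OF wl]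
  by (rule lin_finsum[OF TA.mod TA.mod flat_restr_lin]) (use g in auto)
  also have "... \<in> K"
  proof (rule TA.submodule_finsum[OF K_sub])
  fix j assume "j \<in> {..<length w}"
  hence j: "j < length w" by simp
  let ?u = "take j w @ drop (Suc j) w"
  have u: "?u \<in> lists X" by (rule face_in[OF wl])
  have lu: "length ?u = length w - 1" using j by auto
  have eq: "flr Q (?g j) = sg R (int j) \<odot>.T flr Q (mono ?u)"
  by (rule linD(3)[OF flat_restr_lin]) (use u in auto)
  have "flr Q (mono ?u) \<in> K"
  proof (cases "flat ?u \<in> Q")
  case False thus ?thesis by (simp add: flat_restr_mono subD(2)[OF K_sub])
  next
  case True
  hence ne: "flat ?u ~= flat w" using Q by auto
  have sub: "set ?u <= set w" by (auto dest: in_set_takeD in_set_dropD)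
  have wc: "set w <= carrier L" using wl atoms_subset by auto
  have "flat ?u \<sqsubseteq>.L flat w" unfolding flat_def
  by (rule sup_least) (use sub wc sup_in sup_upper[OF wc] in auto)
  hence "r (flat ?u) < r (flat w)" using rank_strict[OF flat_in[OF u] flat_in[OF wl] _ ne] by blast
  hence "r (flat ?u) < length ?u" using assms lu by (auto simp: dependent_def)
  thus ?thesis using mono_dependent[OF u] True by (simp add: flat_restr_mono)
  qed
  thus "flr Q (?g j) \<in> K" unfolding eq using subD(4)[OF K_sub] by simp
  qed simp
  finally show ?thesis .
 qed
 show ?thesis
 proof (cases "flat w \<in> Q")
  case False thus ?thesis by (rule notin)
 next
  case True
  hence "flr (- Q) (dif T (mono w)) \<in> K" by (intro notin) auto
  moreover have "flr (- Q) (dif T (mono w)) \<oplus>.T flr Q (dif T (mono w)) \<in> K"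
  using flat_restr_compl[OF dc, of "- Q"] K_relator[OF assms] by simp
  ultimately show ?thesis
  using TA.submodule_cancel[OF K_sub _ linD(1)[OF flat_restr_lin dc]] by blast
 qed
qed

text \<open>Supplies the mixed terms in the square of a sum. The words \<open>a b\<close> and
  \<open>b a\<close> have the same flat, so a restriction keeps or drops them together.\<close>

lemma K_flat_restr_anticomm:
 assumes "v \<in> homog T 1" "w \<in> homog T 1"
 shows "flr Q (v \<otimes>.T w \<oplus>.T w \<otimes>.T v) \<in> K"
proof -
 have K0: "\<zero>.T \<in> K" by (rule subD(2)[OF K_sub])
 have hc: "x .: T" if "x \<in> homog T 1" for x using that homog_T by blast
 have lin: "lin R T T (%v. flr Q (v \<otimes>.T w \<oplus>.T w \<otimes>.T v))" if "w .: T" for w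
  by (rule lin_comp[OF TA.lin_sum[OF TA.rmul_lin TA.lmul_lin] flat_restr_lin]) (use that in auto)
 have step: "flr Q (v \<otimes>.T w \<oplus>.T w \<otimes>.T v) \<in> K"
  if v: "v \<in> homog T 1" and w: "w .: T" and base: "!!a. a \<in> X ==> flr Q (mono [a] \<otimes>.T w \<oplus>.T w \<otimes>.T mono [a]) \<in> K" for v w
  using v
 proof (induction v rule: homog1_induct)
  case zero
  show ?case unfolding lin_zero[OF TA.mod TA.mod lin[OF w]] by (rule K0)
 next
  case (add f g)
  show ?case unfolding linD(2)[OF lin[OF w] hc[OF add(1)] hc[OF add(2)]] by (rule subD(3)[OF K_sub add(3,4)])
 next
  case (basis c a)
  have "mono [a] .: T" using basis by simp
  from linD(3)[OF lin[OF w] basis(1) this] show ?case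
  using subD(4)[OF K_sub basis(1) base[OF basis(2)]] by simp
 qed
 have mm: "flr Q (mono [a] \<otimes>.T mono [b] \<oplus>.T mono [b] \<otimes>.T mono [a]) \<in> K" if a: "a \<in> X" and b: "b \<in> X" for a b
 proof -
  have f: "flat [a,b] = flat [b,a]" by (simp add: flat_def insert_commute)
  have c: "mono [a,b] .: T" "mono [b,a] .: T" using a b by auto
  have h: "mono [a] \<in> homog T 1" "mono [b] \<in> homog T 1" unfolding homog1_eq by (rule basis_elt_in; use a b in simp)+
  have hab: "mono [a] \<oplus>.T mono [b] \<in> homog T 1" using fsf_add h unfolding homog1_eq T_simps(5) by blast
  have "mono [a] \<otimes>.T mono [b] \<oplus>.T mono [b] \<otimes>.T mono [a] \<in> K"
  proof -
  let ?a = "mono [a]" and ?b = "mono [b]"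
  have ac: "?a .: T" "?b .: T" using a b by auto
  have "(?a \<oplus>.T ?b) \<otimes>.T (?a \<oplus>.T ?b) = ?a \<otimes>.T ?a \<oplus>.T (?b \<otimes>.T ?b \<oplus>.T (?a \<otimes>.T ?b \<oplus>.T ?b \<otimes>.T ?a))"
  using ac by (simp add: TA.mult_l_distr TA.mult_r_distr TA.M.a_ac)
  hence 1: "?a \<otimes>.T ?a \<oplus>.T (?b \<otimes>.T ?b \<oplus>.T (?a \<otimes>.T ?b \<oplus>.T ?b \<otimes>.T ?a)) \<in> K" using J_square[OF hab] J_subset_K by auto
  have sq: "?a \<otimes>.T ?a \<in> K" "?b \<otimes>.T ?b \<in> K" using J_square[OF h(1)] J_square[OF h(2)] J_subset_K by auto
  from TA.submodule_cancel[OF K_sub sq(1) _ 1] have 2: "?b \<otimes>.T ?b \<oplus>.T (?a \<otimes>.T ?b \<oplus>.T ?b \<otimes>.T ?a) \<in> K" using ac by simp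
  from TA.submodule_cancel[OF K_sub sq(2) _ 2] show ?thesis using ac by simp
  qed
  thus ?thesis using a b c f K0 linD(2)[OF flat_restr_lin[of Q] c]
  by (simp add: T_mult_mono flat_restr_mono)
 qed
 have "flr Q (mono [a] \<otimes>.T w \<oplus>.T w \<otimes>.T mono [a]) \<in> K" if a: "a \<in> X" for a
 proof -
  have ac: "mono [a] .: T" using a by simp
  have "flr Q (w \<otimes>.T mono [a] \<oplus>.T mono [a] \<otimes>.T w) \<in> K"
  by (rule step[OF assms(2) ac mm[OF _ a]])
  thus ?thesis using TA.M.a_comm[of "w \<otimes>.T mono [a]" "mono [a] \<otimes>.T w"] ac hc[OF assms(2)] by simp
 qed
 thus ?thesis by (rule step[OF assms(1) hc[OF assms(2)]])
qed

lemma K_flat_restr_square: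
 assumes "v \<in> homog T 1"
 shows "flr Q (v \<otimes>.T v) \<in> K"
 using assms
proof (induction v rule: homog1_induct)
 case zero
 show ?case using subD(2)[OF K_sub] lin_zero[OF TA.mod TA.mod flat_restr_lin[of Q]] by simp
next
 case (add f g)
 have c: "f .: T" "g .: T" using add homog_T by auto
 have "(f \<oplus>.T g) \<otimes>.T (f \<oplus>.T g) = (f \<otimes>.T f \<oplus>.T g \<otimes>.T g) \<oplus>.T (f \<otimes>.T g \<oplus>.T g \<otimes>.T f)"
  using c by (simp add: TA.mult_l_distr TA.mult_r_distr TA.M.a_ac)
 moreover have "flr Q ((f \<otimes>.T f \<oplus>.T g \<otimes>.T g) \<oplus>.T (f \<otimes>.T g \<oplus>.T g \<otimes>.T f)) =
  (flr Q (f \<otimes>.T f) \<oplus>.T flr Q (g \<otimes>.T g)) \<oplus>.T flr Q (f \<otimes>.T g \<oplus>.T g \<otimes>.T f)"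
  using c linD(2)[OF flat_restr_lin[of Q], of "f \<otimes>.T f" "g \<otimes>.T g"]
  linD(2)[OF flat_restr_lin[of Q], of "f \<otimes>.T f \<oplus>.T g \<otimes>.T g" "f \<otimes>.T g \<oplus>.T g \<otimes>.T f"] by simp
 ultimately show ?case
  using subD(3)[OF K_sub subD(3)[OF K_sub add(3,4)] K_flat_restr_anticomm[OF add(1,2), of Q]] by simp
next
 case (basis c a)
 have a: "[a] \<in> lists X" "mono [a] .: T" "mono [a,a] .: T" using basis by auto
 have aa: "mono [a,a] \<in> K" using J_not_distinct[of "[a,a]"] basis J_subset_K by auto
 have "(c \<odot>.T mono [a]) \<otimes>.T (c \<odot>.T mono [a]) = c \<odot>.T (c \<odot>.T mono [a,a])"
  using a basis(1) T_mult_mono[OF a(1,1)] TA.smult_mult_l[OF basis(1) a(2), of "c \<odot>.T mono [a]"] TA.smult_mult_r[OF basis(1) a(2,2)] by simp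
 moreover have "flr Q (c \<odot>.T (c \<odot>.T mono [a,a])) = c \<odot>.T (c \<odot>.T flr Q (mono [a,a]))"
  using a basis(1) linD(3)[OF flat_restr_lin[of Q] basis(1)] by simp
 moreover have "flr Q (mono [a,a]) \<in> K" using aa subD(2)[OF K_sub] by (simp add: flat_restr_mono)
 ultimately show ?case using subD(4)[OF K_sub basis(1)] by simp
qed

text \<open>This is what grades the OS-algebra by flats. Elements whose restrictions to all sets of
  flats lie in \<open>K\<close> form an ideal, since multiplication by a word only changes the set;
  this ideal contains the generators of \<open>K\<close>.\<close>

lemma K_flr:
 assumes "x \<in> K"
 shows "flr Q x \<in> K"
proof -
 let ?H = "{x \<in> carrier T. ALL Q. flr Q x \<in> K}"
 have fc: "flr Q x .: T" if "x .: T" for Q x by (rule linD(1)[OF flat_restr_lin that])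
 have lm: "mono u \<otimes>.T y \<in> ?H & y \<otimes>.T mono u \<in> ?H" if "u \<in> lists X" "y \<in> ?H" for u y
  using that K_mult_l[OF mono_in[OF that(1)]] K_mult_r[OF mono_in[OF that(1)]]
  by (simp add: flat_restr_mult)
 have sub: "submodule ?H R T"
 proof (rule TA.subI')
  show "?H <= carrier T" by blast
  show "\<zero>.T \<in> ?H" using subD(2)[OF K_sub] lin_zero[OF TA.mod TA.mod flat_restr_lin] by simp
  show "x \<oplus>.T y \<in> ?H" if "x \<in> ?H" "y \<in> ?H" for x y
  using that subD(3)[OF K_sub] linD(2)[OF flat_restr_lin] by simp
  show "a \<odot>.T x \<in> ?H" if "a .: R" "x \<in> ?H" for a x
  using that subD(4)[OF K_sub] linD(3)[OF flat_restr_lin] by simp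
 qed
 have mult: "x \<otimes>.T y \<in> ?H & y \<otimes>.T x \<in> ?H" if x: "x .: T" and y: "y \<in> ?H" for x y
 proof -
  have yc: "y .: T" using y by simp
  have "x \<in> {x \<in> carrier T. x \<otimes>.T y \<in> ?H & y \<otimes>.T x \<in> ?H}"
  proof (rule T_induct[OF x])
  show "\<zero>.T \<in> {x \<in> carrier T. x \<otimes>.T y \<in> ?H & y \<otimes>.T x \<in> ?H}"
  using subD(2)[OF sub] yc by simp
  next
  fix f g assume "f \<in> {x \<in> carrier T. x \<otimes>.T y \<in> ?H & y \<otimes>.T x \<in> ?H}" "g \<in> {x \<in> carrier T. x \<otimes>.T y \<in> ?H & y \<otimes>.T x \<in> ?H}"
  hence *: "f .: T" "g .: T" "f \<otimes>.T y \<in> ?H" "y \<otimes>.T f \<in> ?H" "g \<otimes>.T y \<in> ?H" "y \<otimes>.T g \<in> ?H" by auto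
  have "(f \<oplus>.T g) \<otimes>.T y \<in> ?H" unfolding TA.mult_l_distr[OF *(1,2) yc] by (rule subD(3)[OF sub *(3,5)])
  moreover have "y \<otimes>.T (f \<oplus>.T g) \<in> ?H" unfolding TA.mult_r_distr[OF *(1,2) yc] by (rule subD(3)[OF sub *(4,6)])
  moreover have "f \<oplus>.T g .: T" using *(1,2) by simp
  ultimately show "f \<oplus>.T g \<in> {x \<in> carrier T. x \<otimes>.T y \<in> ?H & y \<otimes>.T x \<in> ?H}" by blast
  next
  fix a u assume a: "a .: R" and u: "u \<in> lists X"
  have uc: "mono u .: T" using u by simp
  have "(a \<odot>.T mono u) \<otimes>.T y \<in> ?H" unfolding TA.smult_mult_l[OF a uc yc] using subD(4)[OF sub a] lm[OF u y] by blast
  moreover have "y \<otimes>.T (a \<odot>.T mono u) \<in> ?H" unfolding TA.smult_mult_r[OF a yc uc] using subD(4)[OF sub a] lm[OF u y] by blast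
  moreover have "a \<odot>.T mono u .: T" using a uc by simp
  ultimately show "a \<odot>.T mono u \<in> {x \<in> carrier T. x \<otimes>.T y \<in> ?H & y \<otimes>.T x \<in> ?H}" by blast
  qed
  thus ?thesis by blast
 qed
 have "K <= ?H"
 proof (rule K_minimal[OF sub])
  show "x \<otimes>.T y \<in> ?H" if "x .: T" "y \<in> ?H" for x y using mult[OF that] by blast
  show "y \<otimes>.T x \<in> ?H" if "x .: T" "y \<in> ?H" for x y using mult[OF that] by blast
  show "v \<otimes>.T v \<in> ?H" if v: "v \<in> homog T 1" for v
  proof -
  have "v .: T" using v homog_T by blast
  thus ?thesis using K_flat_restr_square[OF v] by simp
  qed
  show "dif T (mono w) \<in> ?H" if "dependent w" for w
  using K_flat_restr_relator[OF that] dependent_lists[OF that] by simp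
 qed
 thus ?thesis using assms by blast
qed

end

subsection \<open>Sums over lists\<close>

text \<open>Dual bases below are lists of pairs produced by concatenation and may repeat entries,
  for which a sum over the underlying set would be wrong.\<close>

definition lsum :: "('a, 'm) ring_scheme => ('b => 'a) => 'b list => 'a" where
 "lsum V f xs = foldr (%x s. f x \<oplus>.V s) xs \<zero>.V"

lemma lsum_simps [simp]: "lsum V f [] = \<zero>.V" "lsum V f (x # xs) = f x \<oplus>.V lsum V f xs"
 by (simp_all add: lsum_def)

lemma lsum_map: "lsum V f (map g xs) = lsum V (%x. f (g x)) xs"
 by (induction xs) simp_all

lemma lsum_cong: "(!!x. x \<in> set xs ==> f x = g x) ==> lsum V f xs = lsum V g xs"
 by (induction xs) simp_all

lemma lin_lsum:
 assumes "module R A" "module R B" "lin R A B g" "!!x. x \<in> set xs ==> f x .: A"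
 shows "lsum A f xs .: A & g (lsum A f xs) = lsum B (%x. g (f x)) xs"
proof -
 interpret A: module R A by fact
 show ?thesis using assms(4)
 proof (induction xs)
  case Nil show ?case using lin_zero[OF assms(1-3)] by simp
 next
  case (Cons x xs)
  hence "lsum A f xs .: A & g (lsum A f xs) = lsum B (%x. g (f x)) xs" "f x .: A" by auto
  thus ?case using linD(2)[OF assms(3), of "f x" "lsum A f xs"] by auto
 qed
qed

context module begin

lemma lsum_closed: "(!!x. x \<in> set xs ==> f x .: M) ==> lsum M f xs .: M"
 using lin_lsum[OF mod mod lin_id] by blast

lemma lsum_append:
 assumes "!!x. x \<in> set xs \<union> set ys ==> f x .: M"
 shows "lsum M f (xs @ ys) = lsum M f xs \<oplus>.M lsum M f ys"
 using assms
proof (induction xs)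
 case Nil
 have "lsum M f ys .: M" by (rule lsum_closed) (use Nil in auto)
 thus ?case by simp
next
 case (Cons x xs)
 have c: "f x .: M" "lsum M f xs .: M" "lsum M f ys .: M" using Cons.prems by (auto intro!: lsum_closed)
 have "lsum M f (xs @ ys) = lsum M f xs \<oplus>.M lsum M f ys" by (rule Cons.IH) (use Cons.prems in auto)
 thus ?case using c by (simp add: M.a_assoc)
qed

lemma lsum_concat:
 assumes "!!x. x \<in> set (concat xss) ==> f x .: M"
 shows "lsum M f (concat xss) = lsum M (%xs. lsum M f xs) xss"
 using assms
proof (induction xss)
 case (Cons xs xss)
 have "lsum M f (xs @ concat xss) = lsum M f xs \<oplus>.M lsum M f (concat xss)" by (rule lsum_append) (use Cons.prems in auto)
 thus ?case using Cons by simp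
qed simp

lemma lsum_zero: "(!!x. x \<in> set xs ==> f x = \<zero>.M) ==> lsum M f xs = \<zero>.M"
 by (induction xs) simp_all

lemma lsum_lin:
 assumes "module R A" "!!x. x \<in> set xs ==> lin R A M (f x)"
 shows "lin R A M (%y. lsum M (%x. f x y) xs)"
 using assms(2) by (induction xs) (auto intro!: lin_sum lin_const_zero)

lemma lsum_finsum:
 assumes "distinct xs" "!!x. x \<in> set xs ==> f x .: M"
 shows "lsum M f xs = (\<Oplus>.M x\<in>set xs. f x)"
 using assms
proof (induction xs)
 case (Cons x xs)
 have "(\<Oplus>.M y\<in>insert x (set xs). f y) = f x \<oplus>.M (\<Oplus>.M y\<in>set xs. f y)"
  by (rule M.finsum_insert) (use Cons.prems in auto)
 thus ?case using Cons by simp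
qed simp

lemma submodule_lsum:
 "submodule I R M ==> (!!x. x \<in> set xs ==> f x \<in> I) ==> lsum M f xs \<in> I"
 by (induction xs) (auto intro: subD)

end

lemma module_span_sub:
 assumes "module R A" "S <= carrier A"
 shows "submodule (module_span R A S) R A" "S <= module_span R A S"
proof -
 interpret A: module R A by fact
 have c: "submodule (carrier A) R A" by (rule A.subI') auto
 show "submodule (module_span R A S) R A"
 proof (rule A.subI')
  show "module_span R A S <= carrier A" using c assms(2) by (auto simp: module_span_def)
 qed (auto simp: module_span_def intro: subD)
 show "S <= module_span R A S" by (auto simp: module_span_def)
qed

lemma module_span_minimal: "submodule H R A ==> S <= H ==> module_span R A S <= H"
 by (auto simp: module_span_def)

subsection \<open>The summands of the OS-algebra\<close>

context OS begin

text \<open>The choice of a representative is harmless because \<open>K\<close> is stable under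
  \<open>flr\<close>; see \<open>proj_os\<close>.\<close>

definition proj :: "'p => ('p list => 'r) set set => ('p list => 'r) set set" where
 "proj p y = os (flr {p} (inv_into (carrier T) os y))"

abbreviation "part p == OS_part R L r p"

lemmas frc = linD(1)[OF flat_restr_lin]

lemma proj_os:
 assumes "x .: T" shows "proj p (os x) = os (flr {p} x)"
proof -
 let ?x = "inv_into (carrier T) os (os x)"
 have x': "?x .: T" "os ?x = os x"
  using inv_into_into[of "os x" os "carrier T"] f_inv_into_f[of "os x" os "carrier T"] assms by simp_all
 hence "?x \<ominus>.T x \<in> K" using os_eq_iff[OF x'(1) assms] by simp
 hence "flr {p} ?x \<ominus>.T flr {p} x \<in> K"
  using K_flr[of "?x \<ominus>.T x" "{p}"] lin_minus[OF TA.mod TA.mod flat_restr_lin x'(1) assms] by simp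
 thus ?thesis using os_eq_iff[OF frc[OF x'(1)] frc[OF assms]] by (simp add: proj_def)
qed

lemma proj_lin: "lin R A A (proj p)"
proof (rule linI)
 fix x assume "x .: A"
 then obtain x' where x: "x' .: T" "x = os x'" using os_rep by blast
 show "proj p x .: A" using x frc by (simp add: proj_os)
 show "proj p (a \<odot>.A x) = a \<odot>.A proj p x" if a: "a .: R" for a
 proof -
  have "proj p (os (a \<odot>.T x')) = os (a \<odot>.T flr {p} x')"
  using proj_os[of "a \<odot>.T x'"] a x(1) linD(3)[OF flat_restr_lin a x(1)] by simp
  thus ?thesis using a x os_smult[OF a x(1)] os_smult[OF a frc[OF x(1)]] by (simp add: proj_os)
 qed
 fix y assume "y .: A"
 then obtain y' where y: "y' .: T" "y = os y'" using os_rep by blast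
 have "proj p (os (x' \<oplus>.T y')) = os (flr {p} x' \<oplus>.T flr {p} y')"
  using proj_os[of "x' \<oplus>.T y'"] x(1) y(1) linD(2)[OF flat_restr_lin x(1) y(1)] by simp
 thus "proj p (x \<oplus>.A y) = proj p x \<oplus>.A proj p y"
  using x y os_add[OF x(1) y(1)] os_add[OF frc[OF x(1)] frc[OF y(1)]] by (simp add: proj_os)
qed

lemmas proj_closed [simp] = linD(1)[OF proj_lin]

lemma proj_proj:
 assumes "y .: A"
 shows "proj p (proj q y) = (if p = q then proj q y else \<zero>.A)"
proof -
 obtain x where x: "x .: T" "y = os x" using os_rep[OF assms] by blast
 have "flr {p} (flr {q} x) = (if p = q then flr {q} x else \<zero>.T)"
  by (auto simp: flr_def restr_def T_simps(4) fun_eq_iff)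
 thus ?thesis using x proj_os[OF frc[OF x(1)]] os_zero by (simp add: proj_os)
qed

lemma part_generators_subset:
 "{OS_monomial R L r w | w. distinct w & set w <= X & \<Squnion>.L(set w) = p} <= carrier A"
 by (auto simp: OS_monomial_eq intro!: os_closed mono_in)

lemma part_sub: "submodule (part p) R A"
 unfolding OS_part_def by (rule module_span_sub(1)[OF A.mod part_generators_subset])

lemmas part_subset = subD(1)[OF part_sub]

lemma part_closed [simp]: "x \<in> part p ==> x .: A"
 using part_subset by blast

lemma os_mono_dependent: "w \<in> lists X ==> ~  distinct w | r (flat w) < length w ==> os (mono w) = \<zero>.A"
 using os_eq_zero_iff[OF mono_in] mono_dependent by blast

lemma mono_in_part: "w \<in> lists X ==> os (mono w) \<in> part (flat w)"
proof (cases "distinct w")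
 case False
 assume "w \<in> lists X"
 thus ?thesis using os_mono_dependent False subD(2)[OF part_sub] by simp
next
 case True
 assume "w \<in> lists X"
 hence "os (mono w) \<in> {OS_monomial R L r v | v. distinct v & set v <= X & \<Squnion>.L(set v) = flat w}"
  using True by (auto simp: OS_monomial_eq flat_def)
 thus ?thesis unfolding OS_part_def using module_span_sub(2)[OF A.mod part_generators_subset] by blast
qed

text \<open>Monomials of length exactly \<open>r p\<close> generate \<open>part p\<close>: a longer
  word with join \<open>p\<close> is dependent and gives zero, and a shorter one has a join of
  smaller rank. Hence the whole summand carries the single sign \<open>(-1)^(r p)\<close>.\<close>

lemma part_minimal:
 assumes "submodule H R A"
  "!!w. w \<in> lists X ==> distinct w ==> flat w = p ==> length w = r p ==> os (mono w) \<in> H"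
 shows "part p <= H"
 unfolding OS_part_def
proof (rule module_span_minimal[OF assms(1)], clarify)
 fix w assume w: "distinct w" "set w <= X" "p = \<Squnion>.L(set w)"
 hence wl: "w \<in> lists X" and f: "flat w = p" by (auto simp: flat_def)
 show "OS_monomial R L r w \<in> H"
 proof (cases "length w = r p")
  case True thus ?thesis using assms(2)[OF wl w(1) f] by (simp add: OS_monomial_eq)
 next
  case False
  hence "r (flat w) < length w" using rank_flat[OF wl] f by simp
  thus ?thesis using os_mono_dependent[OF wl] subD(2)[OF assms(1)] by (simp add: OS_monomial_eq)
 qed
qed

lemma linear_eq_sub:
 assumes "module R V" "lin R A V f" "lin R A V g"
 shows "submodule {x \<in> carrier A. f x = g x} R A"
 using linD[OF assms(2)] linD[OF assms(3)] lin_zero[OF A.mod assms(1,2)]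
  lin_zero[OF A.mod assms(1,3)]
 by (intro A.subI') (simp_all add: subset_iff)

lemma part_linear_eqI:
 assumes "module R V" "lin R A V f" "lin R A V g"
  "!!w. w \<in> lists X ==> distinct w ==> flat w = p ==> length w = r p ==> f (os (mono w)) = g (os (mono w))"
  "x \<in> part p"
 shows "f x = g x"
proof -
 have "part p <= {x \<in> carrier A. f x = g x}"
  by (rule part_minimal[OF linear_eq_sub[OF assms(1-3)]]) (use assms(4) in auto)
 thus ?thesis using assms(5) by blast
qed

lemma proj_mono: "w \<in> lists X ==> proj p (os (mono w)) = (if flat w = p then os (mono w) else \<zero>.A)"
 using proj_os[OF mono_in] os_zero by (simp add: flat_restr_mono)

lemma proj_part: "x \<in> part p ==> proj p x = x"
 by (rule part_linear_eqI[OF A.mod proj_lin lin_id]) (simp_all add: proj_mono)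

lemma proj_in_part:
 assumes "y .: A"
 shows "proj p y \<in> part p"
proof -
 obtain x where x: "x .: T" "y = os x" using os_rep[OF assms] by blast
 have "x \<in> {x \<in> carrier T. os (flr {p} x) \<in> part p}"
 proof (rule T_induct[OF x(1)])
  show "\<zero>.T \<in> {x \<in> carrier T. os (flr {p} x) \<in> part p}"
  using lin_zero[OF TA.mod TA.mod flat_restr_lin] os_zero subD(2)[OF part_sub] by simp
 next
  fix f g assume "f \<in> {x \<in> carrier T. os (flr {p} x) \<in> part p}" "g \<in> {x \<in> carrier T. os (flr {p} x) \<in> part p}"
  hence *: "f .: T" "g .: T" "os (flr {p} f) \<in> part p" "os (flr {p} g) \<in> part p" by auto
  have "os (flr {p} (f \<oplus>.T g)) = os (flr {p} f) \<oplus>.A os (flr {p} g)"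
  unfolding linD(2)[OF flat_restr_lin *(1,2)] by (rule os_add[OF frc[OF *(1)] frc[OF *(2)]])
  thus "f \<oplus>.T g \<in> {x \<in> carrier T. os (flr {p} x) \<in> part p}"
  using * subD(3)[OF part_sub *(3,4)] by simp
 next
  fix a u assume a: "a .: R" and u: "u \<in> lists X"
  have uc: "mono u .: T" using u by simp
  have "os (flr {p} (mono u)) \<in> part p"
  using mono_in_part[OF u] subD(2)[OF part_sub] os_zero by (auto simp: flat_restr_mono simp del: part_closed)
  moreover have "os (flr {p} (a \<odot>.T mono u)) = a \<odot>.A os (flr {p} (mono u))"
  unfolding linD(3)[OF flat_restr_lin a uc] by (rule os_smult[OF a frc[OF uc]])
  ultimately show "a \<odot>.T mono u \<in> {x \<in> carrier T. os (flr {p} x) \<in> part p}"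
  using a uc subD(4)[OF part_sub a] by simp
 qed
 thus ?thesis using x by (simp add: proj_os)
qed

lemma sum_proj:
 assumes "y .: A"
 shows "(\<Oplus>.A p\<in>carrier L. proj p y) = y"
proof -
 obtain x where x: "x .: T" "y = os x" using os_rep[OF assms] by blast
 have "(\<Oplus>.A p\<in>carrier L. proj p y) = (\<Oplus>.A p\<in>carrier L. os (flr {p} x))"
  using x by (simp add: proj_os)
 also have "... = os (\<Oplus>.T p\<in>carrier L. flr {p} x)"
  by (rule lin_finsum[OF TA.mod A.mod os_lin finite_carrier, symmetric]) (use x frc in auto)
 also have "(\<Oplus>.T p\<in>carrier L. flr {p} x) = x"
 proof
  fix w
  have "(\<Oplus>.T p\<in>carrier L. flr {p} x) w = (\<Oplus>p\<in>carrier L. flr {p} x w)"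
  by (subst T_finsum[OF finite_carrier]) (use frc[OF x(1)] in "auto simp: T_simps(1)")
  also have "... = x w"
  proof (cases "w \<in> lists X")
  case True
  have "(\<Oplus>p\<in>carrier L. flr {p} x w) = (\<Oplus>p\<in>carrier L. if flat w = p then x w else \<zero>)"
  by (rule finsum_cong') (use T_val[OF x(1)] in "auto simp: flr_def restr_def")
  also have "... = x w"
  by (rule finsum_singleton[OF flat_in[OF True] finite_carrier]) (use T_val[OF x(1)] in auto)
  finally show ?thesis .
  next
  case False
  hence "x w = \<zero>" using fsuppD(3,4)[OF x(1)[unfolded T_simps(1)]] by blast
  hence "flr {p} x w = \<zero>" for p by (simp add: flr_def restr_def)
  thus ?thesis using \<open>x w = \<zero>\<close> finsum_zero by simp
  qed
  finally show "(\<Oplus>.T p\<in>carrier L. flr {p} x) w = x w" .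
 qed
 finally show ?thesis using x by simp
qed

lemma proj_other: "x \<in> part p ==> p ~= q ==> proj q x = \<zero>.A"
 using proj_proj[of x q p] proj_part[of x p] by auto

text \<open>The projections of \<open>x\<close> are one decomposition of it; applying
  \<open>proj s\<close> to any other decomposition isolates the entry at \<open>s\<close>. So the
  description in \<open>OS_component\<close> has a unique solution.\<close>

lemma component_eq:
 assumes "q .: L" "x .: A"
 shows "OS_component R L r q x = proj q x"
proof -
 let ?P = "%y. y \<in> (\<Pi>\<^sub>E p\<in>carrier L. part p) & x = (\<Oplus>.A p\<in>carrier L. y p)"
 let ?y = "restrict (%p. proj p x) (carrier L)"
 have "(\<Oplus>.A p\<in>carrier L. ?y p) = (\<Oplus>.A p\<in>carrier L. proj p x)"
  by (rule A.M.finsum_cong') (use assms in auto)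
 hence ex: "?P ?y" using sum_proj[OF assms(2)] proj_in_part[OF assms(2)] by simp
 have "(THE y. ?P y) = ?y"
 proof (rule the_equality[of ?P, OF ex])
  fix y assume y: "?P y"
  hence yp: "y p \<in> part p" if "p .: L" for p using that by auto
  have ypc: "y p .: A" if "p .: L" for p by (rule part_closed[OF yp[OF that]])
  show "y = ?y"
  proof
  fix s
  show "y s = ?y s"
  proof (cases "s .: L")
  case False
  thus ?thesis using PiE_arb[of y "carrier L" part s] y by simp
  next
  case True
  have "proj s x = proj s (\<Oplus>.A p\<in>carrier L. y p)" using y by simp
  also have "... = (\<Oplus>.A p\<in>carrier L. proj s (y p))"
  by (rule lin_finsum[OF A.mod A.mod proj_lin finite_carrier]) (use yp part_closed in blast)
  also have "... = (\<Oplus>.A p\<in>carrier L. if s = p then y p else \<zero>.A)"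
  proof (rule A.M.finsum_cong')
  show "(%p. if s = p then y p else \<zero>.A) \<in> carrier L \<rightarrow> carrier A" using ypc by simp
  show "proj s (y p) = (if s = p then y p else \<zero>.A)" if "p .: L" for p
  using proj_part[OF yp[OF that]] proj_other[OF yp[OF that], of s] by simp
  qed simp
  also have "... = y s"
  by (rule A.M.finsum_singleton[OF True finite_carrier]) (use ypc in blast)
  finally show ?thesis using True by simp
  qed
  qed
 qed
 thus ?thesis using assms(1) by (simp add: OS_component_def)
qed

lemma part_mult:
 assumes "x \<in> part p" "y \<in> part q"
 shows "x \<otimes>.A y \<in> part (p \<squnion>.L q)"
proof -
 have lm: "submodule {z \<in> carrier A. f z \<in> part s} R A" if f: "lin R A A f" for f s
  using linD[OF f] lin_zero[OF A.mod A.mod f] subD[OF part_sub[of s]]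
  by (intro A.subI') (simp_all add: subset_iff)
 have 1: "part q <= {y \<in> carrier A. os (mono w) \<otimes>.A y \<in> part (p \<squnion>.L q)}" if w: "w \<in> lists X" "flat w = p" for w
 proof (rule part_minimal[OF lm[OF A.lmul_lin]])
  show "os (mono w) .: A" using w by simp
  fix v assume v: "v \<in> lists X" "flat v = q"
  have "os (mono (w @ v)) \<in> part (p \<squnion>.L q)" using mono_in_part[of "w @ v"] flat_append[OF w(1) v(1)] v w by simp
  thus "os (mono v) \<in> {y \<in> carrier A. os (mono w) \<otimes>.A y \<in> part (p \<squnion>.L q)}"
  using v w os_mult[of "mono w" "mono v"] by (simp add: T_mult_mono)
 qed
 have "part p <= {x \<in> carrier A. x \<otimes>.A y \<in> part (p \<squnion>.L q)}"
 proof (rule part_minimal[OF lm[OF A.rmul_lin]])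
  show "y .: A" using assms by simp
  fix w assume w: "w \<in> lists X" "flat w = p"
  thus "os (mono w) \<in> {x \<in> carrier A. x \<otimes>.A y \<in> part (p \<squnion>.L q)}" using 1[OF w] assms(2) by auto
 qed
 thus ?thesis using assms(1) by blast
qed

text \<open>If the ranks do not add up, concatenating words of lengths \<open>r p\<close> and
  \<open>r q\<close> yields a word longer than the rank of its flat, whose monomial vanishes. Signs
  depending on the rank of a join are computed with this.\<close>

lemma part_mult_zero:
 assumes "x \<in> part p" "y \<in> part q" "r (p \<squnion>.L q) ~= r p + r q"
 shows "x \<otimes>.A y = \<zero>.A"
proof -
 have yc: "y .: A" using assms by simp
 show ?thesis
 proof (rule part_linear_eqI[OF A.mod A.rmul_lin[OF yc] A.lin_const_zero _ assms(1)])
  fix w assume w: "w \<in> lists X" "flat w = p" "length w = r p"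
  hence wc: "os (mono w) .: A" by simp
  show "os (mono w) \<otimes>.A y = \<zero>.A"
  proof (rule part_linear_eqI[OF A.mod A.lmul_lin[OF wc] A.lin_const_zero _ assms(2)])
  fix v assume v: "v \<in> lists X" "flat v = q" "length v = r q"
  have f: "flat (w @ v) = p \<squnion>.L q" using flat_append[OF w(1) v(1)] w v by simp
  have wv: "w @ v \<in> lists X" using v w by simp
  have "r (flat (w @ v)) < length (w @ v)" using rank_flat[OF wv] f w v assms(3) by simp
  hence "os (mono (w @ v)) = \<zero>.A" using os_mono_dependent[OF wv] by blast
  thus "os (mono w) \<otimes>.A os (mono v) = \<zero>.A"
  using v w os_mult[of "mono w" "mono v"] by (simp add: T_mult_mono)
  qed
 qed
qed

lemma one_in_part: "\<one>.A \<in> part \<bottom>.L"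
 using mono_in_part[of "[]"] os_one by (simp add: flat_Nil T_one)

text \<open>A face of a word of length \<open>r p\<close> has length \<open>r p - 1\<close>. It is
  nonzero only if this is also the rank of its flat, which is then covered by
  \<open>p\<close>.\<close>

lemma d_part:
 assumes "p .: L" "x \<in> part p" "~  covers L p q"
 shows "proj q (dif A x) = \<zero>.A"
proof (rule part_linear_eqI[OF A.mod lin_comp[OF A.d_lin proj_lin] A.lin_const_zero _ assms(2)])
 fix w assume w: "w \<in> lists X" "flat w = p" "length w = r p"
 let ?g = "%j. sg R (int j) \<odot>.T mono (take j w @ drop (Suc j) w)"
 have g: "?g j .: T" for j using face_in[OF w(1)] by simp
 have "dif A (os (mono w)) = os (\<Oplus>.T j\<in>{..<length w}. ?g j)"
  using os_d[OF mono_in[OF w(1)]] T_d_mono[OF w(1)] face_sum_eq[OF w(1)] by simp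
 also have "proj q ... = (\<Oplus>.A j\<in>{..<length w}. proj q (os (?g j)))"
  by (rule lin_finsum[OF TA.mod A.mod lin_comp[OF os_lin proj_lin]]) (use g in auto)
 also have "... \<in> {\<zero>.A}"
 proof (rule A.submodule_finsum)
  show "submodule {\<zero>.A} R A" by (rule A.subI') auto
  fix j assume "j \<in> {..<length w}"
  hence j: "j < length w" by simp
  let ?u = "take j w @ drop (Suc j) w"
  have u: "?u \<in> lists X" "os (mono ?u) .: A" using face_in[OF w(1)] by auto
  have lu: "length ?u = length w - 1" using j by auto
  have "proj q (os (mono ?u)) = \<zero>.A"
  proof (cases "flat ?u = q & ~  r (flat ?u) < length ?u")
  case False thus ?thesis using os_mono_dependent[OF u(1)] by (auto simp: proj_mono[OF u(1)])
  next
  case True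
  have sub: "set ?u <= set w" by (auto dest: in_set_takeD in_set_dropD)
  have wc: "set w <= carrier L" using w(1) atoms_subset by auto
  have le: "flat ?u \<sqsubseteq>.L flat w" unfolding flat_def
  by (rule sup_least) (use sub wc sup_in sup_upper[OF wc] in auto)
  have "r p = Suc (r q)" using True rank_flat[OF u(1)] lu w(3) j by auto
  hence "covers L p q" using coversI[OF assms(1) flat_in[OF u(1)]] le w(2) True by blast
  thus ?thesis using assms(3) by blast
  qed
  hence "proj q (os (?g j)) = \<zero>.A"
  using os_smult[OF sg_closed mono_in[OF u(1)]] linD(3)[OF proj_lin sg_closed u(2)] by simp
  thus "proj q (os (?g j)) \<in> {\<zero>.A}" by simp
 qed simp
 finally show "proj q (dif A (os (mono w))) = \<zero>.A" by simp
qed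

lemma leibniz_A:
 assumes "x \<in> part p" "y .: A"
 shows "dif A (x \<otimes>.A y) = dif A x \<otimes>.A y \<oplus>.A sg R (int (r p)) \<odot>.A (x \<otimes>.A dif A y)"
proof (rule part_linear_eqI[OF A.mod _ _ _ assms(1)])
 show "lin R A A (%x. dif A (x \<otimes>.A y))"
  by (rule lin_comp[OF A.rmul_lin[OF assms(2)] A.d_lin])
 show "lin R A A (%x. dif A x \<otimes>.A y \<oplus>.A sg R (int (r p)) \<odot>.A (x \<otimes>.A dif A y))"
  by (intro A.lin_sum lin_comp[OF A.d_lin A.rmul_lin[OF assms(2)]] A.lin_smult A.rmul_lin) (use assms in auto)
 fix w assume w: "w \<in> lists X" "length w = r p"
 obtain y' where y: "y' .: T" "y = os y'" using os_rep[OF assms(2)] by blast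
 have m: "mono w .: T" using w by simp
 have s: "sign_op (mono w) \<otimes>.T dif T y' = sg R (int (r p)) \<odot>.T (mono w \<otimes>.T dif T y')"
  using m y TA.smult_mult_l[OF sg_closed m] by (simp add: sign_op_mono w(2))
 have c: "mono w \<otimes>.T y' .: T" "dif T (mono w) \<otimes>.T y' .: T" "mono w \<otimes>.T dif T y' .: T"
  "sg R (int (r p)) \<odot>.T (mono w \<otimes>.T dif T y') .: T" using m y by auto
 have "os (dif T (mono w \<otimes>.T y')) = os (dif T (mono w) \<otimes>.T y') \<oplus>.A sg R (int (r p)) \<odot>.A os (mono w \<otimes>.T dif T y')"
  unfolding leibniz_T[OF m y(1)] s os_add[OF c(2,4)] os_smult[OF sg_closed c(3)] ..
 thus "dif A (os (mono w) \<otimes>.A y) = dif A (os (mono w)) \<otimes>.A y \<oplus>.A sg R (int (r p)) \<odot>.A (os (mono w) \<otimes>.A dif A y)"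
  using m y c by (simp add: os_mult os_d)
qed

lemma d_d_A: "x .: A ==> dif A (dif A x) = \<zero>.A"
proof -
 assume "x .: A"
 then obtain x' where x: "x' .: T" "x = os x'" using os_rep by blast
 thus ?thesis using os_d[of x'] os_d[of "dif T x'"] d_d_T[OF x(1)] os_zero by simp
qed

definition atom_elt :: "'p => ('p list => 'r) set set" where
 "atom_elt a = os (mono [a])"

lemma atom_elt_part: "a \<in> X ==> atom_elt a \<in> part a"
 using mono_in_part[of "[a]"] by (simp add: atom_elt_def flat_letter)

lemma d_atom_mult:
 assumes "a \<in> X" "x .: A"
 shows "dif A (atom_elt a \<otimes>.A x) = x \<ominus>.A atom_elt a \<otimes>.A dif A x"
proof -
 obtain y where y: "y .: T" "x = os y" using os_rep[OF assms(2)] by blast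
 have a: "mono [a] .: T" using assms by simp
 have "os (dif T (mono [a] \<otimes>.T y)) = os y \<ominus>.A os (mono [a] \<otimes>.T dif T y)"
  unfolding d_letter[OF assms(1) y(1)] using a y by (intro os_minus) auto
 thus ?thesis using a y by (simp add: os_d os_mult atom_elt_def)
qed

lemma atom_mult_zero:
 assumes "a \<in> X" "p .: L" "a \<sqsubseteq>.L p" "x \<in> part p"
 shows "atom_elt a \<otimes>.A x = \<zero>.A"
proof (rule part_mult_zero[OF atom_elt_part[OF assms(1)] assms(4)])
 have "a \<squnion>.L p = p" using join_absorb assms atoms_subset by blast
 thus "r (a \<squnion>.L p) ~= r a + r p" using rank_atom[OF assms(1)] by simp
qed

section \<open>The augmentation of the OS-algebra\<close>

definition eps :: "('p list => 'r) set set => 'r" where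
 "eps y = inv_into (carrier T) os y []"

lemma T_mult_Nil:
 assumes "x .: T" "y .: T"
 shows "(x \<otimes>.T y) [] = x [] \<otimes> y []"
proof -
 note S = scal
 have ev: "lin R T (scal R) (%x. x [])"
  by (rule linI) (simp_all add: T_val scal_def T_simps(5,6))
 have 1: "(mono u \<otimes>.T y) [] = mono u [] \<otimes> y []" if u: "u \<in> lists X" for u
 proof (rule T_linear_eqI[OF S _ _ _ assms(2)])
  show "lin R T (scal R) (%y. (mono u \<otimes>.T y) [])"
  by (rule lin_comp[OF TA.lmul_lin ev]) (use u in simp)
  have "mono u [] .: R" by (simp add: basis_elt_def)
  thus "lin R T (scal R) (%y. mono u [] \<otimes> y [])"
  using module.lin_smult[OF S ev, of "mono u []"] by (simp add: scal_def)
  show "(mono u \<otimes>.T mono v) [] = mono u [] \<otimes> mono v []" if "v \<in> lists X" for v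
  using that u by (simp add: T_mult_mono) (simp add: basis_elt_def)
 qed
 show ?thesis
 proof (rule T_linear_eqI[OF S _ _ _ assms(1)])
  show "lin R T (scal R) (%x. (x \<otimes>.T y) [])"
  by (rule lin_comp[OF TA.rmul_lin[OF assms(2)] ev])
  show "lin R T (scal R) (%x. x [] \<otimes> y [])"
  using module.lin_smult[OF S ev T_val[OF assms(2)]] unfolding lin_def
  by (auto simp: scal_def T_val[OF assms(2)] m_comm T_val)
 qed (rule 1)
qed

lemma homog1_Nil: "v \<in> homog T 1 ==> v [] = \<zero>"
proof -
 assume "v \<in> homog T 1"
 hence "ALL w:support R v. int (length w) = 1" by (simp add: T_simps(7))
 hence "[] \<notin> support R v" by auto
 thus ?thesis by (simp add: support_def)
qed

text \<open>No relation has a constant term: a dependent word has at least two letters, because an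
  atom has positive rank, so all its faces are nonempty words. It makes \<open>eps\<close>
  independent of the representative.\<close>

lemma K_Nil: "x \<in> K ==> x [] = \<zero>"
proof -
 let ?H = "{x \<in> carrier T. x [] = \<zero>}"
 have "K <= ?H"
 proof (rule K_minimal)
  show "submodule ?H R T"
  proof (rule TA.subI')
  show "\<zero>.T \<in> ?H" using TA.M.zero_closed by (simp add: T_simps(4) del: TA.M.zero_closed)
  show "x \<oplus>.T y \<in> ?H" if "x \<in> ?H" "y \<in> ?H" for x y
  using that TA.M.a_closed[of x y] by (simp add: T_simps(5) del: TA.M.a_closed)
  show "a \<odot>.T x \<in> ?H" if "a .: R" "x \<in> ?H" for a x
  using that TA.smult_closed[of a x] by (simp add: T_simps(6) del: TA.smult_closed)
  qed auto
  show "x \<otimes>.T y \<in> ?H" "y \<otimes>.T x \<in> ?H" if "x .: T" "y \<in> ?H" for x y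
  using that by (simp_all add: T_mult_Nil T_val)
  show "v \<otimes>.T v \<in> ?H" if v: "v \<in> homog T 1" for v
  proof -
  have "v .: T" using v homog_T by blast
  thus ?thesis using homog1_Nil[OF v] by (simp add: T_mult_Nil)
  qed
  fix w assume w: "dependent w"
  have wl: "w \<in> lists X" by (rule dependent_lists[OF w])
  have "length w > 1"
  proof (rule ccontr)
  assume "~  1 < length w"
  then consider "w = []" | a where "w = [a]" by (cases w) auto
  thus False
  proof cases
  case 1 thus ?thesis using w by (simp add: dependent_def)
  next
  case 2
  hence "a \<in> X" using wl by simp
  thus ?thesis using w 2 rank_atom[of a] flat_letter[of a] by (simp add: dependent_def)
  qed
  qed
  hence "mono (take j w @ drop (Suc j) w) [] = \<zero>" if "j < length w" for j
  using that by (auto simp: basis_elt_def)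
  hence "(\<Oplus>j\<in>{..<length w}. sg R (int j) \<otimes> mono (take j w @ drop (Suc j) w) []) = (\<Oplus>j\<in>{..<length w}. \<zero>)"
  by (intro finsum_cong') auto
  hence "face_sum w [] = \<zero>" by (simp add: face_sum_def)
  thus "dif T (mono w) \<in> ?H" using wl T_d_mono[OF wl] TA.d_closed[OF mono_in[OF wl]] by simp
 qed
 thus "x \<in> K ==> x [] = \<zero>" by blast
qed

lemma eps_os:
 assumes "x .: T" shows "eps (os x) = x []"
proof -
 let ?x = "inv_into (carrier T) os (os x)"
 have x': "?x .: T" "os ?x = os x"
  using inv_into_into[of "os x" os "carrier T"] f_inv_into_f[of "os x" os "carrier T"] assms by simp_all
 hence k: "?x \<ominus>.T x \<in> K" using os_eq_iff[OF x'(1) assms] by simp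
 have "?x = (?x \<ominus>.T x) \<oplus>.T x" using x'(1) assms by (simp add: a_minus_def TA.M.a_assoc TA.M.l_neg)
 hence "?x [] = (?x \<ominus>.T x) [] \<oplus> x []" by (metis T_simps(5))
 thus ?thesis using K_Nil[OF k] T_val[OF assms] by (simp add: eps_def)
qed

lemma eps_closed [simp]: "y .: A ==> eps y .: R"
 using os_rep eps_os T_val by metis

lemma eps_lin: "lin R A (scal R) eps"
proof (rule linI)
 fix x assume "x .: A"
 then obtain x' where x: "x' .: T" "x = os x'" using os_rep by blast
 show "eps x .: (scal R)" using x T_val by (simp add: eps_os scal_def)
 show "eps (a \<odot>.A x) = a \<odot>\<^bsub>scal R\<^esub> eps x" if a: "a .: R" for a
 proof -
  have "eps (os (a \<odot>.T x')) = (a \<odot>.T x') []" using a x(1) by (intro eps_os) simp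
  thus ?thesis unfolding x(2) os_smult[OF a x(1)] eps_os[OF x(1)] by (simp add: scal_def T_simps(6))
 qed
 fix y assume "y .: A"
 then obtain y' where y: "y' .: T" "y = os y'" using os_rep by blast
 show "eps (x \<oplus>.A y) = eps x \<oplus>\<^bsub>scal R\<^esub> eps y"
 proof -
  have "eps (os (x' \<oplus>.T y')) = (x' \<oplus>.T y') []" using x(1) y(1) by (intro eps_os) simp
  thus ?thesis unfolding x(2) y(2) os_add[OF x(1) y(1)] eps_os[OF x(1)] eps_os[OF y(1)] by (simp add: scal_def T_simps(5))
 qed
qed

lemma eps_mult: "x .: A ==> y .: A ==> eps (x \<otimes>.A y) = eps x \<otimes> eps y"
proof -
 assume "x .: A" "y .: A"
 then obtain x' y' where *: "x' .: T" "x = os x'" "y' .: T" "y = os y'" using os_rep by metis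
 thus ?thesis using eps_os[of "x' \<otimes>.T y'"] by (simp add: os_mult eps_os T_mult_Nil)
qed

lemma eps_one: "eps \<one>.A = \<one>"
 using eps_os[OF mono_in[of "[]"]] os_one by (simp add: T_one) (simp add: basis_elt_def)

lemma eps_proj: "y .: A ==> eps (proj p y) = (if p = \<bottom>.L then eps y else \<zero>)"
proof -
 assume "y .: A"
 then obtain x where x: "x .: T" "y = os x" using os_rep by blast
 have "eps (os (flr {p} x)) = flr {p} x []" by (rule eps_os[OF frc[OF x(1)]])
 thus ?thesis unfolding x(2) proj_os[OF x(1)] eps_os[OF x(1)] by (simp add: flr_def restr_def flat_Nil)
qed

lemma eps_part: "x \<in> part p ==> p ~= \<bottom>.L ==> eps x = \<zero>"
 using eps_proj[of x p] proj_part[of x p] by simp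

lemma part_bottom: "x \<in> part \<bottom>.L ==> x = eps x \<odot>.A \<one>.A"
proof (rule part_linear_eqI[OF A.mod lin_id])
 show "lin R A A (%x. eps x \<odot>.A \<one>.A)"
  using linD[OF eps_lin] by (intro linI) (simp_all add: scal_def A.smult_l_distr A.smult_assoc1)
 fix w :: "'p list" assume "length w = r \<bottom>.L"
 hence "w = []" by (simp add: rank_bottom)
 hence 1: "os (mono w) = \<one>.A" using os_one by (simp add: T_one)
 show "os (mono w) = eps (os (mono w)) \<odot>.A \<one>.A" unfolding 1 eps_one by simp
qed

text \<open>A dual basis of \<open>part p\<close>: since \<open>x = e\<^sub>a (\<partial> x)\<close> for an atom \<open>a\<close> below \<open>p\<close>, the coordinates of \<open>x\<close> are
  read off from the components of \<open>\<partial> x\<close>.\<close>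

definition dual_basis :: "'p => (('p list => 'r) set set \<times> (('p list => 'r) set set => 'r)) list => bool" where
 "dual_basis p B <-> (ALL (b, f):set B. b \<in> part p & lin R A (scal R) f) &
  (ALL x:part p. x = lsum A (%(b, f). f x \<odot>.A b) B)"

lemma dual_basis_exists:
 assumes "p .: L"
 shows "EX B. dual_basis p B"
 using assms
proof (induction "r p" arbitrary: p rule: less_induct)
 case less
 show ?case
 proof (cases "p = \<bottom>.L")
  case True
  have "dual_basis p [(\<one>.A, eps)]"
  unfolding dual_basis_def True using one_in_part eps_lin
  by (simp add: A.M.r_zero) (use part_bottom in blast)
  thus ?thesis by blast
 next
  case False
  obtain S where S: "S <= X" "p = \<Squnion>.L S" using atomistic[OF less.prems] by blast
  have "S ~= {}" using S(2) False bottom_eq by metis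
  then obtain a where a: "a \<in> S" by blast
  hence aX: "a \<in> X" and ac: "a .: L" using S atoms_subset by auto
  have ap: "a \<sqsubseteq>.L p" using sup_upper[of S a] S a atoms_subset by auto
  define Q where "Q = {q. covers L p q}"
  have Qc: "Q <= carrier L" using coversD by (auto simp: Q_def)
  have finQ: "finite Q" by (rule finite_subset[OF Qc finite_carrier])
  then obtain qs where qs: "set qs = Q" "distinct qs" using finite_distinct_list by blast
  have "ALL q:Q. EX B. dual_basis q B"
  proof
  fix q assume "q \<in> Q"
  hence q: "covers L p q" by (simp add: Q_def)
  hence "q \<sqsubseteq>.L p" "q ~= p" "q .: L" by (auto simp: covers_def lless_def eq_L)
  thus "EX B. dual_basis q B" using less.hyps[OF rank_strict[of q p]] less.prems by simp
  qed
  then obtain Bf where Bf: "!!q. q \<in> Q ==> dual_basis q (Bf q)" unfolding bchoice_iff by blast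
  \<comment> \<open>The dual bases of the flats covered by \<open>p\<close>, multiplied by
    \<open>e_a\<close>, with the coordinates read from the components of
    \<open>\<partial> x\<close>. Entries may be zero (when \<open>a\<close> lies below the covered
    flat) or dependent; as in the dual basis lemma for projective modules, only the expansion of
    \<open>x\<close> is claimed.\<close>
  define B where "B = concat (map (%q. map (%(b, f). (atom_elt a \<otimes>.A b, %x. f (proj q (dif A x)))) (Bf q)) qs)"
  have ea: "atom_elt a .: A" using atom_elt_part[OF aX] by simp
  have Bfp: "b \<in> part q" "lin R A (scal R) f" if "q \<in> Q" "(b, f) \<in> set (Bf q)" for q b f
  using Bf[OF that(1)] that(2) by (auto simp: dual_basis_def)
  have mem: "atom_elt a \<otimes>.A b \<in> part p" if q: "q \<in> Q" and b: "b \<in> part q" for q b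
  proof -
  have qc: "q .: L" "q \<sqsubseteq>.L p" using q coversD[of p q] by (auto simp: Q_def)
  have up: "a \<squnion>.L q \<sqsubseteq>.L p" by (rule join_least[OF ac qc(1) less.prems ap qc(2)])
  have lo: "q \<sqsubseteq>.L a \<squnion>.L q" by (rule join_upper2[OF ac qc(1)])
  have "a \<squnion>.L q = q | a \<squnion>.L q = p"
  using q up lo join_in[OF ac qc(1)] by (auto simp: Q_def covers_def lless_def eq_L)
  thus ?thesis
  proof
  assume e: "a \<squnion>.L q = q"
  hence "a \<sqsubseteq>.L q" using join_upper1[OF ac qc(1)] by simp
  hence "atom_elt a \<otimes>.A b = \<zero>.A" by (rule atom_mult_zero[OF aX qc(1) _ b])
  thus ?thesis using subD(2)[OF part_sub] by simp
  next
  assume "a \<squnion>.L q = p"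
  thus ?thesis using part_mult[OF atom_elt_part[OF aX] b] by simp
  qed
  qed
  have 1: "b \<in> part p & lin R A (scal R) f" if "(b, f) \<in> set B" for b f
  proof -
  have "EX q b' f'. q \<in> Q & (b', f') \<in> set (Bf q) & b = atom_elt a \<otimes>.A b' & f = (%x. f' (proj q (dif A x)))"
  using that unfolding B_def by (force simp: qs(1))
  then obtain q b' f' where q: "q \<in> Q" "(b', f') \<in> set (Bf q)" "b = atom_elt a \<otimes>.A b'" "f = (%x. f' (proj q (dif A x)))" by blast
  show ?thesis unfolding q(3,4)
  using mem[OF q(1) Bfp(1)[OF q(1,2)]] lin_comp[OF lin_comp[OF A.d_lin proj_lin] Bfp(2)[OF q(1,2)]] by blast
  qed
  have 2: "x = lsum A (%(b, f). f x \<odot>.A b) B" if x: "x \<in> part p" for x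
  proof -
  have xc: "x .: A" using x by simp
  let ?y = "dif A x"
  have yc: "?y .: A" using xc by simp
  have fc: "f z .: R" if "q \<in> Q" "(b, f) \<in> set (Bf q)" "z .: A" for q b f z
  using linD(1)[OF Bfp(2)[OF that(1,2)] that(3)] by (simp add: scal_def)
  \<comment> \<open>As \<open>a\<close> lies below \<open>p\<close>, \<open>e_a x\<close> vanishes,
    and so does its differential \<open>x - e_a (\<partial> x)\<close>.\<close>
  have "x = atom_elt a \<otimes>.A ?y"
  proof -
  have "x \<ominus>.A atom_elt a \<otimes>.A ?y = \<zero>.A"
  using d_atom_mult[OF aX xc] atom_mult_zero[OF aX less.prems ap x] by simp
  hence "(x \<ominus>.A atom_elt a \<otimes>.A ?y) \<oplus>.A atom_elt a \<otimes>.A ?y = atom_elt a \<otimes>.A ?y" using ea yc by simp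
  thus ?thesis using ea yc xc by (simp add: a_minus_def A.M.a_assoc A.M.l_neg)
  qed
  also have "?y = (\<Oplus>.A q\<in>carrier L. proj q ?y)" using sum_proj[OF yc] by simp
  also have "... = (\<Oplus>.A q\<in>Q. proj q ?y)"
  by (rule A.M.add.finprod_mono_neutral_cong_right[OF finite_carrier Qc])
  (use d_part[OF less.prems x] yc in "auto simp: Q_def")
  also have "... = lsum A (%q. proj q ?y) qs"
  using A.lsum_finsum[OF qs(2), of "%q. proj q ?y"] yc by (simp add: qs(1))
  also have "atom_elt a \<otimes>.A ... = lsum A (%q. atom_elt a \<otimes>.A proj q ?y) qs"
  using lin_lsum[OF A.mod A.mod A.lmul_lin[OF ea], of qs "%q. proj q ?y"] yc by simp
  also have "... = lsum A (%q. lsum A (%(b, f). f (proj q ?y) \<odot>.A (atom_elt a \<otimes>.A b)) (Bf q)) qs"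
  proof (rule lsum_cong)
  fix q assume "q \<in> set qs"
  hence q: "q \<in> Q" by (simp add: qs)
  let ?z = "proj q ?y"
  have z: "?z \<in> part q" by (rule proj_in_part[OF yc])
  hence zc: "?z .: A" by simp
  have "?z = lsum A (%(b, f). f ?z \<odot>.A b) (Bf q)" using Bf[OF q] z by (simp add: dual_basis_def)
  hence "atom_elt a \<otimes>.A ?z = atom_elt a \<otimes>.A lsum A (%(b, f). f ?z \<odot>.A b) (Bf q)" by simp
  also have "... = lsum A (%bf. atom_elt a \<otimes>.A (case bf of (b, f) => f ?z \<odot>.A b)) (Bf q)"
  proof (rule conjunct2[OF lin_lsum[OF A.mod A.mod A.lmul_lin[OF ea]]])
  fix bf assume "bf \<in> set (Bf q)"
  moreover obtain b f where e: "bf = (b, f)" by (cases bf)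
  ultimately have bf: "(b, f) \<in> set (Bf q)" by simp
  show "(case bf of (b, f) => f ?z \<odot>.A b) .: A"
  unfolding e prod.case by (rule A.smult_closed[OF fc[OF q bf zc] part_closed[OF Bfp(1)[OF q bf]]])
  qed
  also have "... = lsum A (%(b, f). f ?z \<odot>.A (atom_elt a \<otimes>.A b)) (Bf q)"
  proof (rule lsum_cong)
  fix bf assume bf: "bf \<in> set (Bf q)"
  obtain b f where e: "bf = (b, f)" by (cases bf)
  show "atom_elt a \<otimes>.A (case bf of (b, f) => f ?z \<odot>.A b) = (case bf of (b, f) => f ?z \<odot>.A (atom_elt a \<otimes>.A b))"
  unfolding e prod.case by (rule A.smult_mult_r[OF fc[OF q bf[unfolded e] zc] ea part_closed[OF Bfp(1)[OF q bf[unfolded e]]]])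
  qed
  finally show "atom_elt a \<otimes>.A ?z = lsum A (%(b, f). f ?z \<odot>.A (atom_elt a \<otimes>.A b)) (Bf q)" .
  qed
  also have "... = lsum A (%(b, f). f x \<odot>.A b) B"
  proof -
  have c: "(case bf of (b, f) => f x \<odot>.A b) .: A" if "bf \<in> set B" for bf
  proof -
  obtain b f where e: "bf = (b, f)" by (cases bf)
  have "b \<in> part p" "lin R A (scal R) f" using 1[of b f] that e by auto
  hence "b .: A" "f x .: R" using linD(1)[of R A "scal R" f x] xc by (auto simp: scal_def)
  thus ?thesis by (simp add: e)
  qed
  have "lsum A (%(b, f). f x \<odot>.A b) B = lsum A (%bs. lsum A (%(b, f). f x \<odot>.A b) bs)
  (map (%q. map (%(b, f). (atom_elt a \<otimes>.A b, %x. f (proj q (dif A x)))) (Bf q)) qs)"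
  unfolding B_def by (rule A.lsum_concat) (use c in "auto simp: B_def")
  also have "... = lsum A (%q. lsum A (%(b, f). f (proj q ?y) \<odot>.A (atom_elt a \<otimes>.A b)) (Bf q)) qs"
  unfolding lsum_map by (intro lsum_cong) (auto split: prod.splits)
  finally show ?thesis by simp
  qed
  finally show ?thesis .
  qed
  have "dual_basis p B" unfolding dual_basis_def using 1 2 by blast
  thus ?thesis by blast
 qed
qed

end

section \<open>The algebra \<open>A\<^sup>*(L, C)\<close>\<close>

context ranked_lattice begin

text \<open>Some atom lies below \<open>p\<close> but not below \<open>q\<close>. Its join with
  \<open>q\<close> must be \<open>p\<close>, as nothing lies strictly between, and joining a new
  atom raises the rank by exactly one.\<close>

lemma covers_rank:
 assumes "covers L p q" shows "r p = Suc (r q)"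
proof -
 have pq: "p .: L" "q .: L" "q \<sqsubseteq> p" "q ~= p"
  and no: "!!u. u .: L ==> q \<sqsubseteq> u ==> u \<sqsubseteq> p ==> u = q | u = p"
  using assms by (auto simp: covers_def lless_def eq_L)
 obtain S where S: "S <= lattice_atoms L" "p = \<Squnion>S" using atomistic[OF pq(1)] by blast
 have Sc: "S <= carrier L" using S(1) atoms_subset by blast
 have "EX a:S. ~  a \<sqsubseteq> q"
 proof (rule ccontr)
  assume "~  ?thesis"
  hence "p \<sqsubseteq> q" unfolding S(2) by (intro sup_least[OF Sc pq(2)]) blast
  thus False using le_antisym[OF pq(1,2)] pq(3,4) by blast
 qed
 then obtain a where a: "a \<in> S" "~  a \<sqsubseteq> q" by blast
 have aX: "a \<in> lattice_atoms L" "a .: L" using a(1) S(1) Sc by auto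
 have "q \<squnion> a \<sqsubseteq> p" by (rule join_least[OF pq(2) aX(2) pq(1,3)]) (use sup_upper[OF Sc a(1)] S(2) in simp)
 moreover have "q \<squnion> a ~= q" using join_upper2[OF pq(2) aX(2)] a(2) by auto
 ultimately have "q \<squnion> a = p" using no[OF join_in[OF pq(2) aX(2)] join_upper1[OF pq(2) aX(2)]] by blast
 thus ?thesis using rank_join_new_atom[OF pq(2) aX(1) a(2)] by simp
qed

lemma finite_covers: "finite {q. covers L p q}"
 by (rule finite_subset[OF _ finite_carrier]) (auto simp: covers_def)

end

text \<open>The last two assumptions say that \<open>C\<close> is the direct sum of its homogeneous
  parts. They are the bridge to the generators \<open>(p, k, x, c)\<close>, in which
  \<open>c\<close> has the fixed degree \<open>k\<close>.\<close>

locale coefficients = OS R L r + C: graded_dga R C gr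
 for R :: "('r, 'k) ring_scheme" (structure) and L :: "('p, 'n) gorder_scheme" and r :: "'p => nat"
  and C :: "('r, 'c) diff_algebra" and gr :: "(int => 'r) => 'c => 'c" +
 fixes D :: "'p => 'c set"
 assumes D_sub: "p .: L ==> submodule (D p) R C"
  and D_mono: "p .: L ==> q .: L ==> q \<sqsubseteq>.L p ==> D p <= D q"
  and D_mult: "p .: L ==> q .: L ==> c \<in> D p ==> d \<in> D q ==> c \<otimes>.C d \<in> D (p \<squnion>.L q)"
  and D_d: "p .: L ==> c \<in> D p ==> dif C c \<in> D p"
  and D_gr: "p .: L ==> c \<in> D p ==> th .> R ==> gr th c \<in> D p"
  and D_bottom: "D \<bottom>.L = carrier C"
  and homog_mult: "c \<in> homog C k ==> d \<in> homog C l ==> c \<otimes>.C d \<in> homog C (k + l)"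
  and homog_one: "\<one>.C \<in> homog C 0"
  and finite_degrees: "c .: C ==> finite {k. gr (%j. if j = k then \<one> else \<zero>) c ~= \<zero>.C}"
  and sum_degrees: "c .: C ==> (\<Oplus>.C k\<in>{k. gr (%j. if j = k then \<one> else \<zero>) c ~= \<zero>.C}. gr (%j. if j = k then \<one> else \<zero>) c) = c"
begin

abbreviation "pr k == gr (%j. if j = k then \<one> else \<zero>)"

lemma ind_in: "(%j. if j = k then \<one> else \<zero>) .> R"
 by auto

lemma D_closed: "p .: L ==> c \<in> D p ==> c .: C"
 using subD(1)[OF D_sub] by blast

lemma D_add: "p .: L ==> c \<in> D p ==> d \<in> D p ==> c \<oplus>.C d \<in> D p"
 by (rule subD(3)[OF D_sub])

lemma D_smult: "p .: L ==> a .: R ==> c \<in> D p ==> a \<odot>.C c \<in> D p"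
 by (rule subD(4)[OF D_sub])

lemma D_zero: "p .: L ==> \<zero>.C \<in> D p"
 by (rule subD(2)[OF D_sub])

lemma homog_iff: "c \<in> homog C k <-> c .: C & pr k c = c"
proof
 assume c: "c \<in> homog C k"
 hence "c .: C" using C.homog_subset by blast
 thus "c .: C & pr k c = c" using C.gr_homog[OF ind_in c] by simp
next
 assume "c .: C & pr k c = c"
 thus "c \<in> homog C k" using C.gr_indicator[of c k] by simp
qed

lemmas pr_lin = C.gr_lin[OF ind_in]

lemma pr_homog: "c .: C ==> pr k c \<in> homog C k"
 by (rule C.gr_indicator)

lemma pr_other: "c \<in> homog C k ==> j ~= k ==> pr j c = \<zero>.C"
 using C.gr_homog[OF ind_in] C.homog_subset by fastforce

lemma homog_add: "c \<in> homog C k ==> d \<in> homog C k ==> c \<oplus>.C d \<in> homog C k"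
 using linD(2)[OF pr_lin, of c d] by (simp add: homog_iff)

lemma homog_smult: "a .: R ==> c \<in> homog C k ==> a \<odot>.C c \<in> homog C k"
 using linD(3)[OF pr_lin, of a c] by (simp add: homog_iff)

lemma homog_d: "c \<in> homog C k ==> dif C c \<in> homog C (k + 1)"
proof -
 assume c: "c \<in> homog C k"
 hence cc: "c .: C" "pr k c = c" by (auto simp: homog_iff)
 have "dif C (pr k c) = gr (%j. if j - 1 = k then \<one> else \<zero>) (dif C c)"
  using C.d_gr[OF ind_in cc(1)] by simp
 moreover have "(%j. if j - 1 = k then \<one> else \<zero>) = (%j. if j = k + 1 then \<one> else \<zero>)" by auto
 ultimately show ?thesis using cc by (simp add: homog_iff)
qed

text \<open>The degree projections of \<open>c\<close> stay in \<open>D p\<close>, so additive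
  statements about \<open>c\<close> are reduced to the homogeneous case, where
  \<open>x \<otimes> c\<close> is a single generator.\<close>

lemma D_induct [consumes 2, case_names add homog]:
 assumes "p .: L" "c \<in> D p"
  and add: "!!c d. c \<in> D p ==> d \<in> D p ==> P c ==> P d ==> P (c \<oplus>.C d)"
  and homog: "!!c k. c \<in> D p ==> c \<in> homog C k ==> P c"
 shows "P c"
proof -
 have cc: "c .: C" by (rule D_closed[OF assms(1,2)])
 have z: "\<zero>.C \<in> D p" "\<zero>.C \<in> homog C 0"
  using D_zero[OF assms(1)] lin_zero[OF C.mod C.mod pr_lin] by (auto simp: homog_iff)
 have "(\<Oplus>.C k\<in>S. pr k c) \<in> D p & P (\<Oplus>.C k\<in>S. pr k c)" if "finite S" for S
  using that
 proof (induction S rule: finite_induct)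
  case empty show ?case using z homog[of "\<zero>.C" 0] by simp
 next
  case (insert k S)
  have k: "pr k c \<in> D p" "pr k c \<in> homog C k" using D_gr[OF assms(1,2) ind_in] pr_homog[OF cc] by auto
  have "(\<Oplus>.C k\<in>insert k S. pr k c) = pr k c \<oplus>.C (\<Oplus>.C k\<in>S. pr k c)"
  by (rule C.M.finsum_insert) (use insert.hyps linD(1)[OF pr_lin cc] in auto)
  moreover have "(\<Oplus>.C k\<in>S. pr k c) \<in> D p" "P (\<Oplus>.C k\<in>S. pr k c)" using insert.IH by auto
  ultimately show ?case using add[OF k(1) _ homog[OF k]] D_add[OF assms(1) k(1)] by simp
 qed
 from this[OF finite_degrees[OF cc]] show ?thesis using sum_degrees[OF cc] by simp
qed

abbreviation "G == tensor_generators R L r C D"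
abbreviation "F == tensor_free R L r C D"
abbreviation "N == tensor_relations R L r C D"
abbreviation "TT == OS_tensor R L r C D"
abbreviation "gen u == basis_elt R u"

definition gen_mult where
 "gen_mult = (%(p, k, x, c) (q, l, y, d) w. sg R (k * int (r q)) \<otimes> gen (p \<squnion>.L q, k + l, x \<otimes>.A y, c \<otimes>.C d) w)"

definition gen_deg :: "'p \<times> int \<times> ('p list => 'r) set set \<times> 'c => int" where
 "gen_deg = (%(p, k, x, c). k - int (r p))"

definition gen_d where
 "gen_d = (%(p, k, x, c) w. (\<Oplus>q\<in>{q. covers L p q}. gen (q, k, OS_component R L r q (dif A x), c) w)
  \<oplus> sg R (int (r p)) \<otimes> gen (p, k + 1, x, dif C c) w)"

lemma F_eq: "F = free_algebra R G (\<bottom>.L, 0, \<one>.A, \<one>.C) gen_mult gen_deg gen_d"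
 unfolding tensor_free_def Let_def gen_mult_def gen_deg_def gen_d_def ..

lemma G_iff: "(p, k, x, c) \<in> G <-> p .: L & x \<in> part p & c \<in> D p & c \<in> homog C k"
 by (auto simp: tensor_generators_def)

lemma G_mult:
 assumes "(p, k, x, c) \<in> G" "(q, l, y, d) \<in> G"
 shows "(p \<squnion>.L q, k + l, x \<otimes>.A y, c \<otimes>.C d) \<in> G"
 using assms join_in part_mult D_mult homog_mult by (simp add: G_iff)

lemma G_d:
 assumes "(p, k, x, c) \<in> G"
 shows "(p, k + 1, x, dif C c) \<in> G"
  and "covers L p q ==> (q, k, proj q (dif A x), c) \<in> G"
  and "covers L p q ==> OS_component R L r q (dif A x) = proj q (dif A x)"
proof -
 have a: "p .: L" "x \<in> part p" "c \<in> D p" "c \<in> homog C k" using assms by (auto simp: G_iff)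
 show "(p, k + 1, x, dif C c) \<in> G" using a D_d homog_d by (simp add: G_iff)
 have dx: "dif A x .: A" using a by simp
 {
  assume c: "covers L p q"
  hence q: "q .: L" "q \<sqsubseteq>.L p" by (auto simp: covers_def lless_def)
  show "(q, k, proj q (dif A x), c) \<in> G"
  using q a D_mono[OF a(1) q] proj_in_part[OF dx] by (auto simp: G_iff)
  show "OS_component R L r q (dif A x) = proj q (dif A x)"
  by (rule component_eq[OF q(1) dx])
 }
qed

sublocale FF: free_diff_alg R G "(\<bottom>.L, 0, \<one>.A, \<one>.C)" gen_mult gen_deg gen_d
proof
 show "(\<bottom>.L, 0, \<one>.A, \<one>.C) \<in> G" using bottom_in one_in_part D_bottom homog_one by (simp add: G_iff)
 fix u assume u: "u \<in> G"
 obtain p k x c where ue: "u = (p, k, x, c)" by (cases u)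
 show "gen_mult u v \<in> fsupp R G" if v: "v \<in> G" for v
 proof -
  obtain q l y d where ve: "v = (q, l, y, d)" by (cases v)
  show ?thesis unfolding ue ve gen_mult_def prod.case
  by (rule fsf_smult[OF basis_elt_in[OF G_mult[OF u[unfolded ue] v[unfolded ve]]]]) simp
 qed
 show "gen_d u \<in> fsupp R G"
  unfolding ue gen_d_def prod.case
 proof (rule fsf_add[OF fsf_finsum[OF finite_covers] fsf_smult[OF basis_elt_in]])
  fix q assume q: "q \<in> {q. covers L p q}"
  thus "gen (q, k, OS_component R L r q (dif A x), c) \<in> fsupp R G"
  using G_d(2,3)[OF u[unfolded ue]] by (intro basis_elt_in) auto
 qed (use G_d(1)[OF u[unfolded ue]] in auto)
qed

sublocale FA: diff_alg R F
 unfolding F_eq by (rule FF.free_diff_alg)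

lemmas F_simps = fa_simps[of R G "(\<bottom>.L, 0, \<one>.A, \<one>.C)" gen_mult gen_deg gen_d, folded F_eq]
lemmas Fgen_in [simp] = FF.basis_closed[folded F_eq]
lemmas F_mult_gen = FF.mult_basis[folded F_eq]
lemmas F_d_gen = FF.d_basis[folded F_eq]
lemmas F_linear_eqI = FF.lin_eqI[folded F_eq]
lemmas F_induct = FF.free_induct[folded F_eq]
lemmas F_free_lift = FF.linear_free_lift[folded F_eq]

lemma F_mult_gen':
 assumes "(p, k, x, c) \<in> G" "(q, l, y, d) \<in> G"
 shows "gen (p, k, x, c) \<otimes>.F gen (q, l, y, d) = sg R (k * int (r q)) \<odot>.F gen (p \<squnion>.L q, k + l, x \<otimes>.A y, c \<otimes>.C d)"
 unfolding F_mult_gen[OF assms] by (simp add: gen_mult_def F_simps)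

lemma F_d_gen':
 assumes "(p, k, x, c) \<in> G"
 shows "dif F (gen (p, k, x, c)) = (\<Oplus>.F q\<in>{q. covers L p q}. gen (q, k, proj q (dif A x), c))
  \<oplus>.F sg R (int (r p)) \<odot>.F gen (p, k + 1, x, dif C c)"
proof -
 have fs: "gen (q, k, proj q (dif A x), c) \<in> fsupp R G" if "q \<in> {q. covers L p q}" for q
  using that G_d(2)[OF assms] by (intro basis_elt_in) auto
 have 1: "(\<Oplus>.F q\<in>{q. covers L p q}. gen (q, k, proj q (dif A x), c)) =
  (%w. \<Oplus>q\<in>{q. covers L p q}. gen (q, k, proj q (dif A x), c) w)"
  by (rule FF.finsum_pointwise[folded F_eq, OF finite_covers fs])
 have "(\<Oplus>q\<in>{q. covers L p q}. gen (q, k, OS_component R L r q (dif A x), c) w) =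
  (\<Oplus>q\<in>{q. covers L p q}. gen (q, k, proj q (dif A x), c) w)" for w
  by (rule finsum_cong') (use fsuppD(1)[OF fs] G_d(3)[OF assms] in auto)
 thus ?thesis unfolding F_d_gen[OF assms] 1 by (simp add: gen_d_def F_simps)
qed

definition relators where
 "relators = {gen (p, k, x \<oplus>.A y, c) \<ominus>.F (gen (p, k, x, c) \<oplus>.F gen (p, k, y, c)) | p k x y c.
  (p, k, x, c) \<in> G & (p, k, y, c) \<in> G} \<union>
  {gen (p, k, x, c \<oplus>.C d) \<ominus>.F (gen (p, k, x, c) \<oplus>.F gen (p, k, x, d)) | p k x c d.
  (p, k, x, c) \<in> G & (p, k, x, d) \<in> G} \<union>
  {gen (p, k, a \<odot>.A x, c) \<ominus>.F a \<odot>.F gen (p, k, x, c) | a p k x c.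
  a .: R & (p, k, x, c) \<in> G} \<union>
  {gen (p, k, x, a \<odot>.C c) \<ominus>.F a \<odot>.F gen (p, k, x, c) | a p k x c.
  a .: R & (p, k, x, c) \<in> G}"

lemma N_eq: "N = module_span R F relators"
 unfolding tensor_relations_def Let_def relators_def ..

lemma G_add_left: "(p, k, x, c) \<in> G ==> (p, k, y, c) \<in> G ==> (p, k, x \<oplus>.A y, c) \<in> G"
 using subD(3)[OF part_sub] by (simp add: G_iff)

lemma G_add_right: "(p, k, x, c) \<in> G ==> (p, k, x, d) \<in> G ==> (p, k, x, c \<oplus>.C d) \<in> G"
 using D_add homog_add by (simp add: G_iff)

lemma G_smult_left: "a .: R ==> (p, k, x, c) \<in> G ==> (p, k, a \<odot>.A x, c) \<in> G"
 using subD(4)[OF part_sub] by (simp add: G_iff)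

lemma G_smult_right: "a .: R ==> (p, k, x, c) \<in> G ==> (p, k, x, a \<odot>.C c) \<in> G"
 using D_smult homog_smult by (simp add: G_iff)

lemma relators_subset: "relators <= carrier F"
 unfolding relators_def using G_add_left G_add_right G_smult_left G_smult_right by auto

lemma N_sub: "submodule N R F"
 unfolding N_eq by (rule module_span_sub(1)[OF FA.mod relators_subset])

lemma N_relators: "relators <= N"
 unfolding N_eq by (rule module_span_sub(2)[OF FA.mod relators_subset])

section \<open>Balanced maps and the ideal of tensor relations\<close>

definition balanced :: "('r, 'b, 'e) module_scheme => ('p \<times> int \<times> ('p list => 'r) set set \<times> 'c => 'b) => bool" where
 "balanced V \<phi> <-> (ALL u:G. \<phi> u .: V) &
  (ALL p k x y c. (p, k, x, c) \<in> G --> (p, k, y, c) \<in> G --> \<phi> (p, k, x \<oplus>.A y, c) = \<phi> (p, k, x, c) \<oplus>.V \<phi> (p, k, y, c)) &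
  (ALL p k x c d. (p, k, x, c) \<in> G --> (p, k, x, d) \<in> G --> \<phi> (p, k, x, c \<oplus>.C d) = \<phi> (p, k, x, c) \<oplus>.V \<phi> (p, k, x, d)) &
  (ALL a:carrier R. ALL p k x c. (p, k, x, c) \<in> G --> \<phi> (p, k, a \<odot>.A x, c) = a \<odot>.V \<phi> (p, k, x, c)) &
  (ALL a:carrier R. ALL p k x c. (p, k, x, c) \<in> G --> \<phi> (p, k, x, a \<odot>.C c) = a \<odot>.V \<phi> (p, k, x, c))"

lemma balancedI:
 assumes "!!p k x c. (p, k, x, c) \<in> G ==> \<phi> (p, k, x, c) .: V"
  "!!p k x y c. (p, k, x, c) \<in> G ==> (p, k, y, c) \<in> G ==> \<phi> (p, k, x \<oplus>.A y, c) = \<phi> (p, k, x, c) \<oplus>.V \<phi> (p, k, y, c)"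
  "!!p k x c d. (p, k, x, c) \<in> G ==> (p, k, x, d) \<in> G ==> \<phi> (p, k, x, c \<oplus>.C d) = \<phi> (p, k, x, c) \<oplus>.V \<phi> (p, k, x, d)"
  "!!a p k x c. a .: R ==> (p, k, x, c) \<in> G ==> \<phi> (p, k, a \<odot>.A x, c) = a \<odot>.V \<phi> (p, k, x, c)"
  "!!a p k x c. a .: R ==> (p, k, x, c) \<in> G ==> \<phi> (p, k, x, a \<odot>.C c) = a \<odot>.V \<phi> (p, k, x, c)"
 shows "balanced V \<phi>"
 unfolding balanced_def using assms(2-5) assms(1) by (intro conjI allI ballI impI) auto

lemma balancedD:
 assumes "balanced V \<phi>"
 shows "u \<in> G ==> \<phi> u .: V"
  "(p, k, x, c) \<in> G ==> (p, k, y, c) \<in> G ==> \<phi> (p, k, x \<oplus>.A y, c) = \<phi> (p, k, x, c) \<oplus>.V \<phi> (p, k, y, c)"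
  "(p, k, x, c) \<in> G ==> (p, k, x, d) \<in> G ==> \<phi> (p, k, x, c \<oplus>.C d) = \<phi> (p, k, x, c) \<oplus>.V \<phi> (p, k, x, d)"
  "a .: R ==> (p, k, x, c) \<in> G ==> \<phi> (p, k, a \<odot>.A x, c) = a \<odot>.V \<phi> (p, k, x, c)"
  "a .: R ==> (p, k, x, c) \<in> G ==> \<phi> (p, k, x, a \<odot>.C c) = a \<odot>.V \<phi> (p, k, x, c)"
 using assms unfolding balanced_def by simp_all

lemma balanced_kills_N:
 assumes V: "module R V" and lin: "lin R F V \<phi>" and bal: "balanced V (%u. \<phi> (gen u))" and f: "f \<in> N"
 shows "\<phi> f = \<zero>.V"
proof -
 interpret V: module R V by fact
 note l = linD[OF lin] and b = balancedD[OF bal]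
 note lm = lin_minus[OF FA.mod V lin]
 have sub: "submodule {f \<in> carrier F. \<phi> f = \<zero>.V} R F"
  using l lin_zero[OF FA.mod V lin] by (intro FA.subI') (simp_all add: subset_iff)
 have "relators <= {f \<in> carrier F. \<phi> f = \<zero>.V}"
 proof
  fix g assume g: "g \<in> relators"
  hence gc: "g .: F" using relators_subset by blast
  from g consider
  p k x y c where "g = gen (p, k, x \<oplus>.A y, c) \<ominus>.F (gen (p, k, x, c) \<oplus>.F gen (p, k, y, c))" "(p, k, x, c) \<in> G" "(p, k, y, c) \<in> G"
  | p k x c d where "g = gen (p, k, x, c \<oplus>.C d) \<ominus>.F (gen (p, k, x, c) \<oplus>.F gen (p, k, x, d))" "(p, k, x, c) \<in> G" "(p, k, x, d) \<in> G"
  | a p k x c where "g = gen (p, k, a \<odot>.A x, c) \<ominus>.F a \<odot>.F gen (p, k, x, c)" "a .: R" "(p, k, x, c) \<in> G"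
  | a p k x c where "g = gen (p, k, x, a \<odot>.C c) \<ominus>.F a \<odot>.F gen (p, k, x, c)" "a .: R" "(p, k, x, c) \<in> G"
  unfolding relators_def by blast
  hence "\<phi> g = \<zero>.V"
  proof cases
  case 1
  note m = G_add_left[OF 1(2,3)]
  have "\<phi> g = \<phi> (gen (p, k, x \<oplus>.A y, c)) \<ominus>.V (\<phi> (gen (p, k, x, c)) \<oplus>.V \<phi> (gen (p, k, y, c)))"
  unfolding 1(1) using lm[OF Fgen_in[OF m], of "gen (p, k, x, c) \<oplus>.F gen (p, k, y, c)"]
  l(2)[OF Fgen_in[OF 1(2)] Fgen_in[OF 1(3)]] 1 by simp
  also have "... = \<zero>.V" unfolding b(2)[OF 1(2,3)] using b(1)[OF 1(2)] b(1)[OF 1(3)] by (simp add: a_minus_def V.M.r_neg)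
  finally show ?thesis .
  next
  case 2
  note m = G_add_right[OF 2(2,3)]
  have "\<phi> g = \<phi> (gen (p, k, x, c \<oplus>.C d)) \<ominus>.V (\<phi> (gen (p, k, x, c)) \<oplus>.V \<phi> (gen (p, k, x, d)))"
  unfolding 2(1) using lm[OF Fgen_in[OF m], of "gen (p, k, x, c) \<oplus>.F gen (p, k, x, d)"]
  l(2)[OF Fgen_in[OF 2(2)] Fgen_in[OF 2(3)]] 2 by simp
  also have "... = \<zero>.V" unfolding b(3)[OF 2(2,3)] using b(1)[OF 2(2)] b(1)[OF 2(3)] by (simp add: a_minus_def V.M.r_neg)
  finally show ?thesis .
  next
  case 3
  note m = G_smult_left[OF 3(2,3)]
  have "\<phi> g = \<phi> (gen (p, k, a \<odot>.A x, c)) \<ominus>.V a \<odot>.V \<phi> (gen (p, k, x, c))"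
  unfolding 3(1) using lm[OF Fgen_in[OF m], of "a \<odot>.F gen (p, k, x, c)"] l(3)[OF 3(2) Fgen_in[OF 3(3)]] 3 by simp
  also have "... = \<zero>.V" unfolding b(4)[OF 3(2,3)] using b(1)[OF 3(3)] 3(2) by (simp add: a_minus_def V.M.r_neg)
  finally show ?thesis .
  next
  case 4
  note m = G_smult_right[OF 4(2,3)]
  have "\<phi> g = \<phi> (gen (p, k, x, a \<odot>.C c)) \<ominus>.V a \<odot>.V \<phi> (gen (p, k, x, c))"
  unfolding 4(1) using lm[OF Fgen_in[OF m], of "a \<odot>.F gen (p, k, x, c)"] l(3)[OF 4(2) Fgen_in[OF 4(3)]] 4 by simp
  also have "... = \<zero>.V" unfolding b(5)[OF 4(2,3)] using b(1)[OF 4(3)] 4(2) by (simp add: a_minus_def V.M.r_neg)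
  finally show ?thesis .
  qed
  thus "g \<in> {f \<in> carrier F. \<phi> f = \<zero>.V}" using gc by simp
 qed
 hence "N <= {f \<in> carrier F. \<phi> f = \<zero>.V}" unfolding N_eq by (rule module_span_minimal[OF sub])
 thus ?thesis using f by blast
qed

abbreviation "qN f == N +>.F f"

definition sym where "sym u = qN (gen u)"

lemma TT_module: "module R TT"
 unfolding OS_tensor_def by (rule quotient_module[OF FA.mod N_sub])

lemma TT_carrier: "carrier TT = qN ` carrier F"
 unfolding OS_tensor_def by (rule qalg_simps)

lemma TT_zero: "\<zero>.TT = N"
 unfolding OS_tensor_def by (rule qalg_simps)

lemma qN_lin: "lin R F TT qN"
proof (rule linI)
 show "qN x .: TT" if "x .: F" for x using that TT_carrier by blast
 show "qN (x \<oplus>.F y) = qN x \<oplus>.TT qN y" if "x .: F" "y .: F" for x y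
  unfolding OS_tensor_def by (rule quotient_add[OF FA.mod N_sub that, symmetric])
 show "qN (a \<odot>.F x) = a \<odot>.TT qN x" if "a .: R" "x .: F" for a x
  unfolding OS_tensor_def by (rule quotient_smult[OF FA.mod N_sub that, symmetric])
qed

lemma qN_zero_iff: "f .: F ==> qN f = \<zero>.TT <-> f \<in> N"
 unfolding TT_zero by (rule FA.coset_eq_zero_iff[OF N_sub])

lemma balanced_sym: "balanced TT sym"
proof -
 interpret V: module R TT by (rule TT_module)
 note q = linD[OF qN_lin]
 have eqI: "qN f = qN g" if "f .: F" "g .: F" "f \<ominus>.F g \<in> relators" for f g
  using that FA.cos_iff[OF N_sub that(1,2)] N_relators by blast
 show ?thesis
 proof (rule balancedI, unfold sym_def, goal_cases)
  case (1 p k x c) thus ?case by (intro q(1) Fgen_in)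
 next
  case (2 p k x y c)
  show ?case unfolding q(2)[OF Fgen_in[OF 2(1)] Fgen_in[OF 2(2)], symmetric]
  by (rule eqI) (use 2 G_add_left[OF 2] in "simp_all, unfold relators_def, blast")
 next
  case (3 p k x c d)
  show ?case unfolding q(2)[OF Fgen_in[OF 3(1)] Fgen_in[OF 3(2)], symmetric]
  by (rule eqI) (use 3 G_add_right[OF 3] in "simp_all, unfold relators_def, blast")
 next
  case (4 a p k x c)
  show ?case unfolding q(3)[OF 4(1) Fgen_in[OF 4(2)], symmetric]
  by (rule eqI) (use 4 G_smult_left[OF 4] in "simp_all, unfold relators_def, blast")
 next
  case (5 a p k x c)
  show ?case unfolding q(3)[OF 5(1) Fgen_in[OF 5(2)], symmetric]
  by (rule eqI) (use 5 G_smult_right[OF 5] in "simp_all, unfold relators_def, blast")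
 qed
qed

lemmas sym_props = balancedD[OF balanced_sym]

lemma qN_gen_mult:
 assumes "(p, k, x, c) \<in> G" "(q, l, y, d) \<in> G"
 shows "qN (gen (p, k, x, c) \<otimes>.F gen (q, l, y, d)) = sg R (k * int (r q)) \<odot>.TT sym (p \<squnion>.L q, k + l, x \<otimes>.A y, c \<otimes>.C d)"
 unfolding F_mult_gen'[OF assms] sym_def
 by (rule linD(3)[OF qN_lin sg_closed Fgen_in[OF G_mult[OF assms]]])

text \<open>For a single generator on the left, multiplication followed by the quotient map is
  balanced and hence kills \<open>N\<close>: the sign depends only on the labels \<open>k\<close>
  and \<open>q\<close>, which all relators keep fixed.\<close>

lemma N_mult_l:
 assumes "g .: F" "f \<in> N"
 shows "g \<otimes>.F f \<in> N"
proof -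
 interpret V: module R TT by (rule TT_module)
 have fc: "f .: F" using assms(2) subD(1)[OF N_sub] by blast
 have base: "gen u \<otimes>.F f \<in> N" if u: "u \<in> G" for u
 proof -
  obtain p k x c where ue: "u = (p, k, x, c)" by (cases u)
  have uG: "(p, k, x, c) \<in> G" using u ue by simp
  have ac: "x .: A" "c .: C" using uG D_closed by (auto simp: G_iff)
  have yc: "y .: A" "d .: C" if "(q, l, y, d) \<in> G" for q l y d using that D_closed by (auto simp: G_iff)
  have lin: "lin R F TT (%f. qN (gen u \<otimes>.F f))"
  by (rule lin_comp[OF FA.lmul_lin qN_lin]) (use u in simp)
  have "balanced TT (%v. qN (gen u \<otimes>.F gen v))" unfolding ue
  proof (rule balancedI, goal_cases)
  case (1 q l y d)
  thus ?case using linD(1)[OF lin] ue by simp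
  next
  case (2 q l y z d)
  note m = G_mult[OF uG 2(1)] G_mult[OF uG 2(2)]
  show ?case unfolding qN_gen_mult[OF uG 2(1)] qN_gen_mult[OF uG 2(2)] qN_gen_mult[OF uG G_add_left[OF 2]]
  A.mult_r_distr[OF yc(1)[OF 2(1)] yc(1)[OF 2(2)] ac(1)] sym_props(2)[OF m]
  by (rule V.smult_r_distr[OF sg_closed sym_props(1)[OF m(1)] sym_props(1)[OF m(2)]])
  next
  case (3 q l y d e)
  note m = G_mult[OF uG 3(1)] G_mult[OF uG 3(2)]
  show ?case unfolding qN_gen_mult[OF uG 3(1)] qN_gen_mult[OF uG 3(2)] qN_gen_mult[OF uG G_add_right[OF 3]]
  C.mult_r_distr[OF yc(2)[OF 3(1)] yc(2)[OF 3(2)] ac(2)] sym_props(3)[OF m]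
  by (rule V.smult_r_distr[OF sg_closed sym_props(1)[OF m(1)] sym_props(1)[OF m(2)]])
  next
  case (4 a q l y d)
  note m = G_mult[OF uG 4(2)]
  show ?case unfolding qN_gen_mult[OF uG 4(2)] qN_gen_mult[OF uG G_smult_left[OF 4]]
  A.smult_mult_r[OF 4(1) ac(1) yc(1)[OF 4(2)]] sym_props(4)[OF 4(1) m]
  using 4(1) sym_props(1)[OF m] by (simp add: V.smult_assoc1[symmetric] m_comm)
  next
  case (5 a q l y d)
  note m = G_mult[OF uG 5(2)]
  show ?case unfolding qN_gen_mult[OF uG 5(2)] qN_gen_mult[OF uG G_smult_right[OF 5]]
  C.smult_mult_r[OF 5(1) ac(2) yc(2)[OF 5(2)]] sym_props(5)[OF 5(1) m]
  using 5(1) sym_props(1)[OF m] by (simp add: V.smult_assoc1[symmetric] m_comm)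
  qed
  from balanced_kills_N[OF TT_module lin this assms(2)] show ?thesis
  using qN_zero_iff[of "gen u \<otimes>.F f"] u fc by simp
 qed
 have "g \<in> {g \<in> carrier F. g \<otimes>.F f \<in> N}"
 proof (rule F_induct[OF assms(1)])
  show "\<zero>.F \<in> {g \<in> carrier F. g \<otimes>.F f \<in> N}" using fc subD(2)[OF N_sub] by simp
 next
  fix g h assume "g \<in> {g \<in> carrier F. g \<otimes>.F f \<in> N}" "h \<in> {g \<in> carrier F. g \<otimes>.F f \<in> N}"
  thus "g \<oplus>.F h \<in> {g \<in> carrier F. g \<otimes>.F f \<in> N}"
  using FA.mult_l_distr[OF _ _ fc, of g h] subD(3)[OF N_sub] by simp
 next
  fix a u assume "a .: R" "u \<in> G"
  thus "a \<odot>.F gen u \<in> {g \<in> carrier F. g \<otimes>.F f \<in> N}"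
  using FA.smult_mult_l[of a "gen u" f] base[of u] fc subD(4)[OF N_sub] by simp
 qed
 thus ?thesis by simp
qed

lemma N_mult_r:
 assumes "g .: F" "f \<in> N"
 shows "f \<otimes>.F g \<in> N"
proof -
 interpret V: module R TT by (rule TT_module)
 have fc: "f .: F" using assms(2) subD(1)[OF N_sub] by blast
 have base: "f \<otimes>.F gen u \<in> N" if u: "u \<in> G" for u
 proof -
  obtain p k x c where ue: "u = (p, k, x, c)" by (cases u)
  have uG: "(p, k, x, c) \<in> G" using u ue by simp
  have ac: "x .: A" "c .: C" using uG D_closed by (auto simp: G_iff)
  have yc: "y .: A" "d .: C" if "(q, l, y, d) \<in> G" for q l y d using that D_closed by (auto simp: G_iff)
  have lin: "lin R F TT (%f. qN (f \<otimes>.F gen u))"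
  by (rule lin_comp[OF FA.rmul_lin qN_lin]) (use u in simp)
  have "balanced TT (%v. qN (gen v \<otimes>.F gen u))" unfolding ue
  proof (rule balancedI, goal_cases)
  case (1 q l y d)
  thus ?case using linD(1)[OF lin] ue by simp
  next
  case (2 q l y z d)
  note m = G_mult[OF 2(1) uG] G_mult[OF 2(2) uG]
  show ?case unfolding qN_gen_mult[OF 2(1) uG] qN_gen_mult[OF 2(2) uG] qN_gen_mult[OF G_add_left[OF 2] uG]
  A.mult_l_distr[OF yc(1)[OF 2(1)] yc(1)[OF 2(2)] ac(1)] sym_props(2)[OF m]
  by (rule V.smult_r_distr[OF sg_closed sym_props(1)[OF m(1)] sym_props(1)[OF m(2)]])
  next
  case (3 q l y d e)
  note m = G_mult[OF 3(1) uG] G_mult[OF 3(2) uG]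
  show ?case unfolding qN_gen_mult[OF 3(1) uG] qN_gen_mult[OF 3(2) uG] qN_gen_mult[OF G_add_right[OF 3] uG]
  C.mult_l_distr[OF yc(2)[OF 3(1)] yc(2)[OF 3(2)] ac(2)] sym_props(3)[OF m]
  by (rule V.smult_r_distr[OF sg_closed sym_props(1)[OF m(1)] sym_props(1)[OF m(2)]])
  next
  case (4 a q l y d)
  note m = G_mult[OF 4(2) uG]
  show ?case unfolding qN_gen_mult[OF 4(2) uG] qN_gen_mult[OF G_smult_left[OF 4] uG]
  A.smult_mult_l[OF 4(1) yc(1)[OF 4(2)] ac(1)] sym_props(4)[OF 4(1) m]
  using 4(1) sym_props(1)[OF m] by (simp add: V.smult_assoc1[symmetric] m_comm)
  next
  case (5 a q l y d)
  note m = G_mult[OF 5(2) uG]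
  show ?case unfolding qN_gen_mult[OF 5(2) uG] qN_gen_mult[OF G_smult_right[OF 5] uG]
  C.smult_mult_l[OF 5(1) yc(2)[OF 5(2)] ac(2)] sym_props(5)[OF 5(1) m]
  using 5(1) sym_props(1)[OF m] by (simp add: V.smult_assoc1[symmetric] m_comm)
  qed
  from balanced_kills_N[OF TT_module lin this assms(2)] show ?thesis
  using qN_zero_iff[of "f \<otimes>.F gen u"] u fc by simp
 qed
 have "g \<in> {g \<in> carrier F. f \<otimes>.F g \<in> N}"
 proof (rule F_induct[OF assms(1)])
  show "\<zero>.F \<in> {g \<in> carrier F. f \<otimes>.F g \<in> N}" using fc subD(2)[OF N_sub] by simp
 next
  fix g h assume "g \<in> {g \<in> carrier F. f \<otimes>.F g \<in> N}" "h \<in> {g \<in> carrier F. f \<otimes>.F g \<in> N}"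
  thus "g \<oplus>.F h \<in> {g \<in> carrier F. f \<otimes>.F g \<in> N}"
  using FA.mult_r_distr[OF _ _ fc, of g h] subD(3)[OF N_sub] by simp
 next
  fix a u assume "a .: R" "u \<in> G"
  thus "a \<odot>.F gen u \<in> {g \<in> carrier F. f \<otimes>.F g \<in> N}"
  using FA.smult_mult_r[of a f "gen u"] base[of u] fc subD(4)[OF N_sub] by simp
 qed
 thus ?thesis by simp
qed

lemma qN_gen_d:
 assumes "(p, k, x, c) \<in> G"
 shows "qN (dif F (gen (p, k, x, c))) = (\<Oplus>.TT q\<in>{q. covers L p q}. sym (q, k, proj q (dif A x), c))
  \<oplus>.TT sg R (int (r p)) \<odot>.TT sym (p, k + 1, x, dif C c)"
proof -
 note q = linD[OF qN_lin]
 have c: "(%q. gen (q, k, proj q (dif A x), c)) \<in> {q. covers L p q} \<rightarrow> carrier F"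
  using G_d(2)[OF assms] by auto
 have 1: "(\<Oplus>.F q\<in>{q. covers L p q}. gen (q, k, proj q (dif A x), c)) .: F"
  by (rule FA.M.finsum_closed[OF c])
 have 2: "gen (p, k + 1, x, dif C c) .: F" by (rule Fgen_in[OF G_d(1)[OF assms]])
 show ?thesis
  unfolding F_d_gen'[OF assms] q(2)[OF 1 FA.smult_closed[OF sg_closed 2]] q(3)[OF sg_closed 2]
  lin_finsum[OF FA.mod TT_module qN_lin finite_covers c] sym_def ..
qed

text \<open>\<open>\<partial> x\<close> is linear in \<open>x\<close> and \<open>dif C c\<close> in
  \<open>c\<close>, while the sign and the set of covered flats depend only on the label
  \<open>p\<close>. So the differential followed by the quotient map is balanced.\<close>

lemma N_d:
 assumes "f \<in> N"
 shows "dif F f \<in> N"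
proof -
 interpret V: module R TT by (rule TT_module)
 have fc: "f .: F" using assms subD(1)[OF N_sub] by blast
 have lin: "lin R F TT (%f. qN (dif F f))" by (rule lin_comp[OF FA.d_lin qN_lin])
 have xc: "x .: A" "c .: C" if "(q, l, x, c) \<in> G" for q l x c using that D_closed by (auto simp: G_iff)
 have fsum: "(%q. sym (q, k, proj q (dif A x), c)) \<in> {q. covers L p q} \<rightarrow> carrier TT" if "(p, k, x, c) \<in> G" for p k x c
  using sym_props(1)[OF G_d(2)[OF that]] by auto
 note fsc = V.M.finsum_closed[OF fsum]
 note sc = V.smult_closed[OF sg_closed sym_props(1)[OF G_d(1)]]
 have "balanced TT (%v. qN (dif F (gen v)))"
 proof (rule balancedI, goal_cases)
  case (1 q l y d)
  thus ?case using linD(1)[OF lin] by simp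
 next
  case (2 p k x y c)
  have s: "(\<Oplus>.TT q\<in>{q. covers L p q}. sym (q, k, proj q (dif A (x \<oplus>.A y)), c)) =
  (\<Oplus>.TT q\<in>{q. covers L p q}. sym (q, k, proj q (dif A x), c)) \<oplus>.TT (\<Oplus>.TT q\<in>{q. covers L p q}. sym (q, k, proj q (dif A y), c))"
  unfolding V.M.finsum_addf[OF fsum[OF 2(1)] fsum[OF 2(2)], symmetric]
  proof (rule V.M.finsum_cong')
  fix q assume "q \<in> {q. covers L p q}"
  hence q: "covers L p q" by simp
  have "proj q (dif A (x \<oplus>.A y)) = proj q (dif A x) \<oplus>.A proj q (dif A y)"
  using xc(1)[OF 2(1)] xc(1)[OF 2(2)] linD(2)[OF proj_lin, of "dif A x" "dif A y" q] by (simp add: A.d_add)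
  thus "sym (q, k, proj q (dif A (x \<oplus>.A y)), c) = sym (q, k, proj q (dif A x), c) \<oplus>.TT sym (q, k, proj q (dif A y), c)"
  using sym_props(2)[OF G_d(2)[OF 2(1) q] G_d(2)[OF 2(2) q]] by simp
  qed (use sym_props(1)[OF G_d(2)[OF 2(1)]] sym_props(1)[OF G_d(2)[OF 2(2)]] in auto)
  show ?case unfolding qN_gen_d[OF 2(1)] qN_gen_d[OF 2(2)] qN_gen_d[OF G_add_left[OF 2]] s sym_props(2)[OF G_d(1)[OF 2(1)] G_d(1)[OF 2(2)]]
  V.smult_r_distr[OF sg_closed sym_props(1)[OF G_d(1)[OF 2(1)]] sym_props(1)[OF G_d(1)[OF 2(2)]]]
  using fsc[OF 2(1)] fsc[OF 2(2)] sc[OF 2(1)] sc[OF 2(2)] by (simp add: V.M.a_ac)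
 next
  case (3 p k x c d)
  have cd: "c .: C" "d .: C" using xc(2)[OF 3(1)] xc(2)[OF 3(2)] by auto
  have s: "(\<Oplus>.TT q\<in>{q. covers L p q}. sym (q, k, proj q (dif A x), c \<oplus>.C d)) =
  (\<Oplus>.TT q\<in>{q. covers L p q}. sym (q, k, proj q (dif A x), c)) \<oplus>.TT (\<Oplus>.TT q\<in>{q. covers L p q}. sym (q, k, proj q (dif A x), d))"
  unfolding V.M.finsum_addf[OF fsum[OF 3(1)] fsum[OF 3(2)], symmetric]
  by (rule V.M.finsum_cong') (use sym_props(1)[OF G_d(2)[OF 3(1)]] sym_props(1)[OF G_d(2)[OF 3(2)]] sym_props(3)[OF G_d(2)[OF 3(1)] G_d(2)[OF 3(2)]] in auto)
  show ?case unfolding qN_gen_d[OF 3(1)] qN_gen_d[OF 3(2)] qN_gen_d[OF G_add_right[OF 3]] s C.d_add[OF cd] sym_props(3)[OF G_d(1)[OF 3(1)] G_d(1)[OF 3(2)]]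
  V.smult_r_distr[OF sg_closed sym_props(1)[OF G_d(1)[OF 3(1)]] sym_props(1)[OF G_d(1)[OF 3(2)]]]
  using fsc[OF 3(1)] fsc[OF 3(2)] sc[OF 3(1)] sc[OF 3(2)] by (simp add: V.M.a_ac)
 next
  case (4 a p k x c)
  have s: "(\<Oplus>.TT q\<in>{q. covers L p q}. sym (q, k, proj q (dif A (a \<odot>.A x)), c)) =
  a \<odot>.TT (\<Oplus>.TT q\<in>{q. covers L p q}. sym (q, k, proj q (dif A x), c))"
  unfolding V.finsum_smult_ldistr[OF finite_covers 4(1) fsum[OF 4(2)]]
  proof (rule V.M.finsum_cong')
  fix q assume "q \<in> {q. covers L p q}"
  hence q: "covers L p q" by simp
  have "proj q (dif A (a \<odot>.A x)) = a \<odot>.A proj q (dif A x)"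
  using xc(1)[OF 4(2)] 4(1) linD(3)[OF proj_lin 4(1), of "dif A x" q] by (simp add: A.d_smult)
  thus "sym (q, k, proj q (dif A (a \<odot>.A x)), c) = a \<odot>.TT sym (q, k, proj q (dif A x), c)"
  using sym_props(4)[OF 4(1) G_d(2)[OF 4(2) q]] by simp
  qed (use 4(1) sym_props(1)[OF G_d(2)[OF 4(2)]] in auto)
  show ?case unfolding qN_gen_d[OF 4(2)] qN_gen_d[OF G_smult_left[OF 4]] s sym_props(4)[OF 4(1) G_d(1)[OF 4(2)]]
  using 4(1) fsc[OF 4(2)] sc[OF 4(2)] sym_props(1)[OF G_d(1)[OF 4(2)]]
  by (simp add: V.smult_r_distr V.smult_assoc1[symmetric] m_comm)
 next
  case (5 a p k x c)
  have cc: "c .: C" using xc(2)[OF 5(2)] .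
  have s: "(\<Oplus>.TT q\<in>{q. covers L p q}. sym (q, k, proj q (dif A x), a \<odot>.C c)) =
  a \<odot>.TT (\<Oplus>.TT q\<in>{q. covers L p q}. sym (q, k, proj q (dif A x), c))"
  unfolding V.finsum_smult_ldistr[OF finite_covers 5(1) fsum[OF 5(2)]]
  by (rule V.M.finsum_cong') (use 5(1) sym_props(1)[OF G_d(2)[OF 5(2)]] sym_props(5)[OF 5(1) G_d(2)[OF 5(2)]] in auto)
  show ?case unfolding qN_gen_d[OF 5(2)] qN_gen_d[OF G_smult_right[OF 5]] s C.d_smult[OF 5(1) cc] sym_props(5)[OF 5(1) G_d(1)[OF 5(2)]]
  using 5(1) fsc[OF 5(2)] sc[OF 5(2)] sym_props(1)[OF G_d(1)[OF 5(2)]]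
  by (simp add: V.smult_r_distr V.smult_assoc1[symmetric] m_comm)
 qed
 from balanced_kills_N[OF TT_module lin this assms] show ?thesis
  using qN_zero_iff[of "dif F f"] fc by simp
qed

lemma N_diff_ideal: "diff_ideal R F N"
 by (intro diff_ideal.intro FA.diff_alg_axioms diff_ideal_axioms.intro N_sub N_mult_l N_mult_r N_d)

sublocale TT: diff_alg R TT
 unfolding OS_tensor_def by (rule diff_ideal.quotient_diff_alg[OF N_diff_ideal])

lemma sym_mult:
 assumes "(p, k, x, c) \<in> G" "(q, l, y, d) \<in> G"
 shows "sym (p, k, x, c) \<otimes>.TT sym (q, l, y, d) = sg R (k * int (r q)) \<odot>.TT sym (p \<squnion>.L q, k + l, x \<otimes>.A y, c \<otimes>.C d)"
 unfolding qN_gen_mult[OF assms, symmetric] unfolding sym_def OS_tensor_def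
 by (rule diff_ideal.quotient_mult[OF N_diff_ideal Fgen_in[OF assms(1)] Fgen_in[OF assms(2)]])

lemma sym_d:
 assumes "(p, k, x, c) \<in> G"
 shows "dif TT (sym (p, k, x, c)) = (\<Oplus>.TT q\<in>{q. covers L p q}. sym (q, k, proj q (dif A x), c))
  \<oplus>.TT sg R (int (r p)) \<odot>.TT sym (p, k + 1, x, dif C c)"
proof -
 have "dif TT (sym (p, k, x, c)) = qN (dif F (gen (p, k, x, c)))"
  unfolding sym_def OS_tensor_def by (rule diff_ideal.quotient_d[OF N_diff_ideal Fgen_in[OF assms]])
 thus ?thesis unfolding qN_gen_d[OF assms] .
qed

lemma sym_one: "\<one>.TT = sym (\<bottom>.L, 0, \<one>.A, \<one>.C)"
 unfolding sym_def OS_tensor_def qalg_simps F_simps ..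

end

lemma neg_one_pow_cong: "even (a - b) ==> sg R a = sg R b"
 by (auto simp: neg_one_pow_def)

lemma factor_inv:
 assumes "q ` S = Q" "y \<in> Q" shows "inv_into S q y \<in> S" "q (inv_into S q y) = y"
 using assms by (auto intro: inv_into_into f_inv_into_f)

context coefficients begin

subsection \<open>The symbols \<open>x \<otimes> c\<close> for inhomogeneous \<open>c\<close>\<close>

definition degs :: "'c => int set" where
 "degs c = {k. pr k c ~= \<zero>.C}"

text \<open>Without the degree label the symbol is bilinear in \<open>x\<close> and in arbitrary
  \<open>c\<close>, and the complex can be treated as a direct sum over \<open>p\<close>
  alone.\<close>

definition tt :: "'p => ('p list => 'r) set set => 'c => ('p \<times> int \<times> ('p list => 'r) set set \<times> 'c => 'r) set" where
 "tt p x c = (\<Oplus>.TT k\<in>degs c. sym (p, k, x, pr k c))"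

lemma sym_G: "p .: L ==> x \<in> part p ==> c \<in> D p ==> (p, k, x, pr k c) \<in> G"
 using D_gr[OF _ _ ind_in] pr_homog D_closed by (simp add: G_iff)

lemma sym_zero: "p .: L ==> x \<in> part p ==> sym (p, k, x, \<zero>.C) = \<zero>.TT"
proof -
 assume p: "p .: L" "x \<in> part p"
 have "pr k \<zero>.C = \<zero>.C" by (rule lin_zero[OF C.mod C.mod pr_lin])
 hence G: "(p, k, x, \<zero>.C) \<in> G" using sym_G[OF p D_zero[OF p(1)], of k] by simp
 from sym_props(5)[OF zero_closed G] show ?thesis using sym_props(1)[OF G] by simp
qed

lemma tt_superset:
 assumes "p .: L" "x \<in> part p" "c \<in> D p" "finite S" "degs c <= S"
 shows "tt p x c = (\<Oplus>.TT k\<in>S. sym (p, k, x, pr k c))"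
 unfolding tt_def
proof (rule TT.M.add.finprod_mono_neutral_cong_left[OF assms(4,5)])
 show "sym (p, k, x, pr k c) = \<zero>.TT" if "k \<in> S - degs c" for k
  using that sym_zero[OF assms(1,2)] by (simp add: degs_def)
qed (use sym_props(1)[OF sym_G[OF assms(1-3)]] in auto)

lemma finite_degs: "p .: L ==> c \<in> D p ==> finite (degs c)"
 unfolding degs_def by (rule finite_degrees[OF D_closed])

lemma tt_closed [simp]: "p .: L ==> x \<in> part p ==> c \<in> D p ==> tt p x c .: TT"
 unfolding tt_def using sym_props(1)[OF sym_G] by (intro TT.M.finsum_closed) auto

lemma tt_homog:
 assumes "p .: L" "x \<in> part p" "c \<in> D p" "c \<in> homog C k"
 shows "tt p x c = sym (p, k, x, c)"
proof -
 have "degs c <= {k}" using pr_other[OF assms(4)] by (auto simp: degs_def)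
 hence "tt p x c = (\<Oplus>.TT j\<in>{k}. sym (p, j, x, pr j c))" by (intro tt_superset[OF assms(1-3)]) simp_all
 also have "... = sym (p, k, x, pr k c)" using sym_props(1)[OF sym_G[OF assms(1-3)]] by (subst TT.M.finsum_insert) auto
 finally show ?thesis using assms(4) by (simp add: homog_iff)
qed

lemma tt_addr:
 assumes "p .: L" "x \<in> part p" "c \<in> D p" "d \<in> D p"
 shows "tt p x (c \<oplus>.C d) = tt p x c \<oplus>.TT tt p x d"
proof -
 let ?S = "degs c \<union> degs d"
 have cd: "c .: C" "d .: C" using D_closed assms by auto
 have add: "pr k (c \<oplus>.C d) = pr k c \<oplus>.C pr k d" for k by (rule linD(2)[OF pr_lin cd])
 have fin: "finite ?S" using finite_degs assms by simp
 have sub: "degs (c \<oplus>.C d) <= ?S" by (auto simp: degs_def add)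
 note s = sym_props(1)[OF sym_G[OF assms(1-3)]] sym_props(1)[OF sym_G[OF assms(1,2,4)]]
 have "tt p x (c \<oplus>.C d) = (\<Oplus>.TT k\<in>?S. sym (p, k, x, pr k (c \<oplus>.C d)))"
  by (rule tt_superset[OF assms(1,2) D_add[OF assms(1,3,4)] fin sub])
 also have "... = (\<Oplus>.TT k\<in>?S. sym (p, k, x, pr k c) \<oplus>.TT sym (p, k, x, pr k d))"
  unfolding add by (rule TT.M.finsum_cong') (use s sym_props(3)[OF sym_G[OF assms(1-3)] sym_G[OF assms(1,2,4)]] in auto)
 also have "... = (\<Oplus>.TT k\<in>?S. sym (p, k, x, pr k c)) \<oplus>.TT (\<Oplus>.TT k\<in>?S. sym (p, k, x, pr k d))"
  by (rule TT.M.finsum_addf) (use s in auto)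
 also have "(\<Oplus>.TT k\<in>?S. sym (p, k, x, pr k c)) = tt p x c" by (rule tt_superset[OF assms(1-3) fin, symmetric]) simp
 also have "(\<Oplus>.TT k\<in>?S. sym (p, k, x, pr k d)) = tt p x d" by (rule tt_superset[OF assms(1,2,4) fin, symmetric]) simp
 finally show ?thesis .
qed

lemma tt_smr:
 assumes "p .: L" "x \<in> part p" "c \<in> D p" "a .: R"
 shows "tt p x (a \<odot>.C c) = a \<odot>.TT tt p x c"
proof -
 have cc: "c .: C" using D_closed assms by auto
 have sm: "pr k (a \<odot>.C c) = a \<odot>.C pr k c" for k by (rule linD(3)[OF pr_lin assms(4) cc])
 have fin: "finite (degs c)" using finite_degs assms by simp
 have sub: "degs (a \<odot>.C c) <= degs c" using assms(4) by (auto simp: degs_def sm)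
 note s = sym_props(1)[OF sym_G[OF assms(1-3)]]
 have "tt p x (a \<odot>.C c) = (\<Oplus>.TT k\<in>degs c. sym (p, k, x, pr k (a \<odot>.C c)))"
  by (rule tt_superset[OF assms(1,2) D_smult[OF assms(1,4,3)] fin sub])
 also have "... = (\<Oplus>.TT k\<in>degs c. a \<odot>.TT sym (p, k, x, pr k c))"
  unfolding sm by (rule TT.M.finsum_cong') (use s assms(4) sym_props(5)[OF assms(4) sym_G[OF assms(1-3)]] in auto)
 also have "... = a \<odot>.TT (\<Oplus>.TT k\<in>degs c. sym (p, k, x, pr k c))"
  by (rule TT.finsum_smult_ldistr[symmetric]) (use fin s assms(4) in auto)
 finally show ?thesis by (simp add: tt_def)
qed

lemma tt_addl:
 assumes "p .: L" "x \<in> part p" "y \<in> part p" "c \<in> D p"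
 shows "tt p (x \<oplus>.A y) c = tt p x c \<oplus>.TT tt p y c"
proof -
 note s = sym_props(1)[OF sym_G[OF assms(1,2,4)]] sym_props(1)[OF sym_G[OF assms(1,3,4)]]
 have "tt p (x \<oplus>.A y) c = (\<Oplus>.TT k\<in>degs c. sym (p, k, x, pr k c) \<oplus>.TT sym (p, k, y, pr k c))"
  unfolding tt_def by (rule TT.M.finsum_cong') (use s sym_props(2)[OF sym_G[OF assms(1,2,4)] sym_G[OF assms(1,3,4)]] in auto)
 also have "... = tt p x c \<oplus>.TT tt p y c"
  unfolding tt_def by (rule TT.M.finsum_addf) (use s in auto)
 finally show ?thesis .
qed

lemma tt_sml:
 assumes "p .: L" "x \<in> part p" "c \<in> D p" "a .: R"
 shows "tt p (a \<odot>.A x) c = a \<odot>.TT tt p x c"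
proof -
 note s = sym_props(1)[OF sym_G[OF assms(1-3)]]
 have "tt p (a \<odot>.A x) c = (\<Oplus>.TT k\<in>degs c. a \<odot>.TT sym (p, k, x, pr k c))"
  unfolding tt_def by (rule TT.M.finsum_cong') (use s assms(4) sym_props(4)[OF assms(4) sym_G[OF assms(1-3)]] in auto)
 also have "... = a \<odot>.TT tt p x c"
  unfolding tt_def by (rule TT.finsum_smult_ldistr[symmetric]) (use finite_degs[OF assms(1,3)] s assms(4) in auto)
 finally show ?thesis .
qed

lemma tt_zero_left: "p .: L ==> c \<in> D p ==> tt p \<zero>.A c = \<zero>.TT"
 using tt_sml[of p "\<zero>.A" c \<zero>] subD(2)[OF part_sub] by simp

lemma tt_zero_right: "p .: L ==> x \<in> part p ==> tt p x \<zero>.C = \<zero>.TT"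
 using tt_smr[of p x "\<zero>.C" \<zero>] D_zero by simp

lemma TT_submodule_induct:
 assumes "submodule H R TT" "!!p x c. p .: L ==> x \<in> part p ==> c \<in> D p ==> tt p x c \<in> H" "z .: TT"
 shows "z \<in> H"
proof -
 obtain f where f: "f .: F" "z = qN f" using assms(3) TT_carrier by auto
 note q = linD[OF qN_lin]
 have "f \<in> {f \<in> carrier F. qN f \<in> H}"
 proof (rule F_induct[OF f(1)])
  show "\<zero>.F \<in> {f \<in> carrier F. qN f \<in> H}"
  using lin_zero[OF FA.mod TT.mod qN_lin] subD(2)[OF assms(1)] by simp
  show "f \<oplus>.F g \<in> {f \<in> carrier F. qN f \<in> H}" if "f \<in> {f \<in> carrier F. qN f \<in> H}" "g \<in> {f \<in> carrier F. qN f \<in> H}" for f g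
  using that q(2) subD(3)[OF assms(1)] by simp
  fix a u assume a: "a .: R" and u: "u \<in> G"
  obtain p k x c where ue: "u = (p, k, x, c)" by (cases u)
  have pc: "p .: L" "x \<in> part p" "c \<in> D p" "c \<in> homog C k" using u ue by (auto simp: G_iff)
  have "qN (gen u) \<in> H" using assms(2)[OF pc(1-3)] tt_homog[OF pc] by (simp add: sym_def ue)
  thus "a \<odot>.F gen u \<in> {f \<in> carrier F. qN f \<in> H}"
  using q(3)[OF a Fgen_in[OF u]] a u subD(4)[OF assms(1) a] by simp
 qed
 thus ?thesis using f by simp
qed

lemma TT_linear_eqI:
 assumes "module R V" "lin R TT V f" "lin R TT V g"
  "!!p x c. p .: L ==> x \<in> part p ==> c \<in> D p ==> f (tt p x c) = g (tt p x c)" "z .: TT"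
 shows "f z = g z"
proof -
 have "submodule {x \<in> carrier TT. f x = g x} R TT"
  using linD[OF assms(2)] linD[OF assms(3)] lin_zero[OF TT.mod assms(1,2)]
  lin_zero[OF TT.mod assms(1,3)]
  by (intro TT.subI') (simp_all add: subset_iff)
 from TT_submodule_induct[OF this _ assms(5)] show ?thesis using assms(4) by simp
qed

section \<open>Universal property of the tensor complex\<close>

definition bilinear_family where
 "bilinear_family V \<psi> <->
  (ALL p:carrier L. ALL x:part p. ALL c:D p. \<psi> p x c .: V) &
  (ALL p:carrier L. ALL x:part p. ALL y:part p. ALL c:D p. \<psi> p (x \<oplus>.A y) c = \<psi> p x c \<oplus>.V \<psi> p y c) &
  (ALL p:carrier L. ALL x:part p. ALL c:D p. ALL d:D p. \<psi> p x (c \<oplus>.C d) = \<psi> p x c \<oplus>.V \<psi> p x d) &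
  (ALL p:carrier L. ALL x:part p. ALL c:D p. ALL a:carrier R. \<psi> p (a \<odot>.A x) c = a \<odot>.V \<psi> p x c) &
  (ALL p:carrier L. ALL x:part p. ALL c:D p. ALL a:carrier R. \<psi> p x (a \<odot>.C c) = a \<odot>.V \<psi> p x c)"

definition tlift where
 "tlift V \<psi> z = free_lift R V (%(p, k, x, c). \<psi> p x c) (inv_into (carrier F) qN z)"

text \<open>The lift to the free module is balanced, so it kills \<open>N\<close>, and the
  representative chosen in \<open>tlift\<close> does not matter. The degree label plays no part in
  the family; additivity in \<open>c\<close> extends the formula from generators to all
  symbols.\<close>

lemma tlift:
 assumes V: "module R V" and bil: "bilinear_family V \<psi>"
 shows "lin R TT V (tlift V \<psi>)"
  and "p .: L ==> x \<in> part p ==> c \<in> D p ==> tlift V \<psi> (tt p x c) = \<psi> p x c"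
proof -
 interpret V: module R V by fact
 let ?\<phi> = "%(p, k, x, c). \<psi> p x c" and ?g = "free_lift R V (%(p, k, x, c). \<psi> p x c)"
 have \<phi>: "?\<phi> u .: V" if "u \<in> G" for u
  using that bil by (cases u) (simp add: G_iff bilinear_family_def)
 have lin: "lin R F V ?g" by (rule F_free_lift[OF V \<phi>])
 have gen: "?g (gen u) = ?\<phi> u" if "u \<in> G" for u by (rule free_lift_basis[OF V that \<phi>])
 have gen4: "?g (gen (p, k, x, c)) = \<psi> p x c" if "(p, k, x, c) \<in> G" for p k x c using gen[OF that] by simp
 have "balanced V (%u. ?g (gen u))"
 proof (rule balancedI, goal_cases)
  case (1 p k x c) thus ?case using gen4[OF 1] \<phi>[OF 1] by simp
 next
  case (2 p k x y c) thus ?case unfolding gen4[OF 2(1)] gen4[OF 2(2)] gen4[OF G_add_left[OF 2]]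
  using bil by (simp add: G_iff bilinear_family_def)
 next
  case (3 p k x c d) thus ?case unfolding gen4[OF 3(1)] gen4[OF 3(2)] gen4[OF G_add_right[OF 3]]
  using bil by (simp add: G_iff bilinear_family_def)
 next
  case (4 a p k x c) thus ?case unfolding gen4[OF 4(2)] gen4[OF G_smult_left[OF 4]]
  using bil by (simp add: G_iff bilinear_family_def)
 next
  case (5 a p k x c) thus ?case unfolding gen4[OF 5(2)] gen4[OF G_smult_right[OF 5]]
  using bil by (simp add: G_iff bilinear_family_def)
 qed
 note kill = balanced_kills_N[OF V lin this]
 have fac: "tlift V \<psi> (qN f) = ?g f" if f: "f .: F" for f
 proof -
  let ?f = "inv_into (carrier F) qN (qN f)"
  have f': "?f .: F" "qN ?f = qN f" using factor_inv[OF TT_carrier[symmetric], of "qN f"] f TT_carrier by auto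
  hence "?f \<ominus>.F f \<in> N" using FA.cos_iff[OF N_sub f'(1) f] by simp
  hence "?g ?f \<ominus>.V ?g f = \<zero>.V" using kill lin_minus[OF FA.mod V lin f'(1) f] by simp
  hence "(?g ?f \<ominus>.V ?g f) \<oplus>.V ?g f = ?g f" using linD(1)[OF lin f] by simp
  hence "?g ?f = ?g f" using linD(1)[OF lin f] linD(1)[OF lin f'(1)] by (simp add: a_minus_def V.M.a_assoc V.M.l_neg)
  thus ?thesis by (simp add: tlift_def)
 qed
 note q = linD[OF qN_lin] and l = linD[OF lin]
 show lt: "lin R TT V (tlift V \<psi>)"
 proof (rule linI)
  fix z assume "z .: TT"
  then obtain f where f: "f .: F" "z = qN f" using TT_carrier by auto
  show "tlift V \<psi> z .: V" unfolding f(2) fac[OF f(1)] by (rule l(1)[OF f(1)])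
  show "tlift V \<psi> (a \<odot>.TT z) = a \<odot>.V tlift V \<psi> z" if a: "a .: R" for a
  unfolding f(2) q(3)[OF a f(1), symmetric] fac[OF f(1)] fac[OF FA.smult_closed[OF a f(1)]] by (rule l(3)[OF a f(1)])
  fix w assume "w .: TT"
  then obtain g where g: "g .: F" "w = qN g" using TT_carrier by auto
  show "tlift V \<psi> (z \<oplus>.TT w) = tlift V \<psi> z \<oplus>.V tlift V \<psi> w"
  unfolding f(2) g(2) q(2)[OF f(1) g(1), symmetric] fac[OF f(1)] fac[OF g(1)] fac[OF FA.M.a_closed[OF f(1) g(1)]] by (rule l(2)[OF f(1) g(1)])
 qed
 assume p: "p .: L" and x: "x \<in> part p" and "c \<in> D p"
 from p \<open>c \<in> D p\<close> show "tlift V \<psi> (tt p x c) = \<psi> p x c"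
 proof (induction c rule: D_induct)
  case (add c d)
  have "tlift V \<psi> (tt p x (c \<oplus>.C d)) = tlift V \<psi> (tt p x c) \<oplus>.V tlift V \<psi> (tt p x d)"
  unfolding tt_addr[OF p x add(1,2)] by (rule linD(2)[OF lt tt_closed[OF p x add(1)] tt_closed[OF p x add(2)]])
  thus ?case using add bil p x by (simp add: bilinear_family_def)
 next
  case (homog c k)
  have "(p, k, x, c) \<in> G" using homog p x by (simp add: G_iff)
  thus ?case unfolding tt_homog[OF p x homog] sym_def fac[OF Fgen_in[OF \<open>(p, k, x, c) \<in> G\<close>]] by (rule gen4)
 qed
qed

subsection \<open>Product, dif and grading on symbols\<close>

text \<open>Homogeneity is asked of the left coefficient because the sign involves its degree and
  the rank of the right flat; in \<open>d\<close> both sides are additive.\<close>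

lemma tt_mult:
 assumes "p .: L" "x \<in> part p" "c \<in> D p" "c \<in> homog C k" "q .: L" "y \<in> part q" "d \<in> D q"
 shows "tt p x c \<otimes>.TT tt q y d = sg R (k * int (r q)) \<odot>.TT tt (p \<squnion>.L q) (x \<otimes>.A y) (c \<otimes>.C d)"
 using assms(5,7)
proof (induction d rule: D_induct)
 case (add d e)
 note pq = join_in[OF assms(1,5)] part_mult[OF assms(2,6)]
 have D: "c \<otimes>.C d \<in> D (p \<squnion>.L q)" "c \<otimes>.C e \<in> D (p \<squnion>.L q)" using D_mult[OF assms(1,5,3)] add by auto
 have cc: "c .: C" "d .: C" "e .: C" using D_closed assms add by auto
 show ?case
  unfolding tt_addr[OF assms(5,6) add(1,2)] C.mult_r_distr[OF cc(2,3,1)] tt_addr[OF pq D]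
  TT.mult_r_distr[OF tt_closed[OF assms(5,6) add(1)] tt_closed[OF assms(5,6) add(2)] tt_closed[OF assms(1-3)]] add(3,4)
  by (rule TT.smult_r_distr[OF sg_closed tt_closed[OF pq D(1)] tt_closed[OF pq D(2)], symmetric])
next
 case (homog d l)
 have G: "(p, k, x, c) \<in> G" "(q, l, y, d) \<in> G" using assms homog by (auto simp: G_iff)
 show ?case unfolding tt_homog[OF assms(1-4)] tt_homog[OF assms(5,6) homog] sym_mult[OF G]
  using tt_homog[OF join_in[OF assms(1,5)] part_mult[OF assms(2,6)] D_mult[OF assms(1,5,3) homog(1)] homog_mult[OF assms(4) homog(2)]]
  by simp
qed

definition below :: "'p => 'p set" where
 "below p = {q \<in> carrier L. q \<sqsubseteq>.L p}"

text \<open>The \<open>\<partial>\<close>-part of the differential of \<open>x \<otimes> c\<close>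
  as a linear function of \<open>y = \<partial> x\<close>. The sum runs over all flats below
  \<open>p\<close>, not only the covered ones, so that it can also be applied to
  \<open>\<partial> y\<close> and, over \<open>p \<squnion> a\<close>, to
  \<open>e_a y\<close>.\<close>

definition Phi where
 "Phi p c y = (\<Oplus>.TT q\<in>below p. tt q (proj q y) c)"

lemma finite_below: "finite (below p)"
 by (rule finite_subset[OF _ finite_carrier]) (auto simp: below_def)

lemma below_D: "p .: L ==> c \<in> D p ==> q \<in> below p ==> q .: L & c \<in> D q"
 using D_mono[of p q] by (auto simp: below_def)

lemma tt_proj_lin:
 assumes "q .: L" "c \<in> D q"
 shows "lin R A TT (%y. tt q (proj q y) c)"
proof (rule linI)
 fix y assume y: "y .: A"
 note py = proj_in_part[OF y, of q]
 show "tt q (proj q y) c .: TT" by (rule tt_closed[OF assms(1) py assms(2)])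
 show "tt q (proj q (a \<odot>.A y)) c = a \<odot>.TT tt q (proj q y) c" if a: "a .: R" for a
  unfolding linD(3)[OF proj_lin a y] by (rule tt_sml[OF assms(1) py assms(2) a])
 fix z assume z: "z .: A"
 show "tt q (proj q (y \<oplus>.A z)) c = tt q (proj q y) c \<oplus>.TT tt q (proj q z) c"
  unfolding linD(2)[OF proj_lin y z] by (rule tt_addl[OF assms(1) py proj_in_part[OF z] assms(2)])
qed

lemma Phi_lin:
 assumes "p .: L" "c \<in> D p"
 shows "lin R A TT (Phi p c)"
 unfolding Phi_def[abs_def]
 by (rule TT.lin_finsum_fun[OF finite_below _ A.mod]) (use below_D[OF assms] in "intro tt_proj_lin; blast")

lemma Phi_part:
 assumes "p .: L" "c \<in> D p" "q .: L" "q \<sqsubseteq>.L p" "y \<in> part q"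
 shows "Phi p c y = tt q y c"
proof -
 have q: "q \<in> below p" using assms by (simp add: below_def)
 have yc: "y .: A" using assms by simp
 have cq: "c \<in> D q" using below_D[OF assms(1,2) q] by blast
 have t: "tt q y c .: TT" by (rule tt_closed[OF assms(3,5) cq])
 have "Phi p c y = (\<Oplus>.TT s\<in>below p. if q = s then tt q y c else \<zero>.TT)"
  unfolding Phi_def
 proof (rule TT.M.finsum_cong')
  show "(%s. if q = s then tt q y c else \<zero>.TT) \<in> below p \<rightarrow> carrier TT" using t by auto
  fix s assume s: "s \<in> below p"
  show "tt s (proj s y) c = (if q = s then tt q y c else \<zero>.TT)"
  using proj_part[OF assms(5)] proj_other[OF assms(5), of s] tt_zero_left[of s c] below_D[OF assms(1,2) s] by auto
 qed simp
 also have "... = tt q y c" by (rule TT.M.finsum_singleton[OF q finite_below]) (use t in auto)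
 finally show ?thesis .
qed

text \<open>\<open>\<partial> x\<close> is the sum of its components, and those at flats not covered
  by \<open>p\<close> vanish by \<open>d_part\<close>. Identities involving \<open>Phi\<close> are
  thereby checked on a single \<open>part q\<close>, where \<open>Phi\<close> is one symbol.\<close>

lemma d_linear_eqI:
 assumes "module R V" "lin R A V f" "lin R A V g" "p .: L" "x \<in> part p"
  "!!q u. covers L p q ==> u \<in> part q ==> f u = g u"
 shows "f (dif A x) = g (dif A x)"
proof -
 interpret V: module R V by fact
 let ?y = "dif A x"
 have y: "?y .: A" using assms(5) by simp
 have "f ?y = f (\<Oplus>.A q\<in>carrier L. proj q ?y)" using sum_proj[OF y] by simp
 also have "... = (\<Oplus>.V q\<in>carrier L. f (proj q ?y))"
  by (rule lin_finsum[OF A.mod assms(1,2) finite_carrier]) (use y in auto)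
 also have "... = (\<Oplus>.V q\<in>carrier L. g (proj q ?y))"
 proof (rule V.M.finsum_cong')
  show "(%q. g (proj q ?y)) \<in> carrier L \<rightarrow> carrier V" using linD(1)[OF assms(3)] y by auto
  fix q
  show "f (proj q ?y) = g (proj q ?y)"
  proof (cases "covers L p q")
  case True thus ?thesis using assms(6) proj_in_part[OF y] by blast
  next
  case False
  thus ?thesis using d_part[OF assms(4,5)] lin_zero[OF A.mod assms(1,2)] lin_zero[OF A.mod assms(1,3)] by simp
  qed
 qed simp
 also have "... = g (\<Oplus>.A q\<in>carrier L. proj q ?y)"
  by (rule lin_finsum[OF A.mod assms(1,3) finite_carrier, symmetric]) (use y in auto)
 also have "... = g ?y" using sum_proj[OF y] by simp
 finally show ?thesis .
qed

lemma tt_d: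
 assumes "p .: L" "x \<in> part p" "c \<in> D p"
 shows "dif TT (tt p x c) = Phi p c (dif A x) \<oplus>.TT sg R (int (r p)) \<odot>.TT tt p x (dif C c)"
 using assms(1,3)
proof (induction c rule: D_induct)
 case (add c d)
 have dx: "dif A x .: A" using assms by simp
 have cc: "c .: C" "d .: C" using D_closed assms add by auto
 have cd: "c \<oplus>.C d \<in> D p" by (rule D_add[OF assms(1) add(1,2)])
 have P: "Phi p (c \<oplus>.C d) (dif A x) = Phi p c (dif A x) \<oplus>.TT Phi p d (dif A x)"
 proof (rule d_linear_eqI[OF TT.mod Phi_lin[OF assms(1) cd] TT.lin_sum[OF Phi_lin[OF assms(1) add(1)] Phi_lin[OF assms(1) add(2)]] assms(1,2)])
  fix q u assume "covers L p q" and u: "u \<in> part q"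
  hence q: "q .: L" "q \<sqsubseteq>.L p" using coversD by auto
  have cq: "c \<in> D q" "d \<in> D q" using D_mono[OF assms(1) q] add by auto
  show "Phi p (c \<oplus>.C d) u = Phi p c u \<oplus>.TT Phi p d u"
  unfolding Phi_part[OF assms(1) cd q u] Phi_part[OF assms(1) add(1) q u] Phi_part[OF assms(1) add(2) q u]
  by (rule tt_addr[OF q(1) u cq])
 qed
 note dD = D_d[OF assms(1) add(1)] D_d[OF assms(1) add(2)]
 note t = tt_closed[OF assms(1,2) dD(1)] tt_closed[OF assms(1,2) dD(2)] tt_closed[OF assms(1,2) add(1)] tt_closed[OF assms(1,2) add(2)]
 have Pc: "Phi p c (dif A x) .: TT" "Phi p d (dif A x) .: TT"
  using linD(1)[OF Phi_lin[OF assms(1) add(1)] dx] linD(1)[OF Phi_lin[OF assms(1) add(2)] dx] .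
 show ?case unfolding tt_addr[OF assms(1,2) add(1,2)] C.d_add[OF cc] tt_addr[OF assms(1,2) dD] P TT.d_add[OF t(3,4)] add(3,4)
  using t Pc by (simp add: TT.smult_r_distr TT.M.a_ac)
next
 case (homog c k)
 have G: "(p, k, x, c) \<in> G" using assms homog by (simp add: G_iff)
 have dx: "dif A x .: A" using assms by simp
 have "(\<Oplus>.TT q\<in>{q. covers L p q}. sym (q, k, proj q (dif A x), c)) = (\<Oplus>.TT q\<in>{q. covers L p q}. tt q (proj q (dif A x)) c)"
 proof (rule TT.M.finsum_cong')
  show "(%q. tt q (proj q (dif A x)) c) \<in> {q. covers L p q} \<rightarrow> carrier TT"
  using coversD D_mono[OF assms(1)] homog proj_in_part[OF dx] by (auto intro!: tt_closed)
  fix q assume "q \<in> {q. covers L p q}"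
  hence q: "q .: L" "q \<sqsubseteq>.L p" using coversD[of p q] by auto
  have cq: "c \<in> D q" using D_mono[OF assms(1) q] homog by auto
  show "sym (q, k, proj q (dif A x), c) = tt q (proj q (dif A x)) c"
  by (rule tt_homog[OF q(1) proj_in_part[OF dx] cq homog(2), symmetric])
 qed simp
 also have "... = Phi p c (dif A x)"
  unfolding Phi_def
 proof (rule TT.M.add.finprod_mono_neutral_cong_left[OF finite_below])
  show "{q. covers L p q} <= below p" using coversD by (auto simp: below_def)
  show "tt q (proj q (dif A x)) c = \<zero>.TT" if "q \<in> below p - {q. covers L p q}" for q
  using that d_part[OF assms(1,2), of q] tt_zero_left below_D[OF assms(1) homog(1), of q] by auto
  show "(%q. tt q (proj q (dif A x)) c) \<in> below p \<rightarrow> carrier TT"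
  using below_D[OF assms(1) homog(1)] proj_in_part[OF dx] by (auto intro!: tt_closed)
 qed simp
 finally show ?case unfolding tt_homog[OF assms(1,2) homog] sym_d[OF G]
  using tt_homog[OF assms(1,2) D_d[OF assms(1) homog(1)] homog_d[OF homog(2)]] by simp
qed

lemma tt_one: "\<one>.TT = tt \<bottom>.L \<one>.A \<one>.C"
 unfolding sym_one by (rule tt_homog[OF bottom_in one_in_part _ homog_one, symmetric]) (simp add: D_bottom)

text \<open>The total degree of \<open>x \<otimes> c\<close> is \<open>deg c - r p\<close>, hence
  the shift of the weight by \<open>r p\<close>.\<close>

definition grT where
 "grT th = tlift TT (%p x c. tt p x (gr (%k. th (k - int (r p))) c))"

lemma shift_in: "th .> R ==> (%k. th (k - j)) .> R" for j :: int
 by auto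

lemma grT_bilinear:
 assumes "th .> R"
 shows "bilinear_family TT (%p x c. tt p x (gr (%k. th (k - int (r p))) c))"
proof -
 note gl = linD[OF C.gr_lin[OF shift_in[OF assms]]]
 have gD: "gr (%k. th (k - int (r p))) c \<in> D p" if "p .: L" "c \<in> D p" for p c
  by (rule D_gr[OF that shift_in[OF assms]])
 show ?thesis unfolding bilinear_family_def
  using gD D_closed by (simp add: tt_addl tt_sml gl tt_addr tt_smr)
qed

lemmas grT_lin = tlift(1)[OF TT.mod grT_bilinear, folded grT_def]
lemmas grT_tt = tlift(2)[OF TT.mod grT_bilinear, folded grT_def]

lemma homog_TT: "homog TT k = qN ` homog F k"
 unfolding OS_tensor_def by (rule qalg_simps)

lemma homog_F: "homog F k = fsupp R {u \<in> G. gen_deg u = k}"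
 unfolding F_simps(7) by (auto simp: fsupp_def)

lemma homog_F_subset: "homog F k <= carrier F"
 by (auto simp: F_simps(1,7))

lemma homog_TT_sub: "submodule (homog TT k) R TT"
proof -
 note q = linD[OF qN_lin]
 show ?thesis
 proof (rule TT.subI')
  show "homog TT k <= carrier TT" unfolding homog_TT using q(1) homog_F_subset by auto
  have "\<zero>.F \<in> homog F k" unfolding homog_F F_simps(4) by (rule fsf_zero)
  thus "\<zero>.TT \<in> homog TT k" unfolding homog_TT
  using lin_zero[OF FA.mod TT.mod qN_lin] by (metis imageI)
 next
  fix z w assume "z \<in> homog TT k" "w \<in> homog TT k"
  then obtain f g where fg: "f \<in> homog F k" "z = qN f" "g \<in> homog F k" "w = qN g" unfolding homog_TT by auto
  have "f \<oplus>.F g \<in> homog F k" using fg fsf_add unfolding homog_F F_simps(5) by blast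
  moreover have "z \<oplus>.TT w = qN (f \<oplus>.F g)" using fg q(2) homog_F_subset by auto
  ultimately show "z \<oplus>.TT w \<in> homog TT k" unfolding homog_TT by blast
 next
  fix a z assume a: "a .: R" and "z \<in> homog TT k"
  then obtain f where fg: "f \<in> homog F k" "z = qN f" unfolding homog_TT by auto
  have "a \<odot>.F f \<in> homog F k" using fg fsf_smult a unfolding homog_F F_simps(6) by blast
  moreover have "a \<odot>.TT z = qN (a \<odot>.F f)" using fg q(3)[OF a] homog_F_subset by auto
  ultimately show "a \<odot>.TT z \<in> homog TT k" unfolding homog_TT by blast
 qed
qed

lemma tt_in_homog:
 assumes "p .: L" "x \<in> part p" "c \<in> D p" "c \<in> homog C k"
 shows "tt p x c \<in> homog TT (k - int (r p))"
 unfolding tt_homog[OF assms] sym_def homog_TT homog_F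
 by (intro imageI basis_elt_in) (use assms in "auto simp: G_iff gen_deg_def")

lemma homog_TT_minimal:
 assumes "submodule H R TT"
  "!!p x c j. p .: L ==> x \<in> part p ==> c \<in> D p ==> c \<in> homog C j ==> k = j - int (r p) ==> tt p x c \<in> H"
 shows "homog TT k <= H"
proof
 note q = linD[OF qN_lin]
 fix z assume "z \<in> homog TT k"
 then obtain f where f: "f \<in> fsupp R {u \<in> G. gen_deg u = k}" "z = qN f" unfolding homog_TT homog_F by auto
 have "f \<in> {f \<in> carrier F. qN f \<in> H}"
  using f(1)
 proof (rule fsf_induct)
  show "(%_. \<zero>) \<in> {f \<in> carrier F. qN f \<in> H}"
  using lin_zero[OF FA.mod TT.mod qN_lin] subD(2)[OF assms(1)] FA.M.zero_closed by (simp add: F_simps(4))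
 next
  fix f g assume "f \<in> {f \<in> carrier F. qN f \<in> H}" "g \<in> {f \<in> carrier F. qN f \<in> H}"
  hence *: "f .: F" "g .: F" "qN f \<in> H" "qN g \<in> H" by auto
  have "qN (f \<oplus>.F g) \<in> H" unfolding q(2)[OF *(1,2)] by (rule subD(3)[OF assms(1) *(3,4)])
  thus "(%u. f u \<oplus> g u) \<in> {f \<in> carrier F. qN f \<in> H}"
  using FA.M.a_closed[OF *(1,2)] unfolding F_simps(5) by blast
 next
  fix a u assume a: "a .: R" and u: "u \<in> {u \<in> G. gen_deg u = k}"
  obtain p j x c where ue: "u = (p, j, x, c)" by (cases u)
  have pc: "p .: L" "x \<in> part p" "c \<in> D p" "c \<in> homog C j" "k = j - int (r p)" and uG: "u \<in> G"
  using u ue by (auto simp: G_iff gen_deg_def)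
  have "qN (gen u) \<in> H" using assms(2)[OF pc] tt_homog[OF pc(1-4)] by (simp add: sym_def ue)
  hence "qN (a \<odot>.F gen u) \<in> H" unfolding q(3)[OF a Fgen_in[OF uG]] by (rule subD(4)[OF assms(1) a])
  thus "(%w. a \<otimes> gen u w) \<in> {f \<in> carrier F. qN f \<in> H}"
  using FA.smult_closed[OF a Fgen_in[OF uG]] unfolding F_simps(6) by blast
 qed
 thus "z \<in> H" using f(2) by simp
qed

text \<open>The parity of the rank of a join is known only where ranks add up; elsewhere the product
  of the OS-factors is zero and any sign will do.\<close>

lemma tt_sign_cong:
 assumes "p .: L" "x \<in> part p" "c \<in> D p" "x = \<zero>.A | even (a - b)"
 shows "sg R a \<odot>.TT tt p x c = sg R b \<odot>.TT tt p x c"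
proof (cases "x = \<zero>.A")
 case True thus ?thesis using tt_zero_left[OF assms(1,3)] by simp
next
 case False thus ?thesis using neg_one_pow_cong[of a b R] assms(4) by simp
qed

text \<open>The two mixed terms are the same element with the signs of \<open>r p\<close> and of
  \<open>r p - 1\<close>, since \<open>\<partial>\<close> lowers the rank by one; they cancel. The
  pure terms vanish by \<open>d_d_A\<close> and by \<open>dif C (dif C c) = 0\<close>.\<close>

lemma tt_dd:
 assumes "p .: L" "x \<in> part p" "c \<in> D p"
 shows "dif TT (dif TT (tt p x c)) = \<zero>.TT"
proof -
 let ?y = "dif A x" and ?e = "dif C c"
 have y: "?y .: A" using assms by simp
 have cc: "c .: C" by (rule D_closed[OF assms(1,3)])
 have eD: "?e \<in> D p" by (rule D_d[OF assms(1,3)])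
 note PL = Phi_lin[OF assms(1,3)] and PeL = Phi_lin[OF assms(1) eD]
 have W: "Phi p ?e ?y .: TT" by (rule linD(1)[OF PeL y])
 have 1: "dif TT (tt p x ?e) = Phi p ?e ?y"
  unfolding tt_d[OF assms(1,2) eD] C.d_d[OF cc] tt_zero_right[OF assms(1,2)] using W by simp
 have 2: "dif TT (Phi p c ?y) = Phi p c (dif A ?y) \<oplus>.TT sg R (int (r p) - 1) \<odot>.TT Phi p ?e ?y"
 proof (rule d_linear_eqI[OF TT.mod lin_comp[OF PL TT.d_lin]
  TT.lin_sum[OF lin_comp[OF A.d_lin PL] TT.lin_smult[OF PeL sg_closed]] assms(1,2)])
  fix q u assume cov: "covers L p q" and u: "u \<in> part q"
  hence q: "q .: L" "q \<sqsubseteq>.L p" using coversD by auto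
  have cq: "c \<in> D q" using D_mono[OF assms(1) q] assms by auto
  have rq: "int (r p) - 1 = int (r q)" using covers_rank[OF cov] by simp
  have 3: "Phi q c (dif A u) = Phi p c (dif A u)"
  proof (rule d_linear_eqI[OF TT.mod Phi_lin[OF q(1) cq] PL q(1) u])
  fix s v assume cs: "covers L q s" and v: "v \<in> part s"
  hence s: "s .: L" "s \<sqsubseteq>.L q" using coversD by auto
  have sp: "s \<sqsubseteq>.L p" by (rule le_trans[OF s(1) q(1) assms(1) s(2) q(2)])
  show "Phi q c v = Phi p c v" unfolding Phi_part[OF q(1) cq s v] Phi_part[OF assms(1,3) s(1) sp v] ..
  qed
  show "dif TT (Phi p c u) = Phi p c (dif A u) \<oplus>.TT sg R (int (r p) - 1) \<odot>.TT Phi p ?e u"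
  unfolding Phi_part[OF assms(1,3) q u] Phi_part[OF assms(1) eD q u] tt_d[OF q(1) u cq] 3 rq ..
 qed
 have 4: "Phi p c (dif A ?y) = \<zero>.TT"
  using d_d_A[of x] assms lin_zero[OF A.mod TT.mod PL] by simp
 have 5: "sg R (int (r p) - 1) = \<ominus> sg R (int (r p))"
  by (auto simp: neg_one_pow_def)
 have "dif TT (dif TT (tt p x c)) = dif TT (Phi p c ?y) \<oplus>.TT sg R (int (r p)) \<odot>.TT dif TT (tt p x ?e)"
  unfolding tt_d[OF assms] using linD(1)[OF PL y] tt_closed[OF assms(1,2) eD] by (simp add: TT.d_add TT.d_smult)
 also have "... = \<zero>.TT" unfolding 1 2 4 5 using W by (simp add: TT.smult_l_minus TT.M.l_neg)
 finally show ?thesis .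
qed

text \<open>Both sides expand into the same four terms, with \<open>\<partial>\<close> or
  \<open>dif C\<close> on either factor, and what remains is a comparison of exponents modulo two in
  \<open>S1\<close> to \<open>S4\<close>. The terms with \<open>dif C\<close> carry the OS-factor
  \<open>x y\<close>, so there the rank of the join may be replaced by \<open>r p + r q\<close>:
  otherwise \<open>x y\<close> is zero.\<close>

lemma tt_leibniz:
 assumes "p .: L" "x \<in> part p" "c \<in> D p" "c \<in> homog C k" "q .: L" "y \<in> part q" "d \<in> D q"
 shows "dif TT (tt p x c \<otimes>.TT tt q y d) =
  dif TT (tt p x c) \<otimes>.TT tt q y d \<oplus>.TT grT (sg R) (tt p x c) \<otimes>.TT dif TT (tt q y d)"
proof -
 let ?P = "p \<squnion>.L q" and ?n = "sg R" and ?e = "c \<otimes>.C d" and ?xy = "x \<otimes>.A y"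
 let ?dc = "dif C c" and ?dd = "dif C d" and ?dx = "dif A x" and ?dy = "dif A y"
 have PL: "?P .: L" by (rule join_in[OF assms(1,5)])
 have xyP: "?xy \<in> part ?P" by (rule part_mult[OF assms(2,6)])
 have eD: "?e \<in> D ?P" by (rule D_mult[OF assms(1,5,3,7)])
 have cc: "c .: C" "d .: C" using D_closed assms by auto
 have ac: "x .: A" "y .: A" "?dx .: A" "?dy .: A" using assms by auto
 have dcD: "?dc \<in> D p" "?dc \<in> homog C (k + 1)" "?dd \<in> D q" using D_d assms homog_d by auto
 have uD: "?dc \<otimes>.C d \<in> D ?P" by (rule D_mult[OF assms(1,5) dcD(1) assms(7)])
 have vD: "c \<otimes>.C ?dd \<in> D ?P" by (rule D_mult[OF assms(1,5) assms(3) dcD(3)])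
 note Pe = Phi_lin[OF PL eD]
 have tq: "tt q y d .: TT" "tt p x c .: TT" using assms by auto
 have Pc: "Phi ?P ?e (?dx \<otimes>.A y) .: TT" "Phi ?P ?e (x \<otimes>.A ?dy) .: TT" "tt ?P ?xy (?dc \<otimes>.C d) .: TT" "tt ?P ?xy (c \<otimes>.C ?dd) .: TT"
  using linD(1)[OF Pe] ac tt_closed[OF PL xyP uD] tt_closed[OF PL xyP vD] by auto
 have z: "?xy = \<zero>.A | r ?P = r p + r q" using part_mult_zero[OF assms(2,6)] by blast
 have sm: "?n a \<odot>.TT (?n b \<odot>.TT w) = ?n (a + b) \<odot>.TT w" if "w .: TT" for a b w
  using that by (simp add: sg_add TT.smult_assoc1)
 have A1: "Phi p c ?dx \<otimes>.TT tt q y d = ?n (k * int (r q)) \<odot>.TT Phi ?P ?e (?dx \<otimes>.A y)"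
 proof (rule d_linear_eqI[OF TT.mod lin_comp[OF Phi_lin[OF assms(1,3)] TT.rmul_lin[OF tq(1)]]
  TT.lin_smult[OF lin_comp[OF A.rmul_lin[OF ac(2)] Pe] sg_closed] assms(1,2)])
  fix s u assume cov: "covers L p s" and u: "u \<in> part s"
  hence s: "s .: L" "s \<sqsubseteq>.L p" using coversD by auto
  have cs: "c \<in> D s" using D_mono[OF assms(1) s] assms by auto
  have le: "s \<squnion>.L q \<sqsubseteq>.L ?P"
  by (rule join_least[OF s(1) assms(5) PL le_trans[OF s(1) assms(1) PL s(2) join_upper1[OF assms(1,5)]] join_upper2[OF assms(1,5)]])
  show "Phi p c u \<otimes>.TT tt q y d = ?n (k * int (r q)) \<odot>.TT Phi ?P ?e (u \<otimes>.A y)"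
  unfolding Phi_part[OF assms(1,3) s u] Phi_part[OF PL eD join_in[OF s(1) assms(5)] le part_mult[OF u assms(6)]]
  by (rule tt_mult[OF s(1) u cs assms(4-7)])
 qed
 have A2: "tt p x c \<otimes>.TT Phi q d ?dy = ?n (k * (int (r q) - 1)) \<odot>.TT Phi ?P ?e (x \<otimes>.A ?dy)"
 proof (rule d_linear_eqI[OF TT.mod lin_comp[OF Phi_lin[OF assms(5,7)] TT.lmul_lin[OF tq(2)]]
  TT.lin_smult[OF lin_comp[OF A.lmul_lin[OF ac(1)] Pe] sg_closed] assms(5,6)])
  fix s u assume cov: "covers L q s" and u: "u \<in> part s"
  hence s: "s .: L" "s \<sqsubseteq>.L q" using coversD by auto
  have ds: "d \<in> D s" using D_mono[OF assms(5) s] assms by auto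
  have le: "p \<squnion>.L s \<sqsubseteq>.L ?P"
  by (rule join_least[OF assms(1) s(1) PL join_upper1[OF assms(1,5)] le_trans[OF s(1) assms(5) PL s(2) join_upper2[OF assms(1,5)]]])
  have rs: "int (r q) - 1 = int (r s)" using covers_rank[OF cov] by simp
  show "tt p x c \<otimes>.TT Phi q d u = ?n (k * (int (r q) - 1)) \<odot>.TT Phi ?P ?e (x \<otimes>.A u)"
  unfolding Phi_part[OF assms(5,7) s u] Phi_part[OF PL eD join_in[OF assms(1) s(1)] le part_mult[OF assms(2) u]] rs
  by (rule tt_mult[OF assms(1-4) s(1) u ds])
 qed
 have A3: "tt p x ?dc \<otimes>.TT tt q y d = ?n ((k + 1) * int (r q)) \<odot>.TT tt ?P ?xy (?dc \<otimes>.C d)"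
  by (rule tt_mult[OF assms(1,2) dcD(1,2) assms(5-7)])
 have A4: "tt p x c \<otimes>.TT tt q y ?dd = ?n (k * int (r q)) \<odot>.TT tt ?P ?xy (c \<otimes>.C ?dd)"
  by (rule tt_mult[OF assms(1-6) dcD(3)])
 have A5: "grT ?n (tt p x c) = ?n (k - int (r p)) \<odot>.TT tt p x c"
 proof -
  have n: "?n .> R" by simp
  have "gr (%k. ?n (k - int (r p))) c = ?n (k - int (r p)) \<odot>.C c" by (rule C.gr_homog[OF shift_in[OF n] assms(4)])
  thus ?thesis unfolding grT_tt[OF n assms(1-3)] using tt_smr[OF assms(1-3) sg_closed] by simp
 qed
 have B: "dif A ?xy = ?dx \<otimes>.A y \<oplus>.A ?n (int (r p)) \<odot>.A (x \<otimes>.A ?dy)" by (rule leibniz_A[OF assms(2) ac(2)])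
 have B2: "Phi ?P ?e (dif A ?xy) = Phi ?P ?e (?dx \<otimes>.A y) \<oplus>.TT ?n (int (r p)) \<odot>.TT Phi ?P ?e (x \<otimes>.A ?dy)"
  unfolding B using linD[OF Pe] ac by simp
 have C1: "gr ?n c = ?n k \<odot>.C c" by (rule C.gr_homog[OF _ assms(4)]) simp
 have C2: "dif C ?e = ?dc \<otimes>.C d \<oplus>.C ?n k \<odot>.C (c \<otimes>.C ?dd)"
  unfolding C.leibniz[OF cc] C1 using C.smult_mult_l[OF sg_closed cc(1)] cc by simp
 have C3: "tt ?P ?xy (dif C ?e) = tt ?P ?xy (?dc \<otimes>.C d) \<oplus>.TT ?n k \<odot>.TT tt ?P ?xy (c \<otimes>.C ?dd)"
  unfolding C2 tt_addr[OF PL xyP uD D_smult[OF PL sg_closed vD]] tt_smr[OF PL xyP vD sg_closed] ..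
 have lhs: "dif TT (tt p x c \<otimes>.TT tt q y d) =
  (?n (k * int (r q)) \<odot>.TT Phi ?P ?e (?dx \<otimes>.A y) \<oplus>.TT ?n (k * int (r q) + int (r p)) \<odot>.TT Phi ?P ?e (x \<otimes>.A ?dy)) \<oplus>.TT
  (?n (k * int (r q) + int (r ?P)) \<odot>.TT tt ?P ?xy (?dc \<otimes>.C d) \<oplus>.TT ?n (k * int (r q) + (int (r ?P) + k)) \<odot>.TT tt ?P ?xy (c \<otimes>.C ?dd))"
  unfolding tt_mult[OF assms] TT.d_smult[OF sg_closed tt_closed[OF PL xyP eD]] tt_d[OF PL xyP eD] B2 C3
  using Pc by (simp add: TT.smult_r_distr sm add.assoc)
 have S1: "?n (k * int (r q) + int (r ?P)) \<odot>.TT tt ?P ?xy (?dc \<otimes>.C d) = ?n (int (r p) + (k + 1) * int (r q)) \<odot>.TT tt ?P ?xy (?dc \<otimes>.C d)"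
  by (rule tt_sign_cong[OF PL xyP uD]) (use z in "auto simp: algebra_simps")
 have S2: "?n (k * int (r q) + (int (r ?P) + k)) \<odot>.TT tt ?P ?xy (c \<otimes>.C ?dd) = ?n (k - int (r p) + (int (r q) + k * int (r q))) \<odot>.TT tt ?P ?xy (c \<otimes>.C ?dd)"
  by (rule tt_sign_cong[OF PL xyP vD]) (use z in "auto simp: algebra_simps")
 have S3: "?n (k * int (r q) + int (r p)) = ?n (k - int (r p) + k * (int (r q) - 1))"
  by (rule neg_one_pow_cong) (simp add: algebra_simps)
 have S4: "int (r q) + (k - int (r p) + k * int (r q)) = k - int (r p) + (int (r q) + k * int (r q))" by simp
 have Pcx: "Phi p c ?dx .: TT" "Phi q d ?dy .: TT" "tt p x ?dc .: TT" "tt q y ?dd .: TT"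
  using linD(1)[OF Phi_lin[OF assms(1,3)] ac(3)] linD(1)[OF Phi_lin[OF assms(5,7)] ac(4)]
  tt_closed[OF assms(1,2) dcD(1)] tt_closed[OF assms(5,6) dcD(3)] .
 have "dif TT (tt p x c) \<otimes>.TT tt q y d = ?n (k * int (r q)) \<odot>.TT Phi ?P ?e (?dx \<otimes>.A y) \<oplus>.TT ?n (int (r p) + (k + 1) * int (r q)) \<odot>.TT tt ?P ?xy (?dc \<otimes>.C d)"
  unfolding tt_d[OF assms(1-3)] using Pcx tq
  by (simp only: TT.mult_l_distr TT.smult_closed sg_closed TT.smult_mult_l A1 A3 sm[OF Pc(3)])
 moreover have "grT ?n (tt p x c) \<otimes>.TT dif TT (tt q y d) =
  ?n (k - int (r p) + k * (int (r q) - 1)) \<odot>.TT Phi ?P ?e (x \<otimes>.A ?dy) \<oplus>.TT ?n (k - int (r p) + (int (r q) + k * int (r q))) \<odot>.TT tt ?P ?xy (c \<otimes>.C ?dd)"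
  unfolding A5 tt_d[OF assms(5-7)] using Pcx tq Pc
  by (simp add: TT.mult_r_distr TT.smult_mult_l TT.smult_mult_r A2 A4 sm TT.smult_r_distr S4)
 ultimately show ?thesis unfolding lhs S1 S2 S3 using Pc by (simp add: TT.M.a_ac)
qed

lemma TT_graded_dga: "graded_dga R TT grT"
proof (intro graded_dga.intro graded_dga_axioms.intro TT.diff_alg_axioms)
 note M = TT.mod
 fix th \<eta> :: "int => 'r" assume th: "th .> R"
 show "lin R TT TT (grT th)" by (rule grT_lin[OF th])
 show "grT th z = th k \<odot>.TT z" if z: "z \<in> homog TT k" for z k
 proof -
  have tk: "th k .: R" using th by auto
  have lk: "lin R TT TT (%z. th k \<odot>.TT z)" by (rule TT.lin_smult[OF lin_id tk])
  have sub: "submodule {z \<in> carrier TT. grT th z = th k \<odot>.TT z} R TT"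
  using linD[OF grT_lin[OF th]] linD[OF lk] lin_zero[OF M M grT_lin[OF th]] lin_zero[OF M M lk]
  by (intro TT.subI') (simp_all add: subset_iff)
  have "homog TT k <= {z \<in> carrier TT. grT th z = th k \<odot>.TT z}"
  proof (rule homog_TT_minimal[OF sub])
  fix p x c j assume a: "p .: L" "x \<in> part p" "c \<in> D p" "c \<in> homog C j" and k: "k = j - int (r p)"
  have "gr (%k. th (k - int (r p))) c = th k \<odot>.C c" using C.gr_homog[OF shift_in[OF th] a(4)] k by simp
  thus "tt p x c \<in> {z \<in> carrier TT. grT th z = th k \<odot>.TT z}"
  using a by (simp add: grT_tt[OF th a(1-3)] tt_smr[OF a(1-3) tk])
  qed
  thus ?thesis using z by blast
 qed
 fix z assume z: "z .: TT"
 show "grT th (grT \<eta> z) = grT (%k. th k \<otimes> \<eta> k) z" if \<eta>: "\<eta> .> R"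
 proof (rule TT_linear_eqI[OF M lin_comp[OF grT_lin[OF \<eta>] grT_lin[OF th]] grT_lin _ z])
  show te: "(%k. th k \<otimes> \<eta> k) .> R" using th \<eta> by auto
  fix p x c assume a: "p .: L" "x \<in> part p" "c \<in> D p"
  show "grT th (grT \<eta> (tt p x c)) = grT (%k. th k \<otimes> \<eta> k) (tt p x c)"
  unfolding grT_tt[OF \<eta> a] grT_tt[OF te a] grT_tt[OF th a(1,2) D_gr[OF a(1,3) shift_in[OF \<eta>]]]
  C.gr_gr[OF shift_in[OF th] shift_in[OF \<eta>] D_closed[OF a(1,3)]] ..
 qed
 show "dif TT (grT th z) = grT (%k. th (k - 1)) (dif TT z)"
 proof (rule TT_linear_eqI[OF M lin_comp[OF grT_lin[OF th] TT.d_lin] lin_comp[OF TT.d_lin grT_lin[OF shift_in[OF th]]] _ z])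
  fix p x c assume a: "p .: L" "x \<in> part p" "c \<in> D p"
  let ?g = "gr (%k. th (k - int (r p))) c"
  have g: "?g \<in> D p" by (rule D_gr[OF a(1,3) shift_in[OF th]])
  have cc: "c .: C" by (rule D_closed[OF a(1,3)])
  have dx: "dif A x .: A" using a by simp
  have th': "(%k. th (k - 1)) .> R" by (rule shift_in[OF th])
  have sh: "(%k. th (k - int s - 1)) = (%k. th (k - 1 - int s))" for s by (simp add: algebra_simps)
  have 1: "Phi p ?g (dif A x) = grT (%k. th (k - 1)) (Phi p c (dif A x))"
  proof (rule d_linear_eqI[OF M Phi_lin[OF a(1) g] lin_comp[OF Phi_lin[OF a(1,3)] grT_lin[OF th']] a(1,2)])
  fix q u assume cov: "covers L p q" and u: "u \<in> part q"
  hence q: "q .: L" "q \<sqsubseteq>.L p" using coversD by auto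
  have cq: "c \<in> D q" using D_mono[OF a(1) q] a by auto
  have "(%k. th (k - int (r q) - 1)) = (%k. th (k - int (r p)))" using covers_rank[OF cov] by (simp add: algebra_simps)
  thus "Phi p ?g u = grT (%k. th (k - 1)) (Phi p c u)"
  unfolding Phi_part[OF a(1) g q u] Phi_part[OF a(1,3) q u] grT_tt[OF th' q(1) u cq] by simp
  qed
  have 2: "dif C ?g = gr (%k. th (k - int (r p) - 1)) (dif C c)"
  using C.d_gr[OF shift_in[OF th] cc, of "int (r p)"] sh[of "r p"] by simp
  note P = linD(1)[OF Phi_lin[OF a(1,3)] dx]
  note t = tt_closed[OF a(1,2) D_d[OF a(1,3)]]
  show "dif TT (grT th (tt p x c)) = grT (%k. th (k - 1)) (dif TT (tt p x c))"
  unfolding grT_tt[OF th a] tt_d[OF a(1,2) g] tt_d[OF a] 1 2 linD(2)[OF grT_lin[OF th'] P TT.smult_closed[OF sg_closed t]]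
  linD(3)[OF grT_lin[OF th'] sg_closed t] grT_tt[OF th' a(1,2) D_d[OF a(1,3)]] ..
 qed
next
 fix k show "homog TT k <= carrier TT" by (rule subD(1)[OF homog_TT_sub])
next
 note M = TT.mod
 fix z assume z: "z .: TT"
 have one: "(%_::int. \<one>) .> R" by simp
 show "grT (%_. \<one>) z = z"
 proof (rule TT_linear_eqI[OF M grT_lin[OF one] lin_id _ z])
  fix p x c assume a: "p .: L" "x \<in> part p" "c \<in> D p"
  show "grT (%_. \<one>) (tt p x c) = tt p x c" unfolding grT_tt[OF one a] C.gr_one[OF D_closed[OF a(1,3)]] ..
 qed
 show "grT (%j. if j = k then \<one> else \<zero>) z \<in> homog TT k" for k
 proof -
  note gl = linD[OF grT_lin[OF ind_in]] and h = subD[OF homog_TT_sub[of k]]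
  have "submodule {z \<in> carrier TT. pr' z \<in> homog TT k} R TT" if "pr' = grT (%j. if j = k then \<one> else \<zero>)" for pr'
  unfolding that using gl h lin_zero[OF M M grT_lin[OF ind_in]]
  by (intro TT.subI') (simp_all add: subset_iff)
  from TT_submodule_induct[OF this[OF refl] _ z] show ?thesis
  proof -
  have "tt p x c \<in> {z \<in> carrier TT. grT (%j. if j = k then \<one> else \<zero>) z \<in> homog TT k}"
  if a: "p .: L" "x \<in> part p" "c \<in> D p" for p x c
  proof -
  have e: "(%j. if j - int (r p) = k then \<one> else \<zero>) = (%j. if j = k + int (r p) then \<one> else \<zero>)" by auto
  have "pr (k + int (r p)) c \<in> D p" "pr (k + int (r p)) c \<in> homog C (k + int (r p))"
  using D_gr[OF a(1,3) ind_in] pr_homog[OF D_closed[OF a(1,3)]] by auto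
  from tt_in_homog[OF a(1,2) this] show ?thesis using a grT_tt[OF ind_in a, of k] e by simp
  qed
  thus ?thesis using TT_submodule_induct[OF \<open>!!pr'. pr' = grT (%j. if j = k then \<one> else \<zero>) ==> submodule {z \<in> carrier TT. pr' z \<in> homog TT k} R TT\<close>[OF refl] _ z] by blast
  qed
 qed
 show "dif TT (dif TT z) = \<zero>.TT"
  by (rule TT_linear_eqI[OF M lin_comp[OF TT.d_lin TT.d_lin] TT.lin_const_zero tt_dd z])
next
 note M = TT.mod
 have n: "sg R .> R" by simp
 have d1: "dif A \<one>.A = \<zero>.A"
  using os_d[OF TA.unit_closed] os_one os_zero by (simp add: T_one d_mono_Nil)
 show "dif TT \<one>.TT = \<zero>.TT"
 proof -
  have c1: "\<one>.C \<in> D \<bottom>.L" by (simp add: D_bottom)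
  show ?thesis unfolding tt_one tt_d[OF bottom_in one_in_part c1] d1 C.d_one tt_zero_right[OF bottom_in one_in_part]
  lin_zero[OF A.mod M Phi_lin[OF bottom_in c1]] by simp
 qed
 fix z w assume z: "z .: TT" and w: "w .: TT"
 show "dif TT (z \<otimes>.TT w) = dif TT z \<otimes>.TT w \<oplus>.TT grT (sg R) z \<otimes>.TT dif TT w"
 proof (rule TT_linear_eqI[OF M _ _ _ z])
  show lz: "lin R TT TT (%z. dif TT (z \<otimes>.TT w))"
  by (rule lin_comp[OF TT.rmul_lin[OF w] TT.d_lin])
  show rz: "lin R TT TT (%z. dif TT z \<otimes>.TT w \<oplus>.TT grT (sg R) z \<otimes>.TT dif TT w)"
  by (intro TT.lin_sum lin_comp[OF TT.d_lin TT.rmul_lin[OF w]] lin_comp[OF grT_lin[OF n] TT.rmul_lin[OF TT.d_closed[OF w]]])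
  fix p x c assume a: "p .: L" "x \<in> part p" and "c \<in> D p"
  from a(1) \<open>c \<in> D p\<close> show "dif TT (tt p x c \<otimes>.TT w) = dif TT (tt p x c) \<otimes>.TT w \<oplus>.TT grT (sg R) (tt p x c) \<otimes>.TT dif TT w"
  proof (induction c rule: D_induct)
  case (add c d)
  note t = tt_closed[OF a add(1)] tt_closed[OF a add(2)]
  show ?case unfolding tt_addr[OF a add(1,2)] linD(2)[OF lz t] linD(2)[OF rz t] add(3,4) ..
  next
  case (homog c k)
  note t = tt_closed[OF a homog(1)]
  show ?case
  proof (rule TT_linear_eqI[OF M _ _ _ w])
  show "lin R TT TT (%w. dif TT (tt p x c \<otimes>.TT w))"
  by (rule lin_comp[OF TT.lmul_lin[OF t] TT.d_lin])
  show "lin R TT TT (%w. dif TT (tt p x c) \<otimes>.TT w \<oplus>.TT grT (sg R) (tt p x c) \<otimes>.TT dif TT w)"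
  by (intro TT.lin_sum TT.lmul_lin[OF TT.d_closed[OF t]] lin_comp[OF TT.d_lin TT.lmul_lin[OF linD(1)[OF grT_lin[OF n] t]]])
  qed (rule tt_leibniz[OF a homog])
  qed
 qed
qed

end

section \<open>Acyclicity of the kernel of the aug\<close>

text \<open>Isolates the topology. \<open>\<Gamma> Z\<close> is to be read as the elements of
  \<open>C\<close> supported on the closed set \<open>Z\<close>, \<open>\<Delta> p\<close> as the
  diagonal of \<open>p\<close>, and \<open>\<rho>\<close> as restriction to the complement of all
  diagonals. \<open>\<Gamma>_Int\<close> and \<open>\<Gamma>_Un\<close> are the two properties of
  supports on which acyclicity rests.\<close>

locale arrangement = coefficients R L r C gr "%p. \<Gamma> (\<Delta> p)" + B: graded_dga R B grB
 for R :: "('r, 'k) ring_scheme" (structure) and L :: "('p, 'n) gorder_scheme" and r :: "'p => nat"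
  and C :: "('r, 'c) diff_algebra" and gr :: "(int => 'r) => 'c => 'c"
  and \<Gamma> :: "'z set => 'c set" and \<Delta> :: "'p => 'z set"
  and B :: "('r, 'b) diff_algebra" and grB :: "(int => 'r) => 'b => 'b" +
 fixes cl :: "'z set => bool" and \<rho> :: "'c => 'b"
 assumes cl_\<Delta>: "p .: L ==> cl (\<Delta> p)"
  and cl_Int: "cl Y ==> cl Z ==> cl (Y \<inter> Z)"
  and cl_Un: "cl Y ==> cl Z ==> cl (Y \<union> Z)"
  and cl_empty: "cl {}"
  and \<Delta>_join: "p .: L ==> q .: L ==> \<Delta> (p \<squnion>.L q) = \<Delta> p \<inter> \<Delta> q"
  and \<Delta>_bottom: "p .: L ==> \<Delta> p <= \<Delta> \<bottom>.L"
  and \<Gamma>_sub: "cl Y ==> submodule (\<Gamma> Y) R C"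
  and \<Gamma>_mono: "cl Y ==> cl Z ==> Y <= Z ==> \<Gamma> Y <= \<Gamma> Z"
  and \<Gamma>_Int: "cl Y ==> cl Z ==> \<Gamma> Y \<inter> \<Gamma> Z <= \<Gamma> (Y \<inter> Z)"
  and \<Gamma>_Un: "cl Y ==> cl Z ==> c \<in> \<Gamma> (Y \<union> Z) ==> EX d:\<Gamma> Y. EX e:\<Gamma> Z. c = d \<oplus>.C e"
  and \<Gamma>_empty: "\<Gamma> {} = {\<zero>.C}"
  and \<Gamma>_d: "cl Y ==> c \<in> \<Gamma> Y ==> dif C c \<in> \<Gamma> Y"
  and \<Gamma>_gr: "cl Y ==> c \<in> \<Gamma> Y ==> th .> R ==> gr th c \<in> \<Gamma> Y"
  and \<rho>_hom: "diff_hom R C B \<rho>"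
  and \<rho>_surj: "\<rho> ` carrier C = carrier B"
  and \<rho>_homog: "\<rho> ` homog C k = homog B k"
  and \<rho>_kernel: "c .: C ==> \<rho> c = \<zero>.B <-> c \<in> \<Gamma> (\<Union>a\<in>lattice_atoms L. \<Delta> a)"
begin

abbreviation "D p == \<Gamma> (\<Delta> p)"

definition basis_of where
 "basis_of p = (SOME bs. dual_basis p bs)"

lemma basis_of: "p .: L ==> dual_basis p (basis_of p)"
 unfolding basis_of_def by (rule someI_ex[OF dual_basis_exists])

lemma basisD:
 assumes "p .: L" "(b, f) \<in> set (basis_of p)"
 shows "b \<in> part p" "lin R A (scal R) f"
 using basis_of[OF assms(1)] assms(2) by (auto simp: dual_basis_def)

lemma fun_props:
 assumes "lin R A (scal R) f"
 shows "x .: A ==> f x .: R" "x .: A ==> y .: A ==> f (x \<oplus>.A y) = f x \<oplus> f y"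
  "a .: R ==> x .: A ==> f (a \<odot>.A x) = a \<otimes> f x"
 using linD[OF assms] by (simp_all add: scal_def)

text \<open>The coordinate of an element of Tot at the flat \<open>p\<close> along the functional
  \<open>f\<close>. It is an element of \<open>C\<close>, so its support can be spoken of.\<close>

definition coef where
 "coef p f = tlift C (%q x c. if q = p then f x \<odot>.C c else \<zero>.C)"

lemma functional_bilinear:
 assumes "module R V" "lin R A (scal R) f" "lin R C V g"
 shows "bilinear_family V (%q x c. if P q then f x \<odot>.V g c else \<zero>.V)"
proof -
 interpret V: module R V by fact
 note f = fun_props[OF assms(2)] and g = linD[OF assms(3)]
 have 1: "x .: A" if "x \<in> part p" "p .: L" for x p using that by simp
 have 2: "a \<otimes> u \<odot>.V v = a \<odot>.V (u \<odot>.V v)" "u \<odot>.V (a \<odot>.V v) = a \<odot>.V (u \<odot>.V v)"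
  if "a .: R" "u .: R" "v .: V" for a u v
  using that V.smult_assoc1[of a u v] V.smult_assoc1[of u a v] by (simp_all add: m_comm)
 show ?thesis unfolding bilinear_family_def
  by (intro conjI ballI; simp add: f g 1 2 D_closed V.smult_l_distr V.smult_r_distr)
qed

lemmas coef_bilinear = functional_bilinear[OF C.mod _ lin_id, where P = "%q. q = p" for p]

lemmas coef_lin = tlift(1)[OF C.mod coef_bilinear, folded coef_def]
lemmas coef_tt = tlift(2)[OF C.mod coef_bilinear, folded coef_def]

section \<open>Elements of Tot with coefficients in a subcomplex\<close>

definition subcx where
 "subcx H <-> (ALL p:carrier L. submodule (H p) R C & (ALL c:H p. dif C c \<in> H p) &
  (ALL q:carrier L. q \<sqsubseteq>.L p --> H p <= H q))"

lemma subcxD: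
 assumes "subcx H" "p .: L"
 shows "submodule (H p) R C" "c \<in> H p ==> dif C c \<in> H p"
  "q .: L ==> q \<sqsubseteq>.L p ==> c \<in> H p ==> c \<in> H q"
 using assms unfolding subcx_def by blast+

lemma subcomplexes_D: "subcx D"
 unfolding subcx_def by (intro ballI conjI impI; (rule D_sub D_d D_mono)?) simp_all

text \<open>Defined by a test on coordinates, which makes conditions on the same element easy to
  combine. By \<open>tt_in_TH\<close> and \<open>TH_minimal\<close> it is also the span of the
  symbols \<open>x \<otimes> c\<close> with \<open>c\<close> in both \<open>D p\<close> and
  \<open>H p\<close>, whatever dual bases are used.\<close>

definition TH where
 "TH H = {z \<in> carrier TT. ALL p:carrier L. ALL (b, f):set (basis_of p). coef p f z \<in> H p}"

lemma THD: "z \<in> TH H ==> p .: L ==> (b, f) \<in> set (basis_of p) ==> coef p f z \<in> H p"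
 by (auto simp: TH_def)

lemma TH_sub:
 assumes "subcx H"
 shows "submodule (TH H) R TT"
proof (rule TT.subI')
 show "TH H <= carrier TT" by (auto simp: TH_def)
 have z: "coef p f \<zero>.TT \<in> H p" if "p .: L" "(b, f) \<in> set (basis_of p)" for p b f
  using lin_zero[OF TT.mod C.mod coef_lin[OF basisD(2)[OF that]]] subD(2)[OF subcxD(1)[OF assms that(1)]] by simp
 thus "\<zero>.TT \<in> TH H" by (auto simp: TH_def)
 fix z w assume zw: "z \<in> TH H" "w \<in> TH H"
 hence c: "z .: TT" "w .: TT" by (auto simp: TH_def)
 have "coef p f (z \<oplus>.TT w) \<in> H p" if "p .: L" "(b, f) \<in> set (basis_of p)" for p b f
  unfolding linD(2)[OF coef_lin[OF basisD(2)[OF that]] c]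
  by (rule subD(3)[OF subcxD(1)[OF assms that(1)] THD[OF zw(1) that] THD[OF zw(2) that]])
 thus "z \<oplus>.TT w \<in> TH H" using c by (auto simp: TH_def)
next
 fix a z assume a: "a .: R" and z: "z \<in> TH H"
 hence c: "z .: TT" by (auto simp: TH_def)
 have "coef p f (a \<odot>.TT z) \<in> H p" if "p .: L" "(b, f) \<in> set (basis_of p)" for p b f
  unfolding linD(3)[OF coef_lin[OF basisD(2)[OF that]] a c]
  by (rule subD(4)[OF subcxD(1)[OF assms that(1)] a THD[OF z that]])
 thus "a \<odot>.TT z \<in> TH H" using c a by (auto simp: TH_def)
qed

lemma tt_in_TH:
 assumes "subcx H" "p .: L" "x \<in> part p" "c \<in> D p" "c \<in> H p"
 shows "tt p x c \<in> TH H"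
proof -
 have "coef q f (tt p x c) \<in> H q" if q: "q .: L" "(b, f) \<in> set (basis_of q)" for q b f
 proof -
  have xc: "x .: A" using assms(3) by simp
  note fl = basisD(2)[OF q]
  show ?thesis unfolding coef_tt[OF fl assms(2-4)]
  using subD(2)[OF subcxD(1)[OF assms(1) q(1)]] subD(4)[OF subcxD(1)[OF assms(1,2)] fun_props(1)[OF fl xc] assms(5)] by auto
 qed
 thus ?thesis using tt_closed[OF assms(2-4)] by (auto simp: TH_def)
qed

lemma coef_in_D:
 assumes "p .: L" "(b, f) \<in> set (basis_of p)" "z .: TT"
 shows "coef p f z \<in> D p"
proof -
 have "z \<in> TH D"
  by (rule TT_submodule_induct[OF TH_sub[OF subcomplexes_D] _ assms(3)]) (rule tt_in_TH[OF subcomplexes_D], assumption+)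
 thus ?thesis using assms(1,2) by (rule THD)
qed

lemma tt_coef_lin:
 assumes "q .: L" "y \<in> part q" "lin R TT C g" "!!z. z .: TT ==> g z \<in> D q"
 shows "lin R TT TT (%z. tt q y (g z))"
 using assms linD[OF assms(3)] by (intro linI) (simp_all add: tt_addr tt_smr)

lemma lsum_tt_left:
 assumes "p .: L" "c \<in> D p" "!!b f. (b, f) \<in> set bs ==> b \<in> part p" "!!b f. (b, f) \<in> set bs ==> g b f .: R"
 shows "lsum A (%(b, f). g b f \<odot>.A b) bs \<in> part p &
  tt p (lsum A (%(b, f). g b f \<odot>.A b) bs) c = lsum TT (%(b, f). tt p b (g b f \<odot>.C c)) bs"
 using assms(3,4)
proof (induction bs)
 case Nil show ?case using tt_zero_left[OF assms(1,2)] subD(2)[OF part_sub] by simp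
next
 case (Cons bf bs)
 obtain b f where e: "bf = (b, f)" by (cases bf)
 have b: "b \<in> part p" "g b f .: R" using Cons.prems e by auto
 have IH: "lsum A (%(b, f). g b f \<odot>.A b) bs \<in> part p"
  "tt p (lsum A (%(b, f). g b f \<odot>.A b) bs) c = lsum TT (%(b, f). tt p b (g b f \<odot>.C c)) bs"
  using Cons.IH Cons.prems by auto
 have gb: "g b f \<odot>.A b \<in> part p" by (rule subD(4)[OF part_sub b(2,1)])
 show ?case unfolding e lsum_simps prod.case tt_addl[OF assms(1) gb IH(1) assms(2)]
  tt_sml[OF assms(1) b(1) assms(2) b(2)] tt_smr[OF assms(1) b(1) assms(2) b(2)] IH(2)
  using subD(3)[OF part_sub gb IH(1)] by simp
qed

text \<open>Expanding \<open>x\<close> in the dual basis and moving the scalars to the other factor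
  gives \<open>x \<otimes> c = \<Sum> b \<otimes> f(x) c\<close>, and \<open>f(x) c\<close> is the
  coordinate along \<open>f\<close>.\<close>

lemma normal_form:
 assumes "z .: TT"
 shows "z = (\<Oplus>.TT p\<in>carrier L. lsum TT (%(b, f). tt p b (coef p f z)) (basis_of p))"
proof -
 have lin: "lin R TT TT (%z. lsum TT (%(b, f). tt p b (coef p f z)) (basis_of p))" if p: "p .: L" for p
 proof -
  have "lin R TT TT (%z. lsum TT (%bf. (case bf of (b, f) => %z. tt p b (coef p f z)) z) (basis_of p))"
  proof (rule TT.lsum_lin[OF TT.mod])
  fix bf assume bf: "bf \<in> set (basis_of p)"
  obtain b f where e: "bf = (b, f)" by (cases bf)
  note bp = basisD[OF p bf[unfolded e]]
  show "lin R TT TT (case bf of (b, f) => %z. tt p b (coef p f z))"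
  unfolding e prod.case by (rule tt_coef_lin[OF p bp(1) coef_lin[OF bp(2)] coef_in_D[OF p bf[unfolded e]]])
  qed
  thus ?thesis by (simp add: case_prod_unfold)
 qed
 show ?thesis
 proof (rule TT_linear_eqI[OF TT.mod lin_id TT.lin_finsum_fun[OF finite_carrier lin TT.mod] _ assms])
  fix q x c assume a: "q .: L" "x \<in> part q" "c \<in> D q"
  have t: "tt q x c .: TT" using a by simp
  have xc: "x .: A" using a by simp
  have "(\<Oplus>.TT p\<in>carrier L. lsum TT (%(b, f). tt p b (coef p f (tt q x c))) (basis_of p)) =
  (\<Oplus>.TT p\<in>carrier L. if q = p then tt q x c else \<zero>.TT)"
  proof (rule TT.M.finsum_cong')
  show "(%p. if q = p then tt q x c else \<zero>.TT) \<in> carrier L \<rightarrow> carrier TT" using t by auto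
  fix p assume p: "p .: L"
  show "lsum TT (%(b, f). tt p b (coef p f (tt q x c))) (basis_of p) = (if q = p then tt q x c else \<zero>.TT)"
  proof (cases "q = p")
  case False
  have "lsum TT (%(b, f). tt p b (coef p f (tt q x c))) (basis_of p) = \<zero>.TT"
  proof (rule TT.lsum_zero)
  fix bf assume bf: "bf \<in> set (basis_of p)"
  obtain b f where e: "bf = (b, f)" by (cases bf)
  note bp = basisD[OF p bf[unfolded e]]
  show "(case bf of (b, f) => tt p b (coef p f (tt q x c))) = \<zero>.TT"
  unfolding e prod.case coef_tt[OF bp(2) a] using False tt_zero_right[OF p bp(1)] by simp
  qed
  thus ?thesis using False by simp
  next
  case True
  have "lsum TT (%(b, f). tt p b (coef p f (tt q x c))) (basis_of p) = lsum TT (%(b, f). tt q b (f x \<odot>.C c)) (basis_of q)"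
  unfolding True[symmetric]
  proof (rule lsum_cong)
  fix bf assume bf: "bf \<in> set (basis_of q)"
  obtain b f where e: "bf = (b, f)" by (cases bf)
  show "(case bf of (b, f) => tt q b (coef q f (tt q x c))) = (case bf of (b, f) => tt q b (f x \<odot>.C c))"
  unfolding e prod.case coef_tt[OF basisD(2)[OF a(1) bf[unfolded e]] a] by simp
  qed
  also have "... = tt q (lsum A (%(b, f). f x \<odot>.A b) (basis_of q)) c"
  using lsum_tt_left[OF a(1,3), of "basis_of q" "%b f. f x"] basisD[OF a(1)] fun_props(1)[OF basisD(2)[OF a(1)] xc] by simp
  also have "lsum A (%(b, f). f x \<odot>.A b) (basis_of q) = x"
  using basis_of[OF a(1)] a(2) by (simp add: dual_basis_def)
  finally show ?thesis using True by simp
  qed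
  qed simp
  also have "... = tt q x c" by (rule TT.M.finsum_singleton[OF a(1) finite_carrier]) (use t in auto)
  finally show "tt q x c = (\<Oplus>.TT p\<in>carrier L. lsum TT (%(b, f). tt p b (coef p f (tt q x c))) (basis_of p))" ..
 qed
qed

lemma TH_minimal:
 assumes "submodule Q R TT" "!!p x c. p .: L ==> x \<in> part p ==> c \<in> D p ==> c \<in> H p ==> tt p x c \<in> Q"
 shows "TH H <= Q"
proof
 fix z assume z: "z \<in> TH H"
 hence zc: "z .: TT" by (simp add: TH_def)
 have "(\<Oplus>.TT p\<in>carrier L. lsum TT (%(b, f). tt p b (coef p f z)) (basis_of p)) \<in> Q"
 proof (rule TT.submodule_finsum[OF assms(1) finite_carrier], rule TT.submodule_lsum[OF assms(1)])
  fix p bf assume p: "p .: L" and bf: "bf \<in> set (basis_of p)"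
  obtain b f where e: "bf = (b, f)" by (cases bf)
  show "(case bf of (b, f) => tt p b (coef p f z)) \<in> Q"
  unfolding e prod.case
  by (rule assms(2)[OF p basisD(1)[OF p bf[unfolded e]] coef_in_D[OF p bf[unfolded e] zc] THD[OF z p bf[unfolded e]]])
 qed
 thus "z \<in> Q" using normal_form[OF zc] by simp
qed

lemma TH_mono: "(!!p. p .: L ==> H p <= H' p) ==> TH H <= TH H'"
 unfolding TH_def by blast

lemma Phi_in_TH:
 assumes "subcx H" "p .: L" "c \<in> D p" "c \<in> H p" "y .: A"
 shows "Phi p c y \<in> TH H"
 unfolding Phi_def
proof (rule TT.submodule_finsum[OF TH_sub[OF assms(1)] finite_below])
 fix q assume q: "q \<in> below p"
 hence le: "q .: L" "q \<sqsubseteq>.L p" by (auto simp: below_def)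
 thus "tt q (proj q y) c \<in> TH H"
  using below_D[OF assms(2,3) q] subcxD(3)[OF assms(1,2) le assms(4)] proj_in_part[OF assms(5)] by (intro tt_in_TH[OF assms(1)]) auto
qed

lemma TH_d:
 assumes sub: "subcx H" and z: "z \<in> TH H"
 shows "dif TT z \<in> TH H"
proof -
 note s = subD[OF TH_sub[OF sub]]
 have "submodule {z \<in> carrier TT. dif TT z \<in> TH H} R TT"
  by (rule TT.subI') (simp_all add: subset_iff TT.d_add TT.d_smult TT.d_zero s(2) s(3) s(4))
 hence "TH H <= {z \<in> carrier TT. dif TT z \<in> TH H}"
 proof (rule TH_minimal)
  fix p x c assume a: "p .: L" "x \<in> part p" "c \<in> D p" "c \<in> H p"
  have "Phi p c (dif A x) \<in> TH H" by (rule Phi_in_TH[OF sub a(1,3,4) A.d_closed]) (use a in simp)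
  moreover have "tt p x (dif C c) \<in> TH H" by (rule tt_in_TH[OF sub a(1,2) D_d[OF a(1,3)] subcxD(2)[OF sub a(1,4)]])
  ultimately have "dif TT (tt p x c) \<in> TH H" unfolding tt_d[OF a(1-3)] by (intro s(3,4)) auto
  thus "tt p x c \<in> {z \<in> carrier TT. dif TT z \<in> TH H}" using a by simp
 qed
 thus ?thesis using z by blast
qed

subsection \<open>Multiplication by an atom as a contraction\<close>

text \<open>Left multiplication by \<open>e_a\<close>, sending \<open>x \<otimes> c\<close> to
  \<open>e_a x \<otimes> c\<close>. It is not multiplication by an element of Tot, because
  \<open>e_a \<otimes> 1\<close> would need \<open>1\<close> to be supported on the diagonal of
  \<open>a\<close>. Therefore it is written through coordinates and used on
  \<open>TH (Da a)\<close>, where these have the required support.\<close>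

definition lam where
 "lam a z = (\<Oplus>.TT p\<in>carrier L. lsum TT (%(b, f). tt (p \<squnion>.L a) (atom_elt a \<otimes>.A b) (coef p f z)) (basis_of p))"

abbreviation "Da a p == D (p \<squnion>.L a)"

context
 fixes a assumes a: "a \<in> X"
begin

abbreviation "lt p z == (%(b, f). tt (p \<squnion>.L a) (atom_elt a \<otimes>.A b) (coef p f z))"
abbreviation "ls p z == lsum TT (lt p z) (basis_of p)"

lemma aL: "a .: L"
 using a atoms_subset by blast

lemma Da_sub: "p .: L ==> submodule (Da a p) R C"
 by (rule D_sub[OF join_in[OF _ aL]])

lemma Da_subset: "p .: L ==> Da a p <= D p"
 by (rule D_mono[OF join_in[OF _ aL] _ join_upper1[OF _ aL]])

lemma Da_anti: "p .: L ==> q .: L ==> q \<sqsubseteq>.L p ==> Da a p <= Da a q"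
 by (rule D_mono[OF join_in join_in join_least[OF _ _ join_in le_trans[OF _ _ join_in _ join_upper1] join_upper2]]) (simp_all add: aL)

lemma eb_part: "b \<in> part p ==> atom_elt a \<otimes>.A b \<in> part (p \<squnion>.L a)"
 using part_mult[OF atom_elt_part[OF a], of b p] unfolding join_comm[of a p] .

lemma Da_d: "p .: L ==> c \<in> Da a p ==> dif C c \<in> Da a p"
 by (rule D_d[OF join_in[OF _ aL]])

lemma Da_subcx: "subcx (Da a)"
 unfolding subcx_def by (intro ballI conjI impI; (rule Da_sub Da_d Da_anti)?) simp_all

lemmas TDa_sub = TH_sub[OF Da_subcx]

lemma TDa_module: "module R (TT\<lparr>carrier := TH (Da a)\<rparr>)"
 by (rule submodule.submodule_is_module[OF TDa_sub TT.mod])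

lemma lam_lin: "lin R (TT\<lparr>carrier := TH (Da a)\<rparr>) TT (lam a)"
proof -
 have "lin R (TT\<lparr>carrier := TH (Da a)\<rparr>) TT (ls p)" if p: "p .: L" for p
 proof (rule TT.lsum_lin[OF TDa_module, of _ "%bf z. lt p z bf"])
  fix bf assume bf: "bf \<in> set (basis_of p)"
  obtain b f where e: "bf = (b, f)" by (cases bf)
  note bp = basisD[OF p bf[unfolded e]] and T = join_in[OF p aL]
  note eb = eb_part[OF bp(1)] and th = THD[OF _ p bf[unfolded e], of _ "Da a"]
  have c: "z .: TT" if "z \<in> TH (Da a)" for z using that by (simp add: TH_def)
  show "lin R (TT\<lparr>carrier := TH (Da a)\<rparr>) TT (%z. lt p z bf)" unfolding e prod.case
  by (rule linI) (simp_all add: th T eb c tt_addr[OF T eb] tt_smr[OF T eb] linD[OF coef_lin[OF bp(2)]])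
 qed
 thus ?thesis unfolding lam_def[abs_def]
  by (rule TT.lin_finsum_fun[OF finite_carrier _ TDa_module])
qed

lemmas lam_props = linD[OF lam_lin, simplified]

lemma lam_tt:
 assumes "q .: L" "x \<in> part q" "c \<in> Da a q"
 shows "lam a (tt q x c) = tt (q \<squnion>.L a) (atom_elt a \<otimes>.A x) c"
proof -
 have cq: "c \<in> D q" using Da_subset[OF assms(1)] assms(3) by blast
 have xc: "x .: A" using assms by simp
 have qa: "q \<squnion>.L a .: L" by (rule join_in[OF assms(1) aL])
 have ea: "atom_elt a .: A" using atom_elt_part[OF a] by simp
 have t: "tt (q \<squnion>.L a) (atom_elt a \<otimes>.A x) c .: TT" by (rule tt_closed[OF qa eb_part[OF assms(2)] assms(3)])
 have "lam a (tt q x c) = (\<Oplus>.TT p\<in>carrier L. if q = p then tt (q \<squnion>.L a) (atom_elt a \<otimes>.A x) c else \<zero>.TT)"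
  unfolding lam_def
 proof (rule TT.M.finsum_cong')
  show "(%p. if q = p then tt (q \<squnion>.L a) (atom_elt a \<otimes>.A x) c else \<zero>.TT) \<in> carrier L \<rightarrow> carrier TT" using t by auto
  fix p assume p: "p .: L"
  show "ls p (tt q x c) =
  (if q = p then tt (q \<squnion>.L a) (atom_elt a \<otimes>.A x) c else \<zero>.TT)"
  proof (cases "q = p")
  case False
  have "ls p (tt q x c) = \<zero>.TT"
  proof (rule TT.lsum_zero)
  fix bf assume bf: "bf \<in> set (basis_of p)"
  obtain b f where e: "bf = (b, f)" by (cases bf)
  note bp = basisD[OF p bf[unfolded e]]
  show "lt p (tt q x c) bf = \<zero>.TT"
  unfolding e prod.case coef_tt[OF bp(2) assms(1,2) cq] using False tt_zero_right[OF join_in[OF p aL] eb_part[OF bp(1)]] by simp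
  qed
  thus ?thesis using False by simp
  next
  case True
  let ?bs = "map (%(b, f). (atom_elt a \<otimes>.A b, f)) (basis_of q)"
  have bs: "b \<in> part (q \<squnion>.L a)" "f x .: R" if "(b, f) \<in> set ?bs" for b f
  using that eb_part basisD[OF assms(1)] fun_props(1)[OF basisD(2)[OF assms(1)] xc] by auto
  have "ls p (tt q x c) = lsum TT (%(b, f). tt (q \<squnion>.L a) b (f x \<odot>.C c)) ?bs"
  unfolding True[symmetric] lsum_map
  proof (rule lsum_cong)
  fix bf assume bf: "bf \<in> set (basis_of q)"
  obtain b f where e: "bf = (b, f)" by (cases bf)
  show "(case bf of (b, f) => tt (q \<squnion>.L a) (atom_elt a \<otimes>.A b) (coef q f (tt q x c))) =
  (case (case bf of (b, f) => (atom_elt a \<otimes>.A b, f)) of (b, f) => tt (q \<squnion>.L a) b (f x \<odot>.C c))"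
  unfolding e prod.case coef_tt[OF basisD(2)[OF assms(1) bf[unfolded e]] assms(1,2) cq] by simp
  qed
  also have "... = tt (q \<squnion>.L a) (lsum A (%(b, f). f x \<odot>.A b) ?bs) c"
  using lsum_tt_left[OF qa assms(3), of ?bs "%b f. f x"] bs by simp
  also have "lsum A (%(b, f). f x \<odot>.A b) ?bs = atom_elt a \<otimes>.A lsum A (%(b, f). f x \<odot>.A b) (basis_of q)"
  proof -
  have c1: "(case bf of (b, f) => f x \<odot>.A b) .: A &
  atom_elt a \<otimes>.A (case bf of (b, f) => f x \<odot>.A b) = (case (case bf of (b, f) => (atom_elt a \<otimes>.A b, f)) of (b, f) => f x \<odot>.A b)"
  if bf: "bf \<in> set (basis_of q)" for bf
  proof -
  obtain b f where e: "bf = (b, f)" by (cases bf)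
  note bp = basisD[OF assms(1) bf[unfolded e]]
  show ?thesis unfolding e prod.case using fun_props(1)[OF bp(2) xc] part_closed[OF bp(1)] A.smult_mult_r[OF _ ea] by simp
  qed
  have "atom_elt a \<otimes>.A lsum A (%(b, f). f x \<odot>.A b) (basis_of q) = lsum A (%bf. atom_elt a \<otimes>.A (case bf of (b, f) => f x \<odot>.A b)) (basis_of q)"
  by (rule conjunct2[OF lin_lsum[OF A.mod A.mod A.lmul_lin[OF ea]]]) (use c1 in blast)
  also have "... = lsum A (%(b, f). f x \<odot>.A b) ?bs"
  unfolding lsum_map by (rule lsum_cong) (rule conjunct2[OF c1])
  finally show ?thesis ..
  qed
  also have "lsum A (%(b, f). f x \<odot>.A b) (basis_of q) = x"
  using basis_of[OF assms(1)] assms(2) by (simp add: dual_basis_def)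
  finally show ?thesis using True by simp
  qed
 qed simp
 also have "... = tt (q \<squnion>.L a) (atom_elt a \<otimes>.A x) c" by (rule TT.M.finsum_singleton[OF assms(1) finite_carrier]) (use t in auto)
 finally show ?thesis .
qed

text \<open>\<open>lam a\<close> moves a coordinate from \<open>p\<close> to
  \<open>p \<squnion> a\<close>, so it is there that membership in \<open>H\<close> has to be
  tested.\<close>

lemma lam_in_TH:
 assumes "subcx H" "z \<in> TH (Da a)"
  "!!p b f. p .: L ==> (b, f) \<in> set (basis_of p) ==> coef p f z \<in> H (p \<squnion>.L a)"
 shows "lam a z \<in> TH H"
 unfolding lam_def
proof (rule TT.submodule_finsum[OF TH_sub[OF assms(1)] finite_carrier], rule TT.submodule_lsum[OF TH_sub[OF assms(1)]])
 fix p bf assume p: "p .: L" and bf: "bf \<in> set (basis_of p)"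
 obtain b f where e: "bf = (b, f)" by (cases bf)
 show "lt p z bf \<in> TH H"
  unfolding e prod.case
  by (rule tt_in_TH[OF assms(1) join_in[OF p aL] eb_part[OF basisD(1)[OF p bf[unfolded e]]] THD[OF assms(2) p bf[unfolded e]] assms(3)[OF p bf[unfolded e]]])
qed

text \<open>For \<open>\<partial>\<close> this is \<open>d_atom_mult\<close>. The other part of the
  differential anticommutes with \<open>lam a\<close>, because joining with \<open>a\<close> raises
  the rank by one unless \<open>a\<close> lies below the flat, in which case \<open>e_a x\<close> is
  zero.\<close>

lemma d_lam:
 assumes "z \<in> TH (Da a)"
 shows "dif TT (lam a z) = z \<ominus>.TT lam a (dif TT z)"
proof -
 let ?M = "TT\<lparr>carrier := TH (Da a)\<rparr>"
 have dTH: "dif TT z \<in> TH (Da a)" if "z \<in> TH (Da a)" for z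
  by (rule TH_d[OF Da_subcx that])
 have dlin: "lin R ?M ?M (dif TT)"
  using dTH subD(1)[OF TDa_sub] by (intro linI) (auto simp: TT.d_add TT.d_smult subset_iff)
 have l1: "lin R ?M TT (%z. dif TT (lam a z) \<oplus>.TT lam a (dif TT z))"
  by (rule TT.lin_sum[OF lin_comp[OF lam_lin TT.d_lin] lin_comp[OF dlin lam_lin]])
 have l2: "lin R ?M TT (%z. z)" using subD(1)[OF TDa_sub] by (auto simp: lin_def)
 note l1p = linD[OF l1, simplified]
 have s0: "submodule (TH (Da a)) R TT" by (rule TDa_sub)
 note s = subD[OF s0]
 have sub: "submodule {z \<in> TH (Da a). dif TT (lam a z) \<oplus>.TT lam a (dif TT z) = z} R TT"
 proof (rule TT.subI')
  show "{z \<in> TH (Da a). dif TT (lam a z) \<oplus>.TT lam a (dif TT z) = z} <= carrier TT" using s(1) by blast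
  show "\<zero>.TT \<in> {z \<in> TH (Da a). dif TT (lam a z) \<oplus>.TT lam a (dif TT z) = z}"
  using lin_zero[OF TDa_module TT.mod l1] s(2) by simp
 qed (simp_all add: l1p s(3) s(4))
 have "TH (Da a) <= {z \<in> TH (Da a). dif TT (lam a z) \<oplus>.TT lam a (dif TT z) = z}"
 proof (rule TH_minimal[OF sub])
  fix q x c assume q: "q .: L" "x \<in> part q" "c \<in> D q" "c \<in> Da a q"
  let ?P = "q \<squnion>.L a" and ?ex = "atom_elt a \<otimes>.A x" and ?dx = "dif A x" and ?dc = "dif C c"
  have P: "?P .: L" by (rule join_in[OF q(1) aL])
  have ea: "atom_elt a .: A" using atom_elt_part[OF a] by simp
  have xc: "x .: A" "?dx .: A" using q by auto
  have exP: "?ex \<in> part ?P" by (rule eb_part[OF q(2)])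
  have dcP: "?dc \<in> Da a q" by (rule Da_d[OF q(1,4)])
  have ttT: "tt q x c \<in> TH (Da a)" by (rule tt_in_TH[OF Da_subcx q])
  have PT: "Phi q c u \<in> TH (Da a)" if "u .: A" for u by (rule Phi_in_TH[OF Da_subcx q(1,3,4) that])
  have dcT: "tt q x ?dc \<in> TH (Da a)" by (rule tt_in_TH[OF Da_subcx q(1,2) D_d[OF q(1,3)] dcP])
  note PL = Phi_lin[OF P q(4)]
  have PhiM: "lin R A ?M (Phi q c)"
  by (rule linI) (simp_all add: PT linD[OF Phi_lin[OF q(1,3)]])
  have 1: "lam a (Phi q c ?dx) = Phi ?P c (atom_elt a \<otimes>.A ?dx)"
  proof (rule d_linear_eqI[OF TT.mod lin_comp[OF PhiM lam_lin] lin_comp[OF A.lmul_lin[OF ea] PL] q(1,2)])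
  fix s u assume cov: "covers L q s" and u: "u \<in> part s"
  hence s: "s .: L" "s \<sqsubseteq>.L q" using coversD by auto
  have cs: "c \<in> Da a s" using Da_anti[OF q(1) s] q(4) by blast
  have le: "s \<squnion>.L a \<sqsubseteq>.L ?P"
  by (rule join_least[OF s(1) aL P le_trans[OF s(1) q(1) P s(2) join_upper1[OF q(1) aL]] join_upper2[OF q(1) aL]])
  show "lam a (Phi q c u) = Phi ?P c (atom_elt a \<otimes>.A u)"
  unfolding Phi_part[OF q(1,3) s u] Phi_part[OF P q(4) join_in[OF s(1) aL] le eb_part[OF u]] by (rule lam_tt[OF s(1) u cs])
  qed
  have 2: "Phi ?P c (dif A ?ex) = tt q x c \<ominus>.TT Phi ?P c (atom_elt a \<otimes>.A ?dx)"
  unfolding d_atom_mult[OF a xc(1)] lin_minus[OF A.mod TT.mod PL xc(1) A.mult_closed[OF ea xc(2)]]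
  Phi_part[OF P q(4) q(1) join_upper1[OF q(1) aL] q(2)] ..
  have 3: "lam a (dif TT (tt q x c)) = Phi ?P c (atom_elt a \<otimes>.A ?dx) \<oplus>.TT sg R (int (r q)) \<odot>.TT tt ?P ?ex ?dc"
  unfolding tt_d[OF q(1-3)] lam_props(2)[OF PT[OF xc(2)] subD(4)[OF TDa_sub sg_closed dcT]]
  lam_props(3)[OF sg_closed dcT] 1 lam_tt[OF q(1,2) dcP] ..
  have 4: "sg R (int (r ?P)) \<odot>.TT tt ?P ?ex ?dc = sg R (int (r q) + 1) \<odot>.TT tt ?P ?ex ?dc"
  proof (rule tt_sign_cong[OF P exP dcP])
  show "?ex = \<zero>.A | even (int (r ?P) - (int (r q) + 1))"
  proof (cases "a \<sqsubseteq>.L q")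
  case True thus ?thesis using atom_mult_zero[OF a q(1) _ q(2)] by blast
  next
  case False thus ?thesis using rank_join_new_atom[OF q(1) a] by simp
  qed
  qed
  have 5: "sg R (int (r q) + 1) = \<ominus> sg R (int (r q))" by (auto simp: neg_one_pow_def)
  have W: "Phi ?P c (atom_elt a \<otimes>.A ?dx) .: TT" "tt ?P ?ex ?dc .: TT" "tt q x c .: TT"
  using linD(1)[OF PL A.mult_closed[OF ea xc(2)]] tt_closed[OF P exP dcP] tt_closed[OF q(1-3)] .
  let ?W = "Phi ?P c (atom_elt a \<otimes>.A ?dx)" and ?V = "sg R (int (r q)) \<odot>.TT tt ?P ?ex ?dc"
  have V: "?V .: TT" using W by simp
  have "dif TT (lam a (tt q x c)) \<oplus>.TT lam a (dif TT (tt q x c)) = ((tt q x c \<ominus>.TT ?W) \<oplus>.TT \<ominus>.TT ?V) \<oplus>.TT (?W \<oplus>.TT ?V)"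
  unfolding 3 lam_tt[OF q(1,2,4)] tt_d[OF P exP q(4)] 2 4 5 using W by (simp add: TT.smult_l_minus)
  also have "... = (tt q x c \<oplus>.TT (\<ominus>.TT ?W \<oplus>.TT ?W)) \<oplus>.TT (\<ominus>.TT ?V \<oplus>.TT ?V)"
  using W V by (simp add: a_minus_def TT.M.a_ac)
  also have "... = tt q x c" using W V by (simp add: TT.M.l_neg)
  finally show "tt q x c \<in> {z \<in> TH (Da a). dif TT (lam a z) \<oplus>.TT lam a (dif TT z) = z}" using ttT by simp
 qed
 hence eq: "dif TT (lam a z) \<oplus>.TT lam a (dif TT z) = z" using assms by blast
 have c: "lam a (dif TT z) .: TT" "dif TT (lam a z) .: TT"
  using lam_props(1)[OF dTH[OF assms]] lam_props(1)[OF assms] by auto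
 show ?thesis by (subst (2) eq[symmetric]) (use c in "simp add: a_minus_def TT.M.a_assoc TT.M.r_neg")
qed

end

end

section \<open>Acyclicity of the elements supported on diagonals\<close>

context arrangement begin

lemma \<Delta>_mono: "p .: L ==> q .: L ==> q \<sqsubseteq>.L p ==> \<Delta> p <= \<Delta> q"
 using \<Delta>_join[of q p] join_absorb[of q p] by auto

lemma atom_below: "p .: L ==> p ~= \<bottom>.L ==> EX a:X. a \<sqsubseteq>.L p"
proof (rule ccontr)
 assume p: "p .: L" "p ~= \<bottom>.L" and no: "~  (EX a:X. a \<sqsubseteq>.L p)"
 obtain S where S: "S <= X" "p = \<Squnion>.L S" using atomistic[OF p(1)] by blast
 have "S <= carrier L" using S(1) atoms_subset by blast
 hence "S = {}" using sup_upper[of S] S no by blast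
 thus False using S(2) p(2) bottom_eq by simp
qed

abbreviation "on_set Y p == \<Gamma> (\<Delta> p \<inter> Y)"

lemma on_set_subcx:
 assumes "cl Y"
 shows "subcx (on_set Y)"
 unfolding subcx_def
proof (intro ballI conjI impI)
 fix p assume p: "p .: L"
 note c = cl_Int[OF cl_\<Delta>[OF p] assms]
 show "submodule (on_set Y p) R C" by (rule \<Gamma>_sub[OF c])
 show "dif C x \<in> on_set Y p" if "x \<in> on_set Y p" for x by (rule \<Gamma>_d[OF c that])
 show "on_set Y p <= on_set Y q" if q: "q .: L" "q \<sqsubseteq>.L p" for q
  by (rule \<Gamma>_mono[OF c cl_Int[OF cl_\<Delta>[OF q(1)] assms]]) (use \<Delta>_mono[OF p q] in blast)
qed

lemma TH_split:
 assumes "cl Y" "cl Z" "z \<in> TH (on_set (Y \<union> Z))"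
 shows "EX u:TH (on_set Y). EX v:TH (on_set Z). z = u \<oplus>.TT v"
proof -
 let ?Q = "{u \<oplus>.TT v | u v. u \<in> TH (on_set Y) & v \<in> TH (on_set Z)}"
 note sY = subD[OF TH_sub[OF on_set_subcx[OF assms(1)]]]
  and sZ = subD[OF TH_sub[OF on_set_subcx[OF assms(2)]]]
 have c: "u \<in> TH (on_set Y) ==> u .: TT" "v \<in> TH (on_set Z) ==> v .: TT" for u v
  by (simp_all add: TH_def)
 have "submodule ?Q R TT"
 proof (rule TT.subI')
  show "?Q <= carrier TT" using c by auto
  show "\<zero>.TT \<in> ?Q" by (rule CollectI, intro exI[of _ "\<zero>.TT"]) (simp add: sY(2) sZ(2))
  fix x y assume "x \<in> ?Q" "y \<in> ?Q"
  then obtain u v u' v' where e: "x = u \<oplus>.TT v" "y = u' \<oplus>.TT v'"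
  and m: "u \<in> TH (on_set Y)" "v \<in> TH (on_set Z)" "u' \<in> TH (on_set Y)" "v' \<in> TH (on_set Z)" by blast
  have "x \<oplus>.TT y = (u \<oplus>.TT u') \<oplus>.TT (v \<oplus>.TT v')" using m unfolding e by (simp add: c TT.M.a_ac)
  thus "x \<oplus>.TT y \<in> ?Q" using sY(3)[OF m(1,3)] sZ(3)[OF m(2,4)] by blast
 next
  fix a x assume a: "a .: R" and "x \<in> ?Q"
  then obtain u v where e: "x = u \<oplus>.TT v" and m: "u \<in> TH (on_set Y)" "v \<in> TH (on_set Z)" by blast
  have "a \<odot>.TT x = a \<odot>.TT u \<oplus>.TT a \<odot>.TT v" unfolding e by (rule TT.smult_r_distr[OF a c(1)[OF m(1)] c(2)[OF m(2)]])
  thus "a \<odot>.TT x \<in> ?Q" using sY(4)[OF a m(1)] sZ(4)[OF a m(2)] by blast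
 qed
 hence "TH (on_set (Y \<union> Z)) <= ?Q"
 proof (rule TH_minimal)
  fix p x c assume a: "p .: L" "x \<in> part p" "c \<in> D p" "c \<in> on_set (Y \<union> Z) p"
  note clY = cl_Int[OF cl_\<Delta>[OF a(1)] assms(1)] and clZ = cl_Int[OF cl_\<Delta>[OF a(1)] assms(2)]
  obtain d e where de: "d \<in> on_set Y p" "e \<in> on_set Z p" "c = d \<oplus>.C e"
  using \<Gamma>_Un[OF clY clZ, of c] a(4) unfolding Int_Un_distrib by blast
  have D: "d \<in> D p" "e \<in> D p"
  using \<Gamma>_mono[OF clY cl_\<Delta>[OF a(1)]] \<Gamma>_mono[OF clZ cl_\<Delta>[OF a(1)]] de by auto
  have "tt p x c = tt p x d \<oplus>.TT tt p x e" unfolding de(3) by (rule tt_addr[OF a(1,2) D])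
  thus "tt p x c \<in> ?Q"
  using tt_in_TH[OF on_set_subcx[OF assms(1)] a(1,2) D(1) de(1)]
  tt_in_TH[OF on_set_subcx[OF assms(2)] a(1,2) D(2) de(2)] by blast
 qed
 thus ?thesis using assms(3) by blast
qed

lemma cl_Union: "set xs <= carrier L ==> cl (\<Union>a\<in>set xs. \<Delta> a)"
 by (induction xs) (simp_all add: cl_empty cl_Un cl_\<Delta>)

text \<open>Write \<open>z = u + t\<close> with \<open>u\<close> supported on
  \<open>\<Delta> a\<close> and \<open>t\<close> on the remaining diagonals. Contraction gives
  \<open>d (lam a u) = u - lam a (d u)\<close>, and the defect \<open>t + lam a (d u)\<close> is a
  cocycle supported on the remaining diagonals, so by induction it is \<open>d w\<close>. Then
  \<open>lam a u + w\<close> has differential \<open>z\<close>.\<close>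

lemma TH_acyclic:
 assumes "set xs <= X" "z \<in> TH (on_set (\<Union>a\<in>set xs. \<Delta> a))" "dif TT z = \<zero>.TT"
 shows "EX w:TH (on_set (\<Union>a\<in>set xs. \<Delta> a)). dif TT w = z"
 using assms
proof (induction xs arbitrary: z)
 case Nil
 have "subcx (on_set {})" by (rule on_set_subcx[OF cl_empty])
 hence s: "\<zero>.TT \<in> TH (on_set {})" by (rule subD(2)[OF TH_sub])
 have "submodule {\<zero>.TT} R TT" by (rule TT.subI') auto
 hence "TH (on_set {}) <= {\<zero>.TT}"
  by (rule TH_minimal) (simp add: \<Gamma>_empty tt_zero_right)
 hence z: "z = \<zero>.TT" using Nil(2) by (simp only: Int_empty_right list.set UN_empty) blast
 show ?case unfolding z by (rule bexI[of _ "\<zero>.TT"]) (use s TT.d_zero in simp_all)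
next
 case (Cons a xs)
 let ?Y = "\<Union>a\<in>set xs. \<Delta> a"
 let ?U = "TH (on_set ?Y)" and ?V = "TH (on_set (\<Delta> a \<union> ?Y))"
 have a: "a \<in> X" "a .: L" and xs: "set xs <= X" "set xs <= carrier L" using Cons.prems(1) atoms_subset by auto
 have cY: "cl ?Y" by (rule cl_Union[OF xs(2)])
 note ca = cl_\<Delta>[OF a(2)]
 note sub = on_set_subcx[OF cY] and sub' = on_set_subcx[OF cl_Un[OF ca cY]]
 note U = subD[OF TH_sub[OF sub]] and V = subD[OF TH_sub[OF sub']]
 have sa: "TH (on_set (\<Delta> a)) <= TH (Da a)" by (rule TH_mono) (simp add: \<Delta>_join a(2))
 have zV: "z \<in> ?V" using Cons.prems(2) by simp
 obtain u t where ut: "u \<in> TH (Da a)" "t \<in> ?U" "z = u \<oplus>.TT t"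
  using TH_split[OF ca cY zV] sa by blast
 have UV: "?U <= ?V"
  by (rule TH_mono) (intro \<Gamma>_mono cl_Int cl_Un cl_\<Delta> cY ca; blast)
 have UT: "x \<in> ?U ==> x .: TT" for x by (simp add: TH_def)
 have c: "u .: TT" "t .: TT" using ut by (simp_all add: TH_def)
 let ?du = "dif TT u" and ?dt = "dif TT t"
 have d0: "?du \<oplus>.TT ?dt = \<zero>.TT" using Cons.prems(3) c unfolding ut(3) by (simp add: TT.d_add)
 have dc: "?du .: TT" "?dt .: TT" using c by simp_all
 have "?du = \<ominus>.TT ?dt" using TT.M.minus_equality[OF d0] dc by simp
 hence duU: "?du \<in> ?U"
  using U(4)[OF a_inv_closed[OF one_closed] TH_d[OF sub ut(2)]] dc by (simp add: TT.smult_l_minus)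
 have duD: "?du \<in> TH (Da a)" by (rule TH_d[OF Da_subcx[OF a(1)] ut(1)])
 let ?l = "lam a ?du"
 \<comment> \<open>Since \<open>d u = - d t\<close>, this element is supported both on
   \<open>\<Delta> a\<close> and on the other diagonals. \<open>\<Gamma>_Int\<close> puts its
   coordinates on the intersection, which is the support \<open>lam a\<close> has to produce at
   \<open>p \<squnion> a\<close>.\<close>
 have lU: "?l \<in> ?U"
 proof (rule lam_in_TH[OF a(1) sub duD])
  fix p b f assume p: "p .: L" and bf: "(b, f) \<in> set (basis_of p)"
  have "coef p f ?du \<in> \<Gamma> (\<Delta> p \<inter> ?Y) \<inter> \<Gamma> (\<Delta> (p \<squnion>.L a))"
  using THD[OF duU p bf] THD[OF duD p bf] by simp
  hence "coef p f ?du \<in> \<Gamma> ((\<Delta> p \<inter> ?Y) \<inter> \<Delta> (p \<squnion>.L a))"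
  using \<Gamma>_Int[OF cl_Int[OF cl_\<Delta>[OF p] cY] cl_\<Delta>[OF join_in[OF p a(2)]]] by blast
  also have "(\<Delta> p \<inter> ?Y) \<inter> \<Delta> (p \<squnion>.L a) = \<Delta> (p \<squnion>.L a) \<inter> ?Y" unfolding \<Delta>_join[OF p a(2)] by blast
  finally show "coef p f ?du \<in> on_set ?Y (p \<squnion>.L a)" .
 qed
 have luV: "lam a u \<in> ?V"
 proof (rule lam_in_TH[OF a(1) sub' ut(1)])
  fix p b f assume p: "p .: L" and bf: "(b, f) \<in> set (basis_of p)"
  have "\<Delta> (p \<squnion>.L a) = \<Delta> (p \<squnion>.L a) \<inter> (\<Delta> a \<union> ?Y)" unfolding \<Delta>_join[OF p a(2)] by blast
  thus "coef p f u \<in> on_set (\<Delta> a \<union> ?Y) (p \<squnion>.L a)" using THD[OF ut(1) p bf] by simp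
 qed
 note lc = UT[OF lU]
 have "lam a \<zero>.TT = \<zero>.TT" using lam_props(3)[OF a(1) zero_closed duD] lc dc by simp
 hence "dif TT ?l = ?du" using d_lam[OF a(1) duD] dc TT_graded_dga c
  by (simp add: graded_dga.d_d[OF TT_graded_dga] a_minus_def)
 hence "dif TT (t \<oplus>.TT ?l) = \<zero>.TT" using d0 dc c lc by (simp add: TT.d_add TT.M.a_comm)
 from Cons.IH[OF xs(1) U(3)[OF ut(2) lU] this] obtain w where w: "w \<in> ?U" "dif TT w = t \<oplus>.TT ?l" by blast
 have "dif TT (lam a u \<oplus>.TT w) = (u \<ominus>.TT ?l) \<oplus>.TT (t \<oplus>.TT ?l)"
  using luV UT[OF w(1)] V(1) by (simp add: TT.d_add w(2) d_lam[OF a(1) ut(1)] subset_iff)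
 also have "... = (u \<oplus>.TT t) \<oplus>.TT (?l \<oplus>.TT \<ominus>.TT ?l)" using c lc by (simp add: a_minus_def TT.M.a_ac)
 also have "... = z" using c lc by (simp add: TT.M.r_neg ut(3))
 finally show ?case using V(3)[OF luV, of w] w(1) UV by auto
qed

abbreviation "Y0 == \<Union>a\<in>X. \<Delta> a"

lemma cl_Y0: "cl Y0"
 using cl_Union[of "SOME xs. set xs = X"] someI_ex[OF finite_list[OF finite_atoms]] atoms_subset by simp

subsection \<open>The aug is a quasi-isomorphism\<close>

text \<open>The vacuous condition gives the family the shape of \<open>functional_bilinear\<close>,
  which also serves for \<open>coef\<close>.\<close>

definition aug where
 "aug = tlift B (%p x c. if True then eps x \<odot>.B \<rho> c else \<zero>.B)"

lemma \<rho>_linear: "lin R C B \<rho>"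
 using \<rho>_hom by (simp add: diff_hom_def)

lemma augmentation_lin: "lin R TT B aug"
 unfolding aug_def
 by (rule tlift(1)[OF B.mod functional_bilinear[OF B.mod eps_lin \<rho>_linear]])

lemma augmentation_tt: "p .: L ==> x \<in> part p ==> c \<in> D p ==> aug (tt p x c) = eps x \<odot>.B \<rho> c"
 unfolding aug_def
 using tlift(2)[OF B.mod functional_bilinear[OF B.mod eps_lin \<rho>_linear, of "%_. True"]] by simp

lemma \<rho>_closed: "c .: C ==> \<rho> c .: B"
 by (rule linD(1)[OF \<rho>_linear])

lemma augmentation_part: "p .: L ==> p ~= \<bottom>.L ==> x \<in> part p ==> c \<in> D p ==> aug (tt p x c) = \<zero>.B"
 using eps_part[of x p] D_closed[of p c] by (simp add: augmentation_tt \<rho>_closed)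

lemma augmentation_Y0:
 assumes "p .: L" "x \<in> part p" "c \<in> D p" "c \<in> \<Gamma> Y0"
 shows "aug (tt p x c) = \<zero>.B"
proof -
 have "\<rho> c = \<zero>.B" using \<rho>_kernel[OF D_closed[OF assms(1,3)]] assms(4) by simp
 thus ?thesis using assms(2) by (simp add: augmentation_tt[OF assms(1-3)])
qed

lemma \<Delta>_Y0: "p .: L ==> p ~= \<bottom>.L ==> \<Delta> p <= Y0"
 using atom_below[of p] \<Delta>_mono[of p] atoms_subset by blast

text \<open>At a flat other than \<open>\<bottom>\<close> every coefficient is supported on a
  diagonal anyway, so membership on the right is a condition at \<open>\<bottom>\<close> only. There
  \<open>part \<bottom>\<close> consists of the multiples of the unit, and the condition is that the
  constant term restricts to zero.\<close>

lemma augmentation_kernel: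
 assumes "z .: TT"
 shows "aug z = \<zero>.B <-> z \<in> TH (on_set Y0)"
proof
 have cl': "cl (\<Delta> p \<inter> Y0)" if "p .: L" for p by (rule cl_Int[OF cl_\<Delta>[OF that] cl_Y0])
 assume z: "aug z = \<zero>.B"
 have "coef p f z \<in> on_set Y0 p" if p: "p .: L" and bf: "(b, f) \<in> set (basis_of p)" for p b f
 proof (cases "p = \<bottom>.L")
  case False
  hence "\<Delta> p \<inter> Y0 = \<Delta> p" using \<Delta>_Y0[OF p] by blast
  thus ?thesis using coef_in_D[OF p bf assms] by simp
 next
  case True
  \<comment> \<open>The augmentation before restriction to the complement: \<open>\<rho>\<close>
    applied to it is \<open>aug\<close>, and each coordinate at \<open>\<bottom>\<close> is a scalar
    multiple of it.\<close>
  let ?F = "tlift C (%p x c. if True then eps x \<odot>.C c else \<zero>.C)"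
  note bil = functional_bilinear[OF C.mod eps_lin lin_id, of "%_. True"]
  note Fl = tlift(1)[OF C.mod bil] and Ft = tlift(2)[OF C.mod bil]
  note fl = basisD(2)[OF p bf]
  have f1: "f \<one>.A .: R" using fun_props(1)[OF fl] by simp
  have "\<rho> (?F z) = aug z"
  proof (rule TT_linear_eqI[OF B.mod lin_comp[OF Fl \<rho>_linear] augmentation_lin _ assms])
  fix q x c assume a: "q .: L" "x \<in> part q" "c \<in> D q"
  show "\<rho> (?F (tt q x c)) = aug (tt q x c)"
  unfolding Ft[OF a] augmentation_tt[OF a] using linD(3)[OF \<rho>_linear, of "eps x" c] D_closed[OF a(1,3)] a(2) by simp
  qed
  hence FY: "?F z \<in> \<Gamma> Y0" using \<rho>_kernel[OF linD(1)[OF Fl assms]] z by simp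
  have "coef p f z = f \<one>.A \<odot>.C ?F z"
  proof (rule TT_linear_eqI[OF C.mod coef_lin[OF fl] C.lin_smult[OF Fl f1] _ assms])
  fix q x c assume a: "q .: L" "x \<in> part q" "c \<in> D q"
  have cc: "c .: C" by (rule D_closed[OF a(1,3)])
  show "coef p f (tt q x c) = f \<one>.A \<odot>.C ?F (tt q x c)"
  proof (cases "q = p")
  case False
  thus ?thesis unfolding coef_tt[OF fl a] Ft[OF a] using eps_part[OF a(2)] True f1 cc by simp
  next
  case qp: True
  have "f x = f (eps x \<odot>.A \<one>.A)" using part_bottom[of x] a(2) qp True by simp
  also have "... = f \<one>.A \<otimes> eps x" using fun_props(3)[OF fl] a(2) f1 by (simp add: m_comm)
  finally show ?thesis unfolding coef_tt[OF fl a] Ft[OF a] using qp f1 cc a(2) by (simp add: C.smult_assoc1)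
  qed
  qed
  moreover have "\<Delta> p \<inter> Y0 = Y0" using \<Delta>_bottom atoms_subset True by blast
  ultimately show ?thesis using subD(4)[OF \<Gamma>_sub[OF cl_Y0] f1 FY] by simp
 qed
 thus "z \<in> TH (on_set Y0)" using assms by (auto simp: TH_def)
next
 assume z: "z \<in> TH (on_set Y0)"
 have "submodule {z \<in> carrier TT. aug z = \<zero>.B} R TT"
  using linD[OF augmentation_lin] lin_zero[OF TT.mod B.mod augmentation_lin]
  by (intro TT.subI') (simp_all add: subset_iff)
 hence "TH (on_set Y0) <= {z \<in> carrier TT. aug z = \<zero>.B}"
 proof (rule TH_minimal)
  fix p x c assume a: "p .: L" "x \<in> part p" "c \<in> D p" "c \<in> on_set Y0 p"
  have "c \<in> \<Gamma> Y0" using \<Gamma>_mono[OF cl_Int[OF cl_\<Delta>[OF a(1)] cl_Y0] cl_Y0] a(4) by blast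
  thus "tt p x c \<in> {z \<in> carrier TT. aug z = \<zero>.B}" using a augmentation_Y0[OF a(1-3)] by simp
 qed
 thus "aug z = \<zero>.B" using z by blast
qed

lemma augmentation_unit: "c .: C ==> aug (tt \<bottom>.L \<one>.A c) = \<rho> c"
 using augmentation_tt[OF bottom_in one_in_part, of c] D_bottom \<rho>_closed[of c] by (simp add: eps_one)

lemma augmentation_mult:
 assumes "z .: TT" "w .: TT"
 shows "aug (z \<otimes>.TT w) = aug z \<otimes>.B aug w"
proof (rule TT_linear_eqI[OF B.mod lin_comp[OF TT.lmul_lin[OF assms(1)] augmentation_lin]
  lin_comp[OF augmentation_lin B.lmul_lin[OF linD(1)[OF augmentation_lin assms(1)]]] _ assms(2)])
 fix q y d assume q: "q .: L" "y \<in> part q" "d \<in> D q"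
 note tq = tt_closed[OF q]
 show "aug (z \<otimes>.TT tt q y d) = aug z \<otimes>.B aug (tt q y d)"
 proof (rule TT_linear_eqI[OF B.mod lin_comp[OF TT.rmul_lin[OF tq] augmentation_lin]
  lin_comp[OF augmentation_lin B.rmul_lin[OF linD(1)[OF augmentation_lin tq]]] _ assms(1)])
  fix p x c assume p: "p .: L" "x \<in> part p" "c \<in> D p"
  have dc: "d .: C" "\<rho> d .: B" using D_closed[OF q(1,3)] \<rho>_closed by auto
  note al = linD[OF augmentation_lin]
  show "aug (tt p x c \<otimes>.TT tt q y d) = aug (tt p x c) \<otimes>.B aug (tt q y d)"
  using p(1,3)
  proof (induction c rule: D_induct)
  case (add c e)
  note t = tt_closed[OF p(1,2) add(1)] tt_closed[OF p(1,2) add(2)]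
  show ?case unfolding tt_addr[OF p(1,2) add(1,2)] TT.mult_l_distr[OF t tq] al(2)[OF t]
  al(2)[OF TT.mult_closed[OF t(1) tq] TT.mult_closed[OF t(2) tq]] add(3,4)
  by (rule B.mult_l_distr[OF al(1)[OF t(1)] al(1)[OF t(2)] al(1)[OF tq], symmetric])
  next
  case (homog c k)
  have cc: "c .: C" "\<rho> c .: B" using D_closed[OF p(1) homog(1)] \<rho>_closed by auto
  have xy: "x .: A" "y .: A" using p q by auto
  \<comment> \<open>The sign of the product is invisible after augmentation: at
    \<open>\<bottom>\<close> the rank is zero, and elsewhere \<open>eps y\<close> is zero.\<close>
  have e: "eps y \<odot>.B b = sg R (k * int (r q)) \<otimes> eps y \<odot>.B b" if "b .: B" for b
  proof (cases "q = \<bottom>.L")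
  case True thus ?thesis using xy by (simp add: rank_bottom neg_one_pow_def)
  next
  case False thus ?thesis using eps_part[OF q(2)] by simp
  qed
  have t: "tt (p \<squnion>.L q) (x \<otimes>.A y) (c \<otimes>.C d) .: TT"
  by (rule tt_closed[OF join_in[OF p(1) q(1)] part_mult[OF p(2) q(2)] D_mult[OF p(1) q(1) homog(1) q(3)]])
  have "\<rho> (c \<otimes>.C d) = \<rho> c \<otimes>.B \<rho> d" using \<rho>_hom cc(1) dc(1) by (simp add: diff_hom_def)
  hence "aug (tt p x c \<otimes>.TT tt q y d) = sg R (k * int (r q)) \<odot>.B ((eps x \<otimes> eps y) \<odot>.B (\<rho> c \<otimes>.B \<rho> d))"
  unfolding tt_mult[OF p(1,2) homog q] al(3)[OF sg_closed t]
  augmentation_tt[OF join_in[OF p(1) q(1)] part_mult[OF p(2) q(2)] D_mult[OF p(1) q(1) homog(1) q(3)]] eps_mult[OF xy] by simp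
  also have "... = eps x \<odot>.B (sg R (k * int (r q)) \<otimes> eps y \<odot>.B (\<rho> c \<otimes>.B \<rho> d))"
  using xy cc dc B.smult_assoc1[symmetric] by (simp add: m_ac)
  also have "... = eps x \<odot>.B (eps y \<odot>.B (\<rho> c \<otimes>.B \<rho> d))" using e cc dc by simp
  also have "... = (eps x \<odot>.B \<rho> c) \<otimes>.B (eps y \<odot>.B \<rho> d)"
  using xy cc dc by (subst B.smult_mult_l; simp add: B.smult_mult_r)
  finally show ?case unfolding augmentation_tt[OF p(1,2) homog(1)] augmentation_tt[OF q] .
  qed
 qed
qed

text \<open>\<open>eps\<close> by itself does not commute with \<open>\<partial>\<close>, which
  sends an atom to the unit. But the coefficient of an atom is supported on its diagonal and dies
  under \<open>\<rho>\<close>, so the \<open>\<partial>\<close>-part of the differential contributes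
  nothing.\<close>

lemma augmentation_d:
 assumes "z .: TT"
 shows "aug (dif TT z) = dif B (aug z)"
proof (rule TT_linear_eqI[OF B.mod lin_comp[OF TT.d_lin augmentation_lin]
  lin_comp[OF augmentation_lin B.d_lin] _ assms])
 fix p x c assume p: "p .: L" "x \<in> part p" "c \<in> D p"
 have cc: "c .: C" "\<rho> c .: B" using D_closed[OF p(1,3)] \<rho>_closed by auto
 have xc: "x .: A" "eps x .: R" using p by auto
 have "aug (Phi p c (dif A x)) = \<zero>.B"
 proof (rule d_linear_eqI[OF B.mod lin_comp[OF Phi_lin[OF p(1,3)] augmentation_lin] B.lin_const_zero[of A] p(1,2)])
  fix q u assume cov: "covers L p q" and u: "u \<in> part q"
  hence q: "q .: L" "q \<sqsubseteq>.L p" using coversD by auto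
  have cq: "c \<in> D q" using D_mono[OF p(1) q] p(3) by blast
  show "aug (Phi p c u) = \<zero>.B" unfolding Phi_part[OF p(1,3) q u]
  proof (cases "q = \<bottom>.L")
  case True
  hence "p \<in> X" using cov by (simp add: lattice_atoms_def)
  hence "\<Delta> p <= Y0" by blast
  hence "c \<in> \<Gamma> Y0" using \<Gamma>_mono[OF cl_\<Delta>[OF p(1)] cl_Y0] p(3) by blast
  thus "aug (tt q u c) = \<zero>.B" by (rule augmentation_Y0[OF q(1) u cq])
  next
  case False thus "aug (tt q u c) = \<zero>.B" by (rule augmentation_part[OF q(1) _ u cq])
  qed
 qed
 hence "aug (dif TT (tt p x c)) = sg R (int (r p)) \<odot>.B (eps x \<odot>.B \<rho> (dif C c))"
  unfolding tt_d[OF p] using linD[OF augmentation_lin] linD(1)[OF Phi_lin[OF p(1,3)]] p xc cc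
  by (simp add: D_d augmentation_tt \<rho>_closed)
 also have "... = eps x \<odot>.B dif B (\<rho> c)"
 proof (cases "p = \<bottom>.L")
  case True
  thus ?thesis using \<rho>_hom cc xc by (simp add: rank_bottom neg_one_pow_def diff_hom_def)
 next
  case False
  thus ?thesis using eps_part[OF p(2)] cc by (simp add: \<rho>_closed)
 qed
 also have "... = dif B (aug (tt p x c))"
  unfolding augmentation_tt[OF p] using cc xc by (simp add: B.d_smult)
 finally show "aug (dif TT (tt p x c)) = dif B (aug (tt p x c))" .
qed

lemma augmentation_homog: "aug ` homog TT k = homog B k"
proof
 let ?H = "{z \<in> carrier TT. EX c:homog C k. aug z = \<rho> c}"
 note al = linD[OF augmentation_lin] and rl = linD[OF \<rho>_linear]
 have hc: "c \<in> homog C k ==> c .: C" for c using C.homog_subset by blast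
 have zh: "\<zero>.C \<in> homog C k" "\<rho> \<zero>.C = \<zero>.B"
  using lin_zero[OF C.mod C.mod pr_lin] lin_zero[OF C.mod B.mod \<rho>_linear]
  by (simp_all add: homog_iff)
 have "submodule ?H R TT"
 proof (rule TT.subI')
  show "\<zero>.TT \<in> ?H" using zh lin_zero[OF TT.mod B.mod augmentation_lin] by force
  fix z w assume "z \<in> ?H" "w \<in> ?H"
  then obtain c d where *: "z .: TT" "w .: TT" "c \<in> homog C k" "d \<in> homog C k" "aug z = \<rho> c" "aug w = \<rho> d" by blast
  have "aug (z \<oplus>.TT w) = \<rho> (c \<oplus>.C d)" using * by (simp add: al(2) rl(2) hc)
  thus "z \<oplus>.TT w \<in> ?H" using homog_add[OF *(3,4)] *(1,2) TT.M.a_closed by blast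
 next
  fix a z assume a: "a .: R" and "z \<in> ?H"
  then obtain c where *: "z .: TT" "c \<in> homog C k" "aug z = \<rho> c" by blast
  have "aug (a \<odot>.TT z) = \<rho> (a \<odot>.C c)" using * a by (simp add: al(3) rl(3) hc)
  thus "a \<odot>.TT z \<in> ?H" using homog_smult[OF a *(2)] a *(1) TT.smult_closed by blast
 qed blast
 hence "homog TT k <= ?H"
 proof (rule homog_TT_minimal)
  fix p x c j assume p: "p .: L" "x \<in> part p" "c \<in> D p" and c: "c \<in> homog C j" and k: "k = j - int (r p)"
  have "EX d:homog C k. aug (tt p x c) = \<rho> d"
  proof (cases "p = \<bottom>.L")
  case True
  have ex: "eps x .: R" using p by simp
  have "eps x \<odot>.C c \<in> homog C k" using homog_smult[OF ex c] k True rank_bottom by simp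
  moreover have "aug (tt p x c) = \<rho> (eps x \<odot>.C c)"
  unfolding augmentation_tt[OF p] by (rule rl(3)[OF ex D_closed[OF p(1,3)], symmetric])
  ultimately show ?thesis by blast
  next
  case False thus ?thesis using augmentation_part[OF p(1) _ p(2,3)] zh by force
  qed
  thus "tt p x c \<in> ?H" using p by simp
 qed
 thus "aug ` homog TT k <= homog B k" using \<rho>_homog[of k] by auto
 show "homog B k <= aug ` homog TT k"
 proof
  fix b assume "b \<in> homog B k"
  then obtain c where c: "c \<in> homog C k" "b = \<rho> c" using \<rho>_homog[of k] by blast
  have "tt \<bottom>.L \<one>.A c \<in> homog TT k" using tt_in_homog[OF bottom_in one_in_part _ c(1)] hc[OF c(1)] D_bottom rank_bottom by simp
  thus "b \<in> aug ` homog TT k" using augmentation_unit[OF hc[OF c(1)]] c(2) by force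
 qed
qed

theorem augmentation_quasi_iso: "EX \<phi>. graded_algebra_iso R (cohomology TT) (cohomology B) \<phi>"
proof (rule quasi_iso[OF TT_graded_dga B.graded_dga_axioms _ augmentation_homog])
 have "aug \<one>.TT = \<one>.B"
  using \<rho>_hom unfolding tt_one by (simp add: augmentation_unit diff_hom_def)
 thus "diff_hom R TT B aug"
  unfolding diff_hom_def using augmentation_lin augmentation_mult augmentation_d by blast
 show "aug ` carrier TT = carrier B"
 proof
  show "aug ` carrier TT <= carrier B" using linD(1)[OF augmentation_lin] by blast
  show "carrier B <= aug ` carrier TT"
  proof
  fix b assume "b .: B"
  then obtain c where c: "c .: C" "b = \<rho> c" using \<rho>_surj by blast
  thus "b \<in> aug ` carrier TT"
  using augmentation_unit[OF c(1)] tt_closed[OF bottom_in one_in_part, of c] D_bottom by force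
  qed
 qed
 fix z assume z: "z .: TT" "aug z = \<zero>.B"
 hence zT: "z \<in> TH (on_set Y0)" using augmentation_kernel by blast
 show "EX w:carrier TT. aug w = \<zero>.B & dif TT w = z" if dz: "dif TT z = \<zero>.TT"
 proof -
  obtain xs where xs: "set xs = X" using finite_list[OF finite_atoms] by blast
  obtain w where w: "w \<in> TH (on_set Y0)" "dif TT w = z" using TH_acyclic[of xs z] xs zT dz by auto
  hence "w .: TT" by (simp add: TH_def)
  thus ?thesis using w augmentation_kernel by blast
 qed
 fix th :: "int => 'r" assume th: "th .> R"
 note gl = linD[OF grT_lin[OF th]] and al = linD[OF augmentation_lin]
 have "submodule {z \<in> carrier TT. aug (grT th z) = \<zero>.B} R TT"
  using lin_zero[OF TT.mod B.mod lin_comp[OF grT_lin[OF th] augmentation_lin]]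
  by (intro TT.subI') (simp_all add: subset_iff gl al)
 hence "TH (on_set Y0) <= {z \<in> carrier TT. aug (grT th z) = \<zero>.B}"
 proof (rule TH_minimal)
  fix p x c assume a: "p .: L" "x \<in> part p" "c \<in> D p" "c \<in> on_set Y0 p"
  let ?c = "gr (%k. th (k - int (r p))) c"
  have "c \<in> \<Gamma> Y0" using \<Gamma>_mono[OF cl_Int[OF cl_\<Delta>[OF a(1)] cl_Y0] cl_Y0] a(4) by blast
  hence "?c \<in> \<Gamma> Y0" by (rule \<Gamma>_gr[OF cl_Y0 _ shift_in[OF th]])
  hence "aug (grT th (tt p x c)) = \<zero>.B" unfolding grT_tt[OF th a(1-3)]
  by (rule augmentation_Y0[OF a(1,2) D_gr[OF a(1,3) shift_in[OF th]]])
  thus "tt p x c \<in> {z \<in> carrier TT. aug (grT th z) = \<zero>.B}" using a by simp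
 qed
 thus "aug (grT th z) = \<zero>.B" using zT by blast
qed

end

section \<open>Singular cochains\<close>

subsection \<open>Faces of singular simplices\<close>

lemma singular_simplex_reparam:
 assumes "singular_simplex k X s" "\<phi> \<in> sdx l \<rightarrow> sdx k"
  "!!i. continuous_map (powertop_real UNIV) euclideanreal (%x. \<phi> x i)"
 shows "singular_simplex l X (restrict (s \<circ> \<phi>) (sdx l))"
proof -
 have "continuous_map (subtopology (powertop_real UNIV) (sdx l))
  (subtopology (powertop_real UNIV) (sdx k)) \<phi>"
  using assms(2,3) by (auto simp: continuous_map_in_subtopology continuous_map_componentwise continuous_map_from_subtopology)
 hence "continuous_map (subtopology (powertop_real UNIV) (sdx l)) X (s \<circ> \<phi>)"
  by (rule continuous_map_compose) (use assms(1) in "simp add: singular_simplex_def")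
 thus ?thesis by (simp add: singular_simplex_def)
qed

lemma front_face_simplex:
 assumes "singular_simplex k X s" "i \<le> k"
 shows "singular_simplex i X (restrict s (sdx i))"
  "restrict s (sdx i) ` sdx i <= s ` sdx k"
proof -
 have "continuous_map (powertop_real UNIV) euclideanreal (%x. x j)" for j :: nat by (rule continuous_map_product_projection) simp
 hence "singular_simplex i X (restrict (s \<circ> (%x. x)) (sdx i))"
  by (intro singular_simplex_reparam[OF assms(1)]) (use standard_simplex_mono[OF assms(2)] in auto)
 thus "singular_simplex i X (restrict s (sdx i))" by (simp add: comp_def)
qed (use standard_simplex_mono[OF assms(2)] in auto)

text \<open>The inclusion of the face spanned by the vertices from \<open>i\<close> on, singled out
  so that a back face is a reparametrization of the simplex.\<close>

definition shift_simplex :: "nat => (nat => real) => nat => real" where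
 "shift_simplex i x = (%j. if j < i then 0 else x (j - i))"

lemma shift_simplex_in:
 assumes "i \<le> k" "x \<in> sdx (k - i)"
 shows "shift_simplex i x \<in> sdx k"
proof -
 have "(\<Sum>j\<le>k. shift_simplex i x j) = (\<Sum>j\<in>{i..k}. shift_simplex i x j)"
  by (rule sum.mono_neutral_right) (auto simp: shift_simplex_def)
 also have "... = (\<Sum>j\<le>k - i. x j)"
  by (rule sum.reindex_bij_witness[of _ "%j. j + i" "%j. j - i"]) (use assms(1) in "auto simp: shift_simplex_def")
 finally show ?thesis using assms by (auto simp: standard_simplex_def shift_simplex_def)
qed

lemma back_face_eq: "back_face k i s = restrict (s \<circ> shift_simplex i) (sdx (k - i))"
 by (simp add: back_face_def shift_simplex_def comp_def)

lemma back_face_simplex: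
 assumes "singular_simplex k X s" "i \<le> k"
 shows "singular_simplex (k - i) X (back_face k i s)"
  "back_face k i s ` sdx (k - i) <= s ` sdx k"
proof -
 have "continuous_map (powertop_real UNIV) euclideanreal (%x. x j)" for j :: nat by (rule continuous_map_product_projection) simp
 thus "singular_simplex (k - i) X (back_face k i s)" unfolding back_face_eq
  by (intro singular_simplex_reparam[OF assms(1)]) (use shift_simplex_in[OF assms(2)] in "auto simp: shift_simplex_def")
 show "back_face k i s ` sdx (k - i) <= s ` sdx k"
  using shift_simplex_in[OF assms(2)] by (auto simp: back_face_eq)
qed

lemma singular_face_image:
 assumes "1 \<le> k" "j \<le> k"
 shows "sface k j s ` sdx (k - Suc 0) <= s ` sdx k"
 using simplical_face_in_standard_simplex[OF assms] by (auto simp: singular_face_def)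

lemma simplical_face_front: "x \<in> sdx i ==> i < j ==> simplical_face j x = x"
 by (auto simp: simplical_face_def standard_simplex_def)

lemma front_singular_face:
 assumes "i \<le> m"
 shows "j \<le> i ==> restrict (sface (Suc m) j s) (sdx i) =
  sface (Suc i) j (restrict s (sdx (Suc i)))"
  and "i < j ==> restrict (sface (Suc m) j s) (sdx i) = restrict s (sdx i)"
 using standard_simplex_mono[OF assms] simplical_face_in_standard_simplex[of "Suc i" j]
 by (auto simp: singular_face_def simplical_face_front subset_iff restrict_def)

lemma last_face_front: "sface (Suc i) (Suc i) (restrict s (sdx (Suc i))) = restrict s (sdx i)"
 using standard_simplex_mono[of i "Suc i"] by (auto simp: singular_face_def simplical_face_front restrict_def subset_iff)

lemma simplical_face_shift:
 "j \<le> i ==> simplical_face j (shift_simplex i x) = shift_simplex (Suc i) x"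
 "i \<le> j ==> simplical_face j (shift_simplex i x) = shift_simplex i (simplical_face (j - i) x)"
 by (auto simp: fun_eq_iff simplical_face_def shift_simplex_def)

lemma back_singular_face:
 assumes "i \<le> m"
 shows "j \<le> i ==> back_face m i (sface (Suc m) j s) = back_face (Suc m) (Suc i) s"
  and "i \<le> j ==> j \<le> Suc m ==> back_face m i (sface (Suc m) j s) = sface (Suc m - i) (j - i) (back_face (Suc m) i s)"
 using shift_simplex_in[OF assms] simplical_face_in_standard_simplex[of "Suc m - i" "j - i"] assms
 by (auto simp: back_face_eq singular_face_def simplical_face_shift restrict_def fun_eq_iff Suc_diff_le)

lemma first_face_back: "i \<le> m ==> sface (Suc m - i) 0 (back_face (Suc m) i s) = back_face (Suc m) (Suc i) s"
 using back_singular_face(2)[of i m i s] back_singular_face(1)[of i m i s] by simp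

lemma (in cring) finsum_atMost_swap:
 assumes "!!i j. i \<le> m ==> j \<le> n ==> f i j .: R"
 shows "(\<Oplus>i\<in>{..m::nat}. \<Oplus>j\<in>{..n::nat}. f i j) = (\<Oplus>j\<in>{..n}. \<Oplus>i\<in>{..m}. f i j)"
 using assms
proof (induction m)
 case 0
 have "(\<Oplus>j\<in>{..n}. \<Oplus>i\<in>{..0}. f i j) = (\<Oplus>j\<in>{..n}. f 0 j)"
  by (rule finsum_cong') (use 0 in "auto simp: Pi_def")
 thus ?case using 0 by (simp add: Pi_def)
next
 case (Suc m)
 have "(\<Oplus>i\<in>{..Suc m}. \<Oplus>j\<in>{..n}. f i j) = (\<Oplus>j\<in>{..n}. f (Suc m) j) \<oplus> (\<Oplus>j\<in>{..n}. \<Oplus>i\<in>{..m}. f i j)"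
  using Suc by (subst finsum_Suc) (auto intro!: finsum_closed)
 also have "... = (\<Oplus>j\<in>{..n}. f (Suc m) j \<oplus> (\<Oplus>i\<in>{..m}. f i j))"
  by (rule finsum_addf[symmetric]) (auto intro!: finsum_closed Suc.prems)
 also have "... = (\<Oplus>j\<in>{..n}. \<Oplus>i\<in>{..Suc m}. f i j)"
  by (rule finsum_cong') (auto intro!: finsum_closed finsum_Suc[symmetric] Suc.prems)
 finally show ?case .
qed

lemma (in cring) finsum_shift:
 assumes "i \<le> m" "!!j. j \<le> Suc m ==> f j .: R"
 shows "(\<Oplus>j\<in>{..Suc m}. f j) = (\<Oplus>j\<in>{..i}. f j) \<oplus> (\<Oplus>j\<in>{..m - i}. f (Suc i + j))"
proof -
 have "inj_on (%j. Suc i + j) {..m - i}" by (simp add: inj_on_def)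
 moreover have "(%j. Suc i + j) ` {..m - i} = {Suc i..Suc m}"
  using assms(1) image_add_atLeastAtMost[of "Suc i" 0 "m - i"] by (simp add: atMost_atLeast0)
 ultimately have "(\<Oplus>j\<in>{..m - i}. f (Suc i + j)) = (\<Oplus>j\<in>{Suc i..Suc m}. f j)"
  using finsum_reindex[of f "%j. Suc i + j" "{..m - i}"] assms by (auto simp: Pi_def)
 moreover have "{..Suc m} = {..i} \<union> {Suc i..Suc m}" using assms(1) by auto
 ultimately show ?thesis using finsum_Un_disjoint[of "{..i}" "{Suc i..Suc m}" f] assms by (auto simp: Pi_def)
qed

subsection \<open>The cochain algebra\<close>

locale cochains = cring R for R :: "('r, 'm) ring_scheme" (structure) + fixes X :: "'a topology"
begin

abbreviation "sx k s == singular_simplex k X s"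
abbreviation "CC == cochain_algebra R X"
abbreviation fr :: "nat => ((nat => real) => 'a) => (nat => real) => 'a" where "fr i s == restrict s (sdx i)"

lemma cochain_fun_val [simp]: "sx k s ==> cochain_fun X g k s = g k s"
 by (simp add: cochain_fun_def)

lemma finite_degrees_iff: "finite {k. EX s. sx k s & c k s ~= z} <-> (EX N. ALL k s. N < k --> sx k s --> c k s = z)"
 unfolding finite_nat_set_iff_bounded_le by (simp add: subset_iff Ball_def) (meson not_le)

lemma CC_iff: "c .: CC <-> (ALL k. c k \<in> {s. sx k s} \<rightarrow>\<^sub>E carrier R) & (EX N. ALL k s. N < k --> sx k s --> c k s = \<zero>)"
 by (simp add: cochain_algebra_def finite_degrees_iff)

lemma CC_I:
 assumes "!!k s. sx k s ==> g k s .: R" "!!k s. N < k ==> sx k s ==> g k s = \<zero>"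
 shows "cochain_fun X g .: CC"
 unfolding CC_iff cochain_fun_def by (intro conjI exI[of _ N]) (use assms in auto)

lemma CC_val [simp]: "c .: CC ==> sx k s ==> c k s .: R"
 by (auto simp: CC_iff PiE_iff)

lemma CC_bound: "c .: CC ==> EX N. ALL k s. N < k --> sx k s --> c k s = \<zero>"
 by (auto simp: CC_iff)

lemma CC_eqI: "c .: CC ==> d .: CC ==> (!!k s. sx k s ==> c k s = d k s) ==> c = d"
 unfolding CC_iff by (intro ext) (metis PiE_iff extensional_arb mem_Collect_eq)

lemma CC_bound2:
 assumes "c .: CC" "d .: CC"
 obtains N where "!!k s. N < k ==> sx k s ==> c k s = \<zero>" "!!k s. N < k ==> sx k s ==> d k s = \<zero>"
proof -
 obtain N M where "ALL k s. N < k --> sx k s --> c k s = \<zero>" "ALL k s. M < k --> sx k s --> d k s = \<zero>"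
  using CC_bound[OF assms(1)] CC_bound[OF assms(2)] by blast
 thus ?thesis by (intro that[of "max N M"]) auto
qed

lemma CC_ops:
 "c \<oplus>.CC d = cochain_fun X (%k s. c k s \<oplus> d k s)" "\<zero>.CC = cochain_fun X (%k s. \<zero>)"
 "a \<odot>.CC c = cochain_fun X (%k s. a \<otimes> c k s)"
 "\<one>.CC = cochain_fun X (%k s. if k = 0 then \<one> else \<zero>)"
 "c \<otimes>.CC d = cochain_fun X (%k s. \<Oplus>i\<in>{..k}. c i (fr i s) \<otimes> d (k - i) (back_face k i s))"
 "dif CC c = cochain_fun X (%k s. if k = 0 then \<zero> else
  (\<Oplus>i\<in>{..k}. sg R (int i) \<otimes> c (k - 1) (sface k i s)))"
 "homog CC m = {c \<in> carrier CC. ALL k. int k ~= m --> (ALL s. sx k s --> c k s = \<zero>)}"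
 by (simp_all add: cochain_algebra_def)

lemma face_sx [simp]: "sx (Suc k) s ==> j \<le> Suc k ==> sx k (sface (Suc k) j s)"
 using singular_simplex_singular_face[of "Suc k" X s j] by simp

lemmas front_sx [simp] = front_face_simplex(1)[where X = X]
lemmas back_sx [simp] = back_face_simplex(1)[where X = X]

lemma add_closed: "c .: CC ==> d .: CC ==> c \<oplus>.CC d .: CC"
proof -
 assume cd: "c .: CC" "d .: CC"
 obtain N where "!!k s. N < k ==> sx k s ==> c k s = \<zero>" "!!k s. N < k ==> sx k s ==> d k s = \<zero>"
  using CC_bound2[OF cd] by blast
 thus ?thesis unfolding CC_ops using cd by (intro CC_I[where N = N]) auto
qed

definition grC :: "(int => 'r) => ('r, 'a) cochain => ('r, 'a) cochain" where
 "grC th c = cochain_fun X (%k s. th (int k) \<otimes> c k s)"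

lemma grC_closed: "th .> R ==> c .: CC ==> grC th c .: CC"
proof -
 assume c: "c .: CC" and th: "th .> R"
 obtain N where "!!k s. N < k ==> sx k s ==> c k s = \<zero>" using CC_bound[OF c] by blast
 moreover have "th k .: R" for k using th by auto
 ultimately show ?thesis unfolding grC_def using c by (intro CC_I[where N = N]) auto
qed

lemma smult_closed: "a .: R ==> c .: CC ==> a \<odot>.CC c .: CC"
 using grC_closed[of "%_. a" c] by (simp add: grC_def CC_ops)

lemma zero_closed': "\<zero>.CC .: CC" and one_closed': "\<one>.CC .: CC"
 unfolding CC_ops by (rule CC_I[where N = 0]; simp)+

lemma mult_term [simp]: "c .: CC ==> d .: CC ==> sx k s ==> i \<le> k ==> c i (fr i s) \<otimes> d (k - i) (back_face k i s) .: R"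
 by (intro m_closed CC_val front_sx back_sx)

lemma mult_closed': "c .: CC ==> d .: CC ==> c \<otimes>.CC d .: CC"
proof -
 assume cd: "c .: CC" "d .: CC"
 obtain N where N: "!!k s. N < k ==> sx k s ==> c k s = \<zero>" "!!k s. N < k ==> sx k s ==> d k s = \<zero>"
  using CC_bound2[OF cd] by blast
 show ?thesis unfolding CC_ops
 proof (rule CC_I[where N = "N + N"])
  fix k s assume s: "sx k s"
  show "(\<Oplus>i\<in>{..k}. c i (fr i s) \<otimes> d (k - i) (back_face k i s)) .: R" using cd s by (auto intro!: finsum_closed)
  assume k: "N + N < k"
  have "c i (fr i s) \<otimes> d (k - i) (back_face k i s) = \<zero>" if "i \<le> k" for i
  proof (cases "N < i")
  case True thus ?thesis using N(1)[of i "fr i s"] that s cd by simp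
  next
  case False thus ?thesis using N(2)[of "k - i" "back_face k i s"] that s cd k by simp
  qed
  thus "(\<Oplus>i\<in>{..k}. c i (fr i s) \<otimes> d (k - i) (back_face k i s)) = \<zero>"
  by (intro add.finprod_one_eqI) simp
 qed
qed

lemma d_closed': "c .: CC ==> dif CC c .: CC"
proof -
 assume c: "c .: CC"
 obtain N where N: "!!k s. N < k ==> sx k s ==> c k s = \<zero>" using CC_bound[OF c] by blast
 have f: "sx (k - 1) (sface k i s)" if "sx k s" "i \<le> k" "k ~= 0" for k i s
  using that by (cases k) auto
 have z: "(if k = 0 then \<zero> else (\<Oplus>i\<in>{..k}. sg R (int i) \<otimes> c (k - 1) (sface k i s))) = \<zero>"
  if k: "Suc N < k" "sx k s" for k s
  using k N[OF _ f] by (auto intro!: add.finprod_one_eqI)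
 show ?thesis unfolding CC_ops
  by (rule CC_I[where N = "Suc N"]) (use f c z in "auto intro!: finsum_closed")
qed

lemma CC_vals [simp]:
 assumes "sx k s"
 shows "(c \<oplus>.CC d) k s = c k s \<oplus> d k s" "\<zero>.CC k s = \<zero>" "(a \<odot>.CC c) k s = a \<otimes> c k s"
  "\<one>.CC k s = (if k = 0 then \<one> else \<zero>)"
  "(c \<otimes>.CC d) k s = (\<Oplus>i\<in>{..k}. c i (fr i s) \<otimes> d (k - i) (back_face k i s))"
  "grC th c k s = th (int k) \<otimes> c k s"
 using assms by (simp_all add: CC_ops grC_def)

lemma d_vals [simp]:
 "sx 0 s ==> dif CC c 0 s = \<zero>"
 "sx (Suc k) s ==> dif CC c (Suc k) s = (\<Oplus>i\<in>{..Suc k}. sg R (int i) \<otimes> c k (sface (Suc k) i s))"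
 by (simp_all add: CC_ops)

lemma CC_module: "module R CC"
proof (intro module.intro is_cring)
 note cl = add_closed smult_closed zero_closed'
 show "abelian_group CC"
 proof (rule abelian_groupI)
  fix c assume c: "c .: CC"
  show "\<zero>.CC \<oplus>.CC c = c" by (rule CC_eqI) (use c cl in auto)
  show "EX d:carrier CC. d \<oplus>.CC c = \<zero>.CC"
  proof (rule bexI[OF _ smult_closed[OF a_inv_closed[OF one_closed] c]])
  show "(\<ominus> \<one>) \<odot>.CC c \<oplus>.CC c = \<zero>.CC"
  by (rule CC_eqI) (use c cl in "auto simp: l_minus l_neg")
  qed
  fix d assume d: "d .: CC"
  show "c \<oplus>.CC d = d \<oplus>.CC c" by (rule CC_eqI) (use c d cl in "auto simp: a_comm")
  fix e assume e: "e .: CC"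
  show "c \<oplus>.CC d \<oplus>.CC e = c \<oplus>.CC (d \<oplus>.CC e)" by (rule CC_eqI) (use c d e cl in "auto simp: a_assoc")
 qed (use cl in auto)
 show "module_axioms R CC"
 proof
  fix c assume c: "c .: CC"
  show "\<one> \<odot>.CC c = c" by (rule CC_eqI) (use c cl in auto)
  fix a assume a: "a .: R"
  show "a \<odot>.CC (c \<oplus>.CC d) = a \<odot>.CC c \<oplus>.CC a \<odot>.CC d" if d: "d .: CC" for d
  by (rule CC_eqI) (use a c d cl in "auto simp: r_distr")
  fix b assume b: "b .: R"
  show "(a \<oplus> b) \<odot>.CC c = a \<odot>.CC c \<oplus>.CC b \<odot>.CC c" by (rule CC_eqI) (use a b c cl in "auto simp: l_distr")
  show "a \<otimes> b \<odot>.CC c = a \<odot>.CC (b \<odot>.CC c)" by (rule CC_eqI) (use a b c cl in "auto simp: m_assoc")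
 qed (use cl in auto)
qed

lemma finsum_eq_add:
 assumes "!!i. i \<le> k ==> f i .: R" "!!i. i \<le> k ==> g i .: R" "!!i. i \<le> k ==> h i = f i \<oplus> g i"
 shows "(\<Oplus>i\<in>{..k::nat}. h i) = (\<Oplus>i\<in>{..k}. f i) \<oplus> (\<Oplus>i\<in>{..k}. g i)"
proof -
 have "(\<Oplus>i\<in>{..k}. h i) = (\<Oplus>i\<in>{..k}. f i \<oplus> g i)" by (rule finsum_cong') (use assms in auto)
 thus ?thesis using finsum_addf[of f "{..k}" g] assms by (auto simp: Pi_def)
qed

lemma finsum_eq_smult:
 assumes "!!i. i \<le> k ==> f i .: R" "a .: R" "!!i. i \<le> k ==> h i = a \<otimes> f i"
 shows "(\<Oplus>i\<in>{..k::nat}. h i) = a \<otimes> (\<Oplus>i\<in>{..k}. f i)"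
proof -
 have "(\<Oplus>i\<in>{..k}. h i) = (\<Oplus>i\<in>{..k}. a \<otimes> f i)" by (rule finsum_cong') (use assms in auto)
 thus ?thesis using finsum_rdistr[of "{..k}" a f] assms by (auto simp: Pi_def)
qed

lemma CC_diff_alg: "diff_alg R CC"
proof (intro diff_alg.intro CC_module diff_alg_axioms.intro)
 note cl = add_closed smult_closed zero_closed' mult_closed' d_closed'
 show "lin R CC CC (dif CC)"
 proof (rule linI)
  fix c assume c: "c .: CC"
  show "dif CC (c \<oplus>.CC d) = dif CC c \<oplus>.CC dif CC d" if d: "d .: CC" for d
  proof (rule CC_eqI)
  fix k s assume s: "sx k s"
  show "dif CC (c \<oplus>.CC d) k s = (dif CC c \<oplus>.CC dif CC d) k s"
  proof (cases k)
  case (Suc l)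
  thus ?thesis using s c d by (simp del: finsum_Suc) (rule finsum_eq_add; simp add: r_distr)
  qed (use s in simp)
  qed (use c d cl in auto)
  show "dif CC (a \<odot>.CC c) = a \<odot>.CC dif CC c" if a: "a .: R" for a
  proof (rule CC_eqI)
  fix k s assume s: "sx k s"
  show "dif CC (a \<odot>.CC c) k s = (a \<odot>.CC dif CC c) k s"
  proof (cases k)
  case (Suc l)
  thus ?thesis using s c a by (simp del: finsum_Suc) (rule finsum_eq_smult; simp add: m_lcomm)
  qed (use s a in simp)
  qed (use c a cl in auto)
 qed (rule d_closed')
 show "\<one>.CC .: CC" by (rule one_closed')
 fix c d assume c: "c .: CC" "d .: CC"
 show "c \<otimes>.CC d .: CC" using c by (rule mult_closed')
 {
  fix e assume e: "e .: CC"
  show "(c \<oplus>.CC d) \<otimes>.CC e = c \<otimes>.CC e \<oplus>.CC d \<otimes>.CC e"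
  by (rule CC_eqI) (simp_all add: cl c e, rule finsum_eq_add, simp_all add: l_distr c e)
  show "e \<otimes>.CC (c \<oplus>.CC d) = e \<otimes>.CC c \<oplus>.CC e \<otimes>.CC d"
  by (rule CC_eqI) (simp_all add: cl c e, rule finsum_eq_add, simp_all add: r_distr c e)
 next
  fix a assume a: "a .: R"
  show "(a \<odot>.CC c) \<otimes>.CC d = a \<odot>.CC (c \<otimes>.CC d)"
  by (rule CC_eqI) (simp_all add: cl c a, rule finsum_eq_smult, simp_all add: m_assoc c a)
  show "c \<otimes>.CC (a \<odot>.CC d) = a \<odot>.CC (c \<otimes>.CC d)"
  by (rule CC_eqI) (simp_all add: cl c a, rule finsum_eq_smult, simp_all add: m_lcomm c a)
 }
qed

end

sublocale cochains \<subseteq> C: diff_alg R CC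
 by (rule CC_diff_alg)

context cochains begin

subsection \<open>Evaluation on chains\<close>

text \<open>The additive extension from simplices to integral chains, through the universal property
  of the free Abelian group. It turns identities about boundaries and subdivision into identities of
  cochains.\<close>

definition ev :: "(((nat => real) => 'a) => 'r) => 'a chain => 'r" where
 "ev g = (SOME h. h \<in> hom (free_Abelian_group UNIV) (add_monoid R) & (ALL x. h (frag_of x) = g x))"

lemma ev_hom:
 assumes "range g <= carrier R"
 shows "ev g (frag_of x) = g x" "ev g u .: R" "ev g (u + v) = ev g u \<oplus> ev g v"
proof -
 have "EX h. h \<in> hom (free_Abelian_group UNIV) (add_monoid R) & (ALL x. h (frag_of x) = g x)"
  using add.free_Abelian_group_universal[of g UNIV] assms by (metis UNIV_I partial_object.select_convs(1))
 from someI_ex[OF this] have h: "ev g \<in> hom (free_Abelian_group UNIV) (add_monoid R)" "ALL x. ev g (frag_of x) = g x"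
  unfolding ev_def by auto
 show "ev g (frag_of x) = g x" using h(2) by simp
 show "ev g u .: R" "ev g (u + v) = ev g u \<oplus> ev g v" using h(1) by (auto simp: hom_def Pi_iff)
qed

lemma ev_zero: "range g <= carrier R ==> ev g 0 = \<zero>"
 using ev_hom(2)[of g 0] ev_hom(3)[of g 0 0] by (metis add.l_cancel_one' add.right_neutral)

lemma ev_diff:
 assumes "range g <= carrier R"
 shows "ev g (u - v) = ev g u \<ominus> ev g v"
 using ev_hom(3)[OF assms, of "u - v" v] ev_hom(2)[OF assms, of "u - v"] ev_hom(2)[OF assms, of v] by (simp add: a_minus_def a_assoc r_neg)

lemma ev_sign:
 assumes "range g <= carrier R"
 shows "ev g (frag_cmul ((-1) ^ i) u) = sg R (int i) \<otimes> ev g u"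
 using ev_diff[OF assms, of 0 u] ev_hom(2)[OF assms, of u] ev_zero[OF assms]
 by (cases "even i") (simp_all add: neg_one_pow_def l_minus a_minus_def)

lemma ev_sum:
 assumes "range g <= carrier R" "finite I"
 shows "ev g (\<Sum>i\<in>I. f i) = (\<Oplus>i\<in>I. ev g (f i))"
 using assms(2) by induction (simp_all add: ev_zero[OF assms(1)] ev_hom(2,3)[OF assms(1)])

text \<open>Outside the singular simplices of \<open>X\<close> a cochain has the value
  \<open>undefined\<close>, which need not lie in the ring, whereas \<open>ev\<close> takes a total
  function with values in the ring.\<close>

definition cv :: "('r, 'a) cochain => nat => ((nat => real) => 'a) => 'r" where
 "cv c k s = (if sx k s then c k s else \<zero>)"

lemma cv_range: "c .: CC ==> range (cv c k) <= carrier R"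
 by (auto simp: cv_def)

lemmas ev_cv = ev_hom(1)[OF cv_range] ev_hom(2)[OF cv_range] ev_hom(3)[OF cv_range] ev_zero[OF cv_range] ev_diff[OF cv_range]

text \<open>With this, \<open>d d = 0\<close> is inherited from the boundary of singular chains, and
  the homotopy of the subdivision argument can be dualized.\<close>

lemma d_ev:
 assumes "c .: CC" "schain k X u"
 shows "ev (cv (dif CC c) k) u = ev (cv c (k - 1)) (bdy k u)"
 using assms(2) unfolding singular_chain_def
proof (induction rule: frag_induction)
 case (one s)
 hence s: "sx k s" by simp
 have z: "ev (cv c l) (frag_of \<tau>) = c l \<tau>" if "sx l \<tau>" for l \<tau> using that by (simp add: ev_cv(1)[OF assms(1)] cv_def)
 show ?case
 proof (cases k)
  case 0 thus ?thesis using s by (simp add: ev_cv assms(1) d_closed' chain_boundary_of) (simp add: cv_def)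
 next
  case (Suc l)
  have "ev (cv c l) (bdy k (frag_of s)) = (\<Oplus>i\<in>{..Suc l}. ev (cv c l) (frag_cmul ((-1) ^ i) (frag_of (sface (Suc l) i s))))"
  unfolding Suc chain_boundary_of by (simp add: ev_sum[OF cv_range[OF assms(1)]] del: finsum_Suc sum.atMost_Suc)
  also have "... = (\<Oplus>i\<in>{..Suc l}. sg R (int i) \<otimes> c l (sface (Suc l) i s))"
  by (rule finsum_cong') (use s Suc assms(1) in "auto simp: ev_sign[OF cv_range] z")
  also have "... = ev (cv (dif CC c) k) (frag_of s)"
  using s Suc by (simp add: ev_cv(1)[OF d_closed'[OF assms(1)]] cv_def del: finsum_Suc)
  finally show ?thesis using Suc by simp
 qed
qed (simp_all add: ev_cv assms(1) d_closed' chain_boundary_diff)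

lemma d_chain: "c .: CC ==> sx k s ==> dif CC c k s = ev (cv c (k - 1)) (bdy k (frag_of s))"
 using d_ev[of c k "frag_of s"] by (simp add: ev_cv(1)[OF d_closed'] cv_def singular_chain_of)

lemma CC_d_d: "c .: CC ==> dif CC (dif CC c) = \<zero>.CC"
proof (rule CC_eqI)
 fix k s assume c: "c .: CC" and s: "sx k s"
 have ch: "schain k X (frag_of s)" using s by (simp add: singular_chain_of)
 have "dif CC (dif CC c) k s = ev (cv c (k - 1 - 1)) (bdy (k - 1) (bdy k (frag_of s)))"
  unfolding d_chain[OF d_closed'[OF c] s] using d_ev[OF c singular_chain_boundary[OF ch]] by simp
 also have "... = \<zero>" using chain_boundary_boundary[OF ch] by (simp add: ev_cv(4)[OF c])
 finally show "dif CC (dif CC c) k s = \<zero>.CC k s" using s by simp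
qed (simp_all add: d_closed' zero_closed')

end

section \<open>Gradings on quotients\<close>

lemma (in graded_dga) quotient_graded_dga:
 assumes "diff_ideal R A I" and I: "!!th x. th .> R ==> x \<in> I ==> gr th x \<in> I"
 defines "grQ == %th z. \<Union>x\<in>z. I +>.A gr th x"
 shows "graded_dga R (quotient_algebra A I) grQ"
  and "!!th x. th .> R ==> x .: A ==> grQ th (I +>.A x) = I +>.A gr th x"
proof -
 interpret I: diff_ideal R A I by fact
 let ?Q = "quotient_algebra A I"
 note qs = I.quotient_simps
 show gq: "grQ th (I +>.A x) = I +>.A gr th x" if th: "th .> R" and x: "x .: A" for th x
  unfolding grQ_def
 proof (rule quotient_union[OF I.I_sub x])
  fix y assume y: "y .: A" "y \<ominus>.A x \<in> I"
  have "gr th y \<ominus>.A gr th x \<in> I"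
  using I[OF th y(2)] lin_minus[OF mod mod gr_lin[OF th] y(1) x] by simp
  thus "I +>.A gr th y = I +>.A gr th x" using y(1) x th by (simp add: cos_iff[OF I.I_sub])
 qed
 have rep: "EX x:carrier A. z = I +>.A x" if "z .: ?Q" for z using that by (auto simp: qs)
 have sgn: "sg R .> R" by auto
 have ind: "(%j. if j = k then \<one> else \<zero>) .> R" for k :: int by auto
 note gl = linD[OF gr_lin]
 show "graded_dga R ?Q grQ"
 proof (intro graded_dga.intro graded_dga_axioms.intro I.quotient_diff_alg)
  fix z assume "z .: ?Q"
  then obtain x where x: "x .: A" "z = I +>.A x" using rep by blast
  show "grQ (%_. \<one>) z = z" using x by (simp add: gq gr_one)
  show "grQ (%j. if j = k then \<one> else \<zero>) z \<in> homog ?Q k" for k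
  unfolding x(2) gq[OF ind x(1)] qs by (rule imageI) (rule gr_indicator[OF x(1)])
  show "dif ?Q (dif ?Q z) = \<zero>.?Q"
  using x by (simp add: qs d_d)
  fix w assume "w .: ?Q"
  then obtain y where y: "y .: A" "w = I +>.A y" using rep by blast
  show "dif ?Q (z \<otimes>.?Q w) =
  dif ?Q z \<otimes>.?Q w \<oplus>.?Q
  grQ (sg R) z \<otimes>.?Q dif ?Q w"
  using x y sgn by (simp add: qs gq leibniz)
 next
  fix th :: "int => 'r" assume th: "th .> R"
  show "lin R ?Q ?Q (grQ th)"
  proof (rule linI)
  fix z assume "z .: ?Q"
  then obtain x where x: "x .: A" "z = I +>.A x" using rep by blast
  show "grQ th z .: ?Q" using x th by (simp add: gq qs)
  show "grQ th (a \<odot>.?Q z) = a \<odot>.?Q grQ th z" if "a .: R" for a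
  using x th that by (simp add: gq qs gl(3)[OF th])
  fix w assume "w .: ?Q"
  then obtain y where y: "y .: A" "w = I +>.A y" using rep by blast
  show "grQ th (z \<oplus>.?Q w) = grQ th z \<oplus>.?Q grQ th w"
  using x y th by (simp add: gq qs gl(2)[OF th])
  qed
  show "grQ th z = th k \<odot>.?Q z" if zq: "z \<in> homog ?Q k" for z k
  proof -
  obtain x where x: "x \<in> homog A k" "z = I +>.A x" using zq unfolding qs by blast
  hence "x .: A" "th k .: R" using homog_subset th by auto
  thus ?thesis using x th by (simp add: gq qs gr_homog)
  qed
  fix z assume "z .: ?Q"
  then obtain x where x: "x .: A" "z = I +>.A x" using rep by blast
  have "(%k. th (k - 1)) .> R" using th by auto
  thus "dif ?Q (grQ th z) = grQ (%k. th (k - 1)) (dif ?Q z)"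
  using x th by (simp add: gq qs d_gr)
  fix \<eta> :: "int => 'r" assume \<eta>: "\<eta> .> R"
  have "(%k. th k \<otimes> \<eta> k) .> R" using th \<eta> by auto
  thus "grQ th (grQ \<eta> z) = grQ (%k. th k \<otimes> \<eta> k) z" using x th \<eta> by (simp add: gq gr_gr)
 qed (use homog_subset in "auto simp: qs d_one")
qed

context cochains begin

subsection \<open>The Leibniz rule\<close>

lemma sgn_Suc: "sg R (1 + int i) = \<ominus> sg R (int i)"
 by (simp add: neg_one_pow_def)

text \<open>The contribution of one front length \<open>i\<close>: faces with
  \<open>j \<le> i\<close> meet the front, the others the back. Each differential on the right has
  one extra term, from the last face of the front and the first face of the back. Both are the
  product of \<open>c\<close> on the front \<open>i\<close>-face and \<open>d\<close> on the back
  face from vertex \<open>i + 1\<close>, with opposite signs.\<close>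

lemma leibniz_row:
 assumes c: "c .: CC" and d: "d .: CC" and s: "sx (Suc m) s" and i: "i \<le> m"
 shows "(\<Oplus>j\<in>{..Suc m}. sg R (int j) \<otimes> (c i (fr i (sface (Suc m) j s)) \<otimes>
  d (m - i) (back_face m i (sface (Suc m) j s)))) =
  dif CC c (Suc i) (fr (Suc i) s) \<otimes> d (m - i) (back_face (Suc m) (Suc i) s) \<oplus>
  (sg R (int i) \<otimes> c i (fr i s)) \<otimes> dif CC d (Suc m - i) (back_face (Suc m) i s)" (is "?l = _")
proof -
 let ?s = "%j. sg R (int j)"
 let ?A = "c i (fr i s)" and ?B = "d (m - i) (back_face (Suc m) (Suc i) s)"
 let ?F = "%j. c i (sface (Suc i) j (fr (Suc i) s))"
  and ?G = "%j. d (m - i) (sface (Suc (m - i)) j (back_face (Suc m) i s))"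
 let ?P = "\<Oplus>j\<in>{..i}. ?s j \<otimes> ?F j" and ?Q = "\<Oplus>j\<in>{..m - i}. ?s (Suc j) \<otimes> ?G (Suc j)"
 have mi: "Suc m - i = Suc (m - i)" "Suc m - Suc i = m - i" using i by auto
 have sb: "sx (Suc (m - i)) (back_face (Suc m) i s)" using back_sx[OF s, of i] i mi by simp
 have sf: "sx (Suc i) (fr (Suc i) s)" using front_sx[OF s, of "Suc i"] i by simp
 have A: "?A .: R" using c s i by simp
 have B: "?B .: R" using CC_val[OF d back_sx[OF s, of "Suc i"]] i by simp
 have F: "?F j .: R" if "j \<le> Suc i" for j using CC_val[OF c face_sx[OF sf that]] .
 have G: "?G j .: R" if "j \<le> Suc (m - i)" for j using CC_val[OF d face_sx[OF sb that]] .
 have P: "?P .: R" and Q: "?Q .: R" using F G by (auto intro!: finsum_closed)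
 have T: "c i (fr i (sface (Suc m) j s)) \<otimes> d (m - i) (back_face m i (sface (Suc m) j s)) =
  (if j \<le> i then ?F j \<otimes> ?B else ?A \<otimes> ?G (j - i))" if "j \<le> Suc m" for j
  using front_singular_face[OF i, of j s] back_singular_face[OF i, of j s] that mi by auto
 have "?l = (\<Oplus>j\<in>{..Suc m}. ?s j \<otimes> (if j \<le> i then ?F j \<otimes> ?B else ?A \<otimes> ?G (j - i)))"
  by (rule finsum_cong') (use T A B F G in "auto simp del: mult_term")
 also have "... = (\<Oplus>j\<in>{..i}. ?s j \<otimes> (if j \<le> i then ?F j \<otimes> ?B else ?A \<otimes> ?G (j - i))) \<oplus>
  (\<Oplus>j\<in>{..m - i}. ?s (Suc i + j) \<otimes> (if Suc i + j \<le> i then ?F (Suc i + j) \<otimes> ?B else ?A \<otimes> ?G (Suc i + j - i)))"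
  by (rule finsum_shift[OF i]) (use A B F G in auto)
 also have "(\<Oplus>j\<in>{..i}. ?s j \<otimes> (if j \<le> i then ?F j \<otimes> ?B else ?A \<otimes> ?G (j - i))) = ?B \<otimes> ?P"
  by (rule finsum_eq_smult) (use F B in "auto simp: m_ac")
 also have "(\<Oplus>j\<in>{..m - i}. ?s (Suc i + j) \<otimes> (if Suc i + j \<le> i then ?F (Suc i + j) \<otimes> ?B else ?A \<otimes> ?G (Suc i + j - i))) =
  (?s i \<otimes> ?A) \<otimes> ?Q"
 proof (rule finsum_eq_smult)
  fix j assume j: "j \<le> m - i"
  have "?s (Suc i + j) = ?s i \<otimes> ?s (Suc j)" using sg_add[of "int i" "int (Suc j)"] by (simp add: add_ac)
  moreover have "Suc i + j - i = Suc j" by simp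
  ultimately show "?s (Suc i + j) \<otimes> (if Suc i + j \<le> i then ?F (Suc i + j) \<otimes> ?B else ?A \<otimes> ?G (Suc i + j - i)) =
  (?s i \<otimes> ?A) \<otimes> (?s (Suc j) \<otimes> ?G (Suc j))" using A G[of "Suc j"] j by (simp add: m_ac)
 qed (use A G in auto)
 finally have l: "?l = ?B \<otimes> ?P \<oplus> (?s i \<otimes> ?A) \<otimes> ?Q" .
 have da: "dif CC c (Suc i) (fr (Suc i) s) = \<ominus> (?s i \<otimes> ?A) \<oplus> ?P"
  unfolding d_vals(2)[OF sf] using F A last_face_front[of i s] by (simp add: sgn_Suc l_minus Pi_def)
 have db: "dif CC d (Suc m - i) (back_face (Suc m) i s) = ?Q \<oplus> ?B"
  unfolding mi d_vals(2)[OF sb] using G first_face_back[OF i, of s] B mi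
  by (subst finsum_Suc2) (auto simp: neg_one_pow_def)
 have u: "?s i \<otimes> ?A .: R" using A by simp
 have "dif CC c (Suc i) (fr (Suc i) s) \<otimes> ?B \<oplus> (?s i \<otimes> ?A) \<otimes> dif CC d (Suc m - i) (back_face (Suc m) i s) =
  ?B \<otimes> ?P \<oplus> (?s i \<otimes> ?A) \<otimes> ?Q \<oplus> (\<ominus> (?s i \<otimes> ?A \<otimes> ?B) \<oplus> ?s i \<otimes> ?A \<otimes> ?B)"
  unfolding da db using u B P Q by (simp add: l_distr r_distr l_minus r_minus a_ac m_comm)
 thus ?thesis unfolding l using u B P Q by (simp add: l_neg)
qed

lemma sgn_fun: "sg R .> R"
 by auto

lemma CC_leibniz:
 assumes c: "c .: CC" and d: "d .: CC"
 shows "dif CC (c \<otimes>.CC d) = dif CC c \<otimes>.CC d \<oplus>.CC grC (sg R) c \<otimes>.CC dif CC d"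
proof (rule CC_eqI)
 note cl = c d grC_closed[OF sgn_fun c]
 let ?r = "dif CC c \<otimes>.CC d \<oplus>.CC grC (sg R) c \<otimes>.CC dif CC d"
 show "dif CC (c \<otimes>.CC d) .: CC" "?r .: CC" using cl by auto
 fix k s assume s: "sx k s"
 show "dif CC (c \<otimes>.CC d) k s = ?r k s"
 proof (cases k)
  case 0
  have s0: "sx 0 (fr 0 s)" "sx 0 (back_face 0 0 s)" using front_sx[OF s, of 0] back_sx[OF s, of 0] 0 by auto
  show ?thesis using s s0 cl unfolding 0 by simp
 next
  case (Suc m)
  let ?s = "%j. sg R (int j)"
  let ?T = "%i j. c i (fr i (sface (Suc m) j s)) \<otimes> d (m - i) (back_face m i (sface (Suc m) j s))"
  let ?U = "%i. dif CC c (Suc i) (fr (Suc i) s) \<otimes> d (m - i) (back_face (Suc m) (Suc i) s)"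
  and ?V = "%i. (?s i \<otimes> c i (fr i s)) \<otimes> dif CC d (Suc m - i) (back_face (Suc m) i s)"
  have s': "sx (Suc m) s" using s Suc by simp
  have T: "?T i j .: R" if "i \<le> m" "j \<le> Suc m" for i j using mult_term[OF c d face_sx[OF s' that(2)] that(1)] .
  have U: "?U i .: R" if "i \<le> m" for i
  using mult_term[OF C.d_closed[OF c] d s', of "Suc i"] that by simp
  have V: "?V i .: R" if "i \<le> Suc m" for i
  using mult_term[OF cl(3) C.d_closed[OF d] s' that] front_sx[OF s' that] by simp
  have "dif CC (c \<otimes>.CC d) k s = (\<Oplus>j\<in>{..Suc m}. \<Oplus>i\<in>{..m}. ?s j \<otimes> ?T i j)"
  unfolding Suc d_vals(2)[OF s']
  proof (rule finsum_cong')
  fix j assume j: "j \<in> {..Suc m}"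
  show "?s j \<otimes> (c \<otimes>.CC d) m (sface (Suc m) j s) = (\<Oplus>i\<in>{..m}. ?s j \<otimes> ?T i j)"
  using j s' T by (simp del: mult_term) (rule finsum_eq_smult[symmetric]; simp)
  qed (use T in "auto intro!: finsum_closed")
  also have "... = (\<Oplus>i\<in>{..m}. \<Oplus>j\<in>{..Suc m}. ?s j \<otimes> ?T i j)" by (rule finsum_atMost_swap) (use T in auto)
  also have "... = (\<Oplus>i\<in>{..m}. ?U i) \<oplus> (\<Oplus>i\<in>{..m}. ?V i)"
  by (rule finsum_eq_add) (use U V leibniz_row[OF c d s'] in auto)
  \<comment> \<open>The cup product in degree \<open>Suc m\<close> has one summand more, with
    \<open>dif CC c\<close> on a vertex. It is zero, so the index may be shifted. In the second sum
    the additional summand is the last one, with \<open>dif CC d\<close> on a vertex.\<close>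
  also have "(\<Oplus>i\<in>{..m}. ?U i) = (dif CC c \<otimes>.CC d) k s"
  proof -
  have "dif CC c 0 (fr 0 s) = \<zero>" using front_sx[OF s', of 0] by simp
  moreover have "d (Suc m) (back_face (Suc m) 0 s) .: R" using CC_val[OF d back_sx[OF s', of 0]] by simp
  moreover have "(\<Oplus>i\<in>{..m}. ?U i) .: R" using U by (auto intro!: finsum_closed)
  ultimately show ?thesis unfolding Suc using s' U mult_term[OF C.d_closed[OF c] d s']
  by (simp del: finsum_Suc mult_term) (subst finsum_Suc2; auto)
  qed
  also have "(\<Oplus>i\<in>{..m}. ?V i) = (grC (sg R) c \<otimes>.CC dif CC d) k s"
  proof -
  have "dif CC d 0 (back_face (Suc m) (Suc m) s) = \<zero>" using back_sx[OF s', of "Suc m"] by simp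
  moreover have "c (Suc m) (fr (Suc m) s) .: R" using c s' by simp
  moreover have "(\<Oplus>i\<in>{..m}. ?V i) .: R" using V by (auto intro!: finsum_closed)
  moreover have "(grC (sg R) c \<otimes>.CC dif CC d) k s = (\<Oplus>i\<in>{..Suc m}. ?V i)"
  unfolding Suc CC_vals(5)[OF s'] by (rule finsum_cong') (use V front_sx[OF s'] in auto)
  ultimately show ?thesis using V by (subst (asm) finsum_Suc) auto
  qed
  finally show ?thesis using s by simp
 qed
qed

lemma CC_graded_dga: "graded_dga R CC grC"
proof (intro graded_dga.intro graded_dga_axioms.intro CC_diff_alg)
 note cl = add_closed smult_closed zero_closed' grC_closed
 fix th :: "int => 'r" assume th: "th .> R"
 hence tc: "th k .: R" for k by auto
 show "lin R CC CC (grC th)"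
  by (rule linI; (rule CC_eqI)?) (simp_all add: cl th tc r_distr m_lcomm)
 show "grC th x = th k \<odot>.CC x" if x: "x \<in> homog CC k" for x k
 proof (rule CC_eqI)
  show "grC th x l s = (th k \<odot>.CC x) l s" if "sx l s" for l s
  using x that tc by (cases "int l = k") (auto simp: CC_ops(7))
 qed (use x cl th tc in "auto simp: CC_ops(7)")
 fix x assume x: "x .: CC"
 have sh: "(%k. th (k - 1)) .> R" using th by auto
 show "dif CC (grC th x) = grC (%k. th (k - 1)) (dif CC x)"
 proof (rule CC_eqI)
  fix k s assume s: "sx k s"
  show "dif CC (grC th x) k s = grC (%k. th (k - 1)) (dif CC x) k s"
  proof (cases k)
  case (Suc l)
  thus ?thesis using s x tc by (simp del: finsum_Suc) (rule finsum_eq_smult; simp add: m_lcomm)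
  qed (use s tc in simp)
 qed (use x cl th sh in auto)
 fix \<eta> :: "int => 'r" assume \<eta>: "\<eta> .> R"
 have te: "(%k. th k \<otimes> \<eta> k) .> R" "\<eta> k .: R" for k using th \<eta> by auto
 show "grC th (grC \<eta> x) = grC (%k. th k \<otimes> \<eta> k) x"
  by (rule CC_eqI) (simp_all add: cl th \<eta> te x tc m_assoc)
next
 show "homog CC k <= carrier CC" for k by (auto simp: CC_ops(7))
 show "dif CC \<one>.CC = \<zero>.CC"
 proof (rule CC_eqI)
  fix k s assume s: "sx k s"
  consider "k = 0" | "k = Suc 0" | l where "k = Suc (Suc l)" by (metis nat.exhaust)
  thus "dif CC \<one>.CC k s = \<zero>.CC k s"
  proof cases
  case 2 thus ?thesis using s by (simp add: neg_one_pow_def l_neg)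
  qed (use s in "auto simp del: finsum_Suc intro!: add.finprod_one_eqI")
 qed auto
 fix x assume x: "x .: CC"
 show "grC (%_. \<one>) x = x" by (rule CC_eqI) (use x in "simp_all add: grC_closed")
 show "grC (%j. if j = k then \<one> else \<zero>) x \<in> homog CC k" for k
  using x grC_closed[of "%j. if j = k then \<one> else \<zero>" x] by (auto simp: CC_ops(7))
 show "dif CC (dif CC x) = \<zero>.CC" by (rule CC_d_d[OF x])
qed (rule CC_leibniz)

end

sublocale cochains \<subseteq> C: graded_dga R CC grC
 by (rule CC_graded_dga)

context cochains begin

subsection \<open>Supports and the complex of germs\<close>

definition vanishes :: "('r, 'a) cochain => 'a set => bool" where
 "vanishes c U <-> (ALL k s. sx k s --> s ` sdx k <= U --> c k s = \<zero>)"

lemma vanishes_mono: "vanishes c U ==> V <= U ==> vanishes c V"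
 unfolding vanishes_def by blast

text \<open>A point lies outside if the cochain vanishes on all simplices within some neighbourhood
  of it. This is weaker than vanishing on all simplices that avoid \<open>supp c\<close>, as a
  simplex may spread over several such neighbourhoods; it depends only on the germ.\<close>

definition supp :: "('r, 'a) cochain => 'a set" where
 "supp c = topspace X - \<Union>{U. openin X U & vanishes c U}"

lemma supp_subset_iff: "supp c <= Z <-> (ALL x:topspace X - Z. EX U. openin X U & x \<in> U & vanishes c U)"
 unfolding supp_def by blast

lemma supp_mono:
 assumes "!!U. vanishes c U ==> vanishes e U" shows "supp e <= supp c"
 using assms unfolding supp_def by blast

lemma supp_mono2:
 assumes "!!U. vanishes c U ==> vanishes d U ==> vanishes e U" shows "supp e <= supp c \<union> supp d"
 unfolding supp_subset_iff
proof
 fix x assume "x \<in> topspace X - (supp c \<union> supp d)"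
 then obtain U V where "openin X U" "x \<in> U" "vanishes c U" "openin X V" "x \<in> V" "vanishes d V"
  unfolding supp_def by blast
 thus "EX U. openin X U & x \<in> U & vanishes e U"
  using assms[of "U \<inter> V"] by (intro exI[of _ "U \<inter> V"]) (auto intro: vanishes_mono)
qed

lemma vanishes_val: "vanishes c U ==> sx k s ==> s ` sdx k <= U ==> c k s = \<zero>"
 unfolding vanishes_def by blast

lemma vanishes_front: "vanishes c U ==> sx k s ==> s ` sdx k <= U ==> i \<le> k ==> c i (fr i s) = \<zero>"
 by (rule vanishes_val[OF _ front_sx]) (use front_face_simplex(2)[of k X s i] in blast)+

lemma vanishes_back: "vanishes c U ==> sx k s ==> s ` sdx k <= U ==> i \<le> k ==> c (k - i) (back_face k i s) = \<zero>"
 by (rule vanishes_val[OF _ back_sx]) (use back_face_simplex(2)[of k X s i] in blast)+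

lemma vanishes_face: "vanishes c U ==> sx (Suc k) s ==> s ` sdx (Suc k) <= U ==> i \<le> Suc k ==> c k (sface (Suc k) i s) = \<zero>"
 by (erule vanishes_val, erule (1) face_sx, erule subset_trans[rotated], rule singular_face_image[of "Suc k", simplified])

lemma supp_add: "supp (c \<oplus>.CC d) <= supp c \<union> supp d"
 by (rule supp_mono2) (simp add: vanishes_def)

lemma supp_smult: "a .: R ==> supp (a \<odot>.CC c) <= supp c"
 by (rule supp_mono) (simp add: vanishes_def)

lemma supp_zero: "supp \<zero>.CC = {}"
proof -
 have "vanishes \<zero>.CC (topspace X)" by (simp add: vanishes_def)
 thus ?thesis unfolding supp_def by blast
qed

lemma supp_gr: "th .> R ==> supp (grC th c) <= supp c"
proof (rule supp_mono)
 fix U assume "th .> R" "vanishes c U"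
 moreover from this have "th k .: R" for k by auto
 ultimately show "vanishes (grC th c) U" by (simp add: vanishes_def)
qed

lemma supp_d: "supp (dif CC c) <= supp c"
proof (rule supp_mono)
 fix U assume v: "vanishes c U"
 have "dif CC c k s = \<zero>" if s: "sx k s" "s ` sdx k <= U" for k s
 proof (cases k)
  case (Suc l)
  thus ?thesis using s vanishes_face[OF v] by (auto simp del: finsum_Suc intro!: add.finprod_one_eqI)
 qed (use s in simp)
 thus "vanishes (dif CC c) U" by (simp add: vanishes_def)
qed

lemma supp_mult:
 assumes "c .: CC" "d .: CC"
 shows "supp (c \<otimes>.CC d) <= supp c \<inter> supp d"
proof -
 have "vanishes (c \<otimes>.CC d) U" if "vanishes c U | vanishes d U" for U
  unfolding vanishes_def
 proof (intro allI impI)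
  fix k s assume s: "sx k s" "s ` sdx k <= U"
  have "c i (fr i s) \<otimes> d (k - i) (back_face k i s) = \<zero>" if i: "i \<le> k" for i
  using CC_val[OF assms(1) front_sx[OF s(1) i]] CC_val[OF assms(2) back_sx[OF s(1) i]]
  vanishes_front[of c U k s i] vanishes_back[of d U k s i] \<open>vanishes c U | vanishes d U\<close> s i by auto
  thus "(c \<otimes>.CC d) k s = \<zero>" using s(1) by (auto intro!: add.finprod_one_eqI)
 qed
 thus ?thesis using supp_mono[of c "c \<otimes>.CC d"] supp_mono[of d "c \<otimes>.CC d"] by blast
qed

abbreviation "LZ == locally_zero_cochains R X"

text \<open>The open sets on which \<open>c\<close> vanishes cover the space exactly when no point
  is left over for the support. From here on covers are replaced by inclusions of supports.\<close>

lemma LZ_iff: "c \<in> LZ <-> c .: CC & supp c = {}"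
proof -
 have e: "(ALL k s. sx k s & (EX U:\<U>. s ` sdx k <= U) --> c k s = \<zero>) <-> (ALL U:\<U>. vanishes c U)" for \<U>
  unfolding vanishes_def by (intro iffI allI ballI impI) (simp, metis, metis)
 have "(EX \<U>. (ALL U:\<U>. openin X U) & \<Union>\<U> = topspace X & (ALL U:\<U>. vanishes c U)) <-> supp c = {}" (is "?l <-> _")
 proof
  assume ?l
  then obtain \<U> where u: "ALL U:\<U>. openin X U" "\<Union>\<U> = topspace X" "ALL U:\<U>. vanishes c U" by (elim exE conjE)
  hence "\<Union>\<U> <= \<Union>{U. openin X U & vanishes c U}" by (intro Union_mono subsetI) simp
  thus "supp c = {}" using u(2) unfolding supp_def by simp
 next
  assume "supp c = {}"
  hence "topspace X <= \<Union>{U. openin X U & vanishes c U}" unfolding supp_def by simp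
  moreover have "\<Union>{U. openin X U & vanishes c U} <= topspace X" by (rule Union_least) (simp add: openin_subset)
  ultimately show ?l by (intro exI[of _ "{U. openin X U & vanishes c U}"]) (simp add: subset_antisym)
 qed
 thus ?thesis unfolding locally_zero_cochains_def mem_Collect_eq e by simp
qed

lemma LZ_ideal: "diff_ideal R CC LZ"
proof (intro diff_ideal.intro diff_ideal_axioms.intro CC_diff_alg)
 show "submodule LZ R CC"
  by (rule C.subI') (use supp_zero supp_add supp_smult in "fastforce simp: LZ_iff")+
qed (use supp_mult supp_d in "fastforce simp: LZ_iff")+

end

sublocale cochains \<subseteq> J: diff_ideal R CC LZ
 by (rule LZ_ideal)

context cochains begin

abbreviation "HH == hat_cochains R X"
abbreviation "germ c == LZ +>.CC c"

definition grH :: "(int => 'r) => ('r, 'a) cochain set => ('r, 'a) cochain set" where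
 "grH th z = (\<Union>c\<in>z. germ (grC th c))"

lemma LZ_gr: "th .> R ==> c \<in> LZ ==> grC th c \<in> LZ"
 using supp_gr[of th c] by (auto simp: LZ_iff grC_closed)

lemma HH_graded_dga: "graded_dga R HH grH"
 by (rule C.quotient_graded_dga(1)[OF LZ_ideal LZ_gr, folded hat_cochains_def grH_def[abs_def]])

lemma grH_germ: "th .> R ==> c .: CC ==> grH th (germ c) = germ (grC th c)"
 by (rule C.quotient_graded_dga(2)[OF LZ_ideal LZ_gr, folded grH_def])
lemmas HH_simps = qalg_simps[where A = CC and I = LZ, folded hat_cochains_def] J.quotient_simps[folded hat_cochains_def]

end

sublocale cochains \<subseteq> H: graded_dga R HH grH
 by (rule HH_graded_dga)

context cochains begin

lemma germ_rep: "z .: HH ==> EX c:carrier CC. z = germ c"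
 by (auto simp: HH_simps)

lemma germ_lin: "lin R CC HH (%c. germ c)"
 by (rule linI) (simp_all add: HH_simps)

lemma HH_homog_mult:
 assumes "z \<in> homog HH k" "w \<in> homog HH l" shows "z \<otimes>.HH w \<in> homog HH (k + l)"
proof -
 obtain c d where cd: "c \<in> homog CC k" "z = germ c" "d \<in> homog CC l" "w = germ d"
  using assms unfolding HH_simps by blast
 hence c: "c .: CC" "d .: CC" using C.homog_subset by blast+
 have "(c \<otimes>.CC d) n s = \<zero>" if n: "int n ~= k + l" and s: "sx n s" for n s
 proof -
  have "c i (fr i s) \<otimes> d (n - i) (back_face n i s) = \<zero>" if i: "i \<le> n" for i
  proof (cases "int i = k")
  case True
  hence "int (n - i) ~= l" using n i by auto
  hence "d (n - i) (back_face n i s) = \<zero>" using cd(3) back_sx[OF s i] by (simp add: CC_ops(7))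
  thus ?thesis using CC_val[OF c(1) front_sx[OF s i]] by simp
  next
  case False
  hence "c i (fr i s) = \<zero>" using cd(1) front_sx[OF s i] by (simp add: CC_ops(7))
  thus ?thesis using CC_val[OF c(2) back_sx[OF s i]] by simp
  qed
  thus ?thesis using s by (auto intro!: add.finprod_one_eqI)
 qed
 hence "c \<otimes>.CC d \<in> homog CC (k + l)" using c by (simp add: CC_ops(7))
 thus ?thesis using c by (auto simp: HH_simps cd)
qed

lemma HH_homog_one: "\<one>.HH \<in> homog HH 0"
proof -
 have "\<one>.CC \<in> homog CC 0" using C.unit_closed by (auto simp: CC_ops(7))
 thus ?thesis by (simp add: HH_simps)
qed

lemma finsum_CC_val:
 assumes "finite I" "!!i. i \<in> I ==> f i .: CC" "sx k s"
 shows "(\<Oplus>.CC i\<in>I. f i) k s = (\<Oplus>i\<in>I. f i k s)"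
 using assms(1,2)
proof induction
 case (insert i I)
 thus ?case using assms(3) by (subst C.M.finsum_insert; simp add: Pi_def)
qed (use assms(3) in simp)

lemma HH_degrees:
 assumes "z .: HH"
 defines "p == %k. grH (%j. if j = k then \<one> else \<zero>) z"
 shows "finite {k. p k ~= \<zero>.HH}" "(\<Oplus>.HH k\<in>{k. p k ~= \<zero>.HH}. p k) = z"
proof -
 obtain c where c: "c .: CC" "z = germ c" using germ_rep[OF assms(1)] by blast
 obtain N where N: "ALL k s. N < k --> sx k s --> c k s = \<zero>" using CC_bound[OF c(1)] by blast
 let ?g = "%k. grC (%j. if j = k then \<one> else \<zero>) c" and ?I = "int ` {..N}"
 have ind: "(%j. if j = k then \<one> else \<zero>) .> R" for k :: int by auto
 have g: "?g k .: CC" for k by (rule grC_closed[OF ind c(1)])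
 have p: "p k = germ (?g k)" for k unfolding p_def c(2) by (rule grH_germ[OF ind c(1)])
 have "?g k = \<zero>.CC" if k: "k \<notin> ?I" for k
 proof (rule CC_eqI)
  fix l s assume s: "sx l s"
  have "int l = k ==> c l s = \<zero>" using k N s by (metis atMost_iff imageI not_le)
  thus "?g k l s = \<zero>.CC l s" using s c(1) by simp
 qed (use g in simp_all)
 hence out: "p k = \<zero>.HH" if "k \<notin> ?I" for k using that unfolding p by (simp add: HH_simps)
 hence sub: "{k. p k ~= \<zero>.HH} <= ?I" by blast
 thus "finite {k. p k ~= \<zero>.HH}" by (rule finite_subset) simp
 have pc: "p k .: HH" for k unfolding p by (rule linD(1)[OF germ_lin g])
 have "(\<Oplus>.HH k\<in>{k. p k ~= \<zero>.HH}. p k) = (\<Oplus>.HH k\<in>?I. p k)"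
  by (rule H.M.add.finprod_mono_neutral_cong_left) (use sub pc in auto)
 also have "... = germ (\<Oplus>.CC k\<in>?I. ?g k)" unfolding p
  by (rule lin_finsum[OF C.mod H.mod germ_lin, symmetric]) (use g in auto)
 also have "(\<Oplus>.CC k\<in>?I. ?g k) = c"
 proof (rule CC_eqI)
  show "(\<Oplus>.CC k\<in>?I. ?g k) .: CC" by (rule C.M.finsum_closed) (use g in auto)
  fix l s assume s: "sx l s"
  have cv: "c l s .: R" using c(1) s by simp
  have "(\<Oplus>.CC k\<in>?I. ?g k) l s = (\<Oplus>k\<in>?I. ?g k l s)" by (rule finsum_CC_val) (use g s in auto)
  also have "... = (\<Oplus>k\<in>?I. if int l = k then c l s else \<zero>)"
  by (rule finsum_cong') (use s cv in auto)
  also have "... = c l s"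
  proof (cases "int l \<in> ?I")
  case True thus ?thesis using finsum_singleton[OF True, of "%_. c l s"] cv by simp
  next
  case False
  hence "(\<Oplus>k\<in>?I. if int l = k then c l s else \<zero>) = \<zero>" by (intro add.finprod_one_eqI) auto
  moreover have "c l s = \<zero>" using False N s by (metis atMost_iff imageI not_le)
  ultimately show ?thesis by simp
  qed
  finally show "(\<Oplus>.CC k\<in>?I. ?g k) l s = c l s" .
 qed (use c in auto)
 finally show "(\<Oplus>.HH k\<in>{k. p k ~= \<zero>.HH}. p k) = z" using c(2) by simp
qed

end

section \<open>Small simplices\<close>

definition small_sx :: "'a topology => 'a set set => nat => ((nat => real) => 'a) set" where
 "small_sx X \<V> k = {s. EX U:\<V>. singular_simplex k (subtopology X U) s}"

definition small_chain :: "'a topology => 'a set set => nat => 'a chain => bool" where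
 "small_chain X \<V> k u <-> Poly_Mapping.keys u <= small_sx X \<V> k"

lemma small_chain_diff: "small_chain X \<V> k u ==> small_chain X \<V> k v ==> small_chain X \<V> k (u - v)"
 unfolding small_chain_def using keys_diff[of u v] by blast

lemma small_chain_zero: "small_chain X \<V> k 0"
 by (simp add: small_chain_def)

text \<open>An additive operator on chains that maps chains in each subspace to chains in the same
  subspace keeps small chains small, as each simplex is treated inside its own \<open>U\<close>.
  Applied to the boundary and to the homotopy of subdivision.\<close>

lemma small_chain_map:
 assumes "F 0 = 0" "!!u v. F (u - v) = F u - F v" and u: "small_chain X \<V> k u"
  and F: "!!U s. schain k (subtopology X U) (frag_of s) ==> schain l (subtopology X U) (F (frag_of s))"
 shows "small_chain X \<V> l (F u)"
 using u[unfolded small_chain_def]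
proof (induction rule: frag_induction)
 case (one s)
 then obtain U where U: "U \<in> \<V>" "singular_simplex k (subtopology X U) s" by (auto simp: small_sx_def)
 hence "schain l (subtopology X U) (F (frag_of s))" using F by (simp add: singular_chain_of)
 thus ?case using U(1) by (auto simp: small_chain_def small_sx_def singular_chain_def)
qed (simp_all add: assms(1,2) small_chain_zero small_chain_diff)

lemma small_chain_boundary: "small_chain X \<V> k u ==> small_chain X \<V> (k - Suc 0) (bdy k u)"
 by (rule small_chain_map[where F = "bdy k"])
  (erule singular_chain_boundary | assumption | simp add: chain_boundary_diff)+

lemma small_simplices_sx: "s \<in> small_sx X \<V> k ==> singular_simplex k X s"
 by (auto simp: small_sx_def singular_simplex_subtopology)

lemma small_vertices:
 assumes "topspace X <= \<Union>\<V>" "singular_simplex 0 X s"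
 shows "s \<in> small_sx X \<V> 0"
proof -
 let ?e = "%j. if j = 0 then 1 else (0::real)"
 have "s ?e \<in> topspace X"
  using assms(2) by (auto simp: singular_simplex_def continuous_map_def standard_simplex_0)
 thus ?thesis using assms by (auto simp: small_sx_def singular_simplex_subtopology standard_simplex_0)
qed

text \<open>Subdivide \<open>N\<close> times until \<open>u\<close> becomes small and take
  \<open>w = - h u\<close>, with \<open>h\<close> the homotopy between the iterated subdivision and
  the identity. What remains of \<open>u\<close> is the subdivided chain minus \<open>h\<close> of
  the boundary, and the latter is small because the boundary already is.\<close>

lemma small_homotopy_step:
 assumes op: "!!U. U \<in> \<V> ==> openin X U" and cov: "topspace X <= \<Union>\<V>"
  and u: "schain k X u" "small_chain X \<V> (k - Suc 0) (bdy k u)"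
 shows "EX w. schain (Suc k) X w & small_chain X \<V> k (u - bdy (Suc k) w)"
proof -
 obtain N where N: "!!m f. N \<le> m ==> f \<in> Poly_Mapping.keys ((singular_subdivision k ^^ m) u) ==> EX V:\<V>. f \<in> sdx k \<rightarrow> V"
  using sufficient_iterated_singular_subdivision_exists[OF op cov u(1)] by blast
 obtain h where h: "!!p. h p 0 = (0 :: 'a chain)" "!!p c1 c2. h p (c1-c2) = h p c1 - h p c2"
  "!!p X c. schain p X c ==> schain (Suc p) X (h p c)"
  "!!p X c. schain p X c ==> bdy (Suc p) (h p c) + h (p - Suc 0) (bdy p c) = (singular_subdivision p ^^ N) c - c"
  using chain_homotopic_iterated_singular_subdivision[of N] by blast
 let ?s = "(singular_subdivision k ^^ N) u" and ?b = "h (k - Suc 0) (bdy k u)"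
 have "schain k X (singular_subdivision k v)" if "schain k X v" for v
  by (rule singular_chain_singular_subdivision[OF that])
 hence "schain k X ?s" by (induction N) (simp_all add: u(1))
 hence sx: "singular_simplex k X f" if "f \<in> Poly_Mapping.keys ?s" for f using that by (auto simp: singular_chain_def)
 have s: "small_chain X \<V> k ?s"
  unfolding small_chain_def
 proof
  fix f assume f: "f \<in> Poly_Mapping.keys ?s"
  obtain V where "V \<in> \<V>" "f \<in> sdx k \<rightarrow> V" using N[OF order_refl f] by blast
  thus "f \<in> small_sx X \<V> k" using sx[OF f]
  unfolding small_sx_def singular_simplex_subtopology by (intro CollectI bexI[of _ V]) auto
 qed
 have b: "small_chain X \<V> k ?b" if "0 < k"
 proof -
  have "small_chain X \<V> (Suc (k - Suc 0)) ?b"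
  by (rule small_chain_map[OF h(1,2) u(2)]) (rule h(3))
  thus ?thesis using that by simp
 qed
 \<comment> \<open>For \<open>k = 0\<close> the predecessor in the degree of \<open>?b\<close> is
   truncated, but then the boundary, and with it \<open>?b\<close>, is zero.\<close>
 have b': "small_chain X \<V> k ?b"
  by (cases "k = 0") (use b in "simp_all add: chain_boundary_def h(1) small_chain_zero")
 have "u - bdy (Suc k) (0 - h k u) = ?s - ?b"
  using h(4)[OF u(1)] by (simp add: chain_boundary_minus algebra_simps)
 moreover have "schain (Suc k) X (0 - h k u)" using h(3)[OF u(1)] by (simp add: singular_chain_minus)
 ultimately show ?thesis using small_chain_diff[OF s b'] by metis
qed

text \<open>How often a simplex must be subdivided depends on the simplex, so no fixed iterate of
  subdivision will do, and \<open>H\<close> is chosen simplex by simplex and degree by degree. For a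
  simplex \<open>s\<close>, the chain \<open>s\<close> minus \<open>H\<close> of its boundary has
  small boundary, and the preceding step applies to it. Choosing zero on small simplices makes the
  dual operator preserve local vanishing.\<close>

lemma small_homotopy:
 assumes op: "!!U. U \<in> \<V> ==> openin X U" and cov: "topspace X <= \<Union>\<V>"
 obtains H where "!!k s. s \<in> small_sx X \<V> k ==> H k s = 0"
  "!!k s. singular_simplex k X s ==> schain (Suc k) X (H k s)"
  "!!k s. singular_simplex (Suc k) X s ==> small_chain X \<V> (Suc k)
  (frag_of s - bdy (Suc (Suc k)) (H (Suc k) s) - frag_extend (H k) (bdy (Suc k) (frag_of s)))"
proof -
 let ?S = "small_sx X \<V>"
 \<comment> \<open>The clause about cycles carries the induction: applied to the boundary of a
   simplex of the next degree, it says that the corrected simplex has small boundary.\<close>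
 define P where "P = (%k H. (ALL s:?S k. H s = 0) & (ALL s. singular_simplex k X s --> schain (Suc k) X (H s)) &
  (ALL v. schain k X v --> bdy k v = 0 --> small_chain X \<V> k (v - bdy (Suc k) (frag_extend H v))))"
 define Q where "Q = (%k H H'. ALL s. singular_simplex (Suc k) X s --> small_chain X \<V> (Suc k)
  (frag_of s - bdy (Suc (Suc k)) (H' s) - frag_extend H (bdy (Suc k) (frag_of s))))"
 have P0: "P 0 (%_. 0)"
 proof -
  have "small_chain X \<V> 0 v" if "schain 0 X v" for v
  using that small_vertices[OF cov] by (auto simp: singular_chain_def small_chain_def)
  moreover have "frag_extend (%_. 0 :: 'a chain) v = 0" for v :: "'a chain" by (rule frag_extend_eq_0) simp
  ultimately show ?thesis by (simp add: P_def)
 qed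
 have step: "EX H'. P (Suc k) H' & Q k H H'" if P: "P k H" for k H
 proof -
  note H1 = P[unfolded P_def, THEN conjunct1, rule_format]
  and H2 = P[unfolded P_def, THEN conjunct2, THEN conjunct1, rule_format]
  and H3 = P[unfolded P_def, THEN conjunct2, THEN conjunct2, rule_format]
  have Hc: "schain (Suc k) X (frag_extend H v)" if "schain k X v" for v
  by (rule singular_chain_extend) (use that H2 in "auto simp: singular_chain_def")
  let ?u = "%s. frag_of s - frag_extend H (bdy (Suc k) (frag_of s))"
  have ex: "EX w. (s \<in> ?S (Suc k) --> w = 0) & schain (Suc (Suc k)) X w & small_chain X \<V> (Suc k) (?u s - bdy (Suc (Suc k)) w)"
  if s: "singular_simplex (Suc k) X s" for s
  proof (cases "s \<in> ?S (Suc k)")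
  case True
  hence sm: "small_chain X \<V> (Suc k) (frag_of s)" by (simp add: small_chain_def)
  have "small_chain X \<V> k (bdy (Suc k) (frag_of s))" using small_chain_boundary[OF sm] by simp
  hence "frag_extend H (bdy (Suc k) (frag_of s)) = 0"
  by (intro frag_extend_eq_0 H1) (auto simp: small_chain_def)
  thus ?thesis using sm by (intro exI[of _ 0]) simp
  next
  case False
  have c: "schain (Suc k) X (frag_of s)" using s by (simp add: singular_chain_of)
  have cb: "schain k X (bdy (Suc k) (frag_of s))" using singular_chain_boundary[OF c] by simp
  have bb: "bdy k (bdy (Suc k) (frag_of s)) = 0" using chain_boundary_boundary[OF c] by simp
  have "small_chain X \<V> k (bdy (Suc k) (?u s))"
  using H3[OF cb bb] by (simp add: chain_boundary_diff)
  thus ?thesis using small_homotopy_step[OF op cov singular_chain_diff[OF c Hc[OF cb]]] False by auto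
  qed
  obtain H' where H': "!!s. singular_simplex (Suc k) X s ==> (s \<in> ?S (Suc k) --> H' s = 0) & schain (Suc (Suc k)) X (H' s) &
  small_chain X \<V> (Suc k) (?u s - bdy (Suc (Suc k)) (H' s))"
  using ex by metis
  have sw: "?u s - y = frag_of s - y - frag_extend H (bdy (Suc k) (frag_of s))" for s y by simp
  have Q: "Q k H H'" unfolding Q_def using H' unfolding sw by simp
  have lin: "small_chain X \<V> (Suc k) (v - bdy (Suc (Suc k)) (frag_extend H' v) - frag_extend H (bdy (Suc k) v))"
  if "schain (Suc k) X v" for v
  using that unfolding singular_chain_def
  proof (induction rule: frag_induction)
  case (one s) thus ?case using Q by (simp add: Q_def)
  next
  case (diff v w)
  thus ?case using small_chain_diff[OF diff]
  by (simp add: frag_extend_diff chain_boundary_diff algebra_simps)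
  qed (simp add: small_chain_zero)
  have "P (Suc k) H'" unfolding P_def
  proof (intro conjI ballI allI impI)
  show "H' s = 0" if "s \<in> ?S (Suc k)" for s using H'[OF small_simplices_sx[OF that]] that by simp
  show "schain (Suc (Suc k)) X (H' s)" if "singular_simplex (Suc k) X s" for s using H'[OF that] by simp
  show "small_chain X \<V> (Suc k) (v - bdy (Suc (Suc k)) (frag_extend H' v))"
  if "schain (Suc k) X v" "bdy (Suc k) v = 0" for v using lin[OF that(1)] that(2) by simp
  qed
  thus ?thesis using Q by blast
 qed
 obtain H where H: "!!k. P k (H k) & Q k (H k) (H (Suc k))"
  using dependent_nat_choice[of P Q, OF exI[of "P 0", OF P0] step] by blast
 show thesis
 proof (rule that[of H])
  show "H k s = 0" if "s \<in> ?S k" for k s using H[of k] that by (simp add: P_def)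
  show "schain (Suc k) X (H k s)" if "singular_simplex k X s" for k s using H[of k] that by (simp add: P_def)
  show "small_chain X \<V> (Suc k) (frag_of s - bdy (Suc (Suc k)) (H (Suc k) s) - frag_extend (H k) (bdy (Suc k) (frag_of s)))"
  if "singular_simplex (Suc k) X s" for k s using H[of k] that by (simp add: Q_def)
 qed
qed

context cochains begin

lemma ev_of: "c .: CC ==> sx k s ==> ev (cv c k) (frag_of s) = c k s"
 unfolding ev_cv(1) by (simp add: cv_def)

lemma ev_zero_cochain: "ev (cv \<zero>.CC k) u = \<zero>"
 using subset_UNIV
proof (induction u rule: frag_induction)
 case (one s) show ?case unfolding ev_cv(1)[OF C.M.zero_closed] by (simp add: cv_def)
qed (simp_all add: ev_cv(4,5)[OF C.M.zero_closed] a_minus_def)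

lemma ev_small:
 assumes c: "c .: CC" and v: "!!U. U \<in> \<V> ==> vanishes c U" and u: "small_chain X \<V> k u"
 shows "ev (cv c k) u = \<zero>"
 using u[unfolded small_chain_def]
proof (induction rule: frag_induction)
 case (one s)
 then obtain U where "U \<in> \<V>" "sx k s" "s ` sdx k <= U"
  unfolding small_sx_def singular_simplex_subtopology by blast
 hence "c k s = \<zero>" "sx k s" using vanishes_val[OF v] by auto
 thus ?case by (simp add: ev_of[OF c])
qed (simp_all add: ev_cv(4,5)[OF c] a_minus_def)

lemma ev_extend:
 assumes c: "c .: CC" and h: "h .: CC" "!!s. sx k s ==> h k s = ev (cv c l) (H s)" and u: "schain k X u"
 shows "ev (cv h k) u = ev (cv c l) (frag_extend H u)"
 using u[unfolded singular_chain_def]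
proof (induction rule: frag_induction)
 case (one s) thus ?case by (simp add: ev_of[OF h(1)] h(2))
qed (simp_all add: ev_cv(4,5)[OF c] ev_cv(4,5)[OF h(1)] frag_extend_diff)

text \<open>Put \<open>h = c\<close> after \<open>H\<close>. As \<open>c\<close> kills small chains,
  \<open>c (s)\<close> equals \<open>c\<close> of the boundary of \<open>H s\<close> plus
  \<open>c\<close> of \<open>H\<close> of the boundary of \<open>s\<close>. The first term is
  \<open>dif CC c\<close> on \<open>H s\<close>, hence zero, and the second is
  \<open>dif CC h\<close> on \<open>s\<close>. Since \<open>H\<close> is zero on small simplices,
  \<open>h\<close> vanishes on the same cover as \<open>c\<close>.\<close>

lemma LZ_acyclic:
 assumes c: "c \<in> LZ" and dc: "dif CC c = \<zero>.CC"
 shows "EX h:LZ. dif CC h = c"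
proof -
 let ?V = "{U. openin X U & vanishes c U}"
 have cc: "c .: CC" and cov: "topspace X <= \<Union>?V" using c by (auto simp: LZ_iff supp_def)
 have op: "openin X U" if "U \<in> ?V" for U using that by simp
 have va: "vanishes c U" if "U \<in> ?V" for U using that by simp
 obtain H where H: "!!k s. s \<in> small_sx X ?V k ==> H k s = 0"
  "!!k s. sx k s ==> schain (Suc k) X (H k s)"
  "!!k s. sx (Suc k) s ==> small_chain X ?V (Suc k)
  (frag_of s - bdy (Suc (Suc k)) (H (Suc k) s) - frag_extend (H k) (bdy (Suc k) (frag_of s)))"
  using small_homotopy[of ?V X, OF op cov] by blast
 define h where "h = cochain_fun X (%k s. ev (cv c (Suc k)) (H k s))"
 have hv: "h k s = ev (cv c (Suc k)) (H k s)" if "sx k s" for k s using that by (simp add: h_def)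
 obtain N where N: "ALL k s. N < k --> sx k s --> c k s = \<zero>" using CC_bound[OF cc] by blast
 have h: "h .: CC" unfolding h_def
 proof (rule CC_I[where N = N])
  show "ev (cv c (Suc k)) (H k s) .: R" for k s by (rule ev_cv(2)[OF cc])
  fix k s assume "N < k"
  hence "cv c (Suc k) = cv \<zero>.CC (Suc k)" using N by (auto simp: cv_def)
  hence "ev (cv c (Suc k)) (H k s) = ev (cv \<zero>.CC (Suc k)) (H k s)" by simp
  thus "ev (cv c (Suc k)) (H k s) = \<zero>" by (simp add: ev_zero_cochain)
 qed
 have "vanishes h U" if U: "U \<in> ?V" for U
  unfolding vanishes_def
 proof (intro allI impI)
  fix k s assume s: "sx k s" "s ` sdx k <= U"
  hence "H k s = 0" using H(1)[of s k] U unfolding small_sx_def singular_simplex_subtopology by blast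
  thus "h k s = \<zero>" using s ev_cv(4)[OF cc] by (simp add: hv)
 qed
 hence "supp h <= {}" unfolding supp_subset_iff using cov by blast
 hence hL: "h \<in> LZ" using h by (simp add: LZ_iff)
 have "dif CC h k s = c k s" if s: "sx k s" for k s
 proof (cases k)
  \<comment> \<open>A coboundary vanishes on vertices, and so does \<open>c\<close>: every vertex
    lies in a member of the cover.\<close>
  case 0
  hence "s \<in> small_sx X ?V 0" using small_vertices[OF cov] s by simp
  then obtain U where "U \<in> ?V" "sx 0 s" "s ` sdx 0 <= U"
  unfolding small_sx_def singular_simplex_subtopology by blast
  thus ?thesis using 0 s vanishes_val[OF va] by simp
 next
  case (Suc l)
  let ?e = "ev (cv c (Suc l))"
  have s': "sx (Suc l) s" using s Suc by simp
  have ch: "schain (Suc l) X (frag_of s)" using s' by (simp add: singular_chain_of)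
  have "schain l X (bdy (Suc l) (frag_of s))" using singular_chain_boundary[OF ch] by simp
  hence 1: "dif CC h (Suc l) s = ?e (frag_extend (H l) (bdy (Suc l) (frag_of s)))"
  using d_chain[OF h s'] ev_extend[OF cc h hv] by simp
  have 2: "?e (bdy (Suc (Suc l)) (H (Suc l) s)) = \<zero>"
  using d_ev[OF cc H(2)[OF s']] dc by (simp add: ev_zero_cochain)
  have 3: "?e (frag_of s) = c (Suc l) s" by (rule ev_of[OF cc s'])
  note v = CC_val[OF cc s'] CC_val[OF C.d_closed[OF h] s']
  have "c (Suc l) s \<ominus> \<zero> \<ominus> dif CC h (Suc l) s = \<zero>"
  using ev_small[OF cc va H(3)[OF s']] unfolding ev_cv(5)[OF cc] 1 2 3 .
  moreover have "c (Suc l) s \<ominus> \<zero> = c (Suc l) s" using v by (simp add: a_minus_def)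
  ultimately show ?thesis unfolding Suc using r_right_minus_eq[OF v] by simp
 qed
 hence "dif CC h = c" by (intro CC_eqI) (use h cc in auto)
 thus ?thesis using hL by blast
qed

lemma germ_quasi_iso: "EX \<phi>. graded_algebra_iso R (cohomology CC) (cohomology HH) \<phi>"
proof (rule quasi_iso[OF CC_graded_dga HH_graded_dga, of "%c. germ c"])
 show "diff_hom R CC HH (%c. germ c)" unfolding diff_hom_def using germ_lin by (simp add: HH_simps)
 have z: "germ c = \<zero>.HH <-> c \<in> LZ" if "c .: CC" for c
  using C.coset_eq_zero_iff[OF J.I_sub that] by (simp add: HH_simps)
 show "germ (grC th c) = \<zero>.HH" if "th .> R" "c .: CC" "germ c = \<zero>.HH" for th c
  using that LZ_gr[of th c] by (simp add: z grC_closed)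
 show "EX w:carrier CC. germ w = \<zero>.HH & dif CC w = c"
  if "c .: CC" "germ c = \<zero>.HH" "dif CC c = \<zero>.CC" for c
 proof -
  have "c \<in> LZ" using that z by simp
  from LZ_acyclic[OF this that(3)] obtain h where "h \<in> LZ" "dif CC h = c" by blast
  thus ?thesis using z[of h] by (auto simp: LZ_iff)
 qed
qed (simp_all add: HH_simps)

end

section \<open>Restriction and relative cochains\<close>

locale cochains_sub = cochains R X for R :: "('r, 'm) ring_scheme" (structure) and X :: "'a topology" +
 fixes S :: "'a set"

sublocale cochains_sub \<subseteq> Y: cochains R "subtopology X S" ..

context cochains_sub begin

abbreviation rs :: "('r, 'a) cochain => ('r, 'a) cochain" where "rs == cochain_fun (subtopology X S)"

lemma Y_sx: "Y.sx k s <-> sx k s & s ` sdx k <= S"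
 by (rule singular_simplex_subtopology)

lemma Y_imp: "Y.sx k s ==> sx k s"
 unfolding Y_sx by simp

lemma rs_closed: "c .: CC ==> rs c .: Y.CC"
proof -
 assume c: "c .: CC"
 obtain N where N: "ALL k s. N < k --> sx k s --> c k s = \<zero>" using CC_bound[OF c] by blast
 show ?thesis by (rule Y.CC_I[where N = N]) (use c N Y_imp in auto)
qed

lemma rs_diff_hom: "diff_hom R CC Y.CC rs"
proof -
 note cl = rs_closed Y.add_closed Y.smult_closed Y.mult_closed' Y.d_closed'
 have 1: "lin R CC Y.CC rs"
  by (rule linI; (rule Y.CC_eqI)?) (simp_all add: cl Y_imp add_closed smult_closed)
 have 2: "rs (c \<otimes>.CC d) = rs c \<otimes>.Y.CC rs d" if c: "c .: CC" and d: "d .: CC" for c d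
 proof (rule Y.CC_eqI)
  fix k s assume s: "Y.sx k s"
  have "(\<Oplus>i\<in>{..k}. c i (fr i s) \<otimes> d (k - i) (back_face k i s)) = (\<Oplus>i\<in>{..k}. rs c i (fr i s) \<otimes> rs d (k - i) (back_face k i s))"
  by (rule finsum_cong') (use s c d mult_term[OF c d Y_imp[OF s]] in "auto simp del: mult_term")
  thus "rs (c \<otimes>.CC d) k s = (rs c \<otimes>.Y.CC rs d) k s" using s by (simp add: Y_imp)
 qed (use c d cl mult_closed' in simp_all)
 have 3: "rs (dif CC c) = dif Y.CC (rs c)" if c: "c .: CC" for c
 proof (rule Y.CC_eqI)
  fix k s assume s: "Y.sx k s"
  show "rs (dif CC c) k s = dif Y.CC (rs c) k s"
  proof (cases k)
  case 0 thus ?thesis using s by (simp add: Y_imp)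
  next
  case (Suc l)
  have s': "Y.sx (Suc l) s" using s Suc by simp
  have "(\<Oplus>i\<in>{..Suc l}. sg R (int i) \<otimes> c l (sface (Suc l) i s)) =
  (\<Oplus>i\<in>{..Suc l}. sg R (int i) \<otimes> rs c l (sface (Suc l) i s))"
  by (rule finsum_cong') (use s' c Y_imp in auto)
  thus ?thesis unfolding Suc using s' by (simp add: Y_imp del: finsum_Suc)
  qed
 qed (use c cl d_closed' in simp_all)
 have 4: "rs \<one>.CC = \<one>.Y.CC"
  by (rule Y.CC_eqI) (use cl one_closed' Y.one_closed' Y_imp in simp_all)
 show ?thesis unfolding diff_hom_def using 1 2 3 4 by blast
qed

definition zero_extension :: "('r, 'a) cochain => ('r, 'a) cochain" where
 "zero_extension c = cochain_fun X (%k s. if s ` sdx k <= S then c k s else \<zero>)"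

lemma zero_extension:
 assumes "c .: Y.CC"
 shows "zero_extension c .: CC" "rs (zero_extension c) = c"
  "c \<in> homog Y.CC k ==> zero_extension c \<in> homog CC k"
proof -
 obtain N where N: "ALL k s. N < k --> Y.sx k s --> c k s = \<zero>" using Y.CC_bound[OF assms] by blast
 show z: "zero_extension c .: CC" unfolding zero_extension_def
  by (rule CC_I[where N = N]) (use N Y.CC_val[OF assms] in "auto simp: Y_sx")
 show "rs (zero_extension c) = c"
  by (rule Y.CC_eqI[OF rs_closed[OF z] assms]) (simp add: zero_extension_def Y_sx)
 show "zero_extension c \<in> homog CC k" if "c \<in> homog Y.CC k"
  using z that by (auto simp: CC_ops(7) Y.CC_ops(7) zero_extension_def Y_sx)
qed

text \<open>Since \<open>S\<close> is open, neighbourhoods in \<open>S\<close> of its points can be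
  taken open in \<open>X\<close>, and a simplex inside such a neighbourhood is the same thing for
  both spaces. So vanishing near the points of \<open>S\<close> can be tested in either.\<close>

lemma rs_LZ_iff:
 assumes S: "openin X S" and c: "c .: CC"
 shows "rs c \<in> Y.LZ <-> supp c <= topspace X - S"
proof -
 have Sub: "S <= topspace X" by (rule openin_subset[OF S])
 have v: "Y.vanishes (rs c) U <-> vanishes c U" if "U <= S" for U
  unfolding vanishes_def Y.vanishes_def Y_sx using that by (auto simp: Y_sx)
 have "Y.supp (rs c) = {} <-> (ALL x:S. EX U. openin X U & U <= S & x \<in> U & Y.vanishes (rs c) U)"
  using Y.supp_subset_iff[of "rs c" "{}"] Sub by (auto simp: openin_open_subtopology[OF S] Int_absorb1)
 also have "... <-> (ALL x:S. EX U. openin X U & x \<in> U & vanishes c U)" (is "?l <-> ?r")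
 proof
  assume ?l thus ?r using v by blast
 next
  assume r: ?r
  show ?l
  proof
  fix x assume x: "x \<in> S"
  then obtain U where "openin X U" "x \<in> U" "vanishes c U" using r by blast
  thus "EX U. openin X U & U <= S & x \<in> U & Y.vanishes (rs c) U"
  using v[of "U \<inter> S"] vanishes_mono[of c U "U \<inter> S"] S x by (intro exI[of _ "U \<inter> S"]) auto
  qed
 qed
 also have "... <-> supp c <= topspace X - S"
  unfolding supp_subset_iff using Sub by (simp add: double_diff)
 finally show ?thesis using rs_closed[OF c] by (simp add: Y.LZ_iff)
qed

lemma rs_LZ: "c \<in> LZ ==> rs c \<in> Y.LZ"
proof -
 assume c: "c \<in> LZ"
 have "EX V. openin (subtopology X S) V & x \<in> V & Y.vanishes (rs c) V" if x: "x \<in> topspace X \<inter> S" for x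
 proof -
  obtain U where U: "openin X U" "x \<in> U" "vanishes c U" using c x unfolding LZ_iff supp_def by blast
  hence "Y.vanishes (rs c) (U \<inter> S)" unfolding vanishes_def Y.vanishes_def Y_sx by (auto simp: Y_sx)
  thus ?thesis using U x by (intro exI[of _ "U \<inter> S"]) (auto simp: openin_subtopology_Int)
 qed
 hence "Y.supp (rs c) <= {}" unfolding Y.supp_subset_iff by simp
 thus ?thesis using c rs_closed by (simp add: LZ_iff Y.LZ_iff)
qed

abbreviation rmap :: "('r, 'a) cochain set => ('r, 'a) cochain set" where
 "rmap == %z. \<Union>c\<in>z. Y.germ (rs c)"

lemmas rs_lin = rs_diff_hom[unfolded diff_hom_def, THEN conjunct1]

lemma rmap_germ:
 assumes "c .: CC"
 shows "rmap (germ c) = Y.germ (rs c)"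
proof (rule C.quotient_union[OF J.I_sub assms])
 fix d assume d: "d .: CC" "d \<ominus>.CC c \<in> LZ"
 have "rs d \<ominus>.Y.CC rs c \<in> Y.LZ"
  using rs_LZ[OF d(2)] lin_minus[OF C.mod Y.C.mod rs_lin d(1) assms] by simp
 thus "Y.germ (rs d) = Y.germ (rs c)"
  using Y.C.cos_iff[OF Y.J.I_sub rs_closed[OF d(1)] rs_closed[OF assms]] by simp
qed

lemma rmap_diff_hom: "diff_hom R HH Y.HH rmap"
proof -
 note rd = rs_diff_hom[unfolded diff_hom_def]
 note l = linD[OF rs_lin] and m = rd[THEN conjunct2, THEN conjunct1, rule_format]
  and o = rd[THEN conjunct2, THEN conjunct2, THEN conjunct1] and d = rd[THEN conjunct2, THEN conjunct2, THEN conjunct2, rule_format]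
 note s = HH_simps Y.HH_simps rmap_germ rs_closed
 have "lin R HH Y.HH rmap"
 proof (rule linI)
  fix z assume "z .: HH"
  then obtain c where c: "c .: CC" "z = germ c" using germ_rep by blast
  show "rmap z .: Y.HH" unfolding c(2) rmap_germ[OF c(1)] by (rule linD(1)[OF Y.germ_lin rs_closed[OF c(1)]])
  show "rmap (a \<odot>.HH z) = a \<odot>.Y.HH rmap z" if a: "a .: R" for a
  unfolding c(2) linD(3)[OF germ_lin a c(1), symmetric] rmap_germ[OF c(1)] rmap_germ[OF smult_closed[OF a c(1)]] l(3)[OF a c(1)]
  by (rule linD(3)[OF Y.germ_lin a rs_closed[OF c(1)]])
  fix w assume "w .: HH"
  then obtain e where e: "e .: CC" "w = germ e" using germ_rep by blast
  show "rmap (z \<oplus>.HH w) = rmap z \<oplus>.Y.HH rmap w"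
  unfolding c(2) e(2) linD(2)[OF germ_lin c(1) e(1), symmetric] rmap_germ[OF c(1)] rmap_germ[OF e(1)]
  rmap_germ[OF add_closed[OF c(1) e(1)]] l(2)[OF c(1) e(1)]
  by (rule linD(2)[OF Y.germ_lin rs_closed[OF c(1)] rs_closed[OF e(1)]])
 qed
 moreover have "rmap (z \<otimes>.HH w) = rmap z \<otimes>.Y.HH rmap w" if zw: "z .: HH" "w .: HH" for z w
 proof -
  obtain c e where c: "c .: CC" "z = germ c" "e .: CC" "w = germ e" using germ_rep[OF zw(1)] germ_rep[OF zw(2)] by blast
  have "z \<otimes>.HH w = germ (c \<otimes>.CC e)" using c by (simp add: HH_simps)
  thus ?thesis unfolding c(2,4) by (simp only: rmap_germ c mult_closed' m) (simp add: Y.HH_simps rs_closed c)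
 qed
 moreover have "rmap (dif HH z) = dif Y.HH (rmap z)" if z: "z .: HH" for z
 proof -
  obtain c where c: "c .: CC" "z = germ c" using germ_rep[OF z] by blast
  have "dif HH z = germ (dif CC c)" using c by (simp add: HH_simps)
  thus ?thesis unfolding c(2) by (simp only: rmap_germ c d_closed' d) (simp add: Y.HH_simps rs_closed c)
 qed
 moreover have "rmap \<one>.HH = \<one>.Y.HH"
  unfolding HH_simps(2) Y.HH_simps(2) rmap_germ[OF C.unit_closed] o ..
 ultimately show ?thesis unfolding diff_hom_def by blast
qed

lemma rmap_surj: "rmap ` carrier HH = carrier Y.HH"
proof
 show "rmap ` carrier HH <= carrier Y.HH"
  using linD(1)[OF rmap_diff_hom[unfolded diff_hom_def, THEN conjunct1]] by blast
 show "carrier Y.HH <= rmap ` carrier HH"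
 proof
  fix z assume "z .: Y.HH"
  then obtain c where c: "c .: Y.CC" "z = Y.germ c" using Y.germ_rep by blast
  have "z = rmap (germ (zero_extension c))" using zero_extension[OF c(1)] c(2) rmap_germ by simp
  thus "z \<in> rmap ` carrier HH" using linD(1)[OF germ_lin zero_extension(1)[OF c(1)]] by blast
 qed
qed

lemma rmap_homog: "rmap ` homog HH k = homog Y.HH k"
proof -
 have h: "homog HH k = (%c. germ c) ` homog CC k" "homog Y.HH k = (%c. Y.germ c) ` homog Y.CC k"
  by (rule HH_simps Y.HH_simps)+
 have "rs c \<in> homog Y.CC k" if "c \<in> homog CC k" for c
  using that rs_closed[of c] by (auto simp: CC_ops(7) Y.CC_ops(7) Y_sx)
 hence "rs ` homog CC k <= homog Y.CC k" by (rule image_subsetI)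
 moreover have "homog Y.CC k <= rs ` homog CC k"
 proof
  fix e assume e: "e \<in> homog Y.CC k"
  have ec: "e .: Y.CC" by (rule subsetD[OF Y.C.homog_subset e])
  show "e \<in> rs ` homog CC k" by (rule image_eqI[where x = "zero_extension e"]) (simp_all add: zero_extension(2)[OF ec] zero_extension(3)[OF ec e])
 qed
 ultimately have "rs ` homog CC k = homog Y.CC k" by (rule subset_antisym)
 moreover have "rmap ` homog HH k = (%c. Y.germ (rs c)) ` homog CC k"
  unfolding h image_image by (rule image_cong[OF refl]) (rule rmap_germ[OF subsetD[OF C.homog_subset]])
 moreover have "(%c. Y.germ (rs c)) ` homog CC k = (%c. Y.germ c) ` (rs ` homog CC k)" by (simp only: image_image)
 ultimately show ?thesis unfolding h(2) by simp
qed

lemma rel_iff: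
 assumes "openin X S" "c .: CC"
 shows "germ c \<in> hat_cochains_rel R X S <-> supp c <= topspace X - S"
proof -
 have "germ c .: HH" by (rule linD(1)[OF germ_lin assms(2)])
 moreover have "rmap (germ c) = \<zero>.Y.HH <-> rs c \<in> Y.LZ"
  unfolding rmap_germ[OF assms(2)] Y.HH_simps(3) by (rule Y.C.coset_eq_zero_iff[OF Y.J.I_sub rs_closed[OF assms(2)]])
 ultimately show ?thesis using rs_LZ_iff[OF assms] by (simp add: hat_cochains_rel_def Let_def a_kernel_def')
qed

lemma rel_kernel: "hat_cochains_rel R X S = {z \<in> carrier HH. rmap z = \<zero>.Y.HH}"
 by (simp add: hat_cochains_rel_def Let_def a_kernel_def')

end

section \<open>Germs supported on a closed set\<close>

context cochains begin

definition gam :: "'a set => ('r, 'a) cochain set set" where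
 "gam Z = hat_cochains_rel R X (topspace X - Z)"

text \<open>For closed \<open>Z\<close> the complement is open and \<open>rs_LZ_iff\<close> applies.
  It identifies the relative germs of the pair with the germs supported on \<open>Z\<close>, and
  every later property of \<open>gam\<close> is read off from supports.\<close>

lemma gam_germ: "closedin X Z ==> c .: CC ==> germ c \<in> gam Z <-> supp c <= Z"
proof -
 assume Z: "closedin X Z" and c: "c .: CC"
 interpret S: cochains_sub R X "topspace X - Z" ..
 have "openin X (topspace X - Z)" using Z by (simp add: closedin_def)
 thus ?thesis unfolding gam_def using S.rel_iff[OF _ c] closedin_subset[OF Z] by (simp add: double_diff)
qed

lemma gam_carrier: "gam Z <= carrier HH"
proof -
 interpret S: cochains_sub R X "topspace X - Z" ..
 show ?thesis unfolding gam_def S.rel_kernel by blast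
qed

lemma gam_rep: "closedin X Z ==> z \<in> gam Z ==> EX c:carrier CC. z = germ c & supp c <= Z"
 using gam_carrier germ_rep gam_germ by blast

lemma gam_sub: "closedin X Z ==> submodule (gam Z) R HH"
proof (rule H.subI')
 assume Z: "closedin X Z"
 show "gam Z <= carrier HH" by (rule gam_carrier)
 have "\<zero>.HH = germ \<zero>.CC" by (simp add: HH_simps)
 thus "\<zero>.HH \<in> gam Z" using gam_germ[OF Z C.M.zero_closed] supp_zero by simp
 fix z assume "z \<in> gam Z"
 then obtain c where c: "c .: CC" "z = germ c" "supp c <= Z" using gam_rep[OF Z] by blast
 show "a \<odot>.HH z \<in> gam Z" if a: "a .: R" for a
  unfolding c(2) linD(3)[OF germ_lin a c(1), symmetric] gam_germ[OF Z smult_closed[OF a c(1)]]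
  using supp_smult[OF a] c(3) by blast
 fix w assume "w \<in> gam Z"
 then obtain d where d: "d .: CC" "w = germ d" "supp d <= Z" using gam_rep[OF Z] by blast
 show "z \<oplus>.HH w \<in> gam Z"
  unfolding c(2) d(2) linD(2)[OF germ_lin c(1) d(1), symmetric] gam_germ[OF Z add_closed[OF c(1) d(1)]]
  using supp_add c(3) d(3) by blast
qed

lemma gam_mono: "closedin X Y ==> closedin X Z ==> Y <= Z ==> gam Y <= gam Z"
proof
 fix z assume cl: "closedin X Y" "closedin X Z" "Y <= Z" and "z \<in> gam Y"
 then obtain c where c: "c .: CC" "z = germ c" "supp c <= Y" using gam_rep[OF cl(1)] by blast
 thus "z \<in> gam Z" using gam_germ[OF cl(2) c(1)] cl(3) by simp
qed

text \<open>A cochain has one support, so both conditions can be tested on the same representative.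
  For ordinary relative cochains the inclusion fails: a simplex may avoid the intersection of
  \<open>Y\<close> and \<open>Z\<close> without avoiding either of them.\<close>

lemma gam_Int:
 assumes "closedin X Y" "closedin X Z"
 shows "gam Y \<inter> gam Z <= gam (Y \<inter> Z)"
proof
 fix z assume z: "z \<in> gam Y \<inter> gam Z"
 then obtain c where c: "c .: CC" "z = germ c" "supp c <= Y" using gam_rep[OF assms(1)] by blast
 hence "supp c <= Z" using z gam_germ[OF assms(2) c(1)] by simp
 thus "z \<in> gam (Y \<inter> Z)" unfolding c(2) using gam_germ[OF closedin_Int[OF assms] c(1)] c(3) by simp
qed

lemma gam_empty: "gam {} = {\<zero>.HH}"
proof -
 have "z = \<zero>.HH" if z: "z \<in> gam {}" for z
 proof -
  obtain c where "c .: CC" "z = germ c" "supp c <= {}" using gam_rep[OF closedin_empty z] by blast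
  thus ?thesis using C.coset_eq_zero_iff[OF J.I_sub, of c] by (simp add: LZ_iff HH_simps)
 qed
 thus ?thesis using subD(2)[OF gam_sub[OF closedin_empty]] by blast
qed

lemma gam_top: "gam (topspace X) = carrier HH"
proof
 show "carrier HH <= gam (topspace X)"
 proof
  fix z assume "z .: HH"
  then obtain c where c: "c .: CC" "z = germ c" using germ_rep by blast
  thus "z \<in> gam (topspace X)" using gam_germ[OF closedin_topspace c(1)] by (simp add: supp_def)
 qed
qed (rule gam_carrier)

lemma gam_d: "closedin X Y ==> z \<in> gam Y ==> dif HH z \<in> gam Y"
proof -
 assume Y: "closedin X Y" and "z \<in> gam Y"
 then obtain c where c: "c .: CC" "z = germ c" "supp c <= Y" using gam_rep by blast
 hence "dif HH z = germ (dif CC c)" by (simp add: HH_simps)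
 thus ?thesis using gam_germ[OF Y C.d_closed[OF c(1)]] supp_d[of c] c(3) by auto
qed

lemma gam_gr: "closedin X Y ==> z \<in> gam Y ==> th .> R ==> grH th z \<in> gam Y"
proof -
 assume Y: "closedin X Y" and th: "th .> R" and "z \<in> gam Y"
 then obtain c where c: "c .: CC" "z = germ c" "supp c <= Y" using gam_rep by blast
 thus ?thesis using gam_germ[OF Y grC_closed[OF th c(1)]] supp_gr[OF th, of c] grH_germ[OF th c(1)] by auto
qed

lemma gam_mult: "closedin X Y ==> closedin X Z ==> z \<in> gam Y ==> w \<in> gam Z ==> z \<otimes>.HH w \<in> gam (Y \<inter> Z)"
proof -
 assume Y: "closedin X Y" "closedin X Z" and z: "z \<in> gam Y" "w \<in> gam Z"
 obtain c d where c: "c .: CC" "z = germ c" "supp c <= Y" "d .: CC" "w = germ d" "supp d <= Z"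
  using gam_rep[OF Y(1) z(1)] gam_rep[OF Y(2) z(2)] by blast
 hence "z \<otimes>.HH w = germ (c \<otimes>.CC d)" by (simp add: HH_simps)
 moreover have "supp (c \<otimes>.CC d) <= Y \<inter> Z" using supp_mult[OF c(1,4)] c(3,6) by blast
 ultimately show ?thesis using gam_germ[OF closedin_Int[OF Y] mult_closed'[OF c(1,4)]] by simp
qed

text \<open>A cochain supported on \<open>Y \<union> Z\<close> is cut in two along disjoint open neighbourhoods of
  \<open>Y - Z\<close> and \<open>Z - Y\<close>, which exist because the open set \<open>X - (Y \<inter> Z)\<close> is normal.\<close>

lemma gam_Un:
 assumes nor: "hereditarily normal_space X" and cl: "closedin X Y" "closedin X Z" and z: "z \<in> gam (Y \<union> Z)"
 shows "EX u:gam Y. EX v:gam Z. z = u \<oplus>.HH v"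
proof -
 obtain c where c: "c .: CC" "z = germ c" "supp c <= Y \<union> Z" using gam_rep[OF closedin_Un[OF cl] z] by blast
 have YZ: "Y <= topspace X" "Z <= topspace X" using cl closedin_subset by auto
 have "X closure_of (Z - Y) <= Z" "X closure_of (Y - Z) <= Y" by (rule closure_of_minimal[OF Diff_subset cl(2)], rule closure_of_minimal[OF Diff_subset cl(1)])
 hence "separatedin X (Y - Z) (Z - Y)" unfolding separatedin_def using YZ by blast
 then obtain P Q where PQ: "openin X P" "openin X Q" "Y - Z <= P" "Z - Y <= Q" "P \<inter> Q = {}"
  using nor unfolding hereditarily_normal_separation disjnt_def by metis
 \<comment> \<open>Simplices inside \<open>Q\<close> go to \<open>e\<close>, all others to
   \<open>d\<close>. Then \<open>d\<close> vanishes on \<open>Q\<close>, a neighbourhood of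
   \<open>Z - Y\<close>, and \<open>e\<close> vanishes on \<open>P\<close>, a neighbourhood of
   \<open>Y - Z\<close>, because a nonempty simplex inside \<open>P\<close> is not inside
   \<open>Q\<close>. Away from \<open>Y \<union> Z\<close> both vanish wherever \<open>c\<close>
   does.\<close>
 let ?in = "%k s. s ` sdx k <= Q"
 define d where "d = cochain_fun X (%k s. if ?in k s then \<zero> else c k s)"
 define e where "e = cochain_fun X (%k s. if ?in k s then c k s else \<zero>)"
 obtain N where N: "ALL k s. N < k --> sx k s --> c k s = \<zero>" using CC_bound[OF c(1)] by blast
 have dc: "d .: CC" unfolding d_def by (rule CC_I[where N = N]) (use c N in auto)
 have ec: "e .: CC" unfolding e_def by (rule CC_I[where N = N]) (use c N in auto)
 have "c = d \<oplus>.CC e" by (rule CC_eqI) (use c dc ec add_closed in "simp_all add: d_def e_def")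
 hence zde: "z = germ d \<oplus>.HH germ e" using linD(2)[OF germ_lin dc ec] c(2) by simp
 have vd: "vanishes d U" if "vanishes c U" for U using that unfolding vanishes_def by (simp add: d_def)
 have ve: "vanishes e U" if "vanishes c U" for U using that unfolding vanishes_def by (simp add: e_def)
 have vQ: "vanishes d Q" unfolding vanishes_def by (simp add: d_def)
 have vP: "vanishes e P"
  unfolding vanishes_def
 proof (intro allI impI)
  fix k s assume s: "sx k s" "s ` sdx k <= P"
  hence "~  ?in k s" using PQ(5) nonempty_standard_simplex[of k] by blast
  thus "e k s = \<zero>" using s by (simp add: e_def)
 qed
 have out: "EX U. openin X U & x \<in> U & vanishes c U" if "x \<in> topspace X" "x \<notin> Y" "x \<notin> Z" for x
  using c(3) that unfolding supp_subset_iff by blast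
 have "supp d <= Y" unfolding supp_subset_iff
 proof
  fix x assume x: "x \<in> topspace X - Y"
  show "EX U. openin X U & x \<in> U & vanishes d U"
  proof (cases "x \<in> Z")
  case True thus ?thesis using x PQ vQ by (intro exI[of _ Q]) auto
  next
  case False then obtain U where "openin X U" "x \<in> U" "vanishes c U" using out x by blast
  thus ?thesis using vd by blast
  qed
 qed
 moreover have "supp e <= Z" unfolding supp_subset_iff
 proof
  fix x assume x: "x \<in> topspace X - Z"
  show "EX U. openin X U & x \<in> U & vanishes e U"
  proof (cases "x \<in> Y")
  case True thus ?thesis using x PQ vP by (intro exI[of _ P]) auto
  next
  case False then obtain U where "openin X U" "x \<in> U" "vanishes c U" using out x by blast
  thus ?thesis using ve by blast
  qed
 qed
 ultimately show ?thesis using zde gam_germ[OF cl(1) dc] gam_germ[OF cl(2) ec] by blast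
qed

end

section \<open>Topology of manifolds\<close>

text \<open>Boxes with sides in a countable base form a base of the product; finiteness of
  \<open>I\<close> makes them open and keeps their number countable.\<close>

lemma second_countable_product:
 assumes "finite I" "second_countable M"
 shows "second_countable (product_topology (%_. M) I)"
proof -
 obtain B where B: "countable B" "!!V. V \<in> B ==> openin M V" "!!U x. openin M U ==> x \<in> U ==> EX V:B. x \<in> V & V <= U"
  using assms(2) unfolding second_countable_def by metis
 show ?thesis unfolding second_countable_def
 proof (intro exI[of _ "PiE I ` (I \<rightarrow>\<^sub>E B)"] conjI ballI allI impI)
  show "countable (PiE I ` (I \<rightarrow>\<^sub>E B))" by (intro countable_image countable_PiE assms B)
  show "openin (product_topology (%_. M) I) V" if V: "V \<in> PiE I ` (I \<rightarrow>\<^sub>E B)" for V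
  proof -
  obtain W where W: "V = PiE I W" "W \<in> I \<rightarrow>\<^sub>E B" using V by (rule imageE)
  have "openin M (W i)" if "i \<in> I" for i using B(2)[OF PiE_mem[OF W(2) that]] .
  thus ?thesis unfolding W(1) by (simp add: openin_PiE_gen assms(1))
  qed
  fix U x assume "openin (product_topology (%_. M) I) U & x \<in> U"
  then obtain Y where Y: "x \<in> PiE I Y" "!!i. openin M (Y i)" "PiE I Y <= U"
  using product_topology_open_contains_basis[of "%_. M" I U x] by metis
  have "EX V:B. x i \<in> V & V <= Y i" if "i \<in> I" for i by (rule B(3)[OF Y(2) PiE_mem[OF Y(1) that]])
  then obtain W where W: "!!i. i \<in> I ==> W i \<in> B & x i \<in> W i & W i <= Y i" by metis
  have "x \<in> PiE I (restrict W I)" using Y(1) by (simp add: PiE_iff W)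
  moreover have "PiE I (restrict W I) <= U" by (rule order_trans[OF PiE_mono Y(3)]) (simp add: W)
  moreover have "restrict W I \<in> I \<rightarrow>\<^sub>E B" by (simp add: W)
  ultimately show "EX V:PiE I ` (I \<rightarrow>\<^sub>E B). x \<in> V & V <= U" by (intro bexI[of _ "PiE I (restrict W I)"]) auto
 qed
qed

text \<open>Charts make \<open>M\<close> locally compact, through open subsets of Euclidean space,
  and a locally compact Hausdorff space is regular.\<close>

lemma manifold_regular:
 assumes "smooth_manifold d M \<A>"
 shows "regular_space M"
proof (rule locally_compact_Hausdorff_imp_regular_space)
 show "Hausdorff_space M" using assms by (simp add: smooth_manifold_def)
 show "locally_compact_space M" unfolding locally_compact_space_def
 proof
  fix x assume "x \<in> topspace M"
  moreover have "(\<Union>(U, \<phi>)\<in>\<A>. U) = topspace M" using assms by (simp add: smooth_manifold_def)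
  ultimately obtain U \<phi> where U: "(U, \<phi>) \<in> \<A>" "x \<in> U" by blast
  have *: "openin M U" "openin (Euclidean_space d) (\<phi> ` U)"
  "homeomorphic_map (subtopology M U) (subtopology (Euclidean_space d) (\<phi> ` U)) \<phi>"
  using assms U(1) unfolding smooth_manifold_def by auto
  have "locally_compact_space (subtopology (Euclidean_space d) (\<phi> ` U))"
  using locally_compact_space_open_subset[OF _ locally_compact_Euclidean_space *(2)] Hausdorff_Euclidean_space by blast
  hence "locally_compact_space (subtopology M U)"
  using homeomorphic_locally_compact_space[OF homeomorphic_map_imp_homeomorphic_space[OF *(3)]] by simp
  moreover have "x \<in> topspace (subtopology M U)" using openin_subset[OF *(1)] U(2) by auto
  ultimately obtain V K where "openin (subtopology M U) V" "compactin (subtopology M U) K" "x \<in> V" "V <= K"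
  unfolding locally_compact_space_def by blast
  thus "EX U K. openin M U & compactin M K & x \<in> U & U <= K"
  using *(1) by (auto simp: openin_open_subtopology compactin_subtopology)
 qed
qed

text \<open>Normality itself need not pass to products or to open subsets. Regularity and second
  countability do pass to the finite power, and together they give normality of all its
  subspaces.\<close>

lemma power_space_hereditarily_normal:
 assumes "smooth_manifold d M \<A>"
 shows "hereditarily normal_space (power_space M n)"
proof (rule regular_second_countable_imp_hereditarily_normal_space)
 have "second_countable M" using assms by (simp add: smooth_manifold_def)
 thus "regular_space (power_space M n) & second_countable (power_space M n)"
  using manifold_regular[OF assms] second_countable_product[of "{1..n}" M]
  by (simp add: power_space_def regular_space_product_topology)
qed

section \<open>The bond lattice\<close>

lemma rtrancl_edges:
 assumes "(i, j) \<in> conn_rel n U" "reflp P" "transp P" "!!i j. {i, j} \<in> U ==> P i j"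
 shows "P i j"
proof -
 have "(i, j) \<in> {(i, j). {i, j} \<in> U}\<^sup>*" using assms(1) by (simp add: conn_rel_def)
 thus ?thesis
  by induction (use assms(2-4) in "auto dest: reflpD transpD")
qed

locale bond =
 fixes n :: nat and E :: "nat set set"
 assumes graph: "simple_graph_on n E"
begin

abbreviation "cp == component_partition n"
abbreviation "cr == conn_rel n"
abbreviation "L == bond_lattice n E"

lemma carrier_L: "carrier L = cp ` Pow E"
 by (simp add: bond_lattice_def)

lemma le_L: "cp S \<sqsubseteq>.L cp T <-> cr S <= cr T"
 using refines_component_partition_iff[of n S T] by (simp add: bond_lattice_def)

lemma edge_in: "{i, j} \<in> E ==> i \<in> {1..n} & j \<in> {1..n}"
 using graph by (auto simp: simple_graph_on_def)

lemma edge_cr: "U <= E ==> {i, j} \<in> U ==> (i, j) \<in> cr U"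
 using edge_in[of i j] by (auto simp: conn_rel_def)

lemma cr_equiv: "i \<in> {1..n} ==> (i, i) \<in> cr U" "(i, j) \<in> cr U ==> (j, i) \<in> cr U" "(i, j) \<in> cr U ==> (j, k) \<in> cr U ==> (i, k) \<in> cr U"
 using equiv_conn_rel[of n U] unfolding equiv_def refl_on_def sym_def trans_def by blast+

lemma cr_in: "(i, j) \<in> cr U ==> i \<in> {1..n} & j \<in> {1..n}"
 by (auto simp: conn_rel_def)

lemma cr_le:
 assumes "!!i j. {i, j} \<in> U ==> (i, j) \<in> cr W"
 shows "cr U <= cr W"
proof (clarify)
 fix i j assume ij: "(i, j) \<in> cr U"
 have "(i, j) \<in> cr W | i = j"
  by (rule rtrancl_edges[OF ij]) (use assms cr_equiv(3) in "auto simp: reflp_def transp_def; blast")+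
 thus "(i, j) \<in> cr W" using cr_equiv(1) cr_in[OF ij] by blast
qed

text \<open>A flat comes from many edge sets; taking the union of all of them represents the join
  without choosing one for each flat.\<close>

definition union_edges where "union_edges A = \<Union>{S. S <= E & cp S \<in> A}"

lemma union_edges_subset: "union_edges A <= E"
 by (auto simp: union_edges_def)

lemma sup_L:
 assumes "A <= carrier L"
 shows "\<Squnion>.L A = cp (union_edges A)"
proof -
 let ?u = "cp (union_edges A)"
 have uc: "?u .: L" using union_edges_subset by (auto simp: carrier_L)
 have up: "p \<sqsubseteq>.L ?u" if p: "p \<in> A" for p
 proof -
  obtain S where S: "S <= E" "p = cp S" using assms p unfolding carrier_L by blast
  hence "S <= union_edges A" using p by (auto simp: union_edges_def)
  thus ?thesis unfolding S(2) le_L by (rule conn_rel_mono)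
 qed
 have least: "?u \<sqsubseteq>.L cp W" if W: "!!p. p \<in> A ==> p \<sqsubseteq>.L cp W" for W
  unfolding le_L
 proof (rule cr_le)
  fix i j assume "{i, j} \<in> union_edges A"
  then obtain S where S: "S <= E" "cp S \<in> A" "{i, j} \<in> S" by (auto simp: union_edges_def)
  thus "(i, j) \<in> cr W" using W[OF S(2)] edge_cr[OF S(1,3)] unfolding le_L by blast
 qed
 have le: "least L ?u (Upper L A)"
  unfolding least_def
 proof (intro conjI ballI)
  show "Upper L A <= carrier L" by (auto simp: Upper_def)
  show "?u \<in> Upper L A" unfolding Upper_def using uc up by simp
  fix y assume y: "y \<in> Upper L A"
  then obtain W where W: "y = cp W" by (auto simp: Upper_def carrier_L)
  have "p \<sqsubseteq>.L cp W" if "p \<in> A" for p using y that assms unfolding Upper_def W by blast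
  thus "?u \<sqsubseteq>.L y" unfolding W by (rule least)
 qed
 have "x = ?u" if x: "least L x (Upper L A)" for x
 proof -
  have "x \<in> Upper L A" "?u \<in> Upper L A" "x .: L" using x le by (auto simp: least_def Upper_def)
  hence "x \<sqsubseteq>.L ?u" "?u \<sqsubseteq>.L x" using x le by (auto simp: least_def)
  moreover obtain S where "x = cp S" using \<open>x .: L\<close> by (auto simp: carrier_L)
  ultimately show ?thesis by (simp add: le_L component_partition_eq_iff)
 qed
 thus ?thesis unfolding sup_def using le by (metis someI)
qed

text \<open>Sends a block to the block of a coarser partition that contains it. It serves to compare
  numbers of blocks.\<close>

definition push where "push S b = cr S `` b"

lemma push: "i \<in> {1..n} ==> cr S <= cr T ==> push T (cr S `` {i}) = cr T `` {i}"
 unfolding push_def using cr_equiv by blast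

lemma block_eq: "i \<in> {1..n} ==> j \<in> {1..n} ==> cr S `` {i} = cr S `` {j} <-> (i, j) \<in> cr S"
 using eq_equiv_class_iff[OF equiv_conn_rel] by blast

lemma cp_blocks: "cp S = (%i. cr S `` {i}) ` {1..n}"
 by (auto simp: component_partition_def quotient_def)

lemma finite_cp: "finite (cp S)"
 by (simp add: cp_blocks)

lemma push_image: "cr S <= cr T ==> push T ` cp S = cp T"
 unfolding cp_blocks image_image by (rule image_cong) (simp_all add: push)

lemma card_cp_le: "card (cp S) \<le> n"
 using card_image_le[of "{1..n}" "%i. cr S `` {i}"] by (simp add: cp_blocks)

text \<open>The map from blocks to coarser blocks is surjective. Were the numbers equal, it would be
  injective, and points connected by \<open>T\<close> would already be connected by
  \<open>S\<close>.\<close>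

lemma card_cp_less:
 assumes "cr S <= cr T" "cr S ~= cr T"
 shows "card (cp T) < card (cp S)"
proof (rule ccontr)
 assume "~  card (cp T) < card (cp S)"
 hence "card (push T ` cp S) = card (cp S)"
  using card_image_le[OF finite_cp, of "push T" S] push_image[OF assms(1)] by simp
 hence inj: "inj_on (push T) (cp S)" by (rule eq_card_imp_inj_on[OF finite_cp])
 have "(i, j) \<in> cr S" if ij: "(i, j) \<in> cr T" for i j
 proof -
  have i: "i \<in> {1..n}" "j \<in> {1..n}" using cr_in[OF ij] by auto
  have "push T (cr S `` {i}) = push T (cr S `` {j})" using push[OF i(1) assms(1)] push[OF i(2) assms(1)] block_eq[OF i, of T] ij by simp
  hence "cr S `` {i} = cr S `` {j}" by (rule inj_onD[OF inj]) (use i in "auto simp: cp_blocks")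
  thus ?thesis using block_eq[OF i] by simp
 qed
 thus False using assms by auto
qed

text \<open>Merging the block of \<open>j\<close> into the block of \<open>i\<close> identifies the ends of every edge of
  \<open>insert {i, j} S\<close> and keeps all other blocks apart.\<close>

lemma card_cp_insert:
 assumes S: "insert {i, j} S <= E"
 shows "card (cp S) \<le> Suc (card (cp (insert {i, j} S)))"
proof -
 let ?T = "insert {i, j} S"
 have ij: "i \<in> {1..n}" "j \<in> {1..n}" using edge_in[of i j] S by auto
 define f where "f x = (if (x, j) \<in> cr S then cr S `` {i} else cr S `` {x})" for x
 have fS: "f a = f b" if ab: "(a, b) \<in> cr S" for a b
 proof -
  have "(a, j) \<in> cr S <-> (b, j) \<in> cr S" using cr_equiv(2)[OF ab] ab cr_equiv(3) by blast
  moreover have "cr S `` {a} = cr S `` {b}" using block_eq[of a b S] cr_in[OF ab] ab by simp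
  ultimately show ?thesis by (simp add: f_def)
 qed
 have fij: "f i = f j" using cr_equiv(1)[OF ij(2)] by (simp add: f_def)
 have fT: "f a = f b" if ab: "(a, b) \<in> cr ?T" for a b
 proof (rule rtrancl_edges[OF ab])
  fix a b assume "{a, b} \<in> ?T"
  then consider "{a, b} = {i, j}" | "{a, b} \<in> S" by blast
  thus "f a = f b"
  proof cases
  case 1 thus ?thesis using fij by (auto simp: doubleton_eq_iff)
  next
  case 2 thus ?thesis using fS[OF edge_cr[OF _ 2]] S by blast
  qed
 qed (simp_all add: reflp_def transp_def)
 \<comment> \<open>\<open>f\<close> is constant on the blocks of \<open>?T\<close> and so factors
   through them, which bounds the number of its values by \<open>card (cp ?T)\<close>. On the other
   hand, every block of \<open>S\<close> except possibly that of \<open>j\<close> occurs as a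
   value.\<close>
 define g where "g b = f (SOME x. x \<in> b)" for b
 have "f x = g (cr ?T `` {x})" if x: "x \<in> {1..n}" for x
 proof -
  have "x \<in> cr ?T `` {x}" using cr_equiv(1)[OF x] by simp
  hence "(SOME y. y \<in> cr ?T `` {x}) \<in> cr ?T `` {x}" by (rule someI)
  thus ?thesis unfolding g_def by (intro fT) simp
 qed
 hence "f ` {1..n} <= g ` cp ?T" unfolding cp_blocks image_image by (simp add: image_subset_iff)
 hence "card (f ` {1..n}) \<le> card (g ` cp ?T)" by (rule card_mono[OF finite_imageI[OF finite_cp]])
 also have "... \<le> card (cp ?T)" by (rule card_image_le[OF finite_cp])
 finally have "card (f ` {1..n}) \<le> card (cp ?T)" .
 moreover have "cp S - {cr S `` {j}} <= f ` {1..n}"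
 proof
  fix b assume "b \<in> cp S - {cr S `` {j}}"
  then obtain x where x: "x \<in> {1..n}" "b = cr S `` {x}" "cr S `` {x} ~= cr S `` {j}" unfolding cp_blocks by blast
  hence "b = f x" using block_eq[OF x(1) ij(2), of S] by (simp add: f_def)
  thus "b \<in> f ` {1..n}" using x(1) by blast
 qed
 hence "card (cp S - {cr S `` {j}}) \<le> card (f ` {1..n})" by (intro card_mono) simp
 moreover have "card (cp S) \<le> Suc (card (cp S - {cr S `` {j}}))" using card_Suc_Diff1[OF finite_cp, of "cr S `` {j}" S] by (cases "cr S `` {j} \<in> cp S") auto
 ultimately show ?thesis by linarith
qed

lemma join_L:
 assumes "S <= E" "T <= E"
 shows "cp S \<squnion>.L cp T = cp (S \<union> T)"
proof -
 have "{cp S, cp T} <= carrier L" using assms by (auto simp: carrier_L)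
 hence "cp S \<squnion>.L cp T = cp (union_edges {cp S, cp T})" unfolding join_def by (rule sup_L)
 also have "... = cp (S \<union> T)" unfolding component_partition_eq_iff
 proof
  show "cr (S \<union> T) <= cr (union_edges {cp S, cp T})" by (rule conn_rel_mono) (use assms in "auto simp: union_edges_def")
  show "cr (union_edges {cp S, cp T}) <= cr (S \<union> T)"
  proof (rule cr_le)
  fix i j assume "{i, j} \<in> union_edges {cp S, cp T}"
  then obtain W where W: "W <= E" "cp W = cp S | cp W = cp T" "{i, j} \<in> W" by (auto simp: union_edges_def)
  hence "(i, j) \<in> cr S \<union> cr T" using edge_cr[OF W(1,3)] by (auto simp: component_partition_eq_iff)
  thus "(i, j) \<in> cr (S \<union> T)" using conn_rel_mono[of S "S \<union> T" n] conn_rel_mono[of T "S \<union> T" n] by blast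
  qed
 qed
 finally show ?thesis .
qed

lemma atoms_L: "lattice_atoms L = (%e. cp {e}) ` E"
 by (rule atoms_bond_lattice[OF graph])

lemma bond_ranked: "ranked_lattice L (bond_rank n)"
proof
 have "finite E" using graph finite_subset[of E "Pow {1..n}"] by (auto simp: simple_graph_on_def)
 thus "finite (carrier L)" by (simp add: carrier_L)
 show "eq L = (=)" by (simp add: bond_lattice_def)
 note cL = carrier_L
 have bot: "\<bottom>.L = cp {}" by (rule bottom_bond_lattice)
 show "p \<sqsubseteq>.L p" if "p .: L" for p using that by (auto simp: cL le_L)
 show "p = q" if pq: "p .: L" "q .: L" "p \<sqsubseteq>.L q" "q \<sqsubseteq>.L p" for p q
 proof -
  obtain S T where "p = cp S" "q = cp T" using pq(1,2) unfolding cL by blast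
  thus ?thesis using pq(3,4) component_partition_eq_iff[of n S T] by (simp add: le_L)
 qed
 show "p \<sqsubseteq>.L s" if "p .: L" "q .: L" "s .: L" "p \<sqsubseteq>.L q" "q \<sqsubseteq>.L s" for p q s
  using that by (auto simp: cL le_L)
 show "\<Squnion>.L A .: L" if A: "A <= carrier L" for A
  unfolding sup_L[OF A] cL using union_edges_subset by blast
 show up: "p \<sqsubseteq>.L \<Squnion>.L A" if A: "A <= carrier L" "p \<in> A" for A p
 proof -
  obtain S where S: "S <= E" "p = cp S" using A unfolding cL by blast
  hence "S <= union_edges A" using A(2) by (auto simp: union_edges_def)
  thus ?thesis unfolding sup_L[OF A(1)] S(2) le_L by (rule conn_rel_mono)
 qed
 show least: "\<Squnion>.L A \<sqsubseteq>.L q" if A: "A <= carrier L" "q .: L" and le: "!!p. p \<in> A ==> p \<sqsubseteq>.L q" for A q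
 proof -
  obtain W where W: "q = cp W" using A(2) unfolding cL by blast
  show ?thesis unfolding sup_L[OF A(1)] W le_L
  proof (rule cr_le)
  fix i j assume "{i, j} \<in> union_edges A"
  then obtain S where S: "S <= E" "cp S \<in> A" "{i, j} \<in> S" by (auto simp: union_edges_def)
  thus "(i, j) \<in> cr W" using le[OF S(2)] edge_cr[OF S(1,3)] unfolding W le_L by blast
  qed
 qed
 show "\<bottom>.L = \<Squnion>.L{}" unfolding bot using sup_L[of "{}"] by (simp add: union_edges_def)
 have "cp {} = (%i. {i}) ` {1..n}" by (auto simp: cp_blocks conn_rel_empty)
 thus "bond_rank n \<bottom>.L = 0" unfolding bot bond_rank_def by (simp add: card_image)
 show "bond_rank n p < bond_rank n q" if pq: "p .: L" "q .: L" "p \<sqsubseteq>.L q" "p ~= q" for p q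
 proof -
  obtain S T where ST: "p = cp S" "q = cp T" using pq(1,2) unfolding cL by blast
  hence "card q < card p" using card_cp_less[of S T] pq(3,4) by (simp add: le_L component_partition_eq_iff)
  thus ?thesis using card_cp_le[of S] ST(1) by (simp add: bond_rank_def)
 qed
 show "bond_rank n (p \<squnion>.L a) \<le> Suc (bond_rank n p)" if pa: "p .: L" "a \<in> lattice_atoms L" for p a
 proof -
  obtain S where S: "S <= E" "p = cp S" using pa(1) unfolding cL by blast
  obtain e where e: "e \<in> E" "a = cp {e}" using pa(2) unfolding atoms_L by blast
  have "card e = 2" using graph e(1) unfolding simple_graph_on_def by blast
  then obtain i j where ij: "e = {i, j}" unfolding card_2_iff by blast
  have "p \<squnion>.L a = cp (insert {i, j} S)" using join_L[OF S(1), of "{e}"] e S(2) ij by simp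
  thus ?thesis using card_cp_insert[of i j S] S e ij unfolding bond_rank_def by simp
 qed
 show "EX A<=lattice_atoms L. p = \<Squnion>.L A" if p: "p .: L" for p
 proof -
  obtain S where S: "S <= E" "p = cp S" using p unfolding cL by blast
  let ?A = "(%e. cp {e}) ` S"
  have A: "?A <= carrier L" using S(1) unfolding cL by blast
  have "e \<in> union_edges ?A" if "e \<in> S" for e
  unfolding union_edges_def by (rule UnionI[of "{e}"]) (use that S(1) in auto)
  hence "cr S <= cr (union_edges ?A)" by (intro conn_rel_mono subsetI)
  moreover have "cr (union_edges ?A) <= cr S"
  proof (rule cr_le)
  fix i j assume "{i, j} \<in> union_edges ?A"
  then obtain W e where W: "W <= E" "{i, j} \<in> W" "e \<in> S" "cp W = cp {e}" unfolding union_edges_def by blast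
  thus "(i, j) \<in> cr S" using edge_cr[OF W(1,2)] conn_rel_mono[of "{e}" S n] by (auto simp: component_partition_eq_iff)
  qed
  ultimately have "p = \<Squnion>.L?A" unfolding sup_L[OF A] S(2) component_partition_eq_iff by blast
  moreover have "?A <= lattice_atoms L" using S(1) unfolding atoms_L by blast
  ultimately show ?thesis by blast
 qed
qed

subsection \<open>Diagonals\<close>

text \<open>Equality of coordinates is an equivalence relation, so along a block it follows from
  equality along the edges. Diagonals become intersections of conditions on edges, from which joins
  and closedness are immediate.\<close>

lemma diagonal_iff:
 assumes U: "U <= E"
 shows "x \<in> partition_diagonal M n (cp U) <-> x \<in> topspace (power_space M n) & (ALL i j. {i, j} \<in> U --> x i = x j)"
proof -
 have "(ALL B:cp U. ALL i:B. ALL j:B. x i = x j) <-> (ALL i j. {i, j} \<in> U --> x i = x j)" (is "?l <-> ?r")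
 proof
  assume l: ?l
  show ?r
  proof (intro allI impI)
  fix i j assume ij: "{i, j} \<in> U"
  have e: "(i, j) \<in> cr U" by (rule edge_cr[OF U ij])
  hence "i \<in> {1..n}" using cr_in by blast
  hence "cr U `` {i} \<in> cp U" "i \<in> cr U `` {i}" using cr_equiv(1) by (auto simp: cp_blocks)
  thus "x i = x j" using l e by blast
  qed
 next
  assume r: ?r
  have c: "x i = x j" if "(i, j) \<in> cr U" for i j
  by (rule rtrancl_edges[OF that]) (use r in "auto simp: reflp_def transp_def")
  show ?l
  proof (intro ballI)
  fix B i j assume "B \<in> cp U" "i \<in> B" "j \<in> B"
  then obtain k where "(k, i) \<in> cr U" "(k, j) \<in> cr U" by (auto simp: cp_blocks)
  thus "x i = x j" using c[of k i] c[of k j] by simp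
  qed
 qed
 thus ?thesis by (simp add: partition_diagonal_def)
qed

lemma diagonal_join:
 assumes "p .: L" "q .: L"
 shows "partition_diagonal M n (p \<squnion>.L q) = partition_diagonal M n p \<inter> partition_diagonal M n q"
proof -
 obtain S T where ST: "S <= E" "T <= E" "p = cp S" "q = cp T" using assms unfolding carrier_L by blast
 show ?thesis unfolding ST(3,4) join_L[OF ST(1,2)] using ST(1,2) by (auto simp: diagonal_iff)
qed

lemma diagonal_bottom: "partition_diagonal M n \<bottom>.L = topspace (power_space M n)"
 unfolding bottom_bond_lattice using diagonal_iff[of "{}"] by auto

lemma closedin_diagonal:
 assumes "Hausdorff_space M" "p .: L"
 shows "closedin (power_space M n) (partition_diagonal M n p)"
proof -
 let ?X = "power_space M n"
 obtain U where U: "U <= E" "p = cp U" using assms(2) unfolding carrier_L by blast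
 have cl: "closedin ?X {x \<in> topspace ?X. x i = x j}" if "{i, j} \<in> U" for i j
 proof -
  have "i \<in> {1..n}" "j \<in> {1..n}" using edge_in[of i j] that U(1) by auto
  thus ?thesis unfolding power_space_def
  by (intro closedin_continuous_maps_eq[OF assms(1)] continuous_map_product_projection)
 qed
 let ?K = "insert (topspace ?X) ((%(i, j). {x \<in> topspace ?X. x i = x j}) ` {(i, j). {i, j} \<in> U})"
 have eq: "partition_diagonal M n p = \<Inter>?K"
  unfolding U(2) by (rule Set.set_eqI) (auto simp add: diagonal_iff[OF U(1)])
 have "closedin ?X S" if "S \<in> ?K" for S
  using that by (elim insertE imageE) (auto intro: cl)
 thus ?thesis unfolding eq by (intro closedin_Inter) simp_all
qed

end

section \<open>The theorem\<close>

theorem corollary1p5: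
  fixes R :: "('r, 'm) ring_scheme"
    and M :: "'a topology"
    and \<A> :: "('a set \<times> ('a \<Rightarrow> nat \<Rightarrow> real)) set"
    and d n :: nat
    and E :: "nat set set"
  assumes "cring R"
    and "smooth_manifold d M \<A>"
    and "connected_space M"
    and "simple_graph_on n E"
  shows "\<exists>\<phi>. graded_algebra_iso R (cohomology (arrangement_algebra R M n E))
              (cohomology (cochain_algebra R (graph_configuration_space M n E))) \<phi>"
proof -
 let ?X = "power_space M n" and ?L = "bond_lattice n E" and ?F = "graph_configuration_space M n E"
 let ?\<Delta> = "partition_diagonal M n"
 let ?Y = "\<Union>a\<in>lattice_atoms ?L. ?\<Delta> a"
 let ?S = "{x \<in> topspace ?X. ALL i j. {i, j} \<in> E --> x i ~= x j}"
 interpret cring R by fact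
 interpret b: bond n E by unfold_locales fact
 interpret c: cochains R ?X ..
 interpret s: cochains_sub R ?X ?S ..
 interpret l: ranked_lattice ?L "bond_rank n" by (rule b.bond_ranked)
 have F: "subtopology ?X ?S = ?F" by (simp add: graph_configuration_space_def)
 \<comment> \<open>The configuration space is the complement of the union of the atom diagonals, so
   the kernel of restriction to it is \<open>gam ?Y\<close> by the definition of
   \<open>gam\<close>.\<close>
 have S: "?S = topspace ?X - ?Y"
  using topspace_graph_configuration_space[OF assms(4), of M] unfolding F[symmetric] by auto
 have nor: "hereditarily normal_space ?X" by (rule power_space_hereditarily_normal[OF assms(2)])
 have haus: "Hausdorff_space M" using assms(2) by (simp add: smooth_manifold_def)
 note cl = b.closedin_diagonal[OF haus]
 \<comment> \<open>The abstract setting with germs on the power of \<open>M\<close> as coefficients,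
   germs on the configuration space as target, and closed subsets of the power as possible supports.
   The assumptions reduce to properties of supports and of the bond lattice.\<close>
 interpret arr: arrangement R ?L "bond_rank n" c.HH c.grH c.gam ?\<Delta> s.Y.HH s.Y.grH "closedin ?X" s.rmap
 proof (intro arrangement.intro coefficients.intro OS.intro coefficients_axioms.intro arrangement_axioms.intro
  is_cring l.ranked_lattice_axioms c.HH_graded_dga s.Y.HH_graded_dga)
  fix p assume p: "p .: ?L"
  show "submodule (c.gam (?\<Delta> p)) R c.HH" by (rule c.gam_sub[OF cl[OF p]])
  show "dif c.HH z \<in> c.gam (?\<Delta> p)" if "z \<in> c.gam (?\<Delta> p)" for z by (rule c.gam_d[OF cl[OF p] that])
  show "c.grH th z \<in> c.gam (?\<Delta> p)" if "z \<in> c.gam (?\<Delta> p)" "th .> R" for th z by (rule c.gam_gr[OF cl[OF p] that])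
  show "closedin ?X (?\<Delta> p)" by (rule cl[OF p])
  show "?\<Delta> p <= ?\<Delta> \<bottom>.?L" unfolding b.diagonal_bottom by (auto simp: partition_diagonal_def)
  fix q assume q: "q .: ?L"
  show "?\<Delta> (p \<squnion>.?L q) = ?\<Delta> p \<inter> ?\<Delta> q" by (rule b.diagonal_join[OF p q])
  show "z \<otimes>.c.HH w \<in> c.gam (?\<Delta> (p \<squnion>.?L q))" if "z \<in> c.gam (?\<Delta> p)" "w \<in> c.gam (?\<Delta> q)" for z w
  unfolding b.diagonal_join[OF p q] by (rule c.gam_mult[OF cl[OF p] cl[OF q] that])
  show "c.gam (?\<Delta> p) <= c.gam (?\<Delta> q)" if "q \<sqsubseteq>.?L p"
  using b.diagonal_join[OF q p, of M] l.join_absorb[OF q p that] by (intro c.gam_mono[OF cl[OF p] cl[OF q]]) auto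
 next
  show "c.gam (?\<Delta> \<bottom>.?L) = carrier c.HH" unfolding b.diagonal_bottom by (rule c.gam_top)
  show "\<one>.c.HH \<in> homog c.HH 0" by (rule c.HH_homog_one)
  show "z \<otimes>.c.HH w \<in> homog c.HH (k + m)" if "z \<in> homog c.HH k" "w \<in> homog c.HH m" for z w k m
  by (rule c.HH_homog_mult[OF that])
  show "finite {k. c.grH (%j. if j = k then \<one>.R else \<zero>.R) z ~= \<zero>.c.HH}" if "z .: c.HH" for z
  by (rule c.HH_degrees(1)[OF that])
  show "(\<Oplus>.c.HH k\<in>{k. c.grH (%j. if j = k then \<one>.R else \<zero>.R) z ~= \<zero>.c.HH}. c.grH (%j. if j = k then \<one>.R else \<zero>.R) z) = z"
  if "z .: c.HH" for z by (rule c.HH_degrees(2)[OF that])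
  show "closedin ?X {}" by simp
  show "c.gam {} = {\<zero>.c.HH}" by (rule c.gam_empty)
  show "diff_hom R c.HH s.Y.HH s.rmap" by (rule s.rmap_diff_hom)
  show "s.rmap ` carrier c.HH = carrier s.Y.HH" by (rule s.rmap_surj)
  show "s.rmap ` homog c.HH k = homog s.Y.HH k" for k by (rule s.rmap_homog)
  show "s.rmap z = \<zero>.s.Y.HH <-> z \<in> c.gam ?Y" if "z .: c.HH" for z
  unfolding c.gam_def S[symmetric] s.rel_kernel using that by simp
  fix Y Z assume Y: "closedin ?X Y"
  show "submodule (c.gam Y) R c.HH" by (rule c.gam_sub[OF Y])
  show "dif c.HH z \<in> c.gam Y" if "z \<in> c.gam Y" for z by (rule c.gam_d[OF Y that])
  show "c.grH th z \<in> c.gam Y" if "z \<in> c.gam Y" "th .> R" for th z by (rule c.gam_gr[OF Y that])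
  assume Z: "closedin ?X Z"
  show "closedin ?X (Y \<inter> Z)" "closedin ?X (Y \<union> Z)" using Y Z by auto
  show "c.gam Y <= c.gam Z" if "Y <= Z" by (rule c.gam_mono[OF Y Z that])
  show "c.gam Y \<inter> c.gam Z <= c.gam (Y \<inter> Z)" by (rule c.gam_Int[OF Y Z])
  show "EX d:c.gam Y. EX e:c.gam Z. z = d \<oplus>.c.HH e" if "z \<in> c.gam (Y \<union> Z)" for z by (rule c.gam_Un[OF nor Y Z that])
 qed
 obtain \<phi> where \<phi>: "graded_algebra_iso R (cohomology (arrangement_algebra R M n E)) (cohomology s.Y.HH) \<phi>"
  using arr.augmentation_quasi_iso unfolding c.gam_def arrangement_algebra_def by blast
 obtain \<psi> where \<psi>: "graded_algebra_iso R (cohomology s.Y.CC) (cohomology s.Y.HH) \<psi>"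
  using s.Y.germ_quasi_iso by blast
 have "homog (cohomology s.Y.CC) k <= carrier (cohomology s.Y.CC)" for k
  unfolding s.Y.C.coh_simps(1,2) by (rule image_mono) simp
 \<comment> \<open>Both quasi-isomorphisms end in the germs on the configuration space, so the
   second one is inverted before composing.\<close>
 from graded_algebra_iso_trans[OF \<phi> graded_algebra_iso_sym[OF s.Y.C.cohomology_diff_alg \<psi> this]]
 show ?thesis unfolding F by blast
qed

end
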